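(* Let $(S,\Omega)$ be a relative Sierpiński carpet, let $V\subset\subset U\subset\subset\Omega$ be open sets and let $M>0$ be a constant. For each $\varepsilon>0$ there exists $\delta>0$ such that if $u:S\to\mathbb R$ is a (normalized) carpet-harmonic function with $D_U(u)\le M$, then for all points $x,y\in S\cap V$ with $|x-y|<\delta$ we have $|u(x)-u(y)|<\varepsilon$. (In particular $\delta$ does not depend on $u$.)
   Context: Relative Sierpiński carpets. Let $\Omega\subset\mathbb C$ be a connected open set and $\{Q_i\}_{i\in\mathbb N}$ open Jordan regions compactly contained in $\Omega$, with pairwise disjoint closures, such that $S:=\Omega\setminus\bigcup_iQ_i$ has empty interior and is locally connected. Then $(S,\Omega)$ is a relative Sierpiński carpet with peripheral disks $Q_i$. Standing assumptions on every relative Sierpiński carpet: (i) $\mathcal H^2(S)=0$; (ii) there is $K_0\ge1$ such that for each $i$ there are concentric balls $B(x,r)\subset Q_i\subset B(x,R)$ with $R/r\le K_0$; (iii) there is $K_1>0$ such that $\mathcal H^2(B(x,r)\cap Q_i)\ge K_1r^2$ for all $i$, $x\in Q_i$, $0<r<\operatorname{diam}(Q_i)$. $\mathcal H^m$ is Hausdorff measure normalized to agree with Lebesgue measure. Notation. $\widehat{\mathbb R}=\mathbb R\cup\{\pm\infty\}$. $V\subset\subset\Omega$: $\overline V$ is compact and contained in $\Omega$. $I_V=\{i:Q_i\cap V\ne\emptyset\}$. $S^\circ$: points of $S$ on no $\partial Q_i$. A path is a continuous map from a bounded interval to $\mathbb C$ with a continuous extension to the closed interval (also its image); it is open if the interval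 is open; subpaths are restrictions to subintervals. For $g:S\to\widehat{\mathbb R}$: $M_{Q_i}(g)=\sup_{\partial Q_i}g$, $m_{Q_i}(g)=\inf_{\partial Q_i}g$, $\operatorname{osc}_{Q_i}(g)=M_{Q_i}(g)-m_{Q_i}(g)$. Moduli of a path family $\Gamma$ in $\Omega$. $\mathrm{mod}_2(\Gamma)=\inf\int\lambda^2d\mathcal H^2$ over Borel $\lambda\ge0$ with $\int_\gamma\lambda\,ds\ge1$ for all $\gamma\in\Gamma$ (with $\int_\gamma\lambda\,ds:=\infty$ if $\gamma$ is not locally rectifiable). Weak modulus $\mathrm{mod}_w(\Gamma)=\inf\sum_i\rho(Q_i)^2$ over non-negative sequences for which there is $\Gamma_0\subset\Gamma$ with $\mathrm{mod}_2(\Gamma_0)=0$ and $\sum_{i:Q_i\cap\gamma\ne\emptyset}\rho(Q_i)\ge1$ for $\gamma\in\Gamma\setminus\Gamma_0$. Strong modulus $\mathrm{mod}_s(\Gamma)$: the same infimum over sequences satisfying this inequality for all $\gamma\in\Gamma$ with $\mathcal H^1(\gamma\cap S)=0$. Sobolev spaces. $\{\rho(Q_i)\}$ is a weak (strong) upper gradient of $g:S\to\widehat{\mathbb R}$ if there is $\Gamma_0$ with $\mathrm{mod}_w(\Gamma_0)=0$ ($\mathrm{mod}_s(\Gamma_0)=0$) such that for all paths $\gamma\subset\Omega$, $\gamma\notin\Gamma_0$, and $x,y\in\gamma\cap S$: $g(x),g(y)\neq\pm\infty$ and $|g(x)-g(y)|\le\sum_{i:Q_i\cap\gamma\ne\emptyset}\rho(Q_i)$.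 $g\in\mathcal W^{1,2}_{\mathrm{loc}}(S)$ if $M_{Q_i}(g),m_{Q_i}(g)$ are finite for all $i$, $\sum_{i\in I_B}M_{Q_i}(g)^2\operatorname{diam}(Q_i)^2<\infty$ and $\sum_{i\in I_B}\operatorname{osc}_{Q_i}(g)^2<\infty$ for every ball $B\subset\subset\Omega$, and $\{\operatorname{osc}_{Q_i}(g)\}$ is an upper gradient of $g$; $g\in\mathcal W^{1,2}(S)$ if moreover the sums over all $i\in\mathbb N$ are finite. There is a weak and a strong version; the statement holds for each, with one version fixed throughout. Dirichlet energy: $D_V(g)=\sum_{i\in I_V}\operatorname{osc}_{Q_i}(g)^2$. $u\in\mathcal W^{1,2}_{\mathrm{loc}}(S)$ is carpet-harmonic if $D_V(u)\le D_V(u+\zeta)$ for every open $V\subset\subset\Omega$ and $\zeta\in\mathcal W^{1,2}(S)$ with $\zeta|_{S\setminus V}\equiv0$. Normalized functions. For $g\in\mathcal W^{1,2}_{\mathrm{loc}}(S)$ let $\hat g(Q_i)=M_{Q_i}(g)$. Let $\mathcal G_{\hat g}$ be the family of non-constant paths $\gamma\subset\Omega$ with: $\mathcal H^1(\gamma\cap S)=0$; for every subpath $\gamma'$ of $\gamma$ and $Q_{i_1},Q_{i_2}$ meeting $\gamma'$, $|\hat g(Q_{i_1})-\hat g(Q_{i_2})|\le\sum_{i:Q_i\cap\gamma'\neq\emptyset}\operatorname{osc}_{Q_i}(g)$; $\sum_{i:Q_i\cap\gamma'\ne\emptyset}\operatorname{osc}_{Q_i}(g)<\infty$ for subpaths $\gamma'\subset\subset\Omega$;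 and, if $\sum_{i\in\mathbb N}\operatorname{osc}_{Q_i}(g)^2<\infty$, also $\sum_{i:Q_i\cap\gamma\ne\emptyset}\operatorname{osc}_{Q_i}(g)<\infty$. A point $x\in S$ is accessible by $\gamma_0$ if $x\in\gamma_0\cap S^\circ$ (put $\gamma=\gamma_0$), or there is an open subpath $\gamma$ of $\gamma_0$ with $x\in\overline\gamma\setminus\gamma$ and $\gamma\cap Q_{i_0}=\emptyset$ whenever $x\in\partial Q_{i_0}$. The normalized version $\tilde g$ of $g$ is: $\tilde g(x)=\liminf_{Q_i\to x,\,Q_i\cap\gamma\ne\emptyset}\hat g(Q_i)$ if $x$ is accessible by a path $\gamma_0\in\mathcal G_{\hat g}$, where $\gamma=\gamma_0$ if $x\in\gamma_0\cap S^\circ$, and otherwise $\gamma$ is an open subpath of $\gamma_0$ with $x\in\overline\gamma\setminus\gamma$ and $\gamma\cap Q_{i_0}=\emptyset$ whenever $x\in\partial Q_{i_0}$ (the value is independent of $\gamma$); for non-accessible $x\in\partial Q_{i_0}$, $\tilde g(x)=\liminf\tilde g(y)$ as $y\to x$ through accessible $y\in\partial Q_{i_0}$; for all other $x$, $\tilde g(x)=\liminf\tilde g(y)$ as $y\to x$ through accessible $y$. A function is normalized if it equals the normalized version of some function in the Sobolev space. Standing convention: carpet-harmonic functions are normalized. *)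

theory Defs
  imports "HOL-Analysis.Analysis"
begin

definition hausdorff_content :: "nat \<Rightarrow> real \<Rightarrow> 'a::metric_space set \<Rightarrow> ennreal" where
  "hausdorff_content m d A =
     (INF U \<in> {U :: nat \<Rightarrow> 'a set. A \<subseteq> (\<Union>i. U i) \<and> (\<forall>i. bounded (U i) \<and> diameter (U i) \<le> d)}.
        \<Sum>i. ennreal (diameter (U i) ^ m))"

text \<open>The factor (volume of the unit ball over \<open>2 ^ m\<close>; it is 1 for \<open>m = 1\<close> and \<open>pi / 4\<close> for
  \<open>m = 2\<close>) makes the measure agree with Lebesgue measure on \<open>m\<close>-dimensional Euclidean space.
  Intended for \<open>m > 0\<close>.\<close>

definition hausdorff :: "nat \<Rightarrow> 'a::metric_space set \<Rightarrow> ennreal" where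
  "hausdorff m A = ennreal (unit_ball_vol (real m) / 2 ^ m) * (SUP d\<in>{0<..}. hausdorff_content m d A)"

definition hausdorff_measure :: "nat \<Rightarrow> 'a::metric_space measure" where
  "hausdorff_measure m = measure_of UNIV (sets borel) (hausdorff m)"

text \<open>\<open>hausdorff m\<close> is a metric outer measure, so \<open>hausdorff_measure m\<close> is not degenerate.\<close>

lemma hausdorff_content_mono: "A \<subseteq> B \<Longrightarrow> hausdorff_content m d A \<le> hausdorff_content m d B"
  unfolding hausdorff_content_def by (rule INF_superset_mono) auto

lemma hausdorff_content_antimono: "d \<le> e \<Longrightarrow> hausdorff_content m e A \<le> hausdorff_content m d A"
  unfolding hausdorff_content_def by (rule INF_superset_mono) (auto intro: order_trans)

lemma hausdorff_content_empty: "m > 0 \<Longrightarrow> d > 0 \<Longrightarrow> hausdorff_content m d {} = 0"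
proof -
  assume "m > 0" "d > 0"
  have "hausdorff_content m d ({}::'a set) \<le> (\<Sum>i::nat. ennreal (diameter ({}::'a set) ^ m))"
    unfolding hausdorff_content_def by (rule INF_lower) (use \<open>d > 0\<close> in auto)
  also have "\<dots> = 0" using \<open>m > 0\<close> by (simp add: zero_power)
  finally show ?thesis by simp
qed

lemma hausdorff_content_subadd:
  "hausdorff_content m d (\<Union>n::nat. A n) \<le> (\<Sum>n. hausdorff_content m d (A n))"
proof (rule ennreal_le_epsilon)
  fix e :: real
  assume e: "0 < e" and fin: "(\<Sum>n. hausdorff_content m d (A n)) < top"
  have lt: "hausdorff_content m d (A n) < hausdorff_content m d (A n) + ennreal (e * (1/2) ^ Suc n)" for n
  proof -
    have "hausdorff_content m d (A n) < top"
      using fin by (metis ennreal_suminf_lessD)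
    then show ?thesis using e by (cases "hausdorff_content m d (A n)")
        (auto simp: ennreal_plus[symmetric] ennreal_less_iff simp del: ennreal_plus)
  qed
  have "\<exists>U. A n \<subseteq> (\<Union>i::nat. U i) \<and> (\<forall>i. bounded (U i) \<and> diameter (U i) \<le> d) \<and>
      (\<Sum>i. ennreal (diameter (U i) ^ m)) < hausdorff_content m d (A n) + ennreal (e * (1/2) ^ Suc n)" for n
    using lt[of n] unfolding hausdorff_content_def[of m d "A n"] INF_less_iff by blast
  then obtain U where U: "\<And>n. A n \<subseteq> (\<Union>i::nat. U n i)" "\<And>n i. bounded (U n i)"
      "\<And>n i. diameter (U n i) \<le> d"
      "\<And>n. (\<Sum>i. ennreal (diameter (U n i) ^ m)) < hausdorff_content m d (A n) + ennreal (e * (1/2) ^ Suc n)"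
    by metis
  define W where "W k = (case prod_decode k of (n, i) \<Rightarrow> U n i)" for k
  have cov: "(\<Union>n. A n) \<subseteq> (\<Union>k. W k)"
  proof
    fix x assume "x \<in> (\<Union>n. A n)"
    then obtain n i where "x \<in> U n i" using U(1) by blast
    then have "x \<in> W (prod_encode (n, i))" by (simp add: W_def)
    then show "x \<in> (\<Union>k. W k)" by blast
  qed
  have "hausdorff_content m d (\<Union>n. A n) \<le> (\<Sum>k. ennreal (diameter (W k) ^ m))"
    unfolding hausdorff_content_def using U(2,3) cov
    by (intro INF_lower) (auto simp: W_def split: prod.split)
  also have "\<dots> = (\<Sum>n. \<Sum>i. ennreal (diameter (U n i) ^ m))"
    using suminf_ennreal_2dimen[where f="\<lambda>(n,i). ennreal (diameter (U n i) ^ m)"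
        and g="\<lambda>n. \<Sum>i. ennreal (diameter (U n i) ^ m)"]
    by (simp add: W_def case_prod_unfold comp_def)
  also have "\<dots> \<le> (\<Sum>n. hausdorff_content m d (A n) + ennreal (e * (1/2) ^ Suc n))"
    using U(4) by (intro suminf_le) (auto intro: less_imp_le)
  also have "\<dots> = (\<Sum>n. hausdorff_content m d (A n)) + (\<Sum>n. ennreal (e * (1/2) ^ Suc n))"
    by (simp add: suminf_add[symmetric])
  also have "(\<Sum>n. ennreal (e * (1/2) ^ Suc n)) = ennreal e"
    using sums_mult[OF power_half_series, of e] e
    by (intro suminf_ennreal_eq) auto
  finally show "hausdorff_content m d (\<Union>n. A n) \<le> (\<Sum>n. hausdorff_content m d (A n)) + ennreal e" .
qed

lemma hausdorff_empty: "m > 0 \<Longrightarrow> hausdorff m {} = 0"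
  by (simp add: hausdorff_def hausdorff_content_empty)

lemma hausdorff_mono: "A \<subseteq> B \<Longrightarrow> hausdorff m A \<le> hausdorff m B"
  unfolding hausdorff_def by (intro mult_left_mono SUP_mono) (auto intro: hausdorff_content_mono)

lemma hausdorff_subadd: "hausdorff m (\<Union>n::nat. A n) \<le> (\<Sum>n. hausdorff m (A n))"
proof -
  have "(SUP d\<in>{0<..}. hausdorff_content m d (\<Union>n. A n))
      \<le> (\<Sum>n. SUP d\<in>{0<..}. hausdorff_content m d (A n))"
  proof (rule SUP_least)
    fix d :: real assume "d \<in> {0<..}"
    then have "(\<Sum>n. hausdorff_content m d (A n)) \<le> (\<Sum>n. SUP d\<in>{0<..}. hausdorff_content m d (A n))"
      by (intro suminf_le SUP_upper) auto
    then show "hausdorff_content m d (\<Union>n. A n) \<le> (\<Sum>n. SUP d\<in>{0<..}. hausdorff_content m d (A n))"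
      using hausdorff_content_subadd order_trans by blast
  qed
  then show ?thesis unfolding hausdorff_def by (simp add: mult_left_mono)
qed

lemma hausdorff_subadd2: "m > 0 \<Longrightarrow> hausdorff m (A \<union> B) \<le> hausdorff m A + hausdorff m B"
proof -
  assume m: "m > 0"
  define C where "C n = (if n = 0 then A else if n = Suc 0 then B else {})" for n
  have "hausdorff m (\<Union>n. C n) \<le> (\<Sum>n. hausdorff m (C n))"
    by (rule hausdorff_subadd)
  also have "\<dots> = (\<Sum>n\<in>{0, Suc 0}. hausdorff m (C n))"
    by (rule suminf_finite) (auto simp: C_def hausdorff_empty[OF m])
  also have "\<dots> = hausdorff m A + hausdorff m B" by (simp add: C_def)
  also have "(\<Union>n. C n) = A \<union> B"
    by (auto simp: C_def split: if_splits)
  finally show ?thesis .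
qed

lemma hausdorff_content_separated:
  fixes A B :: "'a::metric_space set"
  assumes m: "m > 0" and d: "0 < d" "d < r" and sep: "\<And>x y. x \<in> A \<Longrightarrow> y \<in> B \<Longrightarrow> r \<le> dist x y"
  shows "hausdorff_content m d A + hausdorff_content m d B \<le> hausdorff_content m d (A \<union> B)"
  unfolding hausdorff_content_def[of m d "A \<union> B"]
proof (rule INF_greatest, clarsimp)
  fix U :: "nat \<Rightarrow> 'a set"
  assume U: "A \<subseteq> (\<Union>i. U i)" "B \<subseteq> (\<Union>i. U i)" "\<forall>i. bounded (U i) \<and> diameter (U i) \<le> d"
  define UA where "UA i = (if U i \<inter> A = {} then {} else U i)" for i
  define UB where "UB i = (if U i \<inter> A = {} then U i else {})" for i
  have B: "x \<in> (\<Union>i. UB i)" if xB: "x \<in> B" for x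
  proof -
    obtain i where i: "x \<in> U i" using U(2) xB by blast
    have "U i \<inter> A = {}"
    proof (rule ccontr)
      assume "U i \<inter> A \<noteq> {}"
      then obtain y where y: "y \<in> U i" "y \<in> A" by blast
      have "dist y x \<le> diameter (U i)" using U(3) y(1) i by (intro diameter_bounded_bound) auto
      then show False using sep[OF y(2) xB] U(3) d(2) by (meson leD le_less_trans order_trans)
    qed
    then have "x \<in> UB i" using i by (simp add: UB_def)
    then show ?thesis by blast
  qed
  have "A \<subseteq> (\<Union>i. UA i)" using U(1) by (auto simp: UA_def) blast
  then have "hausdorff_content m d A \<le> (\<Sum>i. ennreal (diameter (UA i) ^ m))"
    unfolding hausdorff_content_def using U(3) d(1) by (intro INF_lower) (auto simp: UA_def)
  moreover have "hausdorff_content m d B \<le> (\<Sum>i. ennreal (diameter (UB i) ^ m))"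
    unfolding hausdorff_content_def using U(3) d(1) B by (intro INF_lower) (auto simp: UB_def)
  moreover have "(\<Sum>i. ennreal (diameter (UA i) ^ m)) + (\<Sum>i. ennreal (diameter (UB i) ^ m))
      = (\<Sum>i. ennreal (diameter (U i) ^ m))"
    using m by (subst suminf_add) (auto simp: UA_def UB_def intro!: suminf_cong)
  ultimately show "hausdorff_content m d A + hausdorff_content m d B \<le> (\<Sum>i. ennreal (diameter (U i) ^ m))"
    by (metis add_mono)
qed

lemma hausdorff_separated:
  assumes m: "m > 0" and r: "0 < r" and sep: "\<And>x y. x \<in> A \<Longrightarrow> y \<in> B \<Longrightarrow> r \<le> dist x y"
  shows "hausdorff m A + hausdorff m B \<le> hausdorff m (A \<union> B)"
proof -
  let ?H = "\<lambda>A. SUP d\<in>{0<..}. hausdorff_content m d A"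
  have *: "hausdorff_content m d A + hausdorff_content m e B \<le> ?H (A \<union> B)" if "0 < d" "0 < e" for d e
  proof -
    let ?t = "min (min d e) (r/2)"
    have "hausdorff_content m d A + hausdorff_content m e B
        \<le> hausdorff_content m ?t A + hausdorff_content m ?t B"
      by (intro add_mono hausdorff_content_antimono) auto
    also have "\<dots> \<le> hausdorff_content m ?t (A \<union> B)"
      using that r sep by (intro hausdorff_content_separated[OF m, of _ r]) auto
    also have "\<dots> \<le> ?H (A \<union> B)" using that r by (intro SUP_upper) auto
    finally show ?thesis .
  qed
  have "?H A + ?H B = (SUP e\<in>{0<..}. ?H A + hausdorff_content m e B)"
    by (subst ennreal_SUP_add_right) auto
  also have "\<dots> \<le> ?H (A \<union> B)"
  proof (rule SUP_least)
    fix e :: real assume e: "e \<in> {0<..}"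
    have "?H A + hausdorff_content m e B = (SUP d\<in>{0<..}. hausdorff_content m d A + hausdorff_content m e B)"
      by (subst ennreal_SUP_add_left) auto
    also have "\<dots> \<le> ?H (A \<union> B)" using * e by (intro SUP_least) auto
    finally show "?H A + hausdorff_content m e B \<le> ?H (A \<union> B)" .
  qed
  finally show ?thesis unfolding hausdorff_def distrib_left[symmetric] by (rule mult_left_mono) simp
qed

lemma hausdorff_separated_sum:
  fixes D :: "nat \<Rightarrow> 'a::metric_space set"
  assumes m: "m > 0"
    and sep: "\<And>n. \<exists>r>0. \<forall>k<n. \<forall>x\<in>D k. \<forall>y\<in>D n. r \<le> dist x y"
  shows "(\<Sum>k<n. hausdorff m (D k)) \<le> hausdorff m (\<Union>k<n. D k)"
proof (induction n)
  case (Suc n)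
  obtain r where r: "r > 0" "\<forall>k<n. \<forall>x\<in>D k. \<forall>y\<in>D n. r \<le> dist x y" using sep by blast
  have "(\<Sum>k<Suc n. hausdorff m (D k)) \<le> hausdorff m (\<Union>k<n. D k) + hausdorff m (D n)"
    using Suc by (simp add: add_right_mono)
  also have "\<dots> \<le> hausdorff m ((\<Union>k<n. D k) \<union> D n)"
    using r by (intro hausdorff_separated[OF m r(1)]) auto
  also have "(\<Union>k<n. D k) \<union> D n = (\<Union>k<Suc n. D k)" by (auto simp: less_Suc_eq)
  finally show ?case .
qed simp

lemma hausdorff_caratheodory_closed:
  fixes F X :: "'a::metric_space set"
  assumes m: "m > 0" and F: "closed F"
  shows "hausdorff m (X \<inter> F) + hausdorff m (X - F) = hausdorff m X"
proof (rule antisym)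
  show "hausdorff m X \<le> hausdorff m (X \<inter> F) + hausdorff m (X - F)"
    using hausdorff_subadd2[OF m, of "X \<inter> F" "X - F"] by (simp add: Int_Diff_Un)
next
  show "hausdorff m (X \<inter> F) + hausdorff m (X - F) \<le> hausdorff m X"
  proof (cases "F = {} \<or> hausdorff m X = top")
    case True then show ?thesis by (auto simp: hausdorff_empty[OF m])
  next
    case False
    then have ne: "F \<noteq> {}" and fin: "hausdorff m X < top" by (auto simp: less_top)
    define A where "A n = {x \<in> X - F. infdist x F \<ge> 1 / real (Suc n)}" for n
    define D where "D n = A (Suc n) - A n" for n
    have un: "X - F \<subseteq> A n \<union> (\<Union>k. D (k + n))" for n
    proof
      fix x assume x: "x \<in> X - F"
      then have "infdist x F > 0" using F ne by (simp add: infdist_pos_not_in_closed)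
      then obtain p where "1 / real (Suc p) < infdist x F" by (metis nat_approx_posE)
      then have p: "x \<in> A p" using x by (simp add: A_def)
      show "x \<in> A n \<union> (\<Union>k. D (k + n))"
      proof (cases "x \<in> A n")
        case nA: False
        define q where "q = (LEAST q. x \<in> A q)"
        have q: "x \<in> A q" unfolding q_def using p by (rule LeastI)
        have mon: "x \<in> A j" if "x \<in> A i" "i \<le> j" for i j
        proof -
          have "1 / real (Suc j) \<le> 1 / real (Suc i)" using that(2) by (intro divide_left_mono) auto
          then show ?thesis using that(1) by (auto simp: A_def intro: order_trans)
        qed
        have "n < q" using mon[OF q] nA by (meson not_le)
        then obtain k where k: "q = Suc (k + n)" by (metis add.commute less_imp_Suc_add add_Suc_right)
        have "x \<notin> A (k + n)" using not_less_Least[of "k + n" "\<lambda>q. x \<in> A q"] k by (simp add: q_def[symmetric])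
        then have "x \<in> D (k + n)" using q k by (simp add: D_def)
        then show ?thesis by blast
      qed auto
    qed
    have sepA: "1 / real (Suc n) \<le> dist x y" if "x \<in> X \<inter> F" "y \<in> A n" for x y n
      using that infdist_le[of x F y] by (auto simp: A_def dist_commute)
    have sepD: "\<exists>r>0. \<forall>k<n. \<forall>x\<in>D (2 * k + j). \<forall>y\<in>D (2 * n + j). r \<le> dist x y" for n j
    proof (cases n)
      case (Suc p)
      define r where "r = 1 / real (2 * n + j) - 1 / real (2 * n + j + 1)"
      have "r > 0" unfolding r_def using Suc by (simp add: divide_strict_left_mono)
      moreover have "r \<le> dist x y" if "k < n" "x \<in> D (2 * k + j)" "y \<in> D (2 * n + j)" for k x y
      proof -
        have "1 / real (2 * n + j) \<le> 1 / real (Suc (Suc (2 * k + j)))"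
          using that(1) by (intro divide_left_mono) auto
        also have "\<dots> \<le> infdist x F" using that(2) by (simp add: D_def A_def)
        finally have 1: "1 / real (2 * n + j) \<le> infdist x F" .
        have 2: "infdist y F < 1 / real (2 * n + j + 1)"
          using that(3) by (auto simp: D_def A_def not_le)
        have "infdist x F \<le> infdist y F + dist x y" by (rule infdist_triangle)
        then show ?thesis using 1 2 by (simp add: r_def)
      qed
      ultimately show ?thesis by blast
    qed (auto intro: exI[of _ 1])
    have bnd: "(\<Sum>k<n. hausdorff m (D (2 * k + j))) \<le> hausdorff m X" for n j
    proof -
      have "(\<Sum>k<n. hausdorff m (D (2 * k + j))) \<le> hausdorff m (\<Union>k<n. D (2 * k + j))"
        by (rule hausdorff_separated_sum[OF m sepD])
      also have "\<dots> \<le> hausdorff m X" by (rule hausdorff_mono) (auto simp: D_def A_def)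
      finally show ?thesis .
    qed
    have fin_sum: "(\<Sum>k. hausdorff m (D k)) < top"
    proof -
      have eo: "(\<Sum>k<2 * n. hausdorff m (D k))
          = (\<Sum>k<n. hausdorff m (D (2 * k + 0))) + (\<Sum>k<n. hausdorff m (D (2 * k + 1)))" for n
        by (induction n) (simp_all add: algebra_simps)
      have "(\<Sum>k. hausdorff m (D k)) \<le> hausdorff m X + hausdorff m X"
      proof (rule suminf_le_const[OF summableI])
        fix n
        have "(\<Sum>k<n. hausdorff m (D k)) \<le> (\<Sum>k<2 * n. hausdorff m (D k))"
          by (rule sum_mono2) auto
        also have "\<dots> \<le> hausdorff m X + hausdorff m X"
          unfolding eo by (intro add_mono bnd)
        finally show "(\<Sum>k<n. hausdorff m (D k)) \<le> hausdorff m X + hausdorff m X" .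
      qed
      also have "\<dots> < top" using fin by simp
      finally show ?thesis .
    qed
    have tail: "(\<lambda>n. \<Sum>k. hausdorff m (D (k + n))) \<longlonglongrightarrow> 0"
    proof -
      define f where "f k = enn2real (hausdorff m (D k))" for k
      have f: "hausdorff m (D k) = ennreal (f k)" "f k \<ge> 0" for k
        using ennreal_suminf_lessD[OF fin_sum, of k] by (auto simp: f_def)
      have sm: "summable f"
        using fin_sum f by (intro summable_suminf_not_top) auto
      have "(\<Sum>k. hausdorff m (D (k + n))) = ennreal (\<Sum>k. f (k + n))" for n
        unfolding f(1) using f(2) sm by (intro suminf_ennreal2) (auto simp: summable_iff_shift)
      moreover have "(\<lambda>n. ennreal (\<Sum>k. f (k + n))) \<longlonglongrightarrow> ennreal 0"
        using suminf_exist_split2[OF sm] by (rule tendsto_ennrealI)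
      ultimately show ?thesis by simp
    qed
    have main: "hausdorff m (X \<inter> F) + hausdorff m (X - F)
        \<le> hausdorff m X + (\<Sum>k. hausdorff m (D (k + n)))" for n
    proof -
      have "hausdorff m (X - F) \<le> hausdorff m (A n \<union> (\<Union>k. D (k + n)))"
        by (rule hausdorff_mono[OF un])
      also have "\<dots> \<le> hausdorff m (A n) + hausdorff m (\<Union>k. D (k + n))"
        by (rule hausdorff_subadd2[OF m])
      also have "\<dots> \<le> hausdorff m (A n) + (\<Sum>k. hausdorff m (D (k + n)))"
        by (intro add_left_mono hausdorff_subadd)
      finally have 1: "hausdorff m (X - F) \<le> hausdorff m (A n) + (\<Sum>k. hausdorff m (D (k + n)))" .
      have "hausdorff m (X \<inter> F) + hausdorff m (A n) \<le> hausdorff m (X \<inter> F \<union> A n)"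
        by (rule hausdorff_separated[OF m _ sepA, of n]) auto
      also have "\<dots> \<le> hausdorff m X" by (rule hausdorff_mono) (auto simp: A_def)
      finally have 2: "hausdorff m (X \<inter> F) + hausdorff m (A n) \<le> hausdorff m X" .
      have "hausdorff m (X \<inter> F) + hausdorff m (X - F)
          \<le> hausdorff m (X \<inter> F) + (hausdorff m (A n) + (\<Sum>k. hausdorff m (D (k + n))))"
        by (rule add_left_mono[OF 1])
      also have "\<dots> \<le> hausdorff m X + (\<Sum>k. hausdorff m (D (k + n)))"
        using 2 by (simp add: add.assoc[symmetric] add_right_mono)
      finally show ?thesis .
    qed
    have "(\<lambda>n. hausdorff m X + (\<Sum>k. hausdorff m (D (k + n)))) \<longlonglongrightarrow> hausdorff m X + 0"
      by (intro tendsto_add tendsto_const tail)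
    then show ?thesis using main by (intro LIMSEQ_le_const) auto
  qed
qed

lemma space_hausdorff_measure [simp]: "space (hausdorff_measure m) = UNIV"
  by (simp add: hausdorff_measure_def space_measure_of_conv)

lemma sets_hausdorff_measure [simp]: "sets (hausdorff_measure m) = sets borel"
  unfolding hausdorff_measure_def by (metis sets.sigma_sets_eq sets_measure_of_conv
      space_borel sets_measure_of subset_UNIV Pow_UNIV)

lemma emeasure_hausdorff_measure:
  fixes A :: "'a::metric_space set"
  assumes m: "m > 0" and A: "A \<in> sets borel"
  shows "emeasure (hausdorff_measure m) A = hausdorff m A"
proof -
  interpret sigma_algebra "UNIV :: 'a set" "UNIV :: 'a set set"
    using sigma_algebra_Pow[of "UNIV :: 'a set"] by simp
  let ?L = "lambda_system (UNIV :: 'a set) UNIV (hausdorff m)"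
  have out: "outer_measure_space (UNIV :: 'a set set) (hausdorff m)"
    by (auto simp: outer_measure_space_def positive_def increasing_def countably_subadditive_def
        hausdorff_empty[OF m] hausdorff_mono hausdorff_subadd)
  have meas: "measure_space UNIV ?L (hausdorff m)"
    by (rule caratheodory_lemma[OF out])
  have "sets (borel :: 'a measure) \<subseteq> ?L"
  proof -
    have "Collect closed \<subseteq> ?L"
      using hausdorff_caratheodory_closed[OF m] by (auto simp: lambda_system_eq)
    moreover have "sigma_algebra UNIV ?L" using meas by (simp add: measure_space_def)
    ultimately have "sigma_sets UNIV (Collect closed) \<subseteq> ?L"
      by (rule sigma_algebra.sigma_sets_subset[rotated])
    then show ?thesis by (simp add: borel_eq_closed)
  qed
  then have "measure_space UNIV (sets (borel :: 'a measure)) (hausdorff m)"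
    using meas by (metis measure_down sets.sigma_algebra_axioms space_borel)
  then show ?thesis
    unfolding hausdorff_measure_def using A
    by (metis emeasure_measure_of_sigma measure_space_def)
qed

definition compactly_contained :: "complex set \<Rightarrow> complex set \<Rightarrow> bool" (infix "\<subset>\<subset>" 50) where
  "V \<subset>\<subset> W \<longleftrightarrow> compact (closure V) \<and> closure V \<subseteq> W"

text \<open>A path is a pair of a parameter interval and a function; the values of the function off the
  interval are irrelevant. Constant paths are allowed.\<close>

type_synonym ipath = "real set \<times> (real \<Rightarrow> complex)"

definition is_path :: "ipath \<Rightarrow> bool" where
  "is_path \<gamma> \<longleftrightarrow> fst \<gamma> \<noteq> {} \<and> is_interval (fst \<gamma>) \<and> bounded (fst \<gamma>) \<and>
     (\<exists>h. continuous_on (closure (fst \<gamma>)) h \<and> (\<forall>t\<in>fst \<gamma>. h t = snd \<gamma> t))"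

definition trace :: "ipath \<Rightarrow> complex set" where
  "trace \<gamma> = snd \<gamma> ` fst \<gamma>"

definition paths_in :: "complex set \<Rightarrow> ipath set" where
  "paths_in \<Omega> = {\<gamma>. is_path \<gamma> \<and> trace \<gamma> \<subseteq> \<Omega>}"

definition open_path :: "ipath \<Rightarrow> bool" where
  "open_path \<gamma> \<longleftrightarrow> open (fst \<gamma>)"

definition is_subpath :: "ipath \<Rightarrow> ipath \<Rightarrow> bool" where
  "is_subpath \<gamma>' \<gamma> \<longleftrightarrow> fst \<gamma>' \<noteq> {} \<and> is_interval (fst \<gamma>') \<and> fst \<gamma>' \<subseteq> fst \<gamma> \<and> snd \<gamma>' = snd \<gamma>"

definition path_length :: "(real \<Rightarrow> complex) \<Rightarrow> real \<Rightarrow> real \<Rightarrow> ennreal" where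
  "path_length g a b =
     (SUP (n, t) \<in> {(n, t). mono_on {..n} t \<and> t ` {..n} \<subseteq> {a..b}}.
        \<Sum>i<(n::nat). ennreal (dist (g (t i)) (g (t (Suc i)))))"

definition locally_rectifiable :: "ipath \<Rightarrow> bool" where
  "locally_rectifiable \<gamma> \<longleftrightarrow>
     (\<forall>a b. a \<le> b \<and> {a..b} \<subseteq> fst \<gamma> \<longrightarrow> path_length (snd \<gamma>) a b < \<infinity>)"

text \<open>Arc-length parametrization on \<open>[0, length]\<close> of the restriction of \<open>g\<close> to \<open>[a, b]\<close>; any two
  admissible choices of \<open>t\<close> give the same value of \<open>g t\<close>.\<close>

definition arc_length_param :: "(real \<Rightarrow> complex) \<Rightarrow> real \<Rightarrow> real \<Rightarrow> real \<Rightarrow> complex" where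
  "arc_length_param g a b s = g (SOME t. t \<in> {a..b} \<and> path_length g a t = ennreal s)"

definition line_integral :: "(complex \<Rightarrow> ennreal) \<Rightarrow> ipath \<Rightarrow> ennreal" where
  "line_integral l \<gamma> =
     (if locally_rectifiable \<gamma>
      then SUP (a, b) \<in> {(a, b). a \<le> b \<and> {a..b} \<subseteq> fst \<gamma>}.
             \<integral>\<^sup>+s\<in>{0..enn2real (path_length (snd \<gamma>) a b)}. l (arc_length_param (snd \<gamma>) a b s) \<partial>lborel
      else \<infinity>)"

definition mod2 :: "ipath set \<Rightarrow> ennreal" where
  "mod2 \<Gamma> = (INF l \<in> {l \<in> borel_measurable borel. \<forall>\<gamma>\<in>\<Gamma>. line_integral l \<gamma> \<ge> 1}.
                 \<integral>\<^sup>+z. (l z)\<^sup>2 \<partial>hausdorff_measure 2)"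

definition jordan_region :: "complex set \<Rightarrow> bool" where
  "jordan_region D \<longleftrightarrow>
     (\<exists>c. simple_path c \<and> pathfinish c = pathstart c \<and> D = inside (path_image c))"

definition carpet :: "complex set \<Rightarrow> (nat \<Rightarrow> complex set) \<Rightarrow> complex set" where
  "carpet \<Omega> Q = \<Omega> - (\<Union>i. Q i)"

definition carpet_interior :: "complex set \<Rightarrow> (nat \<Rightarrow> complex set) \<Rightarrow> complex set" where
  "carpet_interior \<Omega> Q = carpet \<Omega> Q - (\<Union>i. frontier (Q i))"

definition relative_sierpinski_carpet :: "complex set \<Rightarrow> (nat \<Rightarrow> complex set) \<Rightarrow> bool" where
  "relative_sierpinski_carpet \<Omega> Q \<longleftrightarrow>
     open \<Omega> \<and> connected \<Omega> \<and>
     (\<forall>i. jordan_region (Q i) \<and> Q i \<subset>\<subset> \<Omega>) \<and>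
     (\<forall>i j. i \<noteq> j \<longrightarrow> closure (Q i) \<inter> closure (Q j) = {}) \<and>
     interior (carpet \<Omega> Q) = {} \<and>
     locally connected (carpet \<Omega> Q) \<and>
     hausdorff 2 (carpet \<Omega> Q) = 0 \<and>
     (\<exists>K0\<ge>1. \<forall>i. \<exists>x r R. 0 < r \<and> ball x r \<subseteq> Q i \<and> Q i \<subseteq> ball x R \<and> R / r \<le> K0) \<and>
     (\<exists>K1>0. \<forall>i. \<forall>x\<in>Q i. \<forall>r. 0 < r \<and> r < diameter (Q i) \<longrightarrow>
        hausdorff 2 (ball x r \<inter> Q i) \<ge> ennreal (K1 * r\<^sup>2))"

definition meeting :: "(nat \<Rightarrow> complex set) \<Rightarrow> complex set \<Rightarrow> nat set" where
  "meeting Q A = {i. Q i \<inter> A \<noteq> {}}"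

datatype version = Weak | Strong

definition mod_weak :: "(nat \<Rightarrow> complex set) \<Rightarrow> ipath set \<Rightarrow> ennreal" where
  "mod_weak Q \<Gamma> =
     (INF \<rho> \<in> {\<rho> :: nat \<Rightarrow> ennreal. (\<forall>i. \<rho> i < \<infinity>) \<and>
          (\<exists>\<Gamma>0\<subseteq>\<Gamma>. mod2 \<Gamma>0 = 0 \<and> (\<forall>\<gamma>\<in>\<Gamma> - \<Gamma>0. (\<Sum>\<^sub>\<infinity>i\<in>meeting Q (trace \<gamma>). \<rho> i) \<ge> 1))}.
        \<Sum>i. (\<rho> i)\<^sup>2)"

definition mod_strong :: "complex set \<Rightarrow> (nat \<Rightarrow> complex set) \<Rightarrow> ipath set \<Rightarrow> ennreal" where
  "mod_strong \<Omega> Q \<Gamma> =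
     (INF \<rho> \<in> {\<rho> :: nat \<Rightarrow> ennreal. (\<forall>i. \<rho> i < \<infinity>) \<and>
          (\<forall>\<gamma>\<in>\<Gamma>. hausdorff 1 (trace \<gamma> \<inter> carpet \<Omega> Q) = 0 \<longrightarrow>
             (\<Sum>\<^sub>\<infinity>i\<in>meeting Q (trace \<gamma>). \<rho> i) \<ge> 1)}.
        \<Sum>i. (\<rho> i)\<^sup>2)"

definition carpet_mod ::
    "version \<Rightarrow> complex set \<Rightarrow> (nat \<Rightarrow> complex set) \<Rightarrow> ipath set \<Rightarrow> ennreal" where
  "carpet_mod v \<Omega> Q \<Gamma> = (case v of Weak \<Rightarrow> mod_weak Q \<Gamma> | Strong \<Rightarrow> mod_strong \<Omega> Q \<Gamma>)"

text \<open>Functions on the carpet are total functions whose values off the carpet are irrelevant.\<close>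

definition Mx :: "(complex \<Rightarrow> ereal) \<Rightarrow> complex set \<Rightarrow> ereal" where
  "Mx g D = (SUP z\<in>frontier D. g z)"

definition Mn :: "(complex \<Rightarrow> ereal) \<Rightarrow> complex set \<Rightarrow> ereal" where
  "Mn g D = (INF z\<in>frontier D. g z)"

definition osc :: "(complex \<Rightarrow> ereal) \<Rightarrow> complex set \<Rightarrow> ennreal" where
  "osc g D = e2ennreal (Mx g D - Mn g D)"

definition upper_gradient :: "version \<Rightarrow> complex set \<Rightarrow> (nat \<Rightarrow> complex set) \<Rightarrow>
    (complex \<Rightarrow> ereal) \<Rightarrow> (nat \<Rightarrow> ennreal) \<Rightarrow> bool" where
  "upper_gradient v \<Omega> Q g \<rho> \<longleftrightarrow>
     (\<exists>\<Gamma>0\<subseteq>paths_in \<Omega>. carpet_mod v \<Omega> Q \<Gamma>0 = 0 \<and>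
        (\<forall>\<gamma>\<in>paths_in \<Omega> - \<Gamma>0. \<forall>x\<in>trace \<gamma> \<inter> carpet \<Omega> Q. \<forall>y\<in>trace \<gamma> \<inter> carpet \<Omega> Q.
           \<bar>g x\<bar> \<noteq> \<infinity> \<and> \<bar>g y\<bar> \<noteq> \<infinity> \<and>
           \<bar>g x - g y\<bar> \<le> enn2ereal (\<Sum>\<^sub>\<infinity>i\<in>meeting Q (trace \<gamma>). \<rho> i)))"

definition sobolev_sums :: "(nat \<Rightarrow> complex set) \<Rightarrow> (complex \<Rightarrow> ereal) \<Rightarrow> nat set \<Rightarrow> bool" where
  "sobolev_sums Q g I \<longleftrightarrow>
     (\<Sum>\<^sub>\<infinity>i\<in>I. ennreal ((real_of_ereal (Mx g (Q i)))\<^sup>2 * (diameter (Q i))\<^sup>2)) < \<infinity> \<and>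
     (\<Sum>\<^sub>\<infinity>i\<in>I. (osc g (Q i))\<^sup>2) < \<infinity>"

definition sobolev_loc ::
    "version \<Rightarrow> complex set \<Rightarrow> (nat \<Rightarrow> complex set) \<Rightarrow> (complex \<Rightarrow> ereal) set" where
  "sobolev_loc v \<Omega> Q = {g.
     (\<forall>i. \<bar>Mx g (Q i)\<bar> \<noteq> \<infinity> \<and> \<bar>Mn g (Q i)\<bar> \<noteq> \<infinity>) \<and>
     (\<forall>x r. ball x r \<subset>\<subset> \<Omega> \<longrightarrow> sobolev_sums Q g (meeting Q (ball x r))) \<and>
     upper_gradient v \<Omega> Q g (\<lambda>i. osc g (Q i))}"

definition sobolev ::
    "version \<Rightarrow> complex set \<Rightarrow> (nat \<Rightarrow> complex set) \<Rightarrow> (complex \<Rightarrow> ereal) set" where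
  "sobolev v \<Omega> Q = {g \<in> sobolev_loc v \<Omega> Q. sobolev_sums Q g UNIV}"

definition dirichlet_energy ::
    "(nat \<Rightarrow> complex set) \<Rightarrow> complex set \<Rightarrow> (complex \<Rightarrow> ereal) \<Rightarrow> ennreal" where
  "dirichlet_energy Q V g = (\<Sum>\<^sub>\<infinity>i\<in>meeting Q V. (osc g (Q i))\<^sup>2)"

definition carpet_harmonic ::
    "version \<Rightarrow> complex set \<Rightarrow> (nat \<Rightarrow> complex set) \<Rightarrow> (complex \<Rightarrow> ereal) \<Rightarrow> bool" where
  "carpet_harmonic v \<Omega> Q u \<longleftrightarrow>
     u \<in> sobolev_loc v \<Omega> Q \<and>
     (\<forall>V \<zeta>. open V \<and> V \<subset>\<subset> \<Omega> \<and> \<zeta> \<in> sobolev v \<Omega> Q \<and> (\<forall>x\<in>carpet \<Omega> Q - V. \<zeta> x = 0) \<longrightarrow>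
        dirichlet_energy Q V u \<le> dirichlet_energy Q V (\<lambda>x. u x + \<zeta> x))"

definition good_paths ::
    "complex set \<Rightarrow> (nat \<Rightarrow> complex set) \<Rightarrow> (complex \<Rightarrow> ereal) \<Rightarrow> ipath set" where
  "good_paths \<Omega> Q g = {\<gamma> \<in> paths_in \<Omega>.
     (\<nexists>z. trace \<gamma> = {z}) \<and>
     hausdorff 1 (trace \<gamma> \<inter> carpet \<Omega> Q) = 0 \<and>
     (\<forall>\<gamma>'. is_subpath \<gamma>' \<gamma> \<longrightarrow>
        (\<forall>i\<in>meeting Q (trace \<gamma>'). \<forall>j\<in>meeting Q (trace \<gamma>').
           \<bar>Mx g (Q i) - Mx g (Q j)\<bar> \<le> enn2ereal (\<Sum>\<^sub>\<infinity>k\<in>meeting Q (trace \<gamma>'). osc g (Q k)))) \<and>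
     (\<forall>\<gamma>'. is_subpath \<gamma>' \<gamma> \<and> trace \<gamma>' \<subset>\<subset> \<Omega> \<longrightarrow>
        (\<Sum>\<^sub>\<infinity>k\<in>meeting Q (trace \<gamma>'). osc g (Q k)) < \<infinity>) \<and>
     ((\<Sum>i. (osc g (Q i))\<^sup>2) < \<infinity> \<longrightarrow> (\<Sum>\<^sub>\<infinity>k\<in>meeting Q (trace \<gamma>). osc g (Q k)) < \<infinity>)}"

text \<open>\<open>x\<close> is accessible by \<open>\<gamma>0\<close> iff \<open>access \<Omega> Q x \<gamma>0 \<gamma>\<close> for some \<open>\<gamma>\<close>; that \<open>\<gamma>\<close> is the path along
  which the limit at \<open>x\<close> is taken.\<close>

definition access ::
    "complex set \<Rightarrow> (nat \<Rightarrow> complex set) \<Rightarrow> complex \<Rightarrow> ipath \<Rightarrow> ipath \<Rightarrow> bool" where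
  "access \<Omega> Q x \<gamma>0 \<gamma> \<longleftrightarrow>
     (if x \<in> trace \<gamma>0 \<inter> carpet_interior \<Omega> Q then \<gamma> = \<gamma>0
      else open_path \<gamma> \<and> is_subpath \<gamma> \<gamma>0 \<and> x \<in> closure (trace \<gamma>) - trace \<gamma> \<and>
           (\<forall>i. x \<in> frontier (Q i) \<longrightarrow> trace \<gamma> \<inter> Q i = {}))"

definition accessible ::
    "complex set \<Rightarrow> (nat \<Rightarrow> complex set) \<Rightarrow> (complex \<Rightarrow> ereal) \<Rightarrow> complex set" where
  "accessible \<Omega> Q g = {x \<in> carpet \<Omega> Q. \<exists>\<gamma>0\<in>good_paths \<Omega> Q g. \<exists>\<gamma>. access \<Omega> Q x \<gamma>0 \<gamma>}"

text \<open>\<open>Q i\<close> tends to \<open>x\<close>, with \<open>Q i\<close> meeting \<open>\<gamma>\<close>, in the sense that \<open>Q i\<close> is contained in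
  arbitrarily small balls centred at \<open>x\<close>.\<close>

definition disks_to ::
    "(nat \<Rightarrow> complex set) \<Rightarrow> complex \<Rightarrow> ipath \<Rightarrow> nat filter" where
  "disks_to Q x \<gamma> = (INF \<epsilon>\<in>{0<..}. principal {i \<in> meeting Q (trace \<gamma>). Q i \<subseteq> ball x \<epsilon>})"

text \<open>The limit inferior at an accessible point does not depend on the path.\<close>

definition accessible_value ::
    "complex set \<Rightarrow> (nat \<Rightarrow> complex set) \<Rightarrow> (complex \<Rightarrow> ereal) \<Rightarrow> complex \<Rightarrow> ereal" where
  "accessible_value \<Omega> Q g x =
     Liminf (disks_to Q x (SOME \<gamma>. \<exists>\<gamma>0\<in>good_paths \<Omega> Q g. access \<Omega> Q x \<gamma>0 \<gamma>)) (\<lambda>i. Mx g (Q i))"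

definition normalized_version ::
    "complex set \<Rightarrow> (nat \<Rightarrow> complex set) \<Rightarrow> (complex \<Rightarrow> ereal) \<Rightarrow> complex \<Rightarrow> ereal" where
  "normalized_version \<Omega> Q g x =
     (if x \<in> accessible \<Omega> Q g then accessible_value \<Omega> Q g x
      else if \<exists>i. x \<in> frontier (Q i)
      then Liminf (at x within {y \<in> accessible \<Omega> Q g. y \<in> frontier (Q (THE i. x \<in> frontier (Q i)))})
             (accessible_value \<Omega> Q g)
      else Liminf (at x within accessible \<Omega> Q g) (accessible_value \<Omega> Q g))"

definition normalized ::
    "version \<Rightarrow> complex set \<Rightarrow> (nat \<Rightarrow> complex set) \<Rightarrow> (complex \<Rightarrow> ereal) \<Rightarrow> bool" where
  "normalized v \<Omega> Q u \<longleftrightarrow>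
     (\<exists>g\<in>sobolev_loc v \<Omega> Q. \<forall>x\<in>carpet \<Omega> Q. u x = normalized_version \<Omega> Q g x)"

end

(*
  Around a point x0 of the carpet one finds, by summing over dyadic square annuli and by
  Cauchy-Schwarz, a square of definite size, depending only on the energy bound, along which the
  oscillation of u is small; the size does not depend on u because the disks away from x0 contribute
  a bounded total energy to the disjoint annuli.  If x0 lies on the boundary of a peripheral disk
  Q_j, the square is replaced by a crosscut of the complement of Q_j contained in it.  The maximum
  principle, obtained by truncating u and comparing Dirichlet energies, then bounds u on the
  boundaries of the peripheral disks inside the square or crosscut, again independently of u.

  Passing from disks to points uses that u is the normalized version of some g.  The limits
  defining this version follow paths outside of our control, but at a point y of a generic line
  lying on no peripheral circle, every such path crosses small squares around y on which g oscillates
  little, so the limit is g(y).  Hence u = g at some point of every peripheral circle, the maxima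
  of g over the circles are controlled by u, and the bounds pass to the limit at every point.
*)
theory Submission
  imports Defs
begin


text \<open>Uniformity is a matter of the order of quantifiers: the range of radii and the size of
  the crosscut region are fixed from the disks near the point, the energy bound and \<epsilon>,
  before a function is chosen. A disk with the point on its boundary meets all small annuli, so its
  oscillation cannot be shared out among them. It is dropped from all sums, and the maximum
  principle is stated so that for this disk one good boundary point, an end point of the crosscut,
  replaces a bound on its whole circle. Squares are used because their sides lie on parallel lines:
  fatness of the disks and Cauchy-Schwarz show that a family exceptional for either modulus contains
  almost no segment of a parallel bundle, so both versions are treated alike. In the comparison of
  energies the truncation needs its own oscillations as an upper gradient; it has them because on a
  circle meeting its zero set the oscillation bounds its maximum. Equal energies only make the
  truncation constant on circles; that it vanishes comes from the connectedness of \<Omega> minus at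
  most one closed disk.\<close>

section \<open>Sums of extended nonnegative reals\<close>

lemma ennreal_summable [simp, intro]: "(f :: 'a \<Rightarrow> ennreal) summable_on A"
  by (rule nonneg_summable_on_complete) simp

lemma infsum_ennreal_mono: "(\<And>i. i \<in> A \<Longrightarrow> f i \<le> g i) \<Longrightarrow> infsum f A \<le> (infsum g A :: ennreal)"
  by (rule infsum_mono) auto

lemma infsum_ennreal_mono_set: "A \<subseteq> B \<Longrightarrow> infsum f A \<le> (infsum f B :: ennreal)"
  by (rule infsum_mono_neutral) auto

lemma infsum_ennreal_Un: "infsum f (A \<union> B) \<le> infsum f A + (infsum f B :: ennreal)"
proof -
  have "infsum f (A \<union> B) = infsum f (A \<union> (B - A))" by simp
  also have "\<dots> = infsum f A + infsum f (B - A)"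
    by (rule infsum_Un_disjoint) auto
  also have "\<dots> \<le> infsum f A + infsum f B"
    by (intro add_left_mono infsum_ennreal_mono_set) auto
  finally show ?thesis .
qed

lemma infsum_ennreal_suminf:
  fixes f :: "nat \<Rightarrow> ennreal"
  shows "infsum f I = (\<Sum>i. f i * indicator I i)"
proof -
  have "infsum f I = infsum (\<lambda>i. f i * indicator I i) UNIV"
    by (rule infsum_cong_neutral) auto
  also have "\<dots> = (\<Sum>i. f i * indicator I i)"
    using has_sum_imp_sums[OF has_sum_infsum[OF ennreal_summable[of "\<lambda>i. f i * indicator I i" UNIV]]]
    by (simp add: sums_iff)
  finally show ?thesis .
qed

lemma infsum_ennreal_ge: "i \<in> I \<Longrightarrow> f i \<le> (infsum f I :: ennreal)"
  using infsum_ennreal_mono_set[of "{i}" I f] by simp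

lemma infsum_ennreal_tail:
  fixes f :: "nat \<Rightarrow> ennreal"
  assumes "infsum f I < \<infinity>" "0 < \<eta>"
  obtains F where "finite F" "F \<subseteq> I" "infsum f (I - F) < \<eta>"
proof -
  have SUPF: "infsum f I = (SUP F\<in>{F. finite F \<and> F \<subseteq> I}. sum f F)"
    by (rule nonneg_infsum_complete) simp
  show ?thesis
  proof (cases "infsum f I = 0")
    case True
    then show ?thesis using that[of "{}"] assms by simp
  next
    case False
    \<comment> \<open>Capping at 1 keeps the threshold finite, so that subtracting it and adding it
      back cancel.\<close>
    define \<eta>' where "\<eta>' = min \<eta> 1"
    have e: "0 < \<eta>'" "\<eta>' < \<infinity>" "\<eta>' \<le> \<eta>" using assms by (auto simp: \<eta>'_def min_less_iff_disj)
    have "infsum f I - \<eta>' < infsum f I"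
      using e False assms(1) by (intro ennreal_between) (auto simp: zero_less_iff_neq_zero)
    then obtain F where F: "finite F" "F \<subseteq> I" "infsum f I - \<eta>' < sum f F"
      unfolding SUPF less_SUP_iff by auto
    have eq: "infsum f I = sum f F + infsum f (I - F)"
      using infsum_Un_disjoint[of f F "I - F"] F by (simp add: Un_absorb1)
    have fin: "sum f F < \<infinity>" "infsum f (I - F) < \<infinity>"
      using assms(1) eq by (auto simp: ennreal_add_eq_top less_top[symmetric])
    have "infsum f (I - F) < \<eta>'"
    proof (rule ccontr)
      assume "\<not> ?thesis"
      then have "sum f F + \<eta>' \<le> infsum f I" using eq by (simp add: add_left_mono)
      then have "sum f F \<le> infsum f I - \<eta>'"
        using e by (metis ennreal_add_diff_cancel_right ennreal_minus_mono infinity_ennreal_def less_irrefl order_refl top.not_eq_extremum)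
      then show False using F(3) by simp
    qed
    then show ?thesis using F that e by (meson less_le_trans)
  qed
qed

text \<open>The integral inequality for counting measure, with both sequences cut off outside
  \<open>I\<close>.\<close>

lemma infsum_ennreal_Cauchy_Schwarz:
  fixes f g :: "nat \<Rightarrow> ennreal"
  shows "(infsum (\<lambda>i. f i * g i) I)\<^sup>2 \<le> infsum (\<lambda>i. (f i)\<^sup>2) I * infsum (\<lambda>i. (g i)\<^sup>2) I"
proof -
  have "(\<integral>\<^sup>+i. (f i * indicator I i) * (g i * indicator I i) \<partial>count_space UNIV)\<^sup>2
    \<le> (\<integral>\<^sup>+i. (f i * indicator I i)\<^sup>2 \<partial>count_space UNIV) * (\<integral>\<^sup>+i. (g i * indicator I i)\<^sup>2 \<partial>count_space UNIV)"
    by (rule Cauchy_Schwarz_nn_integral) auto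
  moreover have "(f i * indicator I i) * (g i * indicator I i) = f i * g i * indicator I i"
    "(f i * indicator I i)\<^sup>2 = (f i)\<^sup>2 * indicator I i" "(g i * indicator I i)\<^sup>2 = (g i)\<^sup>2 * indicator I i" for i
    by (auto simp: indicator_def)
  ultimately show ?thesis
    by (simp add: infsum_ennreal_suminf nn_integral_count_space_nat)
qed

lemma infsum_ennreal_cmult:
  fixes f :: "nat \<Rightarrow> ennreal"
  shows "infsum (\<lambda>i. c * f i) I = c * infsum f I"
  by (simp add: infsum_ennreal_suminf mult.assoc)

lemma infsum_ennreal_add:
  fixes f g :: "nat \<Rightarrow> ennreal"
  shows "infsum (\<lambda>i. f i + g i) I = infsum f I + infsum g I"
  by (rule infsum_add) auto

lemma infsum_ennreal_UN_disjoint_finite_le: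
  fixes f :: "nat \<Rightarrow> ennreal"
  assumes "A \<inter> B = {}" "A \<subseteq> C" "B \<subseteq> C"
  shows "infsum f A + infsum f B \<le> infsum f C"
proof -
  have "infsum f A + infsum f B = infsum f (A \<union> B)"
    by (rule infsum_Un_disjoint[symmetric]) (use assms in auto)
  also have "\<dots> \<le> infsum f C" by (rule infsum_ennreal_mono_set) (use assms in auto)
  finally show ?thesis .
qed

lemma infsum_ennreal_finite_small:
  fixes f :: "nat \<Rightarrow> ennreal"
  assumes "infsum f I < \<infinity>" "0 < c"
  shows "finite {i \<in> I. c \<le> f i}"
proof -
  obtain F where F: "finite F" "F \<subseteq> I" "infsum f (I - F) < c"
    using infsum_ennreal_tail[OF assms] by blast
  have "i \<in> F" if "i \<in> I" "c \<le> f i" for i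
    using infsum_ennreal_ge[of i "I - F" f] that F(3) by fastforce
  then show ?thesis using F(1) by (metis (no_types, lifting) finite_subset mem_Collect_eq subsetI)
qed

lemma ennreal_power2_less_top: "(x::ennreal)\<^sup>2 < \<infinity> \<longleftrightarrow> x < \<infinity>"
  by (cases x) (auto simp: power2_eq_square ennreal_mult[symmetric] ennreal_mult_top)

lemma ennreal_power2_le_iff: "(x::ennreal)\<^sup>2 \<le> y\<^sup>2 \<longleftrightarrow> x \<le> y"
proof
  assume "x\<^sup>2 \<le> y\<^sup>2"
  then show "x \<le> y"
    by (cases x; cases y)
      (auto simp: ennreal_power power2_eq_square[of "top::ennreal"] ennreal_mult_top power2_le_iff_abs_le top_unique)
qed (simp add: power_mono)

text \<open>The set \<open>T\<close> may fail to be measurable; the set where countably many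
  majorants with integrals tending to 0 are all at least 1 is a Borel null set containing it. Most
  statements about almost every line are obtained below by exhibiting such majorants.\<close>

lemma AE_by_Markov:
  fixes T :: "real set"
  assumes "\<And>\<epsilon>. \<epsilon> > 0 \<Longrightarrow> \<exists>F\<in>borel_measurable borel. (\<integral>\<^sup>+s. F s \<partial>lborel) \<le> ennreal \<epsilon> \<and> (\<forall>s\<in>T. 1 \<le> F s)"
  shows "AE s in lborel. s \<notin> T"
proof -
  have "\<exists>F. F \<in> borel_measurable borel \<and> (\<integral>\<^sup>+s. F s \<partial>lborel) \<le> ennreal (1 / Suc n) \<and> (\<forall>s\<in>T. 1 \<le> F s)" for n
    using assms[of "1 / Suc n"] by auto
  then obtain F where F: "\<And>n. F n \<in> borel_measurable borel" "\<And>n. (\<integral>\<^sup>+s. F n s \<partial>lborel) \<le> ennreal (1 / Suc n)"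
    "\<And>n s. s \<in> T \<Longrightarrow> 1 \<le> F n s" by metis
  define B where "B = {s. \<forall>n. 1 \<le> F n s}"
  have [measurable]: "\<And>n. F n \<in> borel_measurable borel" by (rule F)
  have Bm: "B \<in> sets lborel" unfolding B_def by measurable
  have "emeasure lborel B \<le> ennreal (1 / Suc n)" for n
  proof -
    have "emeasure lborel B \<le> emeasure lborel {s\<in>UNIV. 1 \<le> 1 * F n s}"
      by (rule emeasure_mono) (auto simp: B_def)
    also have "\<dots> \<le> 1 * (\<integral>\<^sup>+ s. F n s * indicator UNIV s \<partial>lborel)"
      by (rule nn_integral_Markov_inequality) auto
    also have "\<dots> \<le> ennreal (1 / Suc n)" using F(2)[of n] by simp
    finally show ?thesis .
  qed
  moreover have "(\<lambda>n. ennreal (1 / Suc n)) \<longlonglongrightarrow> ennreal 0"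
    using LIMSEQ_inverse_real_of_nat by (intro tendsto_ennrealI) (simp add: inverse_eq_divide)
  ultimately have "emeasure lborel B \<le> 0"
    by (metis LIMSEQ_le_const ennreal_0)
  then have "B \<in> null_sets lborel" using Bm by (simp add: null_sets_def)
  then show ?thesis
    by (rule AE_I') (auto simp: B_def F(3))
qed


section \<open>Null sets and widths on parallel lines\<close>

lemma hausdorff_zero_cover:
  fixes A :: "'a::metric_space set"
  assumes "hausdorff m A = 0" "0 < d" "0 < \<epsilon>"
  obtains U :: "nat \<Rightarrow> 'a set" where "A \<subseteq> (\<Union>i. U i)" "\<And>i. bounded (U i)" "\<And>i. diameter (U i) \<le> d"
    "(\<Sum>i. ennreal (diameter (U i) ^ m)) < \<epsilon>"
proof -
  have "0 < unit_ball_vol (real m) / 2 ^ m" by simp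
  then have "(SUP d\<in>{0<..}. hausdorff_content m d A) = 0"
    using assms(1) unfolding hausdorff_def by (metis ennreal_eq_0_iff linorder_not_le mult_eq_0_iff)
  then have "hausdorff_content m d A \<le> 0"
    using assms(2) by (metis SUP_upper greaterThan_iff)
  then have "hausdorff_content m d A < \<epsilon>" using assms(3) by simp
  then show ?thesis
    unfolding hausdorff_content_def INF_less_iff using that by blast
qed

text \<open>A Borel majorant of the indicator of the image of \<open>U\<close> under a 1-Lipschitz
  \<open>f\<close>: for bounded \<open>U\<close> the image lies in an interval of radius
  \<open>diameter U\<close> about the value at any point of \<open>U\<close>. Its integral bounds
  the measure of the set of levels of \<open>f\<close> that meet \<open>U\<close>.\<close>

definition width_ind :: "('a::metric_space \<Rightarrow> real) \<Rightarrow> 'a set \<Rightarrow> real \<Rightarrow> ennreal" where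
  "width_ind f U s =
     (if U = {} then 0 else indicator {f (SOME u. u \<in> U) - diameter U..f (SOME u. u \<in> U) + diameter U} s)"

lemma width_ind_measurable [measurable]: "width_ind f U \<in> borel_measurable borel"
  by (cases "U = {}") (auto simp: width_ind_def[abs_def])

lemma width_ind_le_1: "width_ind f U s \<le> 1"
  by (auto simp: width_ind_def indicator_def)

lemma nn_integral_width_ind:
  "bounded U \<Longrightarrow> (\<integral>\<^sup>+s. width_ind f U s \<partial>lborel) \<le> ennreal (2 * diameter U)"
  using diameter_ge_0[of U] by (cases "U = {}") (auto simp: width_ind_def[abs_def])

lemma width_ind_1:
  assumes "\<And>x y. \<bar>f x - f y\<bar> \<le> dist x y" "bounded U" "u \<in> U"
  shows "width_ind f U (f u) = 1"
proof -
  have "(SOME u. u \<in> U) \<in> U" using assms(3) by (rule someI)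
  then have "dist u (SOME u. u \<in> U) \<le> diameter U"
    using assms(2,3) by (intro diameter_bounded_bound) auto
  then have "\<bar>f u - f (SOME u. u \<in> U)\<bar> \<le> diameter U" using assms(1) order_trans by blast
  then show ?thesis using assms(3) by (auto simp: width_ind_def indicator_def)
qed

text \<open>A cover of \<open>A\<close> by sets of small total diameter yields a cover of the image
  by intervals of small total length. With \<open>f\<close> the sup-norm distance to a point, almost
  every square about that point has no point of \<open>A\<close> on its boundary.\<close>

lemma AE_notin_image_hausdorff_null:
  fixes A :: "'a::metric_space set" and f :: "'a \<Rightarrow> real"
  assumes "hausdorff 1 A = 0" and Lip: "\<And>x y. \<bar>f x - f y\<bar> \<le> dist x y"
  shows "AE s in lborel. s \<notin> f ` A"
proof (rule AE_by_Markov)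
  fix \<epsilon> :: real assume "\<epsilon> > 0"
  then obtain U where U: "A \<subseteq> (\<Union>i::nat. U i)" "\<And>i. bounded (U i)" "\<And>i. diameter (U i) \<le> 1"
    "(\<Sum>i. ennreal (diameter (U i) ^ 1)) < ennreal (\<epsilon>/2)"
    using hausdorff_zero_cover[OF assms(1), of 1 "ennreal (\<epsilon>/2)"] by auto
  define F where "F s = (\<Sum>i. width_ind f (U i) s)" for s
  have [measurable]: "F \<in> borel_measurable borel" unfolding F_def by measurable
  have "(\<integral>\<^sup>+s. F s \<partial>lborel) = (\<Sum>i. \<integral>\<^sup>+s. width_ind f (U i) s \<partial>lborel)"
    unfolding F_def by (rule nn_integral_suminf) auto
  also have "\<dots> \<le> (\<Sum>i. 2 * ennreal (diameter (U i) ^ 1))"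
    using nn_integral_width_ind[OF U(2)] by (intro suminf_le) (auto simp: ennreal_mult diameter_ge_0 U(2))
  also have "\<dots> = 2 * (\<Sum>i. ennreal (diameter (U i) ^ 1))" by simp
  also have "\<dots> \<le> 2 * ennreal (\<epsilon>/2)" by (rule mult_left_mono[OF less_imp_le[OF U(4)]]) simp
  also have "\<dots> = ennreal \<epsilon>" using \<open>\<epsilon> > 0\<close> by (simp add: ennreal_mult'[symmetric] flip: ennreal_numeral)
  finally have 1: "(\<integral>\<^sup>+s. F s \<partial>lborel) \<le> ennreal \<epsilon>" .
  have "1 \<le> F s" if sfA: "s \<in> f ` A" for s
  proof -
    obtain x where x: "x \<in> A" "s = f x" using sfA by blast
    then obtain i where "x \<in> U i" using U(1) by blast
    then have "1 = width_ind f (U i) s" using width_ind_1[OF Lip U(2)] x by simp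
    also have "\<dots> = (\<Sum>i\<in>{i}. width_ind f (U i) s)" by simp
    also have "\<dots> \<le> F s" unfolding F_def by (rule sum_le_suminf) auto
    finally show ?thesis .
  qed
  then show "\<exists>F\<in>borel_measurable borel. (\<integral>\<^sup>+s. F s \<partial>lborel) \<le> ennreal \<epsilon> \<and> (\<forall>s\<in>f ` A. 1 \<le> F s)"
    using 1 by (intro bexI[of _ F]) auto
qed

text \<open>An Eilenberg-type inequality: if \<open>A\<close> is covered by countably many sets, the
  slice at level \<open>s\<close> is covered by those that meet it, and the integral over
  \<open>s\<close> of their total diameter is at most twice the sum of the squared diameters. Each
  pair of a scale \<open>1 / Suc n\<close> and a threshold \<open>1 / Suc k\<close> is treated by
  Markov's inequality, and the countably many exceptional sets of levels are united.\<close>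

lemma AE_slices_hausdorff_null:
  fixes A :: "'a::metric_space set" and f :: "'a \<Rightarrow> real"
  assumes "hausdorff 2 A = 0" and Lip: "\<And>x y. \<bar>f x - f y\<bar> \<le> dist x y"
  shows "AE s in lborel. hausdorff 1 {x \<in> A. f x = s} = 0"
proof -
  have *: "AE s in lborel. s \<notin> {s. ennreal (1 / Suc k) \<le> hausdorff_content 1 (1 / Suc n) {x \<in> A. f x = s}}" for n k
  proof (rule AE_by_Markov)
    fix \<epsilon> :: real assume e: "\<epsilon> > 0"
    \<comment> \<open>The factor \<open>Suc k\<close> normalises the majorant to be at least 1 where
      the content is at least \<open>1 / Suc k\<close>; the 2 comes from the width of the
      intervals.\<close>
    define \<epsilon>' where "\<epsilon>' = \<epsilon> / (2 * Suc k)"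
    have e': "\<epsilon>' > 0" using e by (simp add: \<epsilon>'_def)
    obtain U where U: "A \<subseteq> (\<Union>i::nat. U i)" "\<And>i. bounded (U i)" "\<And>i. diameter (U i) \<le> 1 / Suc n"
      "(\<Sum>i. ennreal (diameter (U i) ^ 2)) < ennreal \<epsilon>'"
      by (rule hausdorff_zero_cover[OF assms(1), of "1 / Suc n" "ennreal \<epsilon>'"]) (use e' in auto)
    define F where "F s = ennreal (Suc k) * (\<Sum>i. ennreal (diameter (U i)) * width_ind f (U i) s)" for s
    have [measurable]: "F \<in> borel_measurable borel" unfolding F_def by measurable
    have "(\<integral>\<^sup>+s. F s \<partial>lborel)
        = ennreal (Suc k) * (\<Sum>i. \<integral>\<^sup>+s. ennreal (diameter (U i)) * width_ind f (U i) s \<partial>lborel)"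
      unfolding F_def by (subst nn_integral_cmult, simp, subst nn_integral_suminf) auto
    also have "\<dots> \<le> ennreal (Suc k) * (\<Sum>i. 2 * ennreal (diameter (U i) ^ 2))"
    proof (intro mult_left_mono suminf_le)
      fix i
      have "(\<integral>\<^sup>+s. ennreal (diameter (U i)) * width_ind f (U i) s \<partial>lborel)
          = ennreal (diameter (U i)) * (\<integral>\<^sup>+s. width_ind f (U i) s \<partial>lborel)"
        by (rule nn_integral_cmult) simp
      also have "\<dots> \<le> ennreal (diameter (U i)) * ennreal (2 * diameter (U i))"
        by (intro mult_left_mono nn_integral_width_ind U(2)) simp
      also have "\<dots> = 2 * ennreal (diameter (U i) ^ 2)"
        using diameter_ge_0[OF U(2), of i]
        by (simp add: power2_eq_square ennreal_mult ac_simps)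
      finally show "(\<integral>\<^sup>+s. ennreal (diameter (U i)) * width_ind f (U i) s \<partial>lborel)
          \<le> 2 * ennreal (diameter (U i) ^ 2)" .
    qed auto
    also have "\<dots> = ennreal (Suc k) * (2 * (\<Sum>i. ennreal (diameter (U i) ^ 2)))" by simp
    also have "\<dots> \<le> ennreal (Suc k) * (2 * ennreal \<epsilon>')"
      by (intro mult_left_mono less_imp_le[OF U(4)]) auto
    also have "\<dots> = ennreal (Suc k * (2 * \<epsilon>'))" using e' by (simp add: ennreal_mult)
    also have "Suc k * (2 * \<epsilon>') = \<epsilon>" by (simp add: \<epsilon>'_def field_simps)
    finally have 1: "(\<integral>\<^sup>+s. F s \<partial>lborel) \<le> ennreal \<epsilon>" .
    have "1 \<le> F s" if "ennreal (1 / Suc k) \<le> hausdorff_content 1 (1 / Suc n) {x \<in> A. f x = s}" for s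
    proof -
      define W where "W i = U i \<inter> {x. f x = s}" for i
      have Wb: "bounded (W i)" "diameter (W i) \<le> diameter (U i)" for i
        using U(2)[of i] by (auto simp: W_def intro: bounded_subset diameter_subset)
      have "ennreal (1 / Suc k) \<le> (\<Sum>i. ennreal (diameter (W i) ^ 1))"
        using that
      proof (rule order_trans)
        show "hausdorff_content 1 (1 / Suc n) {x \<in> A. f x = s} \<le> (\<Sum>i. ennreal (diameter (W i) ^ 1))"
          unfolding hausdorff_content_def
        proof (rule INF_lower, intro CollectI conjI allI)
          show "{x \<in> A. f x = s} \<subseteq> (\<Union>i. W i)" using U(1) unfolding W_def by blast
          show "bounded (W i)" "diameter (W i) \<le> 1 / Suc n" for i
            using Wb[of i] U(3)[of i] by auto
        qed
      qed
      also have "\<dots> \<le> (\<Sum>i. ennreal (diameter (U i)) * width_ind f (U i) s)"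
      proof (intro suminf_le)
        fix i
        show "ennreal (diameter (W i) ^ 1) \<le> ennreal (diameter (U i)) * width_ind f (U i) s"
        proof (cases "W i = {}")
          case False
          then obtain u where u: "u \<in> U i" "f u = s" by (auto simp: W_def)
          have "width_ind f (U i) s = 1" using width_ind_1[OF Lip U(2) u(1)] u(2) by simp
          then show ?thesis using Wb(2)[of i] by (simp add: ennreal_leI)
        qed simp
      qed auto
      finally have "ennreal (Suc k) * ennreal (1 / Suc k) \<le> F s"
        unfolding F_def by (rule mult_left_mono) simp
      moreover have "ennreal (Suc k) * ennreal (1 / Suc k) = 1"
        by (simp add: ennreal_mult'[symmetric] del: of_nat_Suc)
      ultimately show ?thesis by simp
    qed
    then show "\<exists>F\<in>borel_measurable borel. (\<integral>\<^sup>+s. F s \<partial>lborel) \<le> ennreal \<epsilon> \<and>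
        (\<forall>s\<in>{s. ennreal (1 / Suc k) \<le> hausdorff_content 1 (1 / Suc n) {x \<in> A. f x = s}}. 1 \<le> F s)"
      using 1 by (intro bexI[of _ F]) auto
  qed
  then have "AE s in lborel. \<forall>n k. s \<notin> {s. ennreal (1 / Suc k) \<le> hausdorff_content 1 (1 / Suc n) {x \<in> A. f x = s}}"
    by (intro AE_all_countable[THEN iffD2] allI)
  then show ?thesis
  proof eventually_elim
    case (elim s)
    let ?B = "{x \<in> A. f x = s}"
    have 0: "hausdorff_content 1 (1 / Suc n) ?B = 0" for n
    proof -
      have "hausdorff_content 1 (1 / Suc n) ?B \<le> ennreal (1 / Suc k)" for k
        using elim[rule_format, of k n] by auto
      moreover have "(\<lambda>n. ennreal (1 / Suc n)) \<longlonglongrightarrow> ennreal 0"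
        using LIMSEQ_inverse_real_of_nat by (intro tendsto_ennrealI) (simp add: inverse_eq_divide)
      ultimately have "hausdorff_content 1 (1 / Suc n) ?B \<le> ennreal 0"
        by (meson LIMSEQ_le_const)
      then show ?thesis by simp
    qed
    have "hausdorff_content 1 d ?B \<le> 0" if d: "d > 0" for d
    proof -
      obtain n where "1 / real (Suc n) < d" using nat_approx_posE[OF d] .
      then show ?thesis using hausdorff_content_antimono[of "1 / Suc n" d 1 ?B] 0[of n] by simp
    qed
    then have "(SUP d\<in>{0<..}. hausdorff_content 1 d ?B) \<le> 0" by (intro SUP_least) auto
    then show ?case by (simp add: hausdorff_def)
  qed
qed

section \<open>Area of squares and of bundles of parallel lines\<close>

lemma hausdorff2_square_le:
  fixes x :: complex
  assumes "r > 0" "A \<subseteq> {w. \<bar>Re (w - x)\<bar> \<le> r \<and> \<bar>Im (w - x)\<bar> \<le> r}"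
  shows "hausdorff 2 A \<le> ennreal (64 * r\<^sup>2)"
proof -
  have "hausdorff_content 2 d A \<le> ennreal (64 * r\<^sup>2)" if "d > 0" for d
  proof -
    obtain n :: nat where n: "4 * r / d < real n" using reals_Archimedean2 by blast
    have n0: "n > 0" using n assms(1) that by (metis divide_pos_pos gr0I less_asym mult_pos_pos of_nat_0 zero_less_numeral)
    \<comment> \<open>Cells of side \<open>h\<close>: two points of a cell differ by at most
      \<open>h\<close> in each coordinate, so its diameter is at most \<open>2 * h\<close>, and
      \<open>n\<close> was chosen to make this at most \<open>d\<close>.\<close>
    define h where "h = 2 * r / n"
    have h: "h > 0" "2 * h \<le> d" using n n0 assms(1) that by (auto simp: h_def field_simps)
    define G where "G k = (if k < n * n then {w. real (k div n) * h \<le> Re (w - x) + r \<and> Re (w - x) + r \<le> real (Suc (k div n)) * h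
        \<and> real (k mod n) * h \<le> Im (w - x) + r \<and> Im (w - x) + r \<le> real (Suc (k mod n)) * h} else {})" for k
    have dG: "dist w w' \<le> 2 * h" if "w \<in> G k" "w' \<in> G k" for k w w'
    proof -
      have "\<bar>Re (w - w')\<bar> \<le> h" "\<bar>Im (w - w')\<bar> \<le> h"
        using that by (auto simp: G_def algebra_simps split: if_splits)
      then show ?thesis using cmod_le[of "w - w'"] by (simp add: dist_norm)
    qed
    have bG: "bounded (G k)" for k
      unfolding bounded_two_points using dG by blast
    have diG: "diameter (G k) \<le> 2 * h" for k
      using dG h by (intro diameter_le) (auto simp: dist_norm)
    have idx: "\<exists>j<n. real j * h \<le> y \<and> y \<le> real (Suc j) * h" if "0 \<le> y" "y \<le> 2 * r" for y
    \<comment> \<open>At the right end the floor would give the index \<open>n\<close>, so the last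
      cell takes it.\<close>
    proof (cases "y = 2 * r")
      case True
      have "n * h = 2 * r" using n0 by (simp add: h_def)
      then show ?thesis using n0 True h by (intro exI[of _ "n - 1"]) (auto simp: algebra_simps of_nat_diff)
    next
      case False
      define j where "j = nat \<lfloor>y / h\<rfloor>"
      have j: "real j = of_int \<lfloor>y / h\<rfloor>" using that h by (simp add: j_def)
      have "real j \<le> y / h" "y / h < real j + 1" unfolding j by linarith+
      then have "real j * h \<le> y" "y \<le> real (Suc j) * h" using h by (auto simp: field_simps)
      moreover have "j < n"
      proof -
        have "real j * h \<le> y" by fact
        also have "y < n * h" using False that n0 by (simp add: h_def)
        finally show ?thesis using h by simp
      qed
      ultimately show ?thesis by blast
    qed
    have cov: "A \<subseteq> (\<Union>k. G k)"
    proof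
      fix w assume "w \<in> A"
      then have "\<bar>Re (w - x)\<bar> \<le> r" "\<bar>Im (w - x)\<bar> \<le> r" using assms(2) by auto
      then obtain i j where ij: "i < n" "real i * h \<le> Re (w - x) + r" "Re (w - x) + r \<le> real (Suc i) * h"
        "j < n" "real j * h \<le> Im (w - x) + r" "Im (w - x) + r \<le> real (Suc j) * h"
        using idx[of "Re (w - x) + r"] idx[of "Im (w - x) + r"] by (auto simp: abs_le_iff)
      have "i * n + j < n * n"
      proof -
        have "i * n + j < Suc i * n" using ij by simp
        also have "\<dots> \<le> n * n" using ij by (intro mult_le_mono1) auto
        finally show ?thesis .
      qed
      moreover have "(i * n + j) div n = i" "(i * n + j) mod n = j" using ij by auto
      ultimately have "w \<in> G (i * n + j)" using ij by (simp add: G_def)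
      then show "w \<in> (\<Union>k. G k)" by blast
    qed
    have "hausdorff_content 2 d A \<le> (\<Sum>k. ennreal (diameter (G k) ^ 2))"
      unfolding hausdorff_content_def using cov bG diG h(2) by (intro INF_lower) (auto intro: order_trans)
    also have "\<dots> = (\<Sum>k<n*n. ennreal (diameter (G k) ^ 2))"
      by (rule suminf_finite) (auto simp: G_def)
    also have "\<dots> \<le> (\<Sum>k<n*n. ennreal ((2*h)^2))"
      using diG diameter_ge_0[OF bG] by (intro sum_mono ennreal_leI power_mono) auto
    also have "\<dots> = ennreal (real (n * n) * (2*h)^2)" by (simp add: ennreal_mult ennreal_of_nat_eq_real_of_nat)
    also have "real (n * n) * (2*h)^2 = 16 * r\<^sup>2" using n0 by (simp add: h_def power2_eq_square field_simps)
    also have "ennreal (16 * r\<^sup>2) \<le> ennreal (64 * r\<^sup>2)" by (rule ennreal_leI) simp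
    finally show ?thesis .
  qed
  then have "(SUP d\<in>{0<..}. hausdorff_content 2 d A) \<le> ennreal (64 * r\<^sup>2)" by (intro SUP_least) auto
  then have "hausdorff 2 A \<le> ennreal (unit_ball_vol (real 2) / 2 ^ 2) * ennreal (64 * r\<^sup>2)"
    unfolding hausdorff_def by (rule mult_left_mono) simp
  also have "unit_ball_vol (real 2) / 2 ^ 2 \<le> 1" using pi_less_4 by (simp add: unit_ball_vol_2)
  then have "ennreal (unit_ball_vol (real 2) / 2 ^ 2) * ennreal (64 * r\<^sup>2) \<le> 1 * ennreal (64 * r\<^sup>2)"
    by (intro mult_right_mono) (auto simp: ennreal_le_1)
  finally show ?thesis by simp
qed

text \<open>With \<open>e\<close> a unit complex number, \<open>t\<close> runs along the line and
  \<open>s\<close> is the signed offset perpendicular to it, so (t, s) are rotated and translated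
  Cartesian coordinates. Fixing \<open>s\<close> selects one member of a family of parallel lines,
  and \<open>hgt z e\<close> recovers \<open>s\<close>.\<close>

definition pline :: "complex \<Rightarrow> complex \<Rightarrow> real \<Rightarrow> real \<Rightarrow> complex" where
  "pline z e s t = z + e * Complex t s"

definition hgt :: "complex \<Rightarrow> complex \<Rightarrow> complex \<Rightarrow> real" where
  "hgt z e w = Im ((w - z) / e)"

lemma pline_dist: "cmod e = 1 \<Longrightarrow> dist (pline z e s t) (pline z e s' t') = cmod (Complex (t - t') (s - s'))"
proof -
  assume e: "cmod e = 1"
  have "pline z e s t - pline z e s' t' = e * Complex (t - t') (s - s')"
    by (simp add: pline_def flip: complex_diff right_diff_distrib)
  then show ?thesis using e by (simp add: dist_norm norm_mult)
qed

lemma pline_dist_same: "cmod e = 1 \<Longrightarrow> dist (pline z e s t) (pline z e s t') = \<bar>t - t'\<bar>"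
  by (simp add: pline_dist complex_norm)

lemma hgt_pline [simp]: "cmod e = 1 \<Longrightarrow> hgt z e (pline z e s t) = s"
  by (auto simp: hgt_def pline_def)

lemma hgt_Lip: "cmod e = 1 \<Longrightarrow> \<bar>hgt z e w - hgt z e w'\<bar> \<le> dist w w'"
proof -
  assume e: "cmod e = 1"
  have "hgt z e w - hgt z e w' = Im ((w - w') / e)"
    by (simp add: hgt_def diff_divide_distrib flip: minus_complex.simps)
  then show ?thesis using abs_Im_le_cmod[of "(w - w') / e"] e by (simp add: norm_divide dist_norm)
qed

lemma continuous_pline [continuous_intros]: "continuous_on A (pline z e s)"
  unfolding pline_def[abs_def] Complex_eq by (intro continuous_intros)

lemma pline_measurable: "(\<lambda>(s, t). pline z e s t) \<in> borel_measurable (lborel \<Otimes>\<^sub>M lborel)"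
proof -
  have "(\<lambda>(s, t). pline z e s t) \<in> borel_measurable (borel \<Otimes>\<^sub>M borel)"
    unfolding pline_def[abs_def] Complex_eq borel_prod
    by (intro borel_measurable_continuous_onI) (auto simp: case_prod_unfold intro!: continuous_intros)
  then show ?thesis by (simp cong: measurable_cong_sets)
qed

text \<open>Each set of a cover is enclosed, in the rotated coordinates, in a square of side twice
  its diameter, whose area is 4 times the squared diameter. The factor 16 exceeds 4 divided by the
  normalising constant \<open>pi / 4\<close>.\<close>

lemma emeasure_pline_le_hausdorff:
  assumes e: "cmod e = 1" and A: "A \<in> sets borel"
  shows "emeasure (lborel \<Otimes>\<^sub>M lborel) {(s, t). pline z e s t \<in> A} \<le> ennreal 16 * hausdorff 2 A"
proof -
  let ?X = "{(s, t). pline z e s t \<in> A}"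
  let ?M = "lborel \<Otimes>\<^sub>M (lborel :: real measure)"
  have "emeasure ?M ?X \<le> 4 * hausdorff_content 2 1 A"
  proof -
    have "emeasure ?M ?X \<le> 4 * (\<Sum>i. ennreal (diameter (U i) ^ 2))"
      if U: "A \<subseteq> (\<Union>i::nat. U i)" "\<And>i. bounded (U i)" for U
    proof -
      define p where "p i = (SOME w. w \<in> U i)" for i
      define B where "B i = (if U i = {} then {} else
        {Im ((p i - z)/e) - diameter (U i)..Im ((p i - z)/e) + diameter (U i)} \<times>
        {Re ((p i - z)/e) - diameter (U i)..Re ((p i - z)/e) + diameter (U i)})" for i
      have Bm: "B i \<in> sets ?M" for i by (auto simp: B_def)
      have Be: "emeasure ?M (B i) \<le> 4 * ennreal (diameter (U i) ^ 2)" for i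
      proof (cases "U i = {}")
        case False
        have "emeasure ?M (B i) = ennreal (2 * diameter (U i)) * ennreal (2 * diameter (U i))"
          using False diameter_ge_0[OF U(2)] by (simp add: B_def lborel.emeasure_pair_measure_Times)
        also have "\<dots> = 4 * ennreal (diameter (U i) ^ 2)"
          using diameter_ge_0[OF U(2)] by (simp add: power2_eq_square ennreal_mult[symmetric] flip: ennreal_numeral)
        finally show ?thesis by simp
      qed (simp add: B_def)
      have "?X \<subseteq> (\<Union>i. B i)"
      proof safe
        fix s t assume "pline z e s t \<in> A"
        then obtain i where i: "pline z e s t \<in> U i" using U(1) by blast
        then have "p i \<in> U i" unfolding p_def by (rule someI)
        then have "dist (pline z e s t) (p i) \<le> diameter (U i)"
          using i U(2) by (intro diameter_bounded_bound) auto
        moreover have "cmod (Complex t s - (p i - z)/e) = dist (pline z e s t) (p i)"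
        proof -
          have "e \<noteq> 0" using e by auto
          then have "e * (Complex t s - (p i - z)/e) = pline z e s t - p i"
            by (simp add: pline_def field_simps)
          then show ?thesis using e by (metis dist_norm mult.left_neutral norm_mult)
        qed
        ultimately have "\<bar>Re (Complex t s - (p i - z)/e)\<bar> \<le> diameter (U i)" "\<bar>Im (Complex t s - (p i - z)/e)\<bar> \<le> diameter (U i)"
          using abs_Re_le_cmod abs_Im_le_cmod order_trans by metis+
        then have "(s, t) \<in> B i" using i by (auto simp: B_def)
        then show "(s, t) \<in> (\<Union>i. B i)" by blast
      qed
      then have "emeasure ?M ?X \<le> emeasure ?M (\<Union>i. B i)" using Bm by (intro emeasure_mono) auto
      also have "\<dots> \<le> (\<Sum>i. emeasure ?M (B i))" using Bm by (intro emeasure_subadditive_countably) auto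
      also have "\<dots> \<le> (\<Sum>i. 4 * ennreal (diameter (U i) ^ 2))" using Be by (intro suminf_le) auto
      also have "\<dots> = 4 * (\<Sum>i. ennreal (diameter (U i) ^ 2))" by simp
      finally show ?thesis .
    qed
    then have "emeasure ?M ?X / 4 \<le> hausdorff_content 2 1 A"
      unfolding hausdorff_content_def by (intro INF_greatest divide_le_posI_ennreal) auto
    then have "4 * (emeasure ?M ?X / 4) \<le> 4 * hausdorff_content 2 1 A" by (rule mult_left_mono) simp
    moreover have "4 * (emeasure ?M ?X / 4) = emeasure ?M ?X"
      using mult_divide_eq_ennreal[of 4 "emeasure ?M ?X"] by (simp add: ennreal_times_divide mult.commute)
    ultimately show ?thesis by simp
  qed
  also have "\<dots> \<le> 4 * (SUP d\<in>{0<..}. hausdorff_content 2 d A)"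
    by (intro mult_left_mono SUP_upper) auto
  also have "\<dots> = ennreal (16 * (1/4)) * (SUP d\<in>{0<..}. hausdorff_content 2 d A)" by simp
  also have "\<dots> \<le> ennreal (16 * (pi / 4)) * (SUP d\<in>{0<..}. hausdorff_content 2 d A)"
    using pi_gt3 by (intro mult_right_mono ennreal_leI) auto
  also have "\<dots> = ennreal 16 * hausdorff 2 A"
  proof -
    have "ennreal (16 * (pi / 4)) = ennreal 16 * ennreal (pi / 4)" by (rule ennreal_mult) auto
    then show ?thesis by (simp add: hausdorff_def unit_ball_vol_2 mult.assoc)
  qed
  finally show ?thesis .
qed

text \<open>The push-forward of planar Lebesgue measure under the rotated coordinates is at most 16
  times the Hausdorff measure on Borel sets; Fubini's theorem turns this into iterated
  integrals.\<close>

lemma nn_integral_pline_le: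
  assumes e: "cmod e = 1" and l: "l \<in> borel_measurable borel"
  shows "(\<integral>\<^sup>+s. \<integral>\<^sup>+t. l (pline z e s t) \<partial>lborel \<partial>lborel) \<le> ennreal 16 * (\<integral>\<^sup>+w. l w \<partial>hausdorff_measure 2)"
proof -
  let ?M = "lborel \<Otimes>\<^sub>M (lborel :: real measure)" and ?f = "\<lambda>(s, t). pline z e s t"
  let ?D = "distr ?M borel ?f" and ?N = "scale_measure (ennreal 16) (hausdorff_measure 2)"
  note [measurable] = pline_measurable[of z e] l
  have s: "sets ?D = sets ?N" by simp
  have "?D \<le> ?N"
  proof (subst le_measure[OF s], safe)
    fix A assume "A \<in> sets ?D"
    then have A: "A \<in> sets borel" by simp
    have "emeasure ?D A = emeasure ?M (?f -` A \<inter> space ?M)" using A by (intro emeasure_distr) auto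
    also have "?f -` A \<inter> space ?M = {(s, t). pline z e s t \<in> A}" by (auto simp: space_pair_measure)
    also have "emeasure ?M \<dots> \<le> emeasure ?N A"
      using emeasure_pline_le_hausdorff[OF e A] A by (simp add: emeasure_hausdorff_measure)
    finally show "emeasure ?D A \<le> emeasure ?N A" .
  qed
  then have "nn_integral ?D l \<le> nn_integral ?N l" by (rule nn_integral_mono_measure[OF s])
  also have "\<dots> = ennreal 16 * (\<integral>\<^sup>+w. l w \<partial>hausdorff_measure 2)"
    by (rule nn_integral_scale_measure) (use l in \<open>simp cong: measurable_cong_sets\<close>)
  also have "nn_integral ?D l = (\<integral>\<^sup>+p. l (?f p) \<partial>?M)" by (rule nn_integral_distr) auto
  also have "\<dots> = (\<integral>\<^sup>+s. \<integral>\<^sup>+t. l (pline z e s t) \<partial>lborel \<partial>lborel)"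
    by (subst lborel.nn_integral_fst[symmetric]) (auto simp: case_prod_unfold)
  finally show ?thesis .
qed


section \<open>Exceptional path families\<close>

lemma INF_ennreal_eq_0_iff: "(INF x\<in>A. f x) = (0::ennreal) \<longleftrightarrow> (\<forall>\<epsilon>>0. \<exists>x\<in>A. f x < \<epsilon>)"
proof
  assume "(INF x\<in>A. f x) = 0"
  then show "\<forall>\<epsilon>>0. \<exists>x\<in>A. f x < \<epsilon>" by (metis INF_less_iff)
next
  assume *: "\<forall>\<epsilon>>0. \<exists>x\<in>A. f x < \<epsilon>"
  show "(INF x\<in>A. f x) = 0"
  proof (rule ccontr)
    assume "(INF x\<in>A. f x) \<noteq> 0"
    then have "(INF x\<in>A. f x) > 0" by (simp add: zero_less_iff_neq_zero)
    then obtain x where "x \<in> A" "f x < (INF x\<in>A. f x)" using * by blast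
    then show False by (meson INF_lower leD)
  qed
qed

lemma ennreal_add_power2_le: "(a + b)\<^sup>2 \<le> 2 * a\<^sup>2 + 2 * (b::ennreal)\<^sup>2"
proof (cases a; cases b)
  fix x y assume "0 \<le> x" "0 \<le> y" and ab: "a = ennreal x" "b = ennreal y"
  then have "(a + b)\<^sup>2 = ennreal ((x + y)\<^sup>2)"
    by (simp add: ennreal_power flip: ennreal_plus)
  moreover have "2 * a\<^sup>2 + 2 * b\<^sup>2 = ennreal (2 * x\<^sup>2 + 2 * y\<^sup>2)"
    using \<open>0 \<le> x\<close> \<open>0 \<le> y\<close> ab by (simp add: ennreal_power ennreal_plus ennreal_mult)
  moreover have "(x + y)\<^sup>2 \<le> 2 * x\<^sup>2 + 2 * y\<^sup>2" using sum_squares_bound[of x y] by (simp add: power2_sum)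
  ultimately show ?thesis by (simp add: ennreal_leI del: ennreal_plus)
qed (auto simp: power2_eq_square ennreal_mult_top)

lemma line_integral_mono: "(\<And>z. l z \<le> l' z) \<Longrightarrow> line_integral l \<gamma> \<le> line_integral l' \<gamma>"
  unfolding line_integral_def
  by (auto intro!: SUP_mono' nn_integral_mono mult_right_mono split: prod.split)

lemma line_integral_subpath:
  assumes "is_subpath \<gamma>' \<gamma>"
  shows "line_integral l \<gamma>' \<le> line_integral l \<gamma>"
proof (cases "locally_rectifiable \<gamma>")
  case True
  then have "locally_rectifiable \<gamma>'" using assms unfolding is_subpath_def locally_rectifiable_def
    by (metis order_trans)
  then show ?thesis using True assms unfolding line_integral_def is_subpath_def
    by (auto intro!: SUP_subset_mono)
qed (simp add: line_integral_def)

lemma mod2_eq_0_iff: "mod2 \<Gamma> = 0 \<longleftrightarrow> (\<forall>\<epsilon>>0. \<exists>l\<in>borel_measurable borel.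
    (\<forall>\<gamma>\<in>\<Gamma>. line_integral l \<gamma> \<ge> 1) \<and> (\<integral>\<^sup>+z. (l z)\<^sup>2 \<partial>hausdorff_measure 2) < \<epsilon>)"
  unfolding mod2_def INF_ennreal_eq_0_iff by blast

text \<open>The sum of two admissible densities is admissible for both families, and
  \<open>ennreal_add_power2_le\<close> bounds its energy; hence the quarters of \<epsilon>.\<close>

lemma mod2_Un_eq_0:
  assumes "mod2 A = 0" "mod2 B = 0"
  shows "mod2 (A \<union> B) = 0"
  unfolding mod2_eq_0_iff
proof (intro allI impI)
  fix \<epsilon> :: ennreal assume "\<epsilon> > 0"
  then have "\<epsilon> / 4 > 0" by (simp add: ennreal_zero_less_divide)
  then obtain l l' where l: "l \<in> borel_measurable borel" "\<And>\<gamma>. \<gamma> \<in> A \<Longrightarrow> line_integral l \<gamma> \<ge> 1"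
    "(\<integral>\<^sup>+z. (l z)\<^sup>2 \<partial>hausdorff_measure 2) < \<epsilon> / 4"
    and l': "l' \<in> borel_measurable borel" "\<And>\<gamma>. \<gamma> \<in> B \<Longrightarrow> line_integral l' \<gamma> \<ge> 1"
    "(\<integral>\<^sup>+z. (l' z)\<^sup>2 \<partial>hausdorff_measure 2) < \<epsilon> / 4"
    using assms unfolding mod2_eq_0_iff by meson
  note [measurable] = l(1) l'(1)
  have m: "borel_measurable (hausdorff_measure 2 :: complex measure) = (borel_measurable borel :: (complex \<Rightarrow> ennreal) set)"
    by (rule measurable_cong_sets) auto
  let ?l = "\<lambda>z. l z + l' z"
  have "(\<integral>\<^sup>+z. (?l z)\<^sup>2 \<partial>hausdorff_measure 2) \<le> (\<integral>\<^sup>+z. 2 * (l z)\<^sup>2 + 2 * (l' z)\<^sup>2 \<partial>hausdorff_measure 2)"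
    by (intro nn_integral_mono ennreal_add_power2_le)
  also have "\<dots> = 2 * (\<integral>\<^sup>+z. (l z)\<^sup>2 \<partial>hausdorff_measure 2) + 2 * (\<integral>\<^sup>+z. (l' z)\<^sup>2 \<partial>hausdorff_measure 2)"
    by (subst nn_integral_add, (simp add: m)+, (subst nn_integral_cmult, simp add: m)+, simp)
  also have "\<dots> < \<epsilon>"
  proof -
    have q: "2 * x + 2 * y < \<epsilon>" if "x < \<epsilon> / 4" "y < \<epsilon> / 4" for x y :: ennreal
      using that by (cases \<epsilon>; cases x; cases y)
        (auto simp: divide_ennreal ennreal_less_iff ennreal_mult[symmetric] ennreal_plus[symmetric] simp del: ennreal_plus simp flip: ennreal_numeral)
    show ?thesis by (rule q[OF l(3) l'(3)])
  qed
  finally have "(\<integral>\<^sup>+z. (?l z)\<^sup>2 \<partial>hausdorff_measure 2) < \<epsilon>" .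
  moreover have "line_integral ?l \<gamma> \<ge> 1" if "\<gamma> \<in> A \<union> B" for \<gamma>
  proof -
    have "line_integral l \<gamma> \<le> line_integral ?l \<gamma>" "line_integral l' \<gamma> \<le> line_integral ?l \<gamma>"
      by (rule line_integral_mono; simp)+
    then show ?thesis using l(2) l'(2) that by (meson UnE order_trans)
  qed
  ultimately show "\<exists>l\<in>borel_measurable borel.
    (\<forall>\<gamma>\<in>A \<union> B. line_integral l \<gamma> \<ge> 1) \<and> (\<integral>\<^sup>+z. (l z)\<^sup>2 \<partial>hausdorff_measure 2) < \<epsilon>"
    by (intro bexI[of _ ?l]) auto
qed

text \<open>Line integrals grow along superpaths, so a density admissible for \<open>A\<close> is
  admissible for \<open>B\<close>.\<close>

lemma mod2_superpaths_eq_0: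
  assumes "mod2 A = 0" "\<And>\<gamma>. \<gamma> \<in> B \<Longrightarrow> \<exists>\<gamma>'\<in>A. is_subpath \<gamma>' \<gamma>"
  shows "mod2 B = 0"
proof -
  have "mod2 B \<le> mod2 A"
    unfolding mod2_def
  proof (rule INF_superset_mono, safe)
    fix l \<gamma> assume l: "\<forall>\<gamma>\<in>A. 1 \<le> line_integral l \<gamma>" and "\<gamma> \<in> B"
    then obtain \<gamma>' where "\<gamma>' \<in> A" "is_subpath \<gamma>' \<gamma>" using assms(2) by blast
    then show "1 \<le> line_integral l \<gamma>" using l line_integral_subpath by (meson order_trans)
  qed
  then show ?thesis using assms(1) by simp
qed

lemma path_length_pline:
  assumes e: "cmod e = 1" and ab: "a \<le> b"
  shows "path_length (pline z e s) a b = ennreal (b - a)"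
  unfolding path_length_def
proof (rule antisym)
  show "(SUP (n, t)\<in>{(n, t). mono_on {..n} t \<and> t ` {..n} \<subseteq> {a..b}}.
        \<Sum>i<n. ennreal (dist (pline z e s (t i)) (pline z e s (t (Suc i))))) \<le> ennreal (b - a)"
  proof (rule SUP_least, clarify)
    fix n and t :: "nat \<Rightarrow> real" assume t: "mono_on {..n} t" "t ` {..n} \<subseteq> {a..b}"
    have "(\<Sum>i<n. ennreal (dist (pline z e s (t i)) (pline z e s (t (Suc i))))) = (\<Sum>i<n. ennreal (t (Suc i) - t i))"
    proof (rule sum.cong[OF refl])
      fix i assume "i \<in> {..<n}"
      then have "t i \<le> t (Suc i)" using t(1) by (auto simp: mono_on_def)
      then show "ennreal (dist (pline z e s (t i)) (pline z e s (t (Suc i)))) = ennreal (t (Suc i) - t i)"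
        by (simp add: pline_dist_same[OF e])
    qed
    also have "\<dots> = ennreal (\<Sum>i<n. t (Suc i) - t i)"
      using t(1) by (intro sum_ennreal) (auto simp: mono_on_def)
    also have "(\<Sum>i<n. t (Suc i) - t i) = t n - t 0" by (rule sum_lessThan_telescope)
    also have "ennreal (t n - t 0) \<le> ennreal (b - a)" 
    proof (rule ennreal_leI)
      have "t n \<in> {a..b}" "t 0 \<in> {a..b}" using t(2) by auto
      then show "t n - t 0 \<le> b - a" by auto
    qed
    finally show "(\<Sum>i<n. ennreal (dist (pline z e s (t i)) (pline z e s (t (Suc i))))) \<le> ennreal (b - a)" .
  qed
  define t where "t i = (if i = (0::nat) then a else b)" for i
  have "ennreal (b - a) = (\<Sum>i<1. ennreal (dist (pline z e s (t i)) (pline z e s (t (Suc i)))))"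
    using ab by (simp add: t_def pline_dist_same[OF e])
  also have "\<dots> \<le> (SUP (n, t)\<in>{(n, t). mono_on {..n} t \<and> t ` {..n} \<subseteq> {a..b}}.
        \<Sum>i<n. ennreal (dist (pline z e s (t i)) (pline z e s (t (Suc i)))))"
    using ab by (intro SUP_upper2[of "(1, t)"]) (auto simp: t_def mono_on_def)
  finally show "ennreal (b - a) \<le> (SUP (n, t)\<in>{(n, t). mono_on {..n} t \<and> t ` {..n} \<subseteq> {a..b}}.
        \<Sum>i<n. ennreal (dist (pline z e s (t i)) (pline z e s (t (Suc i)))))" .
qed

text \<open>A line has unit speed, so its parameter is arc length up to a shift and the choice made
  in \<open>arc_length_param\<close> is forced.\<close>

lemma line_integral_pline_le:
  assumes e: "cmod e = 1" and l: "l \<in> borel_measurable borel"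
  shows "line_integral l ({a..b}, pline z e s) \<le> (\<integral>\<^sup>+t\<in>{a..b}. l (pline z e s t) \<partial>lborel)"
proof -
  note [measurable] = l
  have g[measurable]: "pline z e s \<in> borel_measurable borel"
    by (intro borel_measurable_continuous_onI continuous_pline)
  have "locally_rectifiable ({a..b}, pline z e s)"
    by (auto simp: locally_rectifiable_def path_length_pline[OF e])
  moreover have "(\<integral>\<^sup>+x\<in>{0..enn2real (path_length (pline z e s) a' b')}. l (arc_length_param (pline z e s) a' b' x) \<partial>lborel)
      \<le> (\<integral>\<^sup>+t\<in>{a..b}. l (pline z e s t) \<partial>lborel)" if ab: "a' \<le> b'" "{a'..b'} \<subseteq> {a..b}" for a' b'
  proof -
    have arc: "arc_length_param (pline z e s) a' b' x = pline z e s (a' + x)" if "x \<in> {0..b' - a'}" for x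
    proof -
      have "(SOME t. t \<in> {a'..b'} \<and> path_length (pline z e s) a' t = ennreal x) = a' + x"
        using that by (intro some_equality) (auto simp: path_length_pline[OF e])
      then show ?thesis by (simp add: arc_length_param_def)
    qed
    have "(\<integral>\<^sup>+x\<in>{0..enn2real (path_length (pline z e s) a' b')}. l (arc_length_param (pline z e s) a' b' x) \<partial>lborel)
        = (\<integral>\<^sup>+x. l (pline z e s (a' + 1 * x)) * indicator {a'..b'} (a' + 1 * x) \<partial>lborel)"
      using ab by (intro nn_integral_cong) (auto simp: path_length_pline[OF e] arc indicator_def)
    also have "\<dots> = (\<integral>\<^sup>+t. l (pline z e s t) * indicator {a'..b'} t \<partial>lborel)"
      by (subst nn_integral_real_affine[where c = 1 and t = a', of "\<lambda>t. l (pline z e s t) * indicator {a'..b'} t"]) auto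
    also have "\<dots> \<le> (\<integral>\<^sup>+t. l (pline z e s t) * indicator {a..b} t \<partial>lborel)"
      using ab(2) by (intro nn_integral_mono mult_left_mono) (auto simp: indicator_def)
    finally show ?thesis .
  qed
  ultimately show ?thesis unfolding line_integral_def by (auto intro!: SUP_least)
qed

text \<open>On a segment of length \<open>b - a\<close>, Cauchy-Schwarz bounds the squared line
  integral by \<open>b - a\<close> times the integral of the squared density. Integrating over the
  offset \<open>s\<close> gives at most a multiple of the planar energy, which is arbitrarily
  small.\<close>

lemma mod2_AE_pline:
  assumes "mod2 \<Gamma> = 0" and e: "cmod e = 1" and ab: "a < b"
  shows "AE s in lborel. ({a..b}, pline z e s) \<notin> \<Gamma>"
proof -
  have "AE s in lborel. s \<notin> {s. ({a..b}, pline z e s) \<in> \<Gamma>}"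
  proof (rule AE_by_Markov)
    fix \<epsilon> :: real assume \<epsilon>: "\<epsilon> > 0"
    have "ennreal (\<epsilon> / (16 * (b - a))) > 0" using \<epsilon> ab by (simp add: ennreal_zero_less_divide)
    then obtain l where l: "l \<in> borel_measurable borel" "\<And>\<gamma>. \<gamma> \<in> \<Gamma> \<Longrightarrow> line_integral l \<gamma> \<ge> 1"
      "(\<integral>\<^sup>+z. (l z)\<^sup>2 \<partial>hausdorff_measure 2) < ennreal (\<epsilon> / (16 * (b - a)))"
      using assms(1) unfolding mod2_eq_0_iff by blast
    note [measurable] = l(1)
    have g[measurable]: "pline z e s \<in> borel_measurable borel" for s
      by (intro borel_measurable_continuous_onI continuous_pline)
    define \<psi> where "\<psi> s = (\<integral>\<^sup>+t. (l (pline z e s t))\<^sup>2 \<partial>lborel)" for s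
    have "(\<lambda>p. (l (case p of (s, t) \<Rightarrow> pline z e s t))\<^sup>2) \<in> borel_measurable (lborel \<Otimes>\<^sub>M lborel)"
      using pline_measurable[of z e] by measurable
    then have m: "(\<lambda>p. (l (pline z e (fst p) (snd p)))\<^sup>2) \<in> borel_measurable (lborel \<Otimes>\<^sub>M lborel)"
      by (simp add: case_prod_unfold)
    have [measurable]: "\<psi> \<in> borel_measurable borel"
      using lborel.borel_measurable_nn_integral_fst[OF m] by (simp add: \<psi>_def[abs_def])
    have "(\<integral>\<^sup>+s. ennreal (b - a) * \<psi> s \<partial>lborel) = ennreal (b - a) * (\<integral>\<^sup>+s. \<psi> s \<partial>lborel)"
      by (rule nn_integral_cmult) simp
    also have "\<dots> \<le> ennreal (b - a) * (ennreal 16 * (\<integral>\<^sup>+z. (l z)\<^sup>2 \<partial>hausdorff_measure 2))"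
      unfolding \<psi>_def by (intro mult_left_mono nn_integral_pline_le[OF e]) auto
    also have "\<dots> \<le> ennreal (b - a) * (ennreal 16 * ennreal (\<epsilon> / (16 * (b - a))))"
      by (intro mult_left_mono less_imp_le[OF l(3)]) auto
    also have "\<dots> = ennreal \<epsilon>" 
    proof -
      have "(b - a) * (16 * (\<epsilon> / (16 * (b - a)))) = \<epsilon>" using ab by (simp add: divide_simps)
      then show ?thesis using ab \<epsilon> by (metis ennreal_mult' less_imp_le diff_ge_0_iff_ge zero_le_numeral)
    qed
    finally have 1: "(\<integral>\<^sup>+s. ennreal (b - a) * \<psi> s \<partial>lborel) \<le> ennreal \<epsilon>" .
    have "1 \<le> ennreal (b - a) * \<psi> s" if "({a..b}, pline z e s) \<in> \<Gamma>" for s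
    proof -
      have "1 \<le> (\<integral>\<^sup>+t. l (pline z e s t) * indicator {a..b} t \<partial>lborel)"
        using l(2)[OF that] line_integral_pline_le[OF e l(1), of a b z s] by (rule order_trans)
      then have "1 \<le> (\<integral>\<^sup>+t. l (pline z e s t) * indicator {a..b} t \<partial>lborel)\<^sup>2"
        by (simp add: one_le_power)
      also have "\<dots> \<le> (\<integral>\<^sup>+t. (l (pline z e s t))\<^sup>2 \<partial>lborel) * (\<integral>\<^sup>+t. (indicator {a..b} t)\<^sup>2 \<partial>lborel)"
        by (rule Cauchy_Schwarz_nn_integral) auto
      also have "(\<integral>\<^sup>+t. (indicator {a..b} t)\<^sup>2 \<partial>lborel) = (\<integral>\<^sup>+t. indicator {a..b} t \<partial>lborel)"
        by (intro nn_integral_cong) (auto simp: indicator_def)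
      also have "\<dots> = ennreal (b - a)" using ab by simp
      finally show ?thesis by (simp add: \<psi>_def mult.commute)
    qed
    then show "\<exists>F\<in>borel_measurable borel. (\<integral>\<^sup>+s. F s \<partial>lborel) \<le> ennreal \<epsilon> \<and> (\<forall>s\<in>{s. ({a..b}, pline z e s) \<in> \<Gamma>}. 1 \<le> F s)"
      using 1 by (intro bexI[of _ "\<lambda>s. ennreal (b - a) * \<psi> s"]) auto
  qed
  then show ?thesis by simp
qed

text \<open>The families that an admissible sequence may ignore: those of zero 2-modulus in the weak
  version, those of paths meeting the carpet in nonzero length in the strong one. With this
  predicate the vanishing of the carpet modulus has one description for both versions.\<close>

definition negl_paths :: "version \<Rightarrow> complex set \<Rightarrow> (nat \<Rightarrow> complex set) \<Rightarrow> ipath set \<Rightarrow> bool" where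
  "negl_paths v \<Omega> Q \<Gamma> = (case v of Weak \<Rightarrow> mod2 \<Gamma> = 0
     | Strong \<Rightarrow> (\<forall>\<gamma>\<in>\<Gamma>. hausdorff 1 (trace \<gamma> \<inter> carpet \<Omega> Q) \<noteq> 0))"

lemma ex_aux:
  fixes f :: "'a \<Rightarrow> ennreal"
  shows "(\<forall>\<epsilon>>0. \<exists>x\<in>{\<rho>. P \<rho> \<and> (\<exists>G\<subseteq>A. N G \<and> R G \<rho>)}. f x < \<epsilon>) \<longleftrightarrow>
    (\<forall>\<epsilon>>0. \<exists>\<rho> G. P \<rho> \<and> G \<subseteq> A \<and> N G \<and> R G \<rho> \<and> f \<rho> < \<epsilon>)"
proof -
  have "(\<exists>x\<in>{\<rho>. P \<rho> \<and> (\<exists>G\<subseteq>A. N G \<and> R G \<rho>)}. f x < \<epsilon>) \<longleftrightarrow>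
    (\<exists>\<rho> G. P \<rho> \<and> G \<subseteq> A \<and> N G \<and> R G \<rho> \<and> f \<rho> < \<epsilon>)" for \<epsilon> by auto
  then show ?thesis by simp
qed

lemma carpet_mod_eq_0_iff:
  "carpet_mod v \<Omega> Q \<Gamma> = 0 \<longleftrightarrow> (\<forall>\<epsilon>>0::ennreal. \<exists>(\<rho> :: nat \<Rightarrow> ennreal) \<Gamma>0. (\<forall>i. \<rho> i < \<infinity>) \<and> \<Gamma>0 \<subseteq> \<Gamma> \<and> negl_paths v \<Omega> Q \<Gamma>0 \<and>
      (\<forall>\<gamma>\<in>\<Gamma> - \<Gamma>0. (\<Sum>\<^sub>\<infinity>i\<in>meeting Q (trace \<gamma>). \<rho> i) \<ge> 1) \<and> (\<Sum>i. (\<rho> i)\<^sup>2) < \<epsilon>)"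
proof (cases v)
  case Weak
  show ?thesis
    unfolding carpet_mod_def negl_paths_def Weak version.case mod_weak_def INF_ennreal_eq_0_iff
    by (rule ex_aux[where P="\<lambda>\<rho>. \<forall>i. \<rho> i < \<infinity>" and A=\<Gamma> and N="\<lambda>G. mod2 G = 0"
          and R="\<lambda>G \<rho>. \<forall>\<gamma>\<in>\<Gamma> - G. 1 \<le> infsum \<rho> (meeting Q (trace \<gamma>))" and f="\<lambda>\<rho>. \<Sum>i. (\<rho> i)\<^sup>2"])
next
  case Strong
  \<comment> \<open>The strong condition is rewritten with an explicit ignored subfamily: all paths
    of nonzero length in the carpet.\<close>
  have *: "(\<forall>\<gamma>\<in>\<Gamma>. hausdorff 1 (trace \<gamma> \<inter> carpet \<Omega> Q) = 0 \<longrightarrow> (\<Sum>\<^sub>\<infinity>i\<in>meeting Q (trace \<gamma>). \<rho> i) \<ge> 1)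
    \<longleftrightarrow> (\<exists>\<Gamma>0\<subseteq>\<Gamma>. (\<forall>\<gamma>\<in>\<Gamma>0. hausdorff 1 (trace \<gamma> \<inter> carpet \<Omega> Q) \<noteq> 0) \<and>
       (\<forall>\<gamma>\<in>\<Gamma> - \<Gamma>0. (\<Sum>\<^sub>\<infinity>i\<in>meeting Q (trace \<gamma>). \<rho> i) \<ge> 1))" (is "?L \<longleftrightarrow> ?R") for \<rho> :: "nat \<Rightarrow> ennreal"
  proof
    assume ?L then show ?R
      by (intro exI[of _ "{\<gamma> \<in> \<Gamma>. hausdorff 1 (trace \<gamma> \<inter> carpet \<Omega> Q) \<noteq> 0}"]) auto
  qed blast
  show ?thesis
    unfolding carpet_mod_def negl_paths_def Strong version.case mod_strong_def INF_ennreal_eq_0_iff *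
    by (rule ex_aux[where P="\<lambda>\<rho>. \<forall>i. \<rho> i < \<infinity>" and A=\<Gamma> and N="\<lambda>G. \<forall>\<gamma>\<in>G. hausdorff 1 (trace \<gamma> \<inter> carpet \<Omega> Q) \<noteq> 0"
          and R="\<lambda>G \<rho>. \<forall>\<gamma>\<in>\<Gamma> - G. 1 \<le> infsum \<rho> (meeting Q (trace \<gamma>))" and f="\<lambda>\<rho>. \<Sum>i. (\<rho> i)\<^sup>2"])
qed

lemma trace_subpath: "is_subpath \<gamma>' \<gamma> \<Longrightarrow> trace \<gamma>' \<subseteq> trace \<gamma>"
  by (auto simp: is_subpath_def trace_def)

lemma meeting_mono: "A \<subseteq> B \<Longrightarrow> meeting Q A \<subseteq> meeting Q B"
  by (auto simp: meeting_def)

lemma negl_paths_Un: "negl_paths v \<Omega> Q A \<Longrightarrow> negl_paths v \<Omega> Q B \<Longrightarrow> negl_paths v \<Omega> Q (A \<union> B)"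
  by (cases v) (auto simp: negl_paths_def mod2_Un_eq_0)

lemma negl_paths_superpaths:
  assumes "negl_paths v \<Omega> Q A" "\<And>\<gamma>. \<gamma> \<in> B \<Longrightarrow> \<exists>\<gamma>'\<in>A. is_subpath \<gamma>' \<gamma>"
  shows "negl_paths v \<Omega> Q B"
proof (cases v)
  case Weak
  then show ?thesis using assms mod2_superpaths_eq_0 by (auto simp: negl_paths_def)
next
  case Strong
  have "hausdorff 1 (trace \<gamma> \<inter> carpet \<Omega> Q) \<noteq> 0" if "\<gamma> \<in> B" for \<gamma>
  proof -
    obtain \<gamma>' where "\<gamma>' \<in> A" "is_subpath \<gamma>' \<gamma>" using assms(2) \<open>\<gamma> \<in> B\<close> by blast
    moreover have "hausdorff 1 (trace \<gamma>' \<inter> carpet \<Omega> Q) \<le> hausdorff 1 (trace \<gamma> \<inter> carpet \<Omega> Q)"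
      using trace_subpath[OF calculation(2)] by (intro hausdorff_mono) auto
    ultimately show ?thesis using assms(1) Strong by (auto simp: negl_paths_def)
  qed
  then show ?thesis using Strong by (auto simp: negl_paths_def)
qed

text \<open>Admissible sums only grow when a path is extended, and ignored families stay ignored
  when their paths are extended. Thus an exceptional family can be enlarged so that every subpath of
  a path outside the larger family is outside the original one.\<close>

lemma carpet_mod_superpaths_eq_0:
  assumes "carpet_mod v \<Omega> Q A = 0" "\<And>\<gamma>. \<gamma> \<in> B \<Longrightarrow> \<exists>\<gamma>'\<in>A. is_subpath \<gamma>' \<gamma>"
  shows "carpet_mod v \<Omega> Q B = 0"
  unfolding carpet_mod_eq_0_iff
proof (intro allI impI)
  fix \<epsilon> :: ennreal assume "\<epsilon> > 0"
  then obtain \<rho> \<Gamma>0 where r: "\<And>i. \<rho> i < \<infinity>" "\<Gamma>0 \<subseteq> A" "negl_paths v \<Omega> Q \<Gamma>0"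
    "\<And>\<gamma>. \<gamma> \<in> A - \<Gamma>0 \<Longrightarrow> (\<Sum>\<^sub>\<infinity>i\<in>meeting Q (trace \<gamma>). \<rho> i) \<ge> 1" "(\<Sum>i. (\<rho> i)\<^sup>2) < \<epsilon>"
    using assms(1) unfolding carpet_mod_eq_0_iff by meson
  define B0 where "B0 = {\<gamma> \<in> B. \<exists>\<gamma>'\<in>\<Gamma>0. is_subpath \<gamma>' \<gamma>}"
  have "negl_paths v \<Omega> Q B0" by (rule negl_paths_superpaths[OF r(3)]) (auto simp: B0_def)
  moreover have "(\<Sum>\<^sub>\<infinity>i\<in>meeting Q (trace \<gamma>). \<rho> i) \<ge> 1" if "\<gamma> \<in> B - B0" for \<gamma>
  proof -
    obtain \<gamma>' where g: "\<gamma>' \<in> A" "is_subpath \<gamma>' \<gamma>" using assms(2) \<open>\<gamma> \<in> B - B0\<close> by blast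
    then have "\<gamma>' \<notin> \<Gamma>0" using \<open>\<gamma> \<in> B - B0\<close> by (auto simp: B0_def)
    then have "1 \<le> (\<Sum>\<^sub>\<infinity>i\<in>meeting Q (trace \<gamma>'). \<rho> i)" using r(4) g(1) by blast
    also have "\<dots> \<le> (\<Sum>\<^sub>\<infinity>i\<in>meeting Q (trace \<gamma>). \<rho> i)"
      by (intro infsum_ennreal_mono_set meeting_mono trace_subpath g(2))
    finally show ?thesis .
  qed
  ultimately show "\<exists>\<rho> \<Gamma>0. (\<forall>i. \<rho> i < \<infinity>) \<and> \<Gamma>0 \<subseteq> B \<and> negl_paths v \<Omega> Q \<Gamma>0 \<and>
      (\<forall>\<gamma>\<in>B - \<Gamma>0. (\<Sum>\<^sub>\<infinity>i\<in>meeting Q (trace \<gamma>). \<rho> i) \<ge> 1) \<and> (\<Sum>i. (\<rho> i)\<^sup>2) < \<epsilon>"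
    using r(1,5) by (intro exI[of _ \<rho>] exI[of _ B0]) (auto simp: B0_def)
qed

lemma carpet_mod_Un_eq_0:
  assumes "carpet_mod v \<Omega> Q A = 0" "carpet_mod v \<Omega> Q B = 0"
  shows "carpet_mod v \<Omega> Q (A \<union> B) = 0"
  unfolding carpet_mod_eq_0_iff
proof (intro allI impI)
  fix \<epsilon> :: ennreal assume "\<epsilon> > 0"
  then have "\<epsilon> / 4 > 0" by (simp add: ennreal_zero_less_divide)
  then obtain \<rho> \<Gamma> where r: "\<And>i. \<rho> i < \<infinity>" "\<Gamma> \<subseteq> A" "negl_paths v \<Omega> Q \<Gamma>"
    "\<And>\<gamma>. \<gamma> \<in> A - \<Gamma> \<Longrightarrow> (\<Sum>\<^sub>\<infinity>i\<in>meeting Q (trace \<gamma>). \<rho> i) \<ge> 1" "(\<Sum>i. (\<rho> i)\<^sup>2) < \<epsilon> / 4"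
    using assms(1)[unfolded carpet_mod_eq_0_iff, rule_format, OF \<open>\<epsilon> / 4 > 0\<close>] by blast
  obtain \<rho>' \<Gamma>' where r': "\<And>i. \<rho>' i < \<infinity>" "\<Gamma>' \<subseteq> B" "negl_paths v \<Omega> Q \<Gamma>'"
    "\<And>\<gamma>. \<gamma> \<in> B - \<Gamma>' \<Longrightarrow> (\<Sum>\<^sub>\<infinity>i\<in>meeting Q (trace \<gamma>). \<rho>' i) \<ge> 1" "(\<Sum>i. (\<rho>' i)\<^sup>2) < \<epsilon> / 4"
    using assms(2)[unfolded carpet_mod_eq_0_iff, rule_format, OF \<open>\<epsilon> / 4 > 0\<close>] by blast
  let ?\<rho> = "\<lambda>i. \<rho> i + \<rho>' i"
  have "(\<Sum>i. (?\<rho> i)\<^sup>2) \<le> (\<Sum>i. 2 * (\<rho> i)\<^sup>2 + 2 * (\<rho>' i)\<^sup>2)"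
    by (intro suminf_le ennreal_add_power2_le) auto
  also have "\<dots> = 2 * (\<Sum>i. (\<rho> i)\<^sup>2) + 2 * (\<Sum>i. (\<rho>' i)\<^sup>2)"
    by (simp flip: suminf_add)
  also have "\<dots> < \<epsilon>"
  proof -
    have q: "2 * x + 2 * y < \<epsilon>" if "x < \<epsilon> / 4" "y < \<epsilon> / 4" for x y :: ennreal
      using that by (cases \<epsilon>; cases x; cases y)
        (auto simp: divide_ennreal ennreal_less_iff ennreal_mult[symmetric] ennreal_plus[symmetric] simp del: ennreal_plus simp flip: ennreal_numeral)
    show ?thesis by (rule q[OF r(5) r'(5)])
  qed
  finally have "(\<Sum>i. (?\<rho> i)\<^sup>2) < \<epsilon>" .
  moreover have "(\<Sum>\<^sub>\<infinity>i\<in>meeting Q (trace \<gamma>). ?\<rho> i) \<ge> 1" if "\<gamma> \<in> A \<union> B - (\<Gamma> \<union> \<Gamma>')" for \<gamma>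
  proof -
    have "(\<Sum>\<^sub>\<infinity>i\<in>meeting Q (trace \<gamma>). \<rho> i) \<le> (\<Sum>\<^sub>\<infinity>i\<in>meeting Q (trace \<gamma>). ?\<rho> i)"
      "(\<Sum>\<^sub>\<infinity>i\<in>meeting Q (trace \<gamma>). \<rho>' i) \<le> (\<Sum>\<^sub>\<infinity>i\<in>meeting Q (trace \<gamma>). ?\<rho> i)"
      by (rule infsum_ennreal_mono; simp)+
    moreover have "\<gamma> \<in> A - \<Gamma> \<or> \<gamma> \<in> B - \<Gamma>'" using that by blast
    ultimately show ?thesis using r(4)[of \<gamma>] r'(4)[of \<gamma>] by (metis order_trans)
  qed
  ultimately show "\<exists>\<rho> \<Gamma>0. (\<forall>i. \<rho> i < \<infinity>) \<and> \<Gamma>0 \<subseteq> A \<union> B \<and> negl_paths v \<Omega> Q \<Gamma>0 \<and>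
      (\<forall>\<gamma>\<in>A \<union> B - \<Gamma>0. (\<Sum>\<^sub>\<infinity>i\<in>meeting Q (trace \<gamma>). \<rho> i) \<ge> 1) \<and> (\<Sum>i. (\<rho> i)\<^sup>2) < \<epsilon>"
    using r(1,2) r'(1,2) negl_paths_Un[OF r(3) r'(3)]
    by (intro exI[of _ ?\<rho>] exI[of _ "\<Gamma> \<union> \<Gamma>'"]) auto
qed

text \<open>An infinite sum stays infinite after multiplication by a positive constant, while small
  constants make the energy as small as desired.\<close>

lemma carpet_mod_infinite_sum_eq_0:
  fixes \<rho> :: "nat \<Rightarrow> ennreal"
  assumes "(\<Sum>i. (\<rho> i)\<^sup>2) < \<infinity>" "\<And>\<gamma>. \<gamma> \<in> \<Gamma> \<Longrightarrow> (\<Sum>\<^sub>\<infinity>i\<in>meeting Q (trace \<gamma>). \<rho> i) = \<infinity>"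
  shows "carpet_mod v \<Omega> Q \<Gamma> = 0"
  unfolding carpet_mod_eq_0_iff
proof (intro allI impI)
  fix \<epsilon> :: ennreal assume \<epsilon>: "\<epsilon> > 0"
  obtain S where S: "(\<Sum>i. (\<rho> i)\<^sup>2) = ennreal S" "S \<ge> 0" using assms(1) by (cases "\<Sum>i. (\<rho> i)\<^sup>2") auto
  obtain \<epsilon>' where \<epsilon>': "\<epsilon>' > 0" "ennreal \<epsilon>' \<le> \<epsilon>" using \<epsilon> by (cases \<epsilon>) (auto intro: that[of 1])
  \<comment> \<open>The denominator \<open>2 * (S + 1)\<close> keeps \<open>c\<^sup>2 * S\<close>
    strictly below \<epsilon>' also when \<open>S\<close> is 0.\<close>
  define c where "c = sqrt (\<epsilon>' / (2 * (S + 1)))"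
  have c: "c > 0" "c\<^sup>2 * S < \<epsilon>'"
  proof -
    show "c > 0" using \<epsilon>' S by (simp add: c_def)
    have "c\<^sup>2 * S = \<epsilon>' * (S / (2 * (S + 1)))" using \<epsilon>' S by (simp add: c_def)
    also have "\<dots> < \<epsilon>' * 1" using S \<epsilon>' by (intro mult_strict_left_mono) auto
    finally show "c\<^sup>2 * S < \<epsilon>'" by simp
  qed
  have "\<rho> i < \<infinity>" for i
  proof -
    have "(\<rho> i)\<^sup>2 < top" using ennreal_suminf_lessD[OF assms(1)[unfolded infinity_ennreal_def]] by simp
    then show ?thesis using ennreal_power2_less_top[of "\<rho> i"] by simp
  qed
  then have "ennreal c * \<rho> i < \<infinity>" for i by (simp add: ennreal_mult_less_top)
  moreover have "(\<Sum>i. (ennreal c * \<rho> i)\<^sup>2) < \<epsilon>"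
  proof -
    have "(\<Sum>i. (ennreal c * \<rho> i)\<^sup>2) = ennreal (c\<^sup>2) * (\<Sum>i. (\<rho> i)\<^sup>2)"
      using c by (simp add: power_mult_distrib ennreal_power)
    also have "\<dots> = ennreal (c\<^sup>2 * S)" using S c by (simp add: ennreal_mult)
    also have "\<dots> < ennreal \<epsilon>'" using c S by (simp add: ennreal_less_iff)
    finally show ?thesis using \<epsilon>' by simp
  qed
  moreover have "(\<Sum>\<^sub>\<infinity>i\<in>meeting Q (trace \<gamma>). ennreal c * \<rho> i) \<ge> 1" if "\<gamma> \<in> \<Gamma>" for \<gamma>
    unfolding infsum_ennreal_cmult assms(2)[OF that] using c by (simp add: ennreal_mult_top)
  moreover have "mod2 {} = 0"
    unfolding mod2_eq_0_iff by (auto intro!: bexI[of _ "\<lambda>_. 0"])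
  then have "negl_paths v \<Omega> Q {}" by (cases v) (auto simp: negl_paths_def)
  ultimately show "\<exists>\<rho> \<Gamma>0. (\<forall>i. \<rho> i < \<infinity>) \<and> \<Gamma>0 \<subseteq> \<Gamma> \<and> negl_paths v \<Omega> Q \<Gamma>0 \<and>
      (\<forall>\<gamma>\<in>\<Gamma> - \<Gamma>0. (\<Sum>\<^sub>\<infinity>i\<in>meeting Q (trace \<gamma>). \<rho> i) \<ge> 1) \<and> (\<Sum>i. (\<rho> i)\<^sup>2) < \<epsilon>"
    by (intro exI[of _ "\<lambda>i. ennreal c * \<rho> i"] exI[of _ "{}"]) auto
qed


section \<open>Carpets and generic lines\<close>

text \<open>The distance in the sup norm: its spheres are squares whose sides lie on four lines, so
  that results on generic lines apply to each side. It is comparable to the Euclidean distance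
  within a factor 2.\<close>

definition supdist :: "complex \<Rightarrow> complex \<Rightarrow> real" where
  "supdist x w = max \<bar>Re (w - x)\<bar> \<bar>Im (w - x)\<bar>"

lemma supdist_Lip: "\<bar>supdist x w - supdist x w'\<bar> \<le> dist w w'"
proof -
  have "\<bar>Re w - Re w'\<bar> \<le> cmod (w - w')" "\<bar>Im w - Im w'\<bar> \<le> cmod (w - w')"
    using abs_Re_le_cmod[of "w - w'"] abs_Im_le_cmod[of "w - w'"] by auto
  then show ?thesis unfolding supdist_def dist_norm by (simp add: max_def abs_if split: if_splits) 
qed

lemma supdist_le_dist: "supdist x w \<le> dist x w"
  using abs_Re_le_cmod[of "w - x"] abs_Im_le_cmod[of "w - x"]
  by (simp add: supdist_def dist_norm norm_minus_commute)

lemma dist_le_supdist: "dist x w \<le> 2 * supdist x w"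
  using cmod_le[of "w - x"] by (simp add: supdist_def dist_norm norm_minus_commute max_def split: if_splits)

lemma continuous_supdist [continuous_intros]: "continuous_on A (supdist x)"
  unfolding supdist_def[abs_def] by (intro continuous_intros)

lemma supdist_nonneg [simp]: "0 \<le> supdist x w"
  by (simp add: supdist_def le_max_iff_disj)

lemma supdist_self [simp]: "supdist x x = 0"
  by (simp add: supdist_def)

lemma supdist_eq_0 [simp]: "supdist x w = 0 \<longleftrightarrow> w = x"
  using dist_le_supdist[of x w] by auto

lemma open_supdist_less: "open {w. supdist x w < r}"
  by (intro open_Collect_less continuous_intros)

lemma closed_supdist_le: "closed {w. supdist x w \<le> r}"
  by (intro closed_Collect_le continuous_intros)

lemma bounded_supdist_le: "bounded {w. supdist x w \<le> r}"
proof -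
  have "{w. supdist x w \<le> r} \<subseteq> cball x (2 * r)"
    using dist_le_supdist[of x] by (smt (verit) mem_Collect_eq mem_cball subsetI)
  then show ?thesis using bounded_subset bounded_cball by blast
qed

lemma compact_supdist_le: "compact {w. supdist x w \<le> r}"
  using closed_supdist_le bounded_supdist_le compact_eq_bounded_closed by blast

section \<open>The peripheral disks of a carpet\<close>

lemma jordan_region_imp:
  assumes "jordan_region D"
  obtains c where "simple_path c" "pathfinish c = pathstart c" "D = inside (path_image c)"
    "frontier D = path_image c" "closure D = D \<union> path_image c" "- closure D = outside (path_image c)"
proof -
  obtain c where c: "simple_path c" "pathfinish c = pathstart c" "D = inside (path_image c)"
    using assms by (auto simp: jordan_region_def)
  have J: "frontier D = path_image c" "D \<inter> outside (path_image c) = {}" "D \<union> outside (path_image c) = - path_image c"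
    using Jordan_inside_outside[OF c(1,2)] c(3) by auto
  have cl: "closure D = D \<union> path_image c" using J(1) closure_Un_frontier by metis
  have "outside (path_image c) = (D \<union> outside (path_image c)) - D" using J(2) by blast
  also have "\<dots> = - closure D" unfolding J(3) cl by blast
  finally show ?thesis using that[OF c J(1) cl] by simp
qed

locale rel_carpet =
  fixes \<Omega> :: "complex set" and Q :: "nat \<Rightarrow> complex set"
  assumes rsc: "relative_sierpinski_carpet \<Omega> Q"
begin

abbreviation S :: "complex set" where "S \<equiv> carpet \<Omega> Q"

lemma open_\<Omega>: "open \<Omega>" and connected_\<Omega>: "connected \<Omega>"
  and jordan_Q: "jordan_region (Q i)" and Q_cc: "Q i \<subset>\<subset> \<Omega>"
  and closure_Q_disjoint: "i \<noteq> j \<Longrightarrow> closure (Q i) \<inter> closure (Q j) = {}"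
  and interior_S: "interior S = {}"
  and hausdorff_S: "hausdorff 2 S = 0"
  using rsc by (auto simp: relative_sierpinski_carpet_def)

lemma open_Q: "open (Q i)" and connected_Q: "connected (Q i)" and bounded_Q: "bounded (Q i)"
  and Q_nonempty: "Q i \<noteq> {}" and connected_compl_closure_Q: "connected (- closure (Q i))"
  and frontier_Q_nonempty: "frontier (Q i) \<noteq> {}"
proof -
  obtain c where c: "simple_path c" "pathfinish c = pathstart c" "Q i = inside (path_image c)"
    "frontier (Q i) = path_image c" "closure (Q i) = Q i \<union> path_image c" "- closure (Q i) = outside (path_image c)"
    by (rule jordan_region_imp[OF jordan_Q])
  show "open (Q i)" "connected (Q i)" "bounded (Q i)" "Q i \<noteq> {}" "connected (- closure (Q i))"
    using Jordan_inside_outside[OF c(1,2)] c by auto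
  show "frontier (Q i) \<noteq> {}" using c(4) path_image_nonempty by simp
qed

lemma closure_Q_subset: "closure (Q i) \<subseteq> \<Omega>" and compact_closure_Q: "compact (closure (Q i))"
  using Q_cc[of i] by (auto simp: compactly_contained_def)

lemma Q_subset: "Q i \<subseteq> \<Omega>"
  using closure_Q_subset closure_subset by blast

lemma closure_Q: "closure (Q i) = Q i \<union> frontier (Q i)"
  by (rule closure_Un_frontier)

lemma Q_Int_frontier: "Q i \<inter> frontier (Q i) = {}"
  by (metis frontier_disjoint_eq inf_commute open_Q)

lemma Q_unique: "x \<in> closure (Q i) \<Longrightarrow> x \<in> closure (Q j) \<Longrightarrow> i = j"
  using closure_Q_disjoint by blast

lemma Q_disjoint: "i \<noteq> j \<Longrightarrow> Q i \<inter> Q j = {}"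
  using closure_Q_disjoint[of i j] closure_subset[of "Q i"] closure_subset[of "Q j"] by blast

lemma frontier_Q_subset_S: "frontier (Q i) \<subseteq> S"
proof
  fix x assume x: "x \<in> frontier (Q i)"
  have "x \<notin> Q j" for j
    using x Q_Int_frontier[of i] Q_unique[of x i j] closure_subset[of "Q j"] closure_Q[of i] by blast
  then show "x \<in> S" using x closure_Q[of i] closure_Q_subset[of i] by (auto simp: carpet_def)
qed

lemma not_S_iff: "x \<in> \<Omega> \<Longrightarrow> x \<notin> S \<longleftrightarrow> (\<exists>i. x \<in> Q i)"
  by (auto simp: carpet_def)

lemma S_not_Q: "x \<in> S \<Longrightarrow> x \<notin> Q i"
  by (auto simp: carpet_def)

lemma S_Int_closure_Q: "x \<in> S \<Longrightarrow> x \<in> closure (Q i) \<Longrightarrow> x \<in> frontier (Q i)"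
  using closure_Q S_not_Q by blast

lemma diameter_Q_pos: "0 < diameter (Q i)"
proof -
  obtain x where x: "x \<in> Q i" using Q_nonempty by blast
  then obtain r where r: "r > 0" "ball x r \<subseteq> Q i" using open_Q open_contains_ball by blast
  have "dist x (x + of_real (r/2)) \<le> diameter (Q i)"
    using r x by (intro diameter_bounded_bound bounded_Q subsetD[OF r(2)]) (auto simp: dist_norm)
  then show ?thesis using r by (simp add: dist_norm)
qed

lemma exists_Q_meeting:
  assumes "open A" "x \<in> A" "A \<subseteq> \<Omega>"
  shows "\<exists>i. Q i \<inter> A \<noteq> {}"
proof (rule ccontr)
  assume "\<not> ?thesis"
  then have "A \<subseteq> S" using assms(3) by (auto simp: carpet_def)
  then have "x \<in> interior S" using assms interior_maximal by blast
  then show False using interior_S by simp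
qed

text \<open>Fatness, standing assumption (iii), gives each disk that meets the square of half-side
  \<open>2 * r\<close> a piece of area comparable to the square of
  \<open>min (diameter (Q i)) r\<close> inside the square of half-side \<open>3 * r\<close>. The
  pieces are disjoint, so their areas add up to at most that of the larger square. The truncation at
  \<open>r\<close> accounts for disks much larger than the square.\<close>

lemma area_sum:
  "\<exists>C>0. \<forall>x r I. r > 0 \<longrightarrow> I \<subseteq> meeting Q {w. supdist x w \<le> 2 * r} \<longrightarrow>
      (\<Sum>\<^sub>\<infinity>i\<in>I. ennreal ((min (diameter (Q i)) r)\<^sup>2)) \<le> ennreal (C * r\<^sup>2)"
proof -
  obtain K1 where K1: "K1 > 0" "\<And>i x r. x \<in> Q i \<Longrightarrow> 0 < r \<Longrightarrow> r < diameter (Q i) \<Longrightarrow>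
      ennreal (K1 * r\<^sup>2) \<le> hausdorff 2 (ball x r \<inter> Q i)"
    using rsc unfolding relative_sierpinski_carpet_def by blast
  \<comment> \<open>\<open>64 * 9\<close> comes from the area bound for half-side
    \<open>3 * r\<close>, and \<open>4 / K1\<close> from applying the fatness condition at half the
    scale.\<close>
  define C where "C = 64 * 9 * 4 / K1"
  have "(\<Sum>\<^sub>\<infinity>i\<in>I. ennreal ((min (diameter (Q i)) r)\<^sup>2)) \<le> ennreal (C * r\<^sup>2)"
    if r: "r > 0" and I: "I \<subseteq> meeting Q {w. supdist x w \<le> 2 * r}" for x r I
  proof -
    let ?H = "hausdorff_measure 2 :: complex measure"
    define B where "B = {w. supdist x w \<le> 3 * r}"
    have Bm: "B \<in> sets borel" unfolding B_def using closed_supdist_le by (intro borel_closed)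
    have each: "ennreal ((min (diameter (Q i)) r)\<^sup>2) \<le> ennreal (4 / K1) * emeasure ?H (Q i \<inter> B)" if "i \<in> I" for i
    proof -
      obtain p where p: "p \<in> Q i" "supdist x p \<le> 2 * r" using I \<open>i \<in> I\<close> by (auto simp: meeting_def)
      define r' where "r' = min (diameter (Q i)) r / 2"
      have r': "0 < r'" "r' < diameter (Q i)" "r' \<le> r"
        using r diameter_Q_pos[of i] by (auto simp: r'_def)
      have "ball p r' \<inter> Q i \<subseteq> Q i \<inter> B"
      proof -
        have "supdist x w \<le> 3 * r" if "w \<in> ball p r'" for w
          using supdist_Lip[of x w p] that p(2) r'(3) by (auto simp: dist_commute)
        then show ?thesis by (auto simp: B_def)
      qed
      then have "hausdorff 2 (ball p r' \<inter> Q i) \<le> hausdorff 2 (Q i \<inter> B)" by (rule hausdorff_mono)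
      also have "\<dots> = emeasure ?H (Q i \<inter> B)"
        using open_Q Bm by (intro emeasure_hausdorff_measure[symmetric]) auto
      finally have "ennreal (K1 * r'\<^sup>2) \<le> emeasure ?H (Q i \<inter> B)"
        using K1(2)[OF p(1) r'(1,2)] by (rule order_trans[rotated])
      then have "ennreal (4 / K1) * ennreal (K1 * r'\<^sup>2) \<le> ennreal (4 / K1) * emeasure ?H (Q i \<inter> B)"
        by (rule mult_left_mono) simp
      also have "ennreal (4 / K1) * ennreal (K1 * r'\<^sup>2) = ennreal ((min (diameter (Q i)) r)\<^sup>2)"
        using K1(1) by (simp add: r'_def ennreal_mult'[symmetric] power_divide del: ennreal_numeral)
      finally show ?thesis .
    qed
    have "(\<Sum>\<^sub>\<infinity>i\<in>I. ennreal ((min (diameter (Q i)) r)\<^sup>2)) \<le> (\<Sum>\<^sub>\<infinity>i\<in>I. ennreal (4 / K1) * emeasure ?H (Q i \<inter> B))"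
      by (rule infsum_ennreal_mono[OF each])
    also have "\<dots> \<le> (\<Sum>\<^sub>\<infinity>i\<in>UNIV. ennreal (4 / K1) * emeasure ?H (Q i \<inter> B))"
      by (rule infsum_ennreal_mono_set) simp
    also have "\<dots> = ennreal (4 / K1) * (\<Sum>i. emeasure ?H (Q i \<inter> B))"
      by (simp add: infsum_ennreal_cmult) (simp add: infsum_ennreal_suminf)
    also have "(\<Sum>i. emeasure ?H (Q i \<inter> B)) = emeasure ?H (\<Union>i. Q i \<inter> B)"
    proof (rule suminf_emeasure)
      show "range (\<lambda>i. Q i \<inter> B) \<subseteq> sets ?H" using open_Q Bm by auto
      show "disjoint_family (\<lambda>i. Q i \<inter> B)"
        unfolding disjoint_family_on_def using Q_disjoint by blast
    qed
    also have "\<dots> \<le> emeasure ?H B" using Bm by (intro emeasure_mono) auto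
    also have "\<dots> = hausdorff 2 B" using Bm by (intro emeasure_hausdorff_measure) auto
    also have "\<dots> \<le> ennreal (64 * (3 * r)\<^sup>2)"
      by (rule hausdorff2_square_le[of _ _ x]) (use r in \<open>auto simp: B_def supdist_def\<close>)
    also have "ennreal (4 / K1) * ennreal (64 * (3 * r)\<^sup>2) = ennreal (C * r\<^sup>2)"
      using K1(1) by (simp add: C_def ennreal_mult'[symmetric] del: ennreal_numeral)
    finally show ?thesis by (simp add: mult_left_mono)
  qed
  moreover have "C > 0" using K1 by (simp add: C_def)
  ultimately show ?thesis by (intro exI[of _ C]) simp
qed

text \<open>Each disk of diameter at least \<open>c\<close> contributes at least
  \<open>c\<^sup>2\<close> to a convergent sum.\<close>

lemma finite_big_Q:
  assumes "bounded B" "0 < c"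
  shows "finite {i \<in> meeting Q B. c \<le> diameter (Q i)}"
proof -
  obtain C where C: "C > 0" "\<And>x r I. r > 0 \<Longrightarrow> I \<subseteq> meeting Q {w. supdist x w \<le> 2 * r} \<Longrightarrow>
      (\<Sum>\<^sub>\<infinity>i\<in>I. ennreal ((min (diameter (Q i)) r)\<^sup>2)) \<le> ennreal (C * r\<^sup>2)" using area_sum by blast
  obtain R where R: "R > 0" "B \<subseteq> ball 0 R" using assms(1) bounded_subset_ballD by blast
  define r where "r = max c R"
  have r: "r > 0" "c \<le> r" using assms(2) by (auto simp: r_def)
  have "B \<subseteq> {w. supdist 0 w \<le> 2 * r}"
  proof safe
    fix w assume "w \<in> B"
    then have "dist 0 w < R" using R by auto
    then show "supdist 0 w \<le> 2 * r" using supdist_le_dist[of 0 w] R(1) by (auto simp: r_def max_def)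
  qed
  then have "(\<Sum>\<^sub>\<infinity>i\<in>meeting Q B. ennreal ((min (diameter (Q i)) r)\<^sup>2)) \<le> ennreal (C * r\<^sup>2)"
    by (intro C(2) r meeting_mono)
  also have "\<dots> < \<infinity>" by simp
  finally have "finite {i \<in> meeting Q B. ennreal (c\<^sup>2) \<le> ennreal ((min (diameter (Q i)) r)\<^sup>2)}"
    using assms(2) by (intro infsum_ennreal_finite_small) auto
  moreover have "{i \<in> meeting Q B. c \<le> diameter (Q i)} \<subseteq> {i \<in> meeting Q B. ennreal (c\<^sup>2) \<le> ennreal ((min (diameter (Q i)) r)\<^sup>2)}"
    using assms(2) r by (auto intro!: ennreal_leI power_mono)
  ultimately show ?thesis by (rule finite_subset[rotated])
qed

section \<open>Length-area estimates\<close>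

lemma nn_integral_width_sum:
  assumes Lip: "\<And>x y. \<bar>f x - f y\<bar> \<le> dist x y" and "c \<le> d"
  shows "(\<integral>\<^sup>+s\<in>{c..d}. (\<Sum>\<^sub>\<infinity>i\<in>I. \<rho> i * width_ind f (Q i) s) \<partial>lborel)
      \<le> (\<Sum>\<^sub>\<infinity>i\<in>I. \<rho> i * ennreal (2 * min (diameter (Q i)) (d - c)))"
    and "(\<lambda>s. \<Sum>\<^sub>\<infinity>i\<in>I. \<rho> i * width_ind f (Q i) s) \<in> borel_measurable borel"
proof -
  have eq: "(\<Sum>\<^sub>\<infinity>i\<in>I. \<rho> i * width_ind f (Q i) s) = (\<Sum>i. (\<rho> i * indicator I i) * width_ind f (Q i) s)" for s
    by (simp add: infsum_ennreal_suminf ac_simps)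
  show m: "(\<lambda>s. \<Sum>\<^sub>\<infinity>i\<in>I. \<rho> i * width_ind f (Q i) s) \<in> borel_measurable borel"
    unfolding eq by measurable
  have "(\<integral>\<^sup>+s\<in>{c..d}. (\<Sum>\<^sub>\<infinity>i\<in>I. \<rho> i * width_ind f (Q i) s) \<partial>lborel)
      = (\<integral>\<^sup>+s. (\<Sum>i. (\<rho> i * indicator I i) * (width_ind f (Q i) s * indicator {c..d} s)) \<partial>lborel)"
    unfolding eq by (simp add: mult.assoc flip: ennreal_suminf_multc)
  also have "\<dots> = (\<Sum>i. \<integral>\<^sup>+s. (\<rho> i * indicator I i) * (width_ind f (Q i) s * indicator {c..d} s) \<partial>lborel)"
    by (rule nn_integral_suminf) measurable
  also have "\<dots> = (\<Sum>i. (\<rho> i * indicator I i) * (\<integral>\<^sup>+s. (width_ind f (Q i) s * indicator {c..d} s) \<partial>lborel))"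
    by (intro suminf_cong nn_integral_cmult) measurable
  also have "\<dots> \<le> (\<Sum>i. (\<rho> i * indicator I i) * ennreal (2 * min (diameter (Q i)) (d - c)))"
  proof (intro suminf_le mult_left_mono)
    fix i
    have "(\<integral>\<^sup>+s. (width_ind f (Q i) s * indicator {c..d} s) \<partial>lborel) \<le> (\<integral>\<^sup>+s. width_ind f (Q i) s \<partial>lborel)"
      by (intro nn_integral_mono) (auto simp: indicator_def)
    also have "\<dots> \<le> ennreal (2 * diameter (Q i))" by (rule nn_integral_width_ind[OF bounded_Q])
    finally have 1: "(\<integral>\<^sup>+s. (width_ind f (Q i) s * indicator {c..d} s) \<partial>lborel) \<le> ennreal (2 * diameter (Q i))" .
    have "(\<integral>\<^sup>+s. (width_ind f (Q i) s * indicator {c..d} s) \<partial>lborel) \<le> (\<integral>\<^sup>+s. indicator {c..d} s \<partial>lborel)"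
      using width_ind_le_1 by (intro nn_integral_mono) (auto simp: indicator_def)
    also have "\<dots> \<le> ennreal (2 * (d - c))" using assms(2) by (simp add: ennreal_leI)
    finally show "(\<integral>\<^sup>+s. (width_ind f (Q i) s * indicator {c..d} s) \<partial>lborel) \<le> ennreal (2 * min (diameter (Q i)) (d - c))"
      using 1 by (auto simp: min_def)
  qed auto
  also have "\<dots> = (\<Sum>\<^sub>\<infinity>i\<in>I. \<rho> i * ennreal (2 * min (diameter (Q i)) (d - c)))"
    by (simp add: infsum_ennreal_suminf ac_simps)
  finally show "(\<integral>\<^sup>+s\<in>{c..d}. (\<Sum>\<^sub>\<infinity>i\<in>I. \<rho> i * width_ind f (Q i) s) \<partial>lborel)
      \<le> (\<Sum>\<^sub>\<infinity>i\<in>I. \<rho> i * ennreal (2 * min (diameter (Q i)) (d - c)))" .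
qed

text \<open>The length-area argument: after integration over the levels \<open>s\<close> each disk
  counts with at most twice \<open>min (diameter (Q i)) (d - c)\<close>, and Cauchy-Schwarz against
  the area sum leaves the energy of \<rho>. With \<open>f\<close> the height over a line this
  controls parallel lines, with \<open>f\<close> the sup-norm distance it controls concentric
  squares.\<close>

lemma width_sum_bound:
  "\<exists>C>0. \<forall>(f :: complex \<Rightarrow> real) x r I c d (\<rho> :: nat \<Rightarrow> ennreal). (\<forall>x y. \<bar>f x - f y\<bar> \<le> dist x y) \<longrightarrow> r > 0 \<longrightarrow>
      I \<subseteq> meeting Q {w. supdist x w \<le> 2 * r} \<longrightarrow> c \<le> d \<longrightarrow> d - c \<le> r \<longrightarrow>
      (\<integral>\<^sup>+s\<in>{c..d}. (\<Sum>\<^sub>\<infinity>i\<in>I. \<rho> i * width_ind f (Q i) s) \<partial>lborel)\<^sup>2 \<le> ennreal (C * r\<^sup>2) * (\<Sum>\<^sub>\<infinity>i\<in>I. (\<rho> i)\<^sup>2)"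
proof -
  obtain C where C: "C > 0" "\<And>x r I. r > 0 \<Longrightarrow> I \<subseteq> meeting Q {w. supdist x w \<le> 2 * r} \<Longrightarrow>
      (\<Sum>\<^sub>\<infinity>i\<in>I. ennreal ((min (diameter (Q i)) r)\<^sup>2)) \<le> ennreal (C * r\<^sup>2)" using area_sum by blast
  have "(\<integral>\<^sup>+s\<in>{c..d}. (\<Sum>\<^sub>\<infinity>i\<in>I. \<rho> i * width_ind f (Q i) s) \<partial>lborel)\<^sup>2 \<le> ennreal (4 * C * r\<^sup>2) * (\<Sum>\<^sub>\<infinity>i\<in>I. (\<rho> i)\<^sup>2)"
    if "\<And>x y. \<bar>f x - f y\<bar> \<le> dist x y" "r > 0" "I \<subseteq> meeting Q {w. supdist x w \<le> 2 * r}" "c \<le> d" "d - c \<le> r"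
    for f x r I c d \<rho>
  proof -
    have "(\<Sum>\<^sub>\<infinity>i\<in>I. (ennreal (2 * min (diameter (Q i)) (d - c)))\<^sup>2) \<le> (\<Sum>\<^sub>\<infinity>i\<in>I. 4 * ennreal ((min (diameter (Q i)) r)\<^sup>2))"
    proof (rule infsum_ennreal_mono)
      fix i
      have "(ennreal (2 * min (diameter (Q i)) (d - c)))\<^sup>2 \<le> (ennreal (2 * min (diameter (Q i)) r))\<^sup>2"
        using that by (intro power_mono ennreal_leI) auto
      also have "\<dots> = ennreal ((2 * min (diameter (Q i)) r)\<^sup>2)"
        using diameter_Q_pos[of i] that(2) by (intro ennreal_power) auto
      also have "\<dots> = 4 * ennreal ((min (diameter (Q i)) r)\<^sup>2)" by (simp add: power_mult_distrib ennreal_mult)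
      finally show "(ennreal (2 * min (diameter (Q i)) (d - c)))\<^sup>2 \<le> 4 * ennreal ((min (diameter (Q i)) r)\<^sup>2)" .
    qed
    also have "\<dots> = 4 * (\<Sum>\<^sub>\<infinity>i\<in>I. ennreal ((min (diameter (Q i)) r)\<^sup>2))" by (rule infsum_ennreal_cmult)
    also have "\<dots> \<le> 4 * ennreal (C * r\<^sup>2)" using C(2)[OF that(2,3)] by (rule mult_left_mono) simp
    also have "4 * ennreal (C * r\<^sup>2) = ennreal (4 * C * r\<^sup>2)" using C(1) by (simp add: ennreal_mult mult.assoc)
    finally have A: "(\<Sum>\<^sub>\<infinity>i\<in>I. (ennreal (2 * min (diameter (Q i)) (d - c)))\<^sup>2) \<le> ennreal (4 * C * r\<^sup>2)" .
    have "(\<integral>\<^sup>+s\<in>{c..d}. (\<Sum>\<^sub>\<infinity>i\<in>I. \<rho> i * width_ind f (Q i) s) \<partial>lborel)\<^sup>2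
        \<le> (\<Sum>\<^sub>\<infinity>i\<in>I. \<rho> i * ennreal (2 * min (diameter (Q i)) (d - c)))\<^sup>2"
      by (intro power_mono nn_integral_width_sum that) auto
    also have "\<dots> \<le> (\<Sum>\<^sub>\<infinity>i\<in>I. (\<rho> i)\<^sup>2) * (\<Sum>\<^sub>\<infinity>i\<in>I. (ennreal (2 * min (diameter (Q i)) (d - c)))\<^sup>2)"
      by (rule infsum_ennreal_Cauchy_Schwarz)
    also have "\<dots> \<le> (\<Sum>\<^sub>\<infinity>i\<in>I. (\<rho> i)\<^sup>2) * ennreal (4 * C * r\<^sup>2)"
      by (rule mult_left_mono[OF A]) simp
    finally show ?thesis by (simp only: mult.commute)
  qed
  then show ?thesis using C(1) by (intro exI[of _ "4 * C"]) simp
qed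

section \<open>Generic lines\<close>

lemma width_ind_meeting:
  assumes "\<And>x y. \<bar>f x - f y\<bar> \<le> dist x y" "w \<in> Q i"
  shows "width_ind f (Q i) (f w) = 1"
  by (rule width_ind_1[OF assms(1) bounded_Q assms(2)])

lemma pline_in_square:
  assumes "cmod e = 1" "\<bar>s\<bar> \<le> r" "\<bar>t\<bar> \<le> r"
  shows "supdist z (pline z e s t) \<le> 2 * r"
proof -
  have "cmod (Complex t s) \<le> \<bar>t\<bar> + \<bar>s\<bar>" using cmod_le[of "Complex t s"] by simp
  then have "dist z (pline z e s t) \<le> 2 * r"
    using assms by (simp add: pline_def dist_norm norm_mult)
  then show ?thesis using supdist_le_dist order_trans by blast
qed

lemma pline_sum_le_width_sum:
  assumes "cmod e = 1" "meeting Q (pline z e s ` {a..b}) \<subseteq> I"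
  shows "(\<Sum>\<^sub>\<infinity>i\<in>meeting Q (pline z e s ` {a..b}). \<rho> i) \<le> (\<Sum>\<^sub>\<infinity>i\<in>I. \<rho> i * width_ind (hgt z e) (Q i) s)"
proof -
  have "(\<Sum>\<^sub>\<infinity>i\<in>meeting Q (pline z e s ` {a..b}). \<rho> i)
      = (\<Sum>\<^sub>\<infinity>i\<in>meeting Q (pline z e s ` {a..b}). \<rho> i * width_ind (hgt z e) (Q i) s)"
  proof (rule infsum_cong)
    fix i assume "i \<in> meeting Q (pline z e s ` {a..b})"
    then obtain t where "pline z e s t \<in> Q i" by (auto simp: meeting_def)
    from width_ind_meeting[where f="hgt z e", OF hgt_Lip[OF assms(1)] this]
    show "\<rho> i = \<rho> i * width_ind (hgt z e) (Q i) s" using assms(1) by simp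
  qed
  also have "\<dots> \<le> (\<Sum>\<^sub>\<infinity>i\<in>I. \<rho> i * width_ind (hgt z e) (Q i) s)" by (rule infsum_ennreal_mono_set[OF assms(2)])
  finally show ?thesis .
qed

lemma AE_pline_hausdorff1:
  assumes "cmod e = 1"
  shows "AE s in lborel. hausdorff 1 (pline z e s ` A \<inter> S) = 0"
proof -
  have "AE s in lborel. hausdorff 1 {x \<in> S. hgt z e x = s} = 0"
    by (rule AE_slices_hausdorff_null[OF hausdorff_S hgt_Lip[OF assms]])
  then show ?thesis
  proof eventually_elim
    case (elim s)
    have "hausdorff 1 (pline z e s ` A \<inter> S) \<le> hausdorff 1 {x \<in> S. hgt z e x = s}"
      using assms by (intro hausdorff_mono) auto
    then show ?case using elim by simp
  qed
qed

text \<open>In the strong version the ignored paths meet the carpet in nonzero length, and since the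
  carpet has area zero almost no parallel segment does so.\<close>

lemma negl_paths_AE_pline:
  assumes "negl_paths v \<Omega> Q \<Gamma>" "cmod e = 1" "a < b"
  shows "AE s in lborel. ({a..b}, pline z e s) \<notin> \<Gamma>"
proof (cases v)
  case Weak
  then show ?thesis using assms mod2_AE_pline by (auto simp: negl_paths_def)
next
  case Strong
  then show ?thesis using AE_pline_hausdorff1[OF assms(2), of z "{a..b}"]
    by (rule_tac AE_mp[OF AE_pline_hausdorff1[OF assms(2), of z "{a..b}"]])
       (use assms(1) in \<open>auto simp: negl_paths_def trace_def intro!: AE_I2\<close>)
qed

text \<open>For each n there are an admissible sequence of energy below \<open>1 / Suc n\<close> and
  an ignored family. For offsets avoiding the countably many ignored families, a segment in \<Gamma>
  makes the sum of every sequence at least 1, so the length-area bound makes the set of these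
  offsets null. Confining the offsets to \<open>{c..d}\<close> keeps all segments in one
  square.\<close>

lemma carpet_mod_AE_pline:
  assumes "carpet_mod v \<Omega> Q \<Gamma> = 0" and e: "cmod e = 1" and ab: "a < b"
  shows "AE s in lborel. s \<in> {c..d} \<longrightarrow> ({a..b}, pline z e s) \<notin> \<Gamma>"
proof (cases "c \<le> d")
  case cd: True
  obtain C where C: "C > 0"
    "\<And>f x r I c d \<rho>. (\<And>x y. \<bar>f x - f y\<bar> \<le> dist x y) \<Longrightarrow> r > 0 \<Longrightarrow> I \<subseteq> meeting Q {w. supdist x w \<le> 2 * r} \<Longrightarrow>
      c \<le> d \<Longrightarrow> d - c \<le> r \<Longrightarrow>
      (\<integral>\<^sup>+s\<in>{c..d}. (\<Sum>\<^sub>\<infinity>i\<in>I. \<rho> i * width_ind f (Q i) s) \<partial>lborel)\<^sup>2 \<le> ennreal (C * r\<^sup>2) * (\<Sum>\<^sub>\<infinity>i\<in>I. (\<rho> i)\<^sup>2)"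
    using width_sum_bound by blast
  have "\<exists>\<rho> \<Gamma>0. (\<forall>i. \<rho> i < \<infinity>) \<and> \<Gamma>0 \<subseteq> \<Gamma> \<and> negl_paths v \<Omega> Q \<Gamma>0 \<and>
      (\<forall>\<gamma>\<in>\<Gamma> - \<Gamma>0. (\<Sum>\<^sub>\<infinity>i\<in>meeting Q (trace \<gamma>). \<rho> i) \<ge> 1) \<and> (\<Sum>i. (\<rho> i)\<^sup>2) < ennreal (1 / Suc n)" for n
    using assms(1)[unfolded carpet_mod_eq_0_iff, rule_format, of "ennreal (1 / Suc n)"] by simp
  then obtain \<rho> \<Gamma>0 where r: "\<And>n. negl_paths v \<Omega> Q (\<Gamma>0 n)"
    "\<And>n \<gamma>. \<gamma> \<in> \<Gamma> - \<Gamma>0 n \<Longrightarrow> (\<Sum>\<^sub>\<infinity>i\<in>meeting Q (trace \<gamma>). \<rho> n i) \<ge> 1" "\<And>n. (\<Sum>i. (\<rho> n i)\<^sup>2) < ennreal (1 / Suc n)"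
    by metis
  define T where "T = {s \<in> {c..d}. ({a..b}, pline z e s) \<in> \<Gamma> \<and> (\<forall>n. ({a..b}, pline z e s) \<notin> \<Gamma>0 n)}"
  \<comment> \<open>Large enough for all the segments to lie in the square of half-side
    \<open>2 * r\<close> about \<open>z\<close>, with \<open>d - c \<le> r\<close>.\<close>
  define r where "r = \<bar>a\<bar> + \<bar>b\<bar> + \<bar>c\<bar> + \<bar>d\<bar> + 1"
  define I where "I = meeting Q {w. supdist z w \<le> 2 * r}"
  have r0: "r > 0" "d - c \<le> r" by (auto simp: r_def)
  have "AE s in lborel. s \<notin> T"
  proof (rule AE_by_Markov)
    fix \<epsilon> :: real assume \<epsilon>: "\<epsilon> > 0"
    obtain n where n: "1 / real (Suc n) < \<epsilon>\<^sup>2 / (C * r\<^sup>2)"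
      using nat_approx_posE[of "\<epsilon>\<^sup>2 / (C * r\<^sup>2)"] \<epsilon> C(1) r0 by auto
    define F where "F s = (\<Sum>\<^sub>\<infinity>i\<in>I. \<rho> n i * width_ind (hgt z e) (Q i) s) * indicator {c..d} s" for s
    have "(\<lambda>s. \<Sum>\<^sub>\<infinity>i\<in>I. \<rho> n i * width_ind (hgt z e) (Q i) s) \<in> borel_measurable borel"
      by (rule nn_integral_width_sum(2)[OF hgt_Lip[OF e] cd])
    then have [measurable]: "F \<in> borel_measurable borel" unfolding F_def by measurable
    have "(\<integral>\<^sup>+s. F s \<partial>lborel)\<^sup>2 \<le> ennreal (C * r\<^sup>2) * (\<Sum>\<^sub>\<infinity>i\<in>I. (\<rho> n i)\<^sup>2)"
      unfolding F_def using r0 cd by (intro C(2)[where x = z] hgt_Lip e) (auto simp: I_def)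
    also have "\<dots> \<le> ennreal (C * r\<^sup>2) * (\<Sum>\<^sub>\<infinity>i\<in>UNIV. (\<rho> n i)\<^sup>2)"
      by (intro mult_left_mono infsum_ennreal_mono_set) auto
    also have "(\<Sum>\<^sub>\<infinity>i\<in>UNIV. (\<rho> n i)\<^sup>2) = (\<Sum>i. (\<rho> n i)\<^sup>2)" by (simp add: infsum_ennreal_suminf)
    also have "ennreal (C * r\<^sup>2) * (\<Sum>i. (\<rho> n i)\<^sup>2) \<le> ennreal (C * r\<^sup>2) * ennreal (1 / Suc n)"
      by (intro mult_left_mono less_imp_le[OF r(3)]) auto
    also have "\<dots> = ennreal (C * r\<^sup>2 * (1 / Suc n))" using C(1) by (intro ennreal_mult[symmetric]) auto
    also have "\<dots> \<le> ennreal (\<epsilon>\<^sup>2)"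
      using n C(1) r0 by (intro ennreal_leI) (simp add: field_simps)
    also have "\<dots> = (ennreal \<epsilon>)\<^sup>2" using \<epsilon> by (simp add: ennreal_power)
    finally have "(\<integral>\<^sup>+s. F s \<partial>lborel) \<le> ennreal \<epsilon>" by (simp add: ennreal_power2_le_iff)
    moreover have "1 \<le> F s" if "s \<in> T" for s
    proof -
      have s: "s \<in> {c..d}" "({a..b}, pline z e s) \<in> \<Gamma> - \<Gamma>0 n" using that by (auto simp: T_def)
      have "1 \<le> (\<Sum>\<^sub>\<infinity>i\<in>meeting Q (pline z e s ` {a..b}). \<rho> n i)" using r(2)[OF s(2)] by (simp add: trace_def)
      also have "\<dots> \<le> (\<Sum>\<^sub>\<infinity>i\<in>I. \<rho> n i * width_ind (hgt z e) (Q i) s)"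
      proof (rule pline_sum_le_width_sum[OF e])
        show "meeting Q (pline z e s ` {a..b}) \<subseteq> I"
          unfolding I_def
        proof (rule meeting_mono, safe)
          fix t assume "t \<in> {a..b}"
          then show "supdist z (pline z e s t) \<le> 2 * r"
            using s(1) by (intro pline_in_square[OF e]) (auto simp: r_def)
        qed
      qed
      finally show ?thesis using s(1) by (simp add: F_def)
    qed
    ultimately show "\<exists>F\<in>borel_measurable borel. (\<integral>\<^sup>+s. F s \<partial>lborel) \<le> ennreal \<epsilon> \<and> (\<forall>s\<in>T. 1 \<le> F s)"
      by (intro bexI[of _ F]) auto
  qed
  moreover have "AE s in lborel. \<forall>n. ({a..b}, pline z e s) \<notin> \<Gamma>0 n"
    by (intro AE_all_countable[THEN iffD2] allI negl_paths_AE_pline[OF r(1) e ab])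
  ultimately show ?thesis by eventually_elim (auto simp: T_def)
qed simp

text \<open>The length-area bound makes the sum integrable over the offsets, hence finite for almost
  every one. This serves to make generic segments good paths.\<close>

lemma AE_pline_sum_finite:
  fixes \<rho> :: "nat \<Rightarrow> ennreal"
  assumes "infsum (\<lambda>i. (\<rho> i)\<^sup>2) J < \<infinity>" and e: "cmod e = 1"
  shows "AE s in lborel. s \<in> {c..d} \<longrightarrow> (\<Sum>\<^sub>\<infinity>i\<in>meeting Q (pline z e s ` {a..b}) \<inter> J. \<rho> i) < \<infinity>"
proof (cases "c \<le> d")
  case cd: True
  obtain C where C: "C > 0"
    "\<And>f x r I c d \<rho>. (\<And>x y. \<bar>f x - f y\<bar> \<le> dist x y) \<Longrightarrow> r > 0 \<Longrightarrow> I \<subseteq> meeting Q {w. supdist x w \<le> 2 * r} \<Longrightarrow>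
      c \<le> d \<Longrightarrow> d - c \<le> r \<Longrightarrow>
      (\<integral>\<^sup>+s\<in>{c..d}. (\<Sum>\<^sub>\<infinity>i\<in>I. \<rho> i * width_ind f (Q i) s) \<partial>lborel)\<^sup>2 \<le> ennreal (C * r\<^sup>2) * (\<Sum>\<^sub>\<infinity>i\<in>I. (\<rho> i)\<^sup>2)"
    using width_sum_bound by blast
  define r where "r = \<bar>a\<bar> + \<bar>b\<bar> + \<bar>c\<bar> + \<bar>d\<bar> + 1"
  define I where "I = meeting Q {w. supdist z w \<le> 2 * r} \<inter> J"
  have r0: "r > 0" "d - c \<le> r" by (auto simp: r_def)
  define F where "F s = (\<Sum>\<^sub>\<infinity>i\<in>I. \<rho> i * width_ind (hgt z e) (Q i) s) * indicator {c..d} s" for s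
  have "(\<lambda>s. \<Sum>\<^sub>\<infinity>i\<in>I. \<rho> i * width_ind (hgt z e) (Q i) s) \<in> borel_measurable borel"
    by (rule nn_integral_width_sum(2)[OF hgt_Lip[OF e] cd])
  then have Fm[measurable]: "F \<in> borel_measurable borel" unfolding F_def by measurable
  have "(\<integral>\<^sup>+s. F s \<partial>lborel)\<^sup>2 \<le> ennreal (C * r\<^sup>2) * (\<Sum>\<^sub>\<infinity>i\<in>I. (\<rho> i)\<^sup>2)"
    unfolding F_def using r0 cd by (intro C(2)[where x = z] hgt_Lip e) (auto simp: I_def)
  also have "\<dots> \<le> ennreal (C * r\<^sup>2) * (\<Sum>\<^sub>\<infinity>i\<in>J. (\<rho> i)\<^sup>2)"
    by (intro mult_left_mono infsum_ennreal_mono_set) (auto simp: I_def)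
  also have "\<dots> < \<infinity>" using assms(1) by (simp add: ennreal_mult_less_top)
  finally have "(\<integral>\<^sup>+s. F s \<partial>lborel) < \<infinity>" by (simp only: ennreal_power2_less_top)
  then have "AE s in lborel. F s \<noteq> \<infinity>" by (intro nn_integral_PInf_AE) auto
  then show ?thesis
  proof eventually_elim
    case (elim s)
    show ?case
    proof
      assume s: "s \<in> {c..d}"
      let ?\<rho> = "\<lambda>i. \<rho> i * indicator J i"
      have "(\<Sum>\<^sub>\<infinity>i\<in>meeting Q (pline z e s ` {a..b}) \<inter> J. \<rho> i) = (\<Sum>\<^sub>\<infinity>i\<in>meeting Q (pline z e s ` {a..b}). ?\<rho> i)"
        by (rule infsum_cong_neutral) auto
      also have "\<dots> \<le> (\<Sum>\<^sub>\<infinity>i\<in>meeting Q {w. supdist z w \<le> 2 * r}. ?\<rho> i * width_ind (hgt z e) (Q i) s)"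
      proof (rule pline_sum_le_width_sum[OF e])
        show "meeting Q (pline z e s ` {a..b}) \<subseteq> meeting Q {w. supdist z w \<le> 2 * r}"
        proof (rule meeting_mono, safe)
          fix t assume "t \<in> {a..b}"
          then show "supdist z (pline z e s t) \<le> 2 * r"
            using s by (intro pline_in_square[OF e]) (auto simp: r_def)
        qed
      qed
      also have "\<dots> = (\<Sum>\<^sub>\<infinity>i\<in>I. \<rho> i * width_ind (hgt z e) (Q i) s)"
        by (rule infsum_cong_neutral) (auto simp: I_def)
      also have "\<dots> = F s" using s by (simp add: F_def)
      also have "F s < \<infinity>" using elim by (simp add: top.not_eq_extremum)
      finally show "(\<Sum>\<^sub>\<infinity>i\<in>meeting Q (pline z e s ` {a..b}) \<inter> J. \<rho> i) < \<infinity>" .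
    qed
  qed
qed simp

end


section \<open>Upper gradients along paths\<close>

lemma first_time:
  fixes g :: "real \<Rightarrow> complex"
  assumes "continuous_on {a..b} g" "closed C" "t \<in> {a..b}" "g t \<in> C"
  obtains s where "s \<in> {a..t}" "g s \<in> C" "\<And>r. a \<le> r \<Longrightarrow> r < s \<Longrightarrow> g r \<notin> C"
proof -
  have c: "closed ({a..t} \<inter> g -` C)"
    by (rule continuous_closed_preimage) (use assms in \<open>auto intro: continuous_on_subset[OF assms(1)]\<close>)
  then have "compact ({a..t} \<inter> g -` C)"
    using compact_eq_bounded_closed by (metis bounded_Int bounded_closed_interval)
  moreover have "{a..t} \<inter> g -` C \<noteq> {}" using assms by auto
  ultimately obtain s where s: "s \<in> {a..t} \<inter> g -` C" "\<And>r. r \<in> {a..t} \<inter> g -` C \<Longrightarrow> s \<le> r"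
    using compact_attains_inf by metis
  show ?thesis
  proof (rule that[of s])
    fix r assume "a \<le> r" "r < s"
    then show "g r \<notin> C" using s(2)[of r] s(1) by auto
  qed (use s in auto)
qed

context rel_carpet
begin

section \<open>Oscillation on a peripheral circle\<close>

definition od :: "(complex \<Rightarrow> real) \<Rightarrow> nat \<Rightarrow> ennreal" where
  "od f i = osc (\<lambda>x. ereal (f x)) (Q i)"

text \<open>Collects the real values of the supremum and the oscillation. The last clause, that the
  oscillation is the least bound for differences, lets inequalities between oscillations be checked
  pointwise.\<close>

lemma od_cases:
  assumes "bounded (f ` frontier (Q i))"
  obtains M c where "Mx (\<lambda>x. ereal (f x)) (Q i) = ereal M" "\<bar>Mn (\<lambda>x. ereal (f x)) (Q i)\<bar> \<noteq> \<infinity>"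
    "0 \<le> c" "od f i = ennreal c" "\<And>x y. x \<in> frontier (Q i) \<Longrightarrow> y \<in> frontier (Q i) \<Longrightarrow> f x - f y \<le> c"
    "\<And>x. x \<in> frontier (Q i) \<Longrightarrow> f x \<le> M \<and> M \<le> f x + c"
    "\<And>c'. (\<And>x y. x \<in> frontier (Q i) \<Longrightarrow> y \<in> frontier (Q i) \<Longrightarrow> f x - f y \<le> c') \<Longrightarrow> c \<le> c'"
proof -
  let ?F = "frontier (Q i)" and ?f = "\<lambda>x. ereal (f x)"
  obtain b where b: "\<And>x. x \<in> ?F \<Longrightarrow> \<bar>f x\<bar> \<le> b" using assms by (auto simp: bounded_iff)
  obtain x0 where x0: "x0 \<in> ?F" using frontier_Q_nonempty by blast
  have up: "?f x \<le> Mx ?f (Q i)" "Mn ?f (Q i) \<le> ?f x" if "x \<in> ?F" for x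
    using that unfolding Mx_def Mn_def by (auto intro: SUP_upper INF_lower)
  have "Mx ?f (Q i) \<le> ereal b" unfolding Mx_def using b by (intro SUP_least) (auto simp: abs_le_iff)
  moreover have "ereal (-b) \<le> Mn ?f (Q i)" unfolding Mn_def using b
    by (intro INF_greatest) (metis abs_le_iff ereal_less_eq(3) minus_le_iff)
  ultimately obtain M m where M: "Mx ?f (Q i) = ereal M" and m: "Mn ?f (Q i) = ereal m"
    using up[OF x0] by (cases "Mx ?f (Q i)"; cases "Mn ?f (Q i)") auto
  have fM: "f x \<le> M" and fm: "m \<le> f x" if "x \<in> ?F" for x
    using up[OF that] M m by auto
  have least: "M - m \<le> c'" if c': "\<And>x y. x \<in> ?F \<Longrightarrow> y \<in> ?F \<Longrightarrow> f x - f y \<le> c'" for c'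
  proof -
    have "M \<le> c' + f y" if "y \<in> ?F" for y
    proof -
      have "Mx ?f (Q i) \<le> ereal (c' + f y)" unfolding Mx_def
        using c'[OF _ that] by (intro SUP_least) (auto simp: algebra_simps)
      then show ?thesis using M by simp
    qed
    then have "ereal (M - c') \<le> Mn ?f (Q i)" unfolding Mn_def
      by (intro INF_greatest) (auto simp: algebra_simps)
    then show ?thesis using m by simp
  qed
  show ?thesis
  proof (rule that[of M "M - m"])
    show "od f i = ennreal (M - m)" by (simp add: od_def osc_def M m e2ennreal_ereal)
    show "0 \<le> M - m" using fM[OF x0] fm[OF x0] by simp
    show "M - m \<le> c'" if "\<And>x y. x \<in> ?F \<Longrightarrow> y \<in> ?F \<Longrightarrow> f x - f y \<le> c'" for c' by (rule least[OF that])
    show "f x - f y \<le> M - m" if "x \<in> ?F" "y \<in> ?F" for x y using fM[OF that(1)] fm[OF that(2)] by simp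
    show "f x \<le> M \<and> M \<le> f x + (M - m)" if "x \<in> ?F" for x using fM[OF that] fm[OF that] by simp
  qed (use M m in auto)
qed

lemma od_ge:
  assumes "bounded (f ` frontier (Q i))" "x \<in> frontier (Q i)" "y \<in> frontier (Q i)"
  shows "ennreal \<bar>f x - f y\<bar> \<le> od f i"
proof -
  obtain c where c: "0 \<le> c" "od f i = ennreal c"
    "\<And>x y. x \<in> frontier (Q i) \<Longrightarrow> y \<in> frontier (Q i) \<Longrightarrow> f x - f y \<le> c" by (rule od_cases[OF assms(1)]) blast
  show ?thesis using c(3)[OF assms(2,3)] c(3)[OF assms(3,2)] c(2) by (simp add: ennreal_leI abs_le_iff)
qed

lemma od_le:
  assumes "\<And>x y. x \<in> frontier (Q i) \<Longrightarrow> y \<in> frontier (Q i) \<Longrightarrow> f x - f y \<le> c'" 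
  shows "od f i \<le> ennreal c'"
proof -
  obtain x0 where x0: "x0 \<in> frontier (Q i)" using frontier_Q_nonempty by blast
  have b: "bounded (f ` frontier (Q i))" unfolding bounded_iff
  proof (intro exI[of _ "\<bar>f x0\<bar> + c'"] ballI)
    fix y assume "y \<in> f ` frontier (Q i)"
    then obtain x where "x \<in> frontier (Q i)" "y = f x" by blast
    then show "norm y \<le> \<bar>f x0\<bar> + c'" using assms[of x x0] assms[of x0 x] x0 by auto
  qed
  obtain c where c: "od f i = ennreal c" 
    "\<And>c'. (\<And>x y. x \<in> frontier (Q i) \<Longrightarrow> y \<in> frontier (Q i) \<Longrightarrow> f x - f y \<le> c') \<Longrightarrow> c \<le> c'"
    by (rule od_cases[OF b]) blast
  show ?thesis using c(2)[OF assms] c(1) by (simp add: ennreal_leI)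
qed

lemma Mx_Mn_finite: "bounded (f ` frontier (Q i)) \<Longrightarrow>
    \<bar>Mx (\<lambda>x. ereal (f x)) (Q i)\<bar> \<noteq> \<infinity> \<and> \<bar>Mn (\<lambda>x. ereal (f x)) (Q i)\<bar> \<noteq> \<infinity>"
  by (rule od_cases) auto

text \<open>A Sobolev function may take infinite values off the circles, but only its finite values
  on the circles enter \<open>Mx\<close>, \<open>Mn\<close> and \<open>osc\<close>; this permits
  passing to a real-valued function.\<close>

lemma finite_Mx_Mn:
  assumes "\<bar>Mx g (Q i)\<bar> \<noteq> \<infinity>" "\<bar>Mn g (Q i)\<bar> \<noteq> \<infinity>"
  shows "x \<in> frontier (Q i) \<Longrightarrow> g x = ereal (real_of_ereal (g x))"
    and "bounded ((\<lambda>x. real_of_ereal (g x)) ` frontier (Q i))"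
    and "Mx (\<lambda>x. ereal (real_of_ereal (g x))) (Q i) = Mx g (Q i)"
    and "od (\<lambda>x. real_of_ereal (g x)) i = osc g (Q i)"
proof -
  obtain M m where M: "Mx g (Q i) = ereal M" and m: "Mn g (Q i) = ereal m"
    using assms by (cases "Mx g (Q i)"; cases "Mn g (Q i)") auto
  have up: "g x \<le> ereal M" "ereal m \<le> g x" if "x \<in> frontier (Q i)" for x
    using that unfolding M[symmetric] m[symmetric] Mx_def Mn_def by (auto intro: SUP_upper INF_lower)
  show fin: "g x = ereal (real_of_ereal (g x))" if "x \<in> frontier (Q i)" for x
    using up[OF that] by (cases "g x") auto
  show "bounded ((\<lambda>x. real_of_ereal (g x)) ` frontier (Q i))"
    unfolding bounded_iff
  proof (intro exI[of _ "\<bar>M\<bar> + \<bar>m\<bar>"] ballI)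
    fix y assume "y \<in> (\<lambda>x. real_of_ereal (g x)) ` frontier (Q i)"
    then obtain x where x: "x \<in> frontier (Q i)" "y = real_of_ereal (g x)" by blast
    then show "norm y \<le> \<bar>M\<bar> + \<bar>m\<bar>" using up[OF x(1)] by (cases "g x") auto
  qed
  show 1: "Mx (\<lambda>x. ereal (real_of_ereal (g x))) (Q i) = Mx g (Q i)"
    unfolding Mx_def using fin by (intro SUP_cong) auto
  have 2: "Mn (\<lambda>x. ereal (real_of_ereal (g x))) (Q i) = Mn g (Q i)"
    unfolding Mn_def using fin by (intro INF_cong) auto
  show "od (\<lambda>x. real_of_ereal (g x)) i = osc g (Q i)"
    by (simp add: od_def osc_def 1 2)
qed

text \<open>Stronger than the inequality for the whole trace: the sum runs only over the disks met
  between the two parameters, which is what allows a path to be cut.\<close>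

definition pgrad :: "(complex \<Rightarrow> real) \<Rightarrow> (nat \<Rightarrow> ennreal) \<Rightarrow> (real \<Rightarrow> complex) \<Rightarrow> real \<Rightarrow> real \<Rightarrow> bool" where
  "pgrad f \<rho> g a b \<longleftrightarrow> (\<forall>s t. a \<le> s \<and> s \<le> t \<and> t \<le> b \<and> g s \<in> S \<and> g t \<in> S \<longrightarrow>
     ennreal \<bar>f (g s) - f (g t)\<bar> \<le> (\<Sum>\<^sub>\<infinity>i\<in>meeting Q (g ` {s..t}). \<rho> i))"

lemma pgradD: "pgrad f \<rho> g a b \<Longrightarrow> a \<le> s \<Longrightarrow> s \<le> t \<Longrightarrow> t \<le> b \<Longrightarrow> g s \<in> S \<Longrightarrow> g t \<in> S \<Longrightarrow>
    ennreal \<bar>f (g s) - f (g t)\<bar> \<le> (\<Sum>\<^sub>\<infinity>i\<in>meeting Q (g ` {s..t}). \<rho> i)"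
  unfolding pgrad_def by blast

lemma pgrad_subset: "pgrad f \<rho> g a b \<Longrightarrow> a \<le> a' \<Longrightarrow> b' \<le> b \<Longrightarrow> pgrad f \<rho> g a' b'"
  unfolding pgrad_def by (meson order_trans)

lemma image_reverse: "(\<lambda>t. g (c - t)) ` {s..t} = g ` {c - t..c - s}" for c :: real
proof -
  have "(\<lambda>t. c - t) ` {s..t} = {c - t..c - s}" by auto
  then show ?thesis by (metis image_image)
qed

lemma pgrad_reverse:
  assumes "pgrad f \<rho> g a b"
  shows "pgrad f \<rho> (\<lambda>t. g (a + b - t)) a b"
  unfolding pgrad_def
proof (intro allI impI)
  fix s t assume st: "a \<le> s \<and> s \<le> t \<and> t \<le> b \<and> g (a + b - s) \<in> S \<and> g (a + b - t) \<in> S"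
  then have "ennreal \<bar>f (g (a + b - t)) - f (g (a + b - s))\<bar> \<le> (\<Sum>\<^sub>\<infinity>i\<in>meeting Q (g ` {a + b - t..a + b - s}). \<rho> i)"
    by (intro pgradD[OF assms]) auto
  then show "ennreal \<bar>f (g (a + b - s)) - f (g (a + b - t))\<bar>
      \<le> (\<Sum>\<^sub>\<infinity>i\<in>meeting Q ((\<lambda>t. g (a + b - t)) ` {s..t}). \<rho> i)"
    by (simp add: image_reverse abs_minus_commute)
qed

lemma subpath_interval:
  assumes "\<gamma> \<in> paths_in \<Omega>" "a \<le> b" "{a..b} \<subseteq> fst \<gamma>"
  shows "({a..b}, snd \<gamma>) \<in> paths_in \<Omega>" "is_subpath ({a..b}, snd \<gamma>) \<gamma>" "continuous_on {a..b} (snd \<gamma>)"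
    "snd \<gamma> ` {a..b} \<subseteq> \<Omega>"
proof -
  obtain h where h: "continuous_on (closure (fst \<gamma>)) h" "\<And>t. t \<in> fst \<gamma> \<Longrightarrow> h t = snd \<gamma> t"
    using assms(1) by (auto simp: paths_in_def is_path_def)
  have "continuous_on {a..b} h" using h(1) assms(3) closure_subset by (meson continuous_on_subset order_trans)
  then show c: "continuous_on {a..b} (snd \<gamma>)"
    by (rule continuous_on_cong[THEN iffD1, rotated -1]) (use h(2) assms(3) in auto)
  show im: "snd \<gamma> ` {a..b} \<subseteq> \<Omega>" using assms(1,3) by (auto simp: paths_in_def trace_def)
  show "is_subpath ({a..b}, snd \<gamma>) \<gamma>" using assms(2,3) by (simp add: is_subpath_def is_interval_cc)
  show "({a..b}, snd \<gamma>) \<in> paths_in \<Omega>" using c im assms(2)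
    by (auto simp: paths_in_def is_path_def trace_def is_interval_cc)
qed

text \<open>All superpaths of exceptional paths are made exceptional as well, so every subpath of a
  remaining path satisfies the inequality on its own.\<close>

lemma upper_gradient_pgrad:
  assumes "upper_gradient v \<Omega> Q g \<rho>"
  obtains \<Gamma> where "carpet_mod v \<Omega> Q \<Gamma> = 0"
    "\<And>\<gamma> a b. \<gamma> \<in> paths_in \<Omega> \<Longrightarrow> \<gamma> \<notin> \<Gamma> \<Longrightarrow> {a..b} \<subseteq> fst \<gamma> \<Longrightarrow> pgrad (\<lambda>x. real_of_ereal (g x)) \<rho> (snd \<gamma>) a b"
proof -
  obtain \<Gamma>0 where G: "carpet_mod v \<Omega> Q \<Gamma>0 = 0"
    "\<forall>\<gamma>\<in>paths_in \<Omega> - \<Gamma>0. \<forall>x\<in>trace \<gamma> \<inter> S. \<forall>y\<in>trace \<gamma> \<inter> S.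
      \<bar>g x\<bar> \<noteq> \<infinity> \<and> \<bar>g y\<bar> \<noteq> \<infinity> \<and> \<bar>g x - g y\<bar> \<le> enn2ereal (\<Sum>\<^sub>\<infinity>i\<in>meeting Q (trace \<gamma>). \<rho> i)"
    using assms unfolding upper_gradient_def by (elim exE conjE) (rule that)
  define \<Gamma> where "\<Gamma> = {\<gamma>. \<exists>\<gamma>'\<in>\<Gamma>0. is_subpath \<gamma>' \<gamma>}"
  have "carpet_mod v \<Omega> Q \<Gamma> = 0" by (rule carpet_mod_superpaths_eq_0[OF G(1)]) (auto simp: \<Gamma>_def)
  moreover have "pgrad (\<lambda>x. real_of_ereal (g x)) \<rho> (snd \<gamma>) a b"
    if \<gamma>: "\<gamma> \<in> paths_in \<Omega>" "\<gamma> \<notin> \<Gamma>" "{a..b} \<subseteq> fst \<gamma>" for \<gamma> a b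
    unfolding pgrad_def
  proof (intro allI impI)
    fix s t assume st: "a \<le> s \<and> s \<le> t \<and> t \<le> b \<and> snd \<gamma> s \<in> S \<and> snd \<gamma> t \<in> S"
    then have sub: "s \<le> t" "{s..t} \<subseteq> fst \<gamma>" using \<gamma>(3) by (auto intro: subsetD)
    let ?\<gamma> = "({s..t}, snd \<gamma>)"
    have "?\<gamma> \<in> paths_in \<Omega> - \<Gamma>0"
      using subpath_interval[OF \<gamma>(1) sub] \<gamma>(2) by (auto simp: \<Gamma>_def)
    from G(2)[rule_format, OF this, of "snd \<gamma> s" "snd \<gamma> t"] st
    have "\<bar>g (snd \<gamma> s)\<bar> \<noteq> \<infinity>" "\<bar>g (snd \<gamma> t)\<bar> \<noteq> \<infinity>"
      "\<bar>g (snd \<gamma> s) - g (snd \<gamma> t)\<bar> \<le> enn2ereal (\<Sum>\<^sub>\<infinity>i\<in>meeting Q (snd \<gamma> ` {s..t}). \<rho> i)"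
      by (auto simp: trace_def)
    then have "ereal \<bar>real_of_ereal (g (snd \<gamma> s)) - real_of_ereal (g (snd \<gamma> t))\<bar>
        \<le> enn2ereal (\<Sum>\<^sub>\<infinity>i\<in>meeting Q (snd \<gamma> ` {s..t}). \<rho> i)"
      by (cases "g (snd \<gamma> s)"; cases "g (snd \<gamma> t)") auto
    then show "ennreal \<bar>real_of_ereal (g (snd \<gamma> s)) - real_of_ereal (g (snd \<gamma> t))\<bar>
        \<le> (\<Sum>\<^sub>\<infinity>i\<in>meeting Q (snd \<gamma> ` {s..t}). \<rho> i)"
      by (metis e2ennreal_enn2ereal e2ennreal_ereal e2ennreal_mono)
  qed
  ultimately show ?thesis using that by blast
qed

lemma pgrad_upper_gradient:
  assumes "carpet_mod v \<Omega> Q \<Gamma> = 0"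
    "\<And>\<gamma> a b. \<gamma> \<in> paths_in \<Omega> \<Longrightarrow> \<gamma> \<notin> \<Gamma> \<Longrightarrow> a \<le> b \<Longrightarrow> {a..b} \<subseteq> fst \<gamma> \<Longrightarrow> snd \<gamma> a \<in> S \<Longrightarrow> snd \<gamma> b \<in> S \<Longrightarrow>
      ennreal \<bar>f (snd \<gamma> a) - f (snd \<gamma> b)\<bar> \<le> (\<Sum>\<^sub>\<infinity>i\<in>meeting Q (snd \<gamma> ` {a..b}). \<rho> i)"
  shows "upper_gradient v \<Omega> Q (\<lambda>x. ereal (f x)) \<rho>"
  unfolding upper_gradient_def
proof (intro exI[of _ "\<Gamma> \<inter> paths_in \<Omega>"] conjI ballI)
  show "carpet_mod v \<Omega> Q (\<Gamma> \<inter> paths_in \<Omega>) = 0"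
    by (rule carpet_mod_superpaths_eq_0[OF assms(1)]) (auto simp: is_subpath_def paths_in_def is_path_def)
  fix \<gamma> x y assume \<gamma>: "\<gamma> \<in> paths_in \<Omega> - \<Gamma> \<inter> paths_in \<Omega>" and xy: "x \<in> trace \<gamma> \<inter> S" "y \<in> trace \<gamma> \<inter> S"
  have main: "ennreal \<bar>f (snd \<gamma> a) - f (snd \<gamma> b)\<bar> \<le> (\<Sum>\<^sub>\<infinity>i\<in>meeting Q (trace \<gamma>). \<rho> i)"
    if ab: "a \<le> b" "a \<in> fst \<gamma>" "b \<in> fst \<gamma>" "snd \<gamma> a \<in> S" "snd \<gamma> b \<in> S" for a b
  proof -
    have "is_interval (fst \<gamma>)" using \<gamma> by (auto simp: paths_in_def is_path_def)
    then have sub: "{a..b} \<subseteq> fst \<gamma>" using ab unfolding is_interval_1 by (meson atLeastAtMost_iff subsetI)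
    have "ennreal \<bar>f (snd \<gamma> a) - f (snd \<gamma> b)\<bar> \<le> (\<Sum>\<^sub>\<infinity>i\<in>meeting Q (snd \<gamma> ` {a..b}). \<rho> i)"
      using \<gamma> ab sub by (intro assms(2)) auto
    also have "\<dots> \<le> (\<Sum>\<^sub>\<infinity>i\<in>meeting Q (trace \<gamma>). \<rho> i)"
      using sub by (intro infsum_ennreal_mono_set meeting_mono) (auto simp: trace_def)
    finally show ?thesis .
  qed
  obtain a b where ab: "a \<in> fst \<gamma>" "x = snd \<gamma> a" "b \<in> fst \<gamma>" "y = snd \<gamma> b" using xy by (auto simp: trace_def)
  have "ennreal \<bar>f x - f y\<bar> \<le> (\<Sum>\<^sub>\<infinity>i\<in>meeting Q (trace \<gamma>). \<rho> i)"
  proof (cases "a \<le> b")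
    case True
    then show ?thesis using main[of a b] ab xy by simp
  next
    case False
    then show ?thesis using main[of b a] ab xy by (simp add: abs_minus_commute)
  qed
  then have "enn2ereal (ennreal \<bar>f x - f y\<bar>) \<le> enn2ereal (\<Sum>\<^sub>\<infinity>i\<in>meeting Q (trace \<gamma>). \<rho> i)"
    by (simp add: less_eq_ennreal.rep_eq)
  then show "\<bar>ereal (f x) - ereal (f y)\<bar> \<le> enn2ereal (\<Sum>\<^sub>\<infinity>i\<in>meeting Q (trace \<gamma>). \<rho> i)"
    by (simp add: enn2ereal_ennreal)
qed auto

text \<open>The first visit to the closed disk cannot lie in the open disk: slightly earlier times
  would then be visits too, and the initial time is excluded by assumption.\<close>

lemma first_time_closure_Q:
  fixes g :: "real \<Rightarrow> complex"
  assumes "continuous_on {a..b} g" "g a \<notin> Q i" "t \<in> {a..b}" "g t \<in> closure (Q i)"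
  obtains s where "s \<in> {a..t}" "g s \<in> frontier (Q i)" "\<And>r. a \<le> r \<Longrightarrow> r < s \<Longrightarrow> g r \<notin> closure (Q i)"
proof -
  obtain s where s: "s \<in> {a..t}" "g s \<in> closure (Q i)" "\<And>r. a \<le> r \<Longrightarrow> r < s \<Longrightarrow> g r \<notin> closure (Q i)"
    by (rule first_time[OF assms(1) closed_closure assms(3,4)]) blast
  have "g s \<notin> Q i"
  proof
    assume gs: "g s \<in> Q i"
    then have "s \<noteq> a" using assms(2) by auto
    then have "a < s" using s(1) by auto
    have "continuous_on {a..s} g" using assms(1,3) s(1) by (auto intro: continuous_on_subset)
    then have "(g \<longlongrightarrow> g s) (at_left s)"
      using \<open>a < s\<close> by (simp add: continuous_on_Icc_at_leftD)
    then have "eventually (\<lambda>r. g r \<in> Q i) (at_left s)"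
      using gs open_Q topological_tendstoD by blast
    moreover have "eventually (\<lambda>r. a < r \<and> r < s) (at_left s)"
      using \<open>a < s\<close> eventually_at_left_real by (simp add: eventually_at_left_field)
    ultimately have "eventually (\<lambda>r. False) (at_left s)"
      by eventually_elim (use s(3) closure_subset in \<open>auto dest: less_imp_le\<close>)
    then show False by simp
  qed
  then show ?thesis using that s closure_Q by blast
qed

lemma first_exit_Q:
  fixes g :: "real \<Rightarrow> complex"
  assumes "continuous_on {a..b} g" "g a \<in> Q i" "t \<in> {a..b}" "g t \<notin> Q i"
  obtains s where "s \<in> {a..t}" "g s \<in> frontier (Q i)"
proof -
  obtain s where s: "s \<in> {a..t}" "g s \<in> - Q i" "\<And>r. a \<le> r \<Longrightarrow> r < s \<Longrightarrow> g r \<notin> - Q i"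
    by (rule first_time[OF assms(1), of "- Q i" t]) (use assms(3,4) open_Q in \<open>auto simp: closed_Compl\<close>)
  have "s \<noteq> a" using s(2) assms(2) by auto
  then have as: "a < s" using s(1) by auto
  have "continuous_on {a..s} g" using assms(1,3) s(1) by (auto intro: continuous_on_subset)
  then have "(g \<longlongrightarrow> g s) (at_left s)"
    using as by (simp add: continuous_on_Icc_at_leftD)
  moreover have "eventually (\<lambda>r. g r \<in> closure (Q i)) (at_left s)"
    unfolding eventually_at_left_field using as s(3) by (intro exI[of _ a]) (auto intro!: closure_subset[THEN subsetD])
  ultimately have "g s \<in> closure (Q i)"
    by (intro Lim_in_closed_set[OF closed_closure]) auto
  then show ?thesis using that[OF s(1)] s(2) closure_Q by blast
qed

text \<open>Cut the path at the first visit to a big disk on which \<open>w\<close> is dominated by its oscillation; before that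
  time only disks where the old gradient is dominated, or very small ones, are met.\<close>

lemma truncation_gradient_aux:
  assumes g: "continuous_on {a..b} g" and ab: "a \<le> b" and S: "g a \<in> S" "g b \<in> S"
    and w: "\<And>x. x \<in> S \<Longrightarrow> 0 \<le> w x"
    and grad: "pgrad w \<rho> g a b" and fin: "(\<Sum>\<^sub>\<infinity>i\<in>meeting Q (g ` {a..b}). \<rho> i) < \<infinity>"
    and cls: "\<And>i. \<rho> i \<le> \<omega> i \<or> (\<forall>z\<in>frontier (Q i). ennreal (w z) \<le> \<omega> i)"
  shows "ennreal (w (g a) - w (g b)) \<le> (\<Sum>\<^sub>\<infinity>i\<in>meeting Q (g ` {a..b}). \<omega> i)"
proof (rule ennreal_le_epsilon)
  fix \<eta> :: real assume \<eta>: "0 < \<eta>"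
  let ?I = "meeting Q (g ` {a..b})"
  obtain F where F: "finite F" "F \<subseteq> ?I" "infsum \<rho> (?I - F) < ennreal \<eta>"
    using infsum_ennreal_tail[OF fin, of "ennreal \<eta>"] \<eta> by auto
  \<comment> \<open>The disks off \<open>F\<close> carry less than \<eta> in total, so only these
    finitely many need attention, and on their circles \<open>w\<close> is at most
    \<open>\<omega> i\<close>. Finiteness makes the union of their closures closed, so that a first
    visit exists.\<close>
  define B where "B = {i \<in> F. \<not> \<rho> i \<le> \<omega> i}"
  have est: "infsum \<rho> I \<le> infsum \<omega> I + ennreal \<eta>" if I: "I \<subseteq> ?I - B" for I
  proof -
    let ?G = "{i \<in> I. \<rho> i \<le> \<omega> i}"
    have "infsum \<rho> I \<le> infsum \<rho> (?G \<union> (?I - F))"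
      using I by (intro infsum_ennreal_mono_set) (auto simp: B_def)
    also have "\<dots> \<le> infsum \<rho> ?G + infsum \<rho> (?I - F)" by (rule infsum_ennreal_Un)
    also have "infsum \<rho> ?G \<le> infsum \<omega> ?G" by (rule infsum_ennreal_mono) auto
    also have "infsum \<omega> ?G \<le> infsum \<omega> I" by (rule infsum_ennreal_mono_set) auto
    finally show ?thesis using F(3) by (meson add_mono le_less order_trans add_left_mono)
  qed
  show "ennreal (w (g a) - w (g b)) \<le> infsum \<omega> ?I + ennreal \<eta>"
  proof (cases "B = {}")
    case True
    have "ennreal (w (g a) - w (g b)) \<le> ennreal \<bar>w (g a) - w (g b)\<bar>" by (rule ennreal_leI) simp
    also have "\<dots> \<le> infsum \<rho> ?I" by (rule pgradD[OF grad]) (use ab S in auto)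
    also have "\<dots> \<le> infsum \<omega> ?I + ennreal \<eta>" using True by (intro est) auto
    finally show ?thesis .
  next
    case False
    define C where "C = (\<Union>i\<in>B. closure (Q i))"
    have C: "closed C" unfolding C_def B_def using F(1) by (intro closed_UN) auto
    obtain i0 where "i0 \<in> B" using False by blast
    moreover from this have "i0 \<in> ?I" using F(2) by (auto simp: B_def)
    ultimately obtain t0 where i0: "i0 \<in> B" "t0 \<in> {a..b}" "g t0 \<in> Q i0"
      unfolding meeting_def by blast
    then have "g t0 \<in> C" using closure_subset by (auto simp: C_def)
    then obtain s where s: "s \<in> {a..t0}" "g s \<in> C" "\<And>r. a \<le> r \<Longrightarrow> r < s \<Longrightarrow> g r \<notin> C"
      using first_time[OF g C i0(2)] by metis
    then obtain j where j: "j \<in> B" "g s \<in> closure (Q j)" by (auto simp: C_def)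
    \<comment> \<open>The first visit to the union is also the first visit to the closed disk
      reached, hence lies on its circle and not inside.\<close>
    obtain s' where s': "s' \<in> {a..s}" "g s' \<in> frontier (Q j)"
      using first_time_closure_Q[OF g S_not_Q[OF S(1)] _ j(2)] s(1) i0(2) by auto
    have "g s' \<in> C" using s'(2) j(1) closure_Q by (auto simp: C_def)
    then have "s' = s" using s(3)[of s'] s'(1) by force
    then have gs: "g s \<in> frontier (Q j)" "g s \<in> S" using s'(2) frontier_Q_subset_S by auto
    have sb: "s \<in> {a..b}" using s(1) i0(2) by auto
    have sub: "meeting Q (g ` {a..s}) \<subseteq> ?I - B"
    proof
      fix i assume "i \<in> meeting Q (g ` {a..s})"
      then obtain r where r: "r \<in> {a..s}" "g r \<in> Q i" unfolding meeting_def by blast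
      have "i \<notin> B"
      proof
        assume "i \<in> B"
        then have "g r \<in> C" using r(2) closure_subset by (auto simp: C_def)
        then have "r = s" using s(3)[of r] r(1) by force
        then show False using r(2) gs(2) S_not_Q by auto
      qed
      then show "i \<in> ?I - B" using r sb by (auto simp: meeting_def)
    qed
    have jn: "j \<notin> meeting Q (g ` {a..s})" and jI: "j \<in> ?I" using sub j(1) F(2) by (auto simp: B_def)
    \<comment> \<open>Nonnegativity of \<open>w\<close> at the end point replaces the rest of the
      path: it costs at most \<open>w (g s)\<close>, which is charged to the disk \<open>j\<close>,
      and \<open>j\<close> is not met up to time \<open>s\<close>.\<close>
    have "w (g a) - w (g b) \<le> \<bar>w (g a) - w (g s)\<bar> + w (g s)" using w[OF S(2)] by simp
    then have "ennreal (w (g a) - w (g b)) \<le> ennreal (\<bar>w (g a) - w (g s)\<bar> + w (g s))" by (rule ennreal_leI)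
    also have "\<dots> = ennreal \<bar>w (g a) - w (g s)\<bar> + ennreal (w (g s))" using w[OF gs(2)] by (intro ennreal_plus) auto
    also have "\<dots> \<le> infsum \<rho> (meeting Q (g ` {a..s})) + \<omega> j"
    proof (rule add_mono)
      show "ennreal \<bar>w (g a) - w (g s)\<bar> \<le> infsum \<rho> (meeting Q (g ` {a..s}))"
        by (rule pgradD[OF grad]) (use sb S gs in auto)
      show "ennreal (w (g s)) \<le> \<omega> j" using cls[of j] j(1) gs(1) by (auto simp: B_def)
    qed
    also have "\<dots> \<le> (infsum \<omega> (meeting Q (g ` {a..s})) + ennreal \<eta>) + \<omega> j"
      by (intro add_right_mono est sub)
    also have "\<dots> = (infsum \<omega> (meeting Q (g ` {a..s})) + infsum \<omega> {j}) + ennreal \<eta>" by (simp add: ac_simps)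
    also have "\<dots> \<le> infsum \<omega> ?I + ennreal \<eta>"
      using sub jn jI by (intro add_right_mono infsum_ennreal_UN_disjoint_finite_le) auto
    finally show ?thesis .
  qed
qed

text \<open>Reversing the path gives the bound for the opposite sign. The intended \<omega> is the
  oscillation of a truncated function \<open>w\<close>, and \<rho> a gradient inherited from the
  function before truncation.\<close>

lemma truncation_gradient:
  assumes g: "continuous_on {a..b} g" and ab: "a \<le> b" and S: "g a \<in> S" "g b \<in> S"
    and w: "\<And>x. x \<in> S \<Longrightarrow> 0 \<le> w x"
    and grad: "pgrad w \<rho> g a b" and fin: "(\<Sum>\<^sub>\<infinity>i\<in>meeting Q (g ` {a..b}). \<rho> i) < \<infinity>"
    and cls: "\<And>i. \<rho> i \<le> \<omega> i \<or> (\<forall>z\<in>frontier (Q i). ennreal (w z) \<le> \<omega> i)"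
  shows "ennreal \<bar>w (g a) - w (g b)\<bar> \<le> (\<Sum>\<^sub>\<infinity>i\<in>meeting Q (g ` {a..b}). \<omega> i)"
proof -
  let ?h = "\<lambda>t. g (a + b - t)"
  have h: "continuous_on {a..b} ?h"
    by (rule continuous_on_compose2[OF g]) (auto intro!: continuous_intros)
  have im: "?h ` {a..b} = g ` {a..b}" using image_reverse[of g "a + b" a b] by simp
  have "ennreal (w (?h a) - w (?h b)) \<le> (\<Sum>\<^sub>\<infinity>i\<in>meeting Q (?h ` {a..b}). \<omega> i)"
    by (rule truncation_gradient_aux[OF h ab _ _ w pgrad_reverse[OF grad] _ cls]) (use S fin im in auto)
  then have "ennreal (w (g b) - w (g a)) \<le> (\<Sum>\<^sub>\<infinity>i\<in>meeting Q (g ` {a..b}). \<omega> i)" by (simp add: im)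
  then show ?thesis using truncation_gradient_aux[OF assms] by (simp add: abs_if)
qed

end

text \<open>Small sideways shifts of the segment from \<open>z\<close> to \<open>z'\<close> keep its
  ends in the open sets, and convexity of the ball keeps the rest inside. A bundle of positive width
  is what statements about almost every line can be applied to.\<close>

lemma parallel_segments:
  fixes z z' :: complex
  assumes "open A" "open B" "z \<in> A" "z' \<in> B" "z \<in> ball q r" "z' \<in> ball q r" "z \<noteq> z'"
  obtains e L s0 where "cmod e = 1" "L > 0" "s0 > 0"
    "\<And>s. s \<in> {-s0..s0} \<Longrightarrow> pline z e s 0 \<in> A \<and> pline z e s L \<in> B \<and> pline z e s ` {0..L} \<subseteq> ball q r"
proof -
  define L where "L = cmod (z' - z)"
  define e where "e = (z' - z) / of_real L"
  have L: "L > 0" using assms(7) by (simp add: L_def)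
  have e: "cmod e = 1" using L by (simp add: e_def L_def norm_divide)
  have p: "pline z e s t = z + of_real t * e + of_real s * (\<i> * e)" for s t
    by (simp add: pline_def Complex_eq algebra_simps)
  have z': "z' = z + of_real L * e" using L by (simp add: e_def)
  obtain d1 where d1: "d1 > 0" "ball z d1 \<subseteq> A \<inter> ball q r"
    using assms open_contains_ball[of "A \<inter> ball q r"] by (metis IntI open_Int open_ball)
  obtain d2 where d2: "d2 > 0" "ball z' d2 \<subseteq> B \<inter> ball q r"
    using assms open_contains_ball[of "B \<inter> ball q r"] by (metis IntI open_Int open_ball)
  define s0 where "s0 = min d1 d2 / 2"
  have s0: "s0 > 0" "s0 < d1" "s0 < d2" using d1 d2 by (auto simp: s0_def)
  have "pline z e s 0 \<in> A \<and> pline z e s L \<in> B \<and> pline z e s ` {0..L} \<subseteq> ball q r" if "s \<in> {-s0..s0}" for s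
  proof -
    have s: "\<bar>s\<bar> < d1" "\<bar>s\<bar> < d2" using that s0 by auto
    have 1: "pline z e s 0 \<in> ball z d1" using s e by (simp add: p dist_norm norm_mult)
    have 2: "pline z e s L \<in> ball z' d2" using s e by (simp add: p z' dist_norm norm_mult)
    have "pline z e s t \<in> ball q r" if t: "t \<in> {0..L}" for t
    proof -
      have "pline z e s t = (1 - t / L) *\<^sub>R pline z e s 0 + (t / L) *\<^sub>R pline z e s L"
        using L by (simp add: p scaleR_conv_of_real field_simps)
      moreover have "pline z e s 0 \<in> ball q r" "pline z e s L \<in> ball q r" using 1 2 d1(2) d2(2) by blast+
      ultimately show ?thesis
        using convexD[OF convex_ball[of q r], of "pline z e s 0" "pline z e s L" "1 - t / L" "t / L"] t L
        by simp
    qed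
    then show ?thesis using 1 2 d1(2) d2(2) by blast
  qed
  then show ?thesis using that[OF e L s0(1)] by blast
qed


section \<open>The maximum principle\<close>

lemma AE_E_interval:
  fixes a b :: real
  assumes "AE s in lborel. P s" "a < b"
  shows "\<exists>s\<in>{a..b}. P s"
proof (rule ccontr)
  assume n: "\<not> ?thesis"
  obtain N where N: "{s \<in> space lborel. \<not> P s} \<subseteq> N" "emeasure lborel N = 0" "N \<in> sets lborel"
    using AE_E[OF assms(1)] by blast
  have "{a..b} \<subseteq> N" using n N(1) by auto
  then have "emeasure lborel {a..b} \<le> emeasure lborel N" using N(3) by (intro emeasure_mono) auto
  then show False using assms(2) N(2) by simp
qed

context rel_carpet
begin

section \<open>Local sums, equality of energies and connectedness\<close>

lemma infsum_ennreal_finite_UN: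
  fixes f :: "nat \<Rightarrow> ennreal"
  assumes "finite K" "\<And>k. k \<in> K \<Longrightarrow> infsum f (A k) < \<infinity>"
  shows "infsum f (\<Union>k\<in>K. A k) < \<infinity>"
  using assms
proof (induction K)
  case (insert k K)
  have "infsum f (\<Union>k\<in>insert k K. A k) \<le> infsum f (A k) + infsum f (\<Union>k\<in>K. A k)"
    using infsum_ennreal_Un by simp
  also have "\<dots> < \<infinity>" using insert by simp
  finally show ?case .
qed simp

text \<open>The definition asks for finite sums on balls, and finitely many of them cover the
  compact closure.\<close>

lemma sobolev_sums_compact:
  assumes "g \<in> sobolev_loc v \<Omega> Q" "V \<subset>\<subset> \<Omega>"
  shows "sobolev_sums Q g (meeting Q V)"
proof -
  have K: "compact (closure V)" "closure V \<subseteq> \<Omega>" using assms(2) by (auto simp: compactly_contained_def)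
  have "\<exists>r>0. cball x r \<subseteq> \<Omega>" if "x \<in> closure V" for x
    using open_\<Omega> K(2) that open_contains_cball by blast
  then obtain r where r: "\<And>x. x \<in> closure V \<Longrightarrow> r x > 0 \<and> cball x (r x) \<subseteq> \<Omega>" by metis
  have cov: "closure V \<subseteq> (\<Union>x\<in>closure V. ball x (r x))" using r by force
  obtain X where X: "X \<subseteq> closure V" "finite X" "closure V \<subseteq> (\<Union>x\<in>X. ball x (r x))"
    by (rule compactE_image[OF K(1) _ cov]) auto
  have "ball x (r x) \<subset>\<subset> \<Omega>" if "x \<in> X" for x
  proof -
    have "closure (ball x (r x)) \<subseteq> cball x (r x)" by (simp add: closure_minimal)
    moreover have "cball x (r x) \<subseteq> \<Omega>" using r X(1) that by blast
    ultimately show ?thesis by (auto simp: compactly_contained_def)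
  qed
  then have s: "sobolev_sums Q g (meeting Q (ball x (r x)))" if "x \<in> X" for x
    using assms(1) that by (auto simp: sobolev_loc_def)
  have sub: "meeting Q V \<subseteq> (\<Union>x\<in>X. meeting Q (ball x (r x)))"
    using X(3) closure_subset[of V] by (fastforce simp: meeting_def)
  show ?thesis unfolding sobolev_sums_def
  proof
    show "(\<Sum>\<^sub>\<infinity>i\<in>meeting Q V. ennreal ((real_of_ereal (Mx g (Q i)))\<^sup>2 * (diameter (Q i))\<^sup>2)) < \<infinity>"
      using infsum_ennreal_finite_UN[OF X(2), of "\<lambda>i. ennreal ((real_of_ereal (Mx g (Q i)))\<^sup>2 * (diameter (Q i))\<^sup>2)" "\<lambda>x. meeting Q (ball x (r x))"]
        s infsum_ennreal_mono_set[OF sub] by (auto simp: sobolev_sums_def intro: le_less_trans)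
    show "(\<Sum>\<^sub>\<infinity>i\<in>meeting Q V. (osc g (Q i))\<^sup>2) < \<infinity>"
      using infsum_ennreal_finite_UN[OF X(2), of "\<lambda>i. (osc g (Q i))\<^sup>2" "\<lambda>x. meeting Q (ball x (r x))"]
        s infsum_ennreal_mono_set[OF sub] by (auto simp: sobolev_sums_def intro: le_less_trans)
  qed
qed

text \<open>The area sum takes care of all disks of diameter below \<open>r\<close>, and only
  finitely many others meet a bounded set.\<close>

lemma sum_diameter_squares:
  assumes "bounded V"
  shows "(\<Sum>\<^sub>\<infinity>i\<in>meeting Q V. ennreal ((diameter (Q i))\<^sup>2)) < \<infinity>"
    and "\<exists>D. \<forall>i\<in>meeting Q V. diameter (Q i) \<le> D"
proof -
  obtain C where C: "C > 0" "\<And>x r I. r > 0 \<Longrightarrow> I \<subseteq> meeting Q {w. supdist x w \<le> 2 * r} \<Longrightarrow>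
      (\<Sum>\<^sub>\<infinity>i\<in>I. ennreal ((min (diameter (Q i)) r)\<^sup>2)) \<le> ennreal (C * r\<^sup>2)" using area_sum by blast
  obtain R where R: "R > 0" "V \<subseteq> ball 0 R" using assms bounded_subset_ballD by blast
  define r where "r = R"
  define I where "I = meeting Q V"
  define F where "F = {i \<in> I. r \<le> diameter (Q i)}"
  have F: "finite F" unfolding F_def I_def by (rule finite_big_Q[OF assms]) (simp add: R(1) r_def)
  have IF: "I - F \<subseteq> meeting Q {w. supdist 0 w \<le> 2 * r}"
  proof -
    have "supdist 0 w \<le> 2 * r" if "w \<in> V" for w
    proof -
      have "dist 0 w < R" using that R by auto
      then show ?thesis using supdist_le_dist[of 0 w] R(1) by (auto simp: r_def)
    qed
    then show ?thesis unfolding I_def meeting_def by blast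
  qed
  have "infsum (\<lambda>i. ennreal ((diameter (Q i))\<^sup>2)) (I - F) = (\<Sum>\<^sub>\<infinity>i\<in>I - F. ennreal ((min (diameter (Q i)) r)\<^sup>2))"
    by (rule infsum_cong) (auto simp: F_def min_def)
  also have "\<dots> \<le> ennreal (C * r\<^sup>2)" by (rule C(2)[OF _ IF]) (simp add: R(1) r_def)
  finally have 1: "infsum (\<lambda>i. ennreal ((diameter (Q i))\<^sup>2)) (I - F) < \<infinity>"
    by (metis ennreal_less_top infinity_ennreal_def le_less_trans)
  have "infsum (\<lambda>i. ennreal ((diameter (Q i))\<^sup>2)) I \<le> infsum (\<lambda>i. ennreal ((diameter (Q i))\<^sup>2)) F
      + infsum (\<lambda>i. ennreal ((diameter (Q i))\<^sup>2)) (I - F)"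
    using infsum_ennreal_Un[of _ F "I - F"] by (simp add: F_def Un_absorb1)
  also have "\<dots> < \<infinity>" using 1 F by simp
  finally show "(\<Sum>\<^sub>\<infinity>i\<in>meeting Q V. ennreal ((diameter (Q i))\<^sup>2)) < \<infinity>" by (simp add: I_def)
  have "diameter (Q i) \<le> max r (Max (insert 0 ((\<lambda>i. diameter (Q i)) ` F)))" if "i \<in> I" for i
  proof (cases "i \<in> F")
    case True
    then have "diameter (Q i) \<le> Max (insert 0 ((\<lambda>i. diameter (Q i)) ` F))" using F by (intro Max_ge) auto
    then show ?thesis by simp
  next
    case False
    then have "diameter (Q i) < r" using that by (auto simp: F_def)
    then show ?thesis by simp
  qed
  then show "\<exists>D. \<forall>i\<in>meeting Q V. diameter (Q i) \<le> D" unfolding I_def by blast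
qed

text \<open>Termwise inequality in one direction and inequality of finite totals in the other leave
  no room for a strict inequality in a single term.\<close>

lemma infsum_ennreal_eq_imp_eq:
  fixes a b :: "nat \<Rightarrow> ennreal"
  assumes "infsum a I \<le> infsum b I" "\<And>i. i \<in> I \<Longrightarrow> b i \<le> a i" "infsum a I < \<infinity>" "i \<in> I"
  shows "a i \<le> b i"
proof (rule ccontr)
  assume "\<not> ?thesis"
  then have lt: "b i < a i" by simp
  have sp: "infsum f I = f i + infsum f (I - {i})" for f :: "nat \<Rightarrow> ennreal"
    using infsum_Un_disjoint[of f "{i}" "I - {i}"] assms(4) by (simp add: insert_absorb)
  have "infsum b (I - {i}) \<le> infsum a (I - {i})" by (rule infsum_ennreal_mono) (use assms(2) in auto)
  moreover have "infsum a (I - {i}) < \<infinity>" using assms(3) sp[of a] by auto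
  ultimately have "infsum b (I - {i}) + b i \<le> infsum a (I - {i}) + b i"
    "infsum a (I - {i}) + b i < infsum a (I - {i}) + a i"
    using lt by (auto simp: add_right_mono ennreal_add_left_cancel_less)
  then have "infsum b (I - {i}) + b i < infsum a (I - {i}) + a i" by (rule le_less_trans)
  then have "infsum b I < infsum a I" unfolding sp[of a] sp[of b] by (simp only: add.commute)
  then show False using assms(1) by simp
qed

text \<open>By Janiszewski's theorem: neither the closed disk nor the complement of \<Omega>
  separates the two points, and these sets are disjoint.\<close>

lemma connected_minus_closures:
  assumes "J = {} \<or> (\<exists>j. J = {j})"
  shows "connected (\<Omega> - (\<Union>j\<in>J. closure (Q j)))"
proof (cases "J = {}")
  case True then show ?thesis using connected_\<Omega> by simp
next
  case False
  then obtain j where j: "J = {j}" using assms by blast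
  have "\<exists>T. connected T \<and> T \<subseteq> \<Omega> - closure (Q j) \<and> a \<in> T \<and> b \<in> T"
    if "a \<in> \<Omega> - closure (Q j)" "b \<in> \<Omega> - closure (Q j)" for a b
  proof -
    have "connected_component (- closure (Q j)) a b"
      using connected_compl_closure_Q that by (auto simp: connected_component_def)
    moreover have "connected_component (- (- \<Omega>)) a b"
      using connected_\<Omega> that by (auto simp: connected_component_def)
    moreover have "closure (Q j) \<inter> - \<Omega> = {}" using closure_Q_subset by blast
    ultimately have "connected_component (- (closure (Q j) \<union> - \<Omega>)) a b"
      using open_\<Omega> by (intro Janiszewski compact_closure_Q) auto
    moreover have "- (closure (Q j) \<union> - \<Omega>) = \<Omega> - closure (Q j)" by auto
    ultimately show ?thesis unfolding connected_component_def by auto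
  qed
  then show ?thesis unfolding j by (subst connected_iff_connected_component) (auto simp: connected_component_def)
qed

text \<open>The competitor is \<sigma> u cut off at the level \<open>M\<close> inside
  \<open>V\<close>; \<sigma> = -1 gives the minimum principle. \<open>A\<close> is the set through
  which paths leave \<open>V\<close> outside the disk of \<open>J\<close>. At that disk only one
  boundary point with \<sigma> u at most \<open>M\<close> is asked for, because its full oscillation
  can be charged to any path meeting it. Near \<open>q1\<close>, outside the closure of
  \<open>V\<close>, the truncation vanishes, and connectedness carries this to all disks not in
  \<open>J\<close>.\<close>

lemma maximum_principle:
  fixes u :: "complex \<Rightarrow> real"
  assumes harm: "carpet_harmonic v \<Omega> Q (\<lambda>x. ereal (u x))"
    and \<sigma>: "\<sigma> = 1 \<or> \<sigma> = - 1"
    and V: "open V" "V \<subset>\<subset> \<Omega>"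
    and J: "J = {} \<or> (\<exists>j. J = {j})"
    and front: "closure (V - (\<Union>j\<in>J. Q j)) - V \<subseteq> A \<union> (\<Union>j\<in>J. Q j)"
    and meetJ: "\<And>j. j \<in> J \<Longrightarrow> Q j \<inter> V \<noteq> {}"
    and A1: "\<And>x. x \<in> A \<inter> S \<Longrightarrow> \<sigma> * u x \<le> M"
    and A2: "\<And>i x. i \<in> meeting Q A - J \<Longrightarrow> x \<in> frontier (Q i) \<Longrightarrow> \<sigma> * u x \<le> M"
    and A3: "\<And>j. j \<in> J \<Longrightarrow> \<exists>x\<in>frontier (Q j). \<sigma> * u x \<le> M"
    and q1: "q1 \<in> \<Omega> - (\<Union>j\<in>J. closure (Q j))" "q1 \<notin> closure V"
    and i: "i \<notin> J" "Q i \<inter> V \<noteq> {}" and x: "x \<in> frontier (Q i)"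
  shows "\<sigma> * u x \<le> M"
proof -
  define Q0 where "Q0 = (\<Union>j\<in>J. Q j)"
  define D where "D = (\<Union>j\<in>J. closure (Q j))"
  define w where "w x = (if x \<in> V then max (\<sigma> * u x - M) 0 else 0)" for x
  have finJ: "finite J" using J by auto
  have closedD: "closed D" unfolding D_def using finJ by (intro closed_UN) auto
  have Q0D: "Q0 \<subseteq> D" using closure_subset by (auto simp: Q0_def D_def)
  have DO: "D \<subseteq> \<Omega>" using closure_Q_subset by (auto simp: D_def)
  have QiD: "closure (Q i) \<inter> D = {}" if "i \<notin> J" for i
  proof -
    have "closure (Q i) \<inter> closure (Q j) = {}" if "j \<in> J" for j
      using closure_Q_disjoint[of i j] that \<open>i \<notin> J\<close> by metis
    then show ?thesis unfolding D_def by blast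
  qed
  have QJD: "Q j \<subseteq> D" if "j \<in> J" for j
    using that closure_subset[of "Q j"] by (auto simp: D_def)
  have QQ: "Q i \<inter> (\<Union>j\<in>J. Q j) = {}" if "i \<notin> J" for i
    using QiD[OF that] Q0D closure_subset[of "Q i"] unfolding Q0_def by blast
  have SQ0: "x \<notin> Q0" if "x \<in> S" for x using that S_not_Q by (auto simp: Q0_def)
  have usob: "(\<lambda>x. ereal (u x)) \<in> sobolev_loc v \<Omega> Q" using harm by (simp add: carpet_harmonic_def)
  have ubd: "bounded (u ` frontier (Q i))" for i
    using finite_Mx_Mn(2)[of "\<lambda>x. ereal (u x)" i] usob by (simp add: sobolev_loc_def)
  have \<sigma>abs: "\<bar>\<sigma> * a - \<sigma> * b\<bar> = \<bar>a - b\<bar>" for a b using \<sigma> by auto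
  have w0: "0 \<le> w x" for x by (simp add: w_def)
  have wle: "w x \<le> max (\<sigma> * u x - M) 0" for x by (simp add: w_def)
  \<comment> \<open>A disk not in \<open>J\<close> that meets \<open>V\<close> but not
    \<open>A\<close> cannot cross the frontier of \<open>V\<close>, by connectedness of the disk and
    \<open>front\<close>.\<close>
  have F0: "Q i \<subseteq> V \<or> Q i \<inter> A \<noteq> {}" if "i \<notin> J" "Q i \<inter> V \<noteq> {}" for i
  proof (rule ccontr)
    assume con: "\<not> (Q i \<subseteq> V \<or> Q i \<inter> A \<noteq> {})"
    then have "Q i \<inter> frontier V \<noteq> {}" using that(2) connected_Q by (intro connected_Int_frontier) auto
    then obtain z where z: "z \<in> Q i" "z \<in> frontier V" by blast
    have "z \<notin> V" using z(2) V(1) frontier_disjoint_eq by blast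
    have "z \<in> closure V" using z(2) by (auto simp: frontier_def)
    then have "z \<in> closure (Q i \<inter> V)"
      using open_Int_closure_subset[OF open_Q, of i V] z(1) by blast
    moreover have "Q i \<inter> V \<subseteq> V - (\<Union>j\<in>J. Q j)" using QQ[OF that(1)] by blast
    ultimately have "z \<in> closure (V - (\<Union>j\<in>J. Q j))" by (meson closure_mono subsetD)
    then have "z \<in> A \<union> (\<Union>j\<in>J. Q j)" using front \<open>z \<notin> V\<close> by blast
    then show False using con z(1) QQ[OF that(1)] by blast
  qed
  \<comment> \<open>On these circles the bound already holds off \<open>V\<close>, so setting
    \<open>w\<close> to 0 there agrees with the truncation formula; \<open>F3\<close> records
    this.\<close>
  have F1: "\<sigma> * u x \<le> M" if "i \<notin> J" "Q i \<inter> V \<noteq> {}" "x \<in> frontier (Q i)" "x \<notin> V" for i x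
  proof (cases "Q i \<inter> A = {}")
    case True
    then have "Q i \<subseteq> V - (\<Union>j\<in>J. Q j)" using F0[OF that(1,2)] QQ[OF that(1)] by blast
    then have "closure (Q i) \<subseteq> closure (V - (\<Union>j\<in>J. Q j))" by (rule closure_mono)
    then have "x \<in> closure (V - (\<Union>j\<in>J. Q j)) - V" using that(3,4) closure_Q[of i] by blast
    moreover have xS: "x \<in> S" using that(3) frontier_Q_subset_S[of i] by blast
    ultimately show ?thesis using front SQ0[OF xS] A1 by (auto simp: Q0_def)
  next
    case False
    then show ?thesis using A2 that by (auto simp: meeting_def)
  qed
  have F2: "x \<notin> V" if "Q i \<inter> V = {}" "x \<in> frontier (Q i)" for i x
  proof -
    have "closure (Q i) \<inter> V = {}" using that(1) V(1) open_Int_closure_eq_empty by (metis inf_commute)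
    then show ?thesis using that(2) closure_Q[of i] by blast
  qed
  have F3: "w x = max (\<sigma> * u x - M) 0" if "i \<notin> J" "Q i \<inter> V \<noteq> {}" "x \<in> frontier (Q i)" for i x
    using F1[OF that] by (auto simp: w_def)
  have wbd: "bounded (w ` frontier (Q i))" for i
  proof -
    obtain b where b: "\<And>x. x \<in> frontier (Q i) \<Longrightarrow> \<bar>u x\<bar> \<le> b" using ubd[of i] by (auto simp: bounded_iff)
    have "\<bar>w x\<bar> \<le> b + \<bar>M\<bar>" if "x \<in> frontier (Q i)" for x
      using b[OF that] w0[of x] wle[of x] \<sigma> by auto
    then show ?thesis unfolding bounded_iff by auto
  qed
  \<comment> \<open>The oscillations of \<open>u\<close> on the disks meeting \<open>V\<close> only:
    their energy is finite because \<open>V\<close> is compactly contained, and by \<open>BG\<close>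
    they form a gradient of \<open>w\<close> along the relevant paths.\<close>
  define \<rho> where "\<rho> i = (if Q i \<inter> V \<noteq> {} then od u i else 0)" for i
  \<comment> \<open>The dichotomy for \<open>truncation_gradient\<close>: if \<open>w\<close>
    vanishes somewhere on the circle, its oscillation bounds it there; otherwise \<open>w\<close>
    equals \<sigma> u - M on the whole circle and oscillates as much as \<open>u\<close>.\<close>
  have cls: "\<rho> i \<le> od w i \<or> (\<forall>z\<in>frontier (Q i). ennreal (w z) \<le> od w i)" for i
  proof (cases "\<exists>z0\<in>frontier (Q i). w z0 = 0")
    case True
    then obtain z0 where z0: "z0 \<in> frontier (Q i)" "w z0 = 0" by blast
    have "ennreal (w z) \<le> od w i" if "z \<in> frontier (Q i)" for z
      using od_ge[OF wbd that z0(1)] z0(2) w0[of z] by simp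
    then show ?thesis by blast
  next
    case False
    then have iV: "Q i \<inter> V \<noteq> {}" using F2 frontier_Q_nonempty[of i] by (metis all_not_in_conv w_def)
    have iJ: "i \<notin> J"
    proof
      assume "i \<in> J"
      then obtain z where z: "z \<in> frontier (Q i)" "\<sigma> * u z \<le> M" using A3 by blast
      then have "w z = 0" by (simp add: w_def)
      then show False using False z(1) by blast
    qed
    have eq: "w x = \<sigma> * u x - M" if "x \<in> frontier (Q i)" for x
      using F3[OF iJ iV that] False that by (metis max_def)
    obtain c where c: "0 \<le> c" "od w i = ennreal c"
      "\<And>x y. x \<in> frontier (Q i) \<Longrightarrow> y \<in> frontier (Q i) \<Longrightarrow> w x - w y \<le> c" by (rule od_cases[OF wbd[of i]]) blast
    have "od u i \<le> ennreal c"
    proof (rule od_le)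
      fix x y assume "x \<in> frontier (Q i)" "y \<in> frontier (Q i)"
      then show "u x - u y \<le> c"
        using c(3)[of x y] c(3)[of y x] \<sigma> by (auto simp: eq)
    qed
    then show ?thesis using c(2) iV by (simp add: \<rho>_def)
  qed
  \<comment> \<open>Only a path starting where \<open>w\<close> is positive, hence in
    \<open>V\<close>, matters for this one-sided bound. It is followed until it leaves
    \<open>V\<close> or reaches the disk of \<open>J\<close>; from there a nearby value of \<sigma>
    u that is at most \<open>M\<close> is compared with the value at the start.\<close>
  have BG1: "ennreal (w (g s) - w (g t)) \<le> (\<Sum>\<^sub>\<infinity>i\<in>meeting Q (g ` {s..t}). \<rho> i)"
    if g: "continuous_on {s..t} g" "g ` {s..t} \<subseteq> \<Omega>" and st: "s \<le> t" "g s \<in> S" "g t \<in> S"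
      and grad: "pgrad u (od u) g s t" for g s t
  proof (cases "w (g s) = 0")
    case True
    then have "w (g s) - w (g t) \<le> 0" using w0[of "g t"] by simp
    then show ?thesis by (simp add: ennreal_neg)
  next
    case False
    then have gsV: "g s \<in> V" and wgs: "w (g s) = \<sigma> * u (g s) - M" by (auto simp: w_def max_def split: if_splits)
    have wt: "ennreal (w (g s) - w (g t)) \<le> ennreal (w (g s))" using w0[of "g t"] by (intro ennreal_leI) simp
    have up: "ennreal \<bar>u (g s) - u (g r)\<bar> \<le> (\<Sum>\<^sub>\<infinity>i\<in>meeting Q (g ` {s..r}). \<rho> i)"
      if r: "r \<in> {s..t}" "g r \<in> S" "\<And>q. s \<le> q \<Longrightarrow> q < r \<Longrightarrow> g q \<in> V" for r
    proof -
      have "ennreal \<bar>u (g s) - u (g r)\<bar> \<le> (\<Sum>\<^sub>\<infinity>i\<in>meeting Q (g ` {s..r}). od u i)"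
        by (rule pgradD[OF grad]) (use r st in auto)
      also have "\<dots> = (\<Sum>\<^sub>\<infinity>i\<in>meeting Q (g ` {s..r}). \<rho> i)"
      proof (rule infsum_cong)
        fix i assume "i \<in> meeting Q (g ` {s..r})"
        then obtain q where q: "q \<in> {s..r}" "g q \<in> Q i" unfolding meeting_def by blast
        then have "q \<noteq> r" using r(2) S_not_Q by auto
        then have "g q \<in> V" using r(3) q(1) by auto
        then show "od u i = \<rho> i" using q(2) by (auto simp: \<rho>_def)
      qed
      finally show ?thesis .
    qed
    have sub: "(\<Sum>\<^sub>\<infinity>i\<in>meeting Q (g ` {s..r}). \<rho> i) \<le> (\<Sum>\<^sub>\<infinity>i\<in>meeting Q (g ` {s..t}). \<rho> i)" if "r \<in> {s..t}" for r
      using that by (intro infsum_ennreal_mono_set meeting_mono) auto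
    \<comment> \<open>Only a disk whose interior is met by this path can be charged with its
      oscillation; touching its circle alone does not stop the path.\<close>
    define Jm where "Jm = {j \<in> J. Q j \<inter> g ` {s..t} \<noteq> {}}"
    define C where "C = - V \<union> (\<Union>j\<in>Jm. closure (Q j))"
    have C: "closed C" unfolding C_def using V(1) finJ by (intro closed_Un closed_UN) (auto simp: Jm_def)
    show ?thesis
    proof (cases "\<exists>r\<in>{s..t}. g r \<in> C")
      case False
      then have inV: "g r \<in> V" if "r \<in> {s..t}" for r using that by (auto simp: C_def)
      have "w (g s) - w (g t) \<le> \<bar>u (g s) - u (g t)\<bar>"
        using inV[of t] st(1) wgs \<sigma>abs[of "u (g s)" "u (g t)"] by (auto simp: w_def)
      then have "ennreal (w (g s) - w (g t)) \<le> ennreal \<bar>u (g s) - u (g t)\<bar>" by (rule ennreal_leI)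
      also have "\<dots> \<le> (\<Sum>\<^sub>\<infinity>i\<in>meeting Q (g ` {s..t}). \<rho> i)" using inV st by (intro up) auto
      finally show ?thesis .
    next
      case True
      then obtain r0 where r0: "r0 \<in> {s..t}" "g r0 \<in> C" by blast
      obtain r where r: "r \<in> {s..r0}" "g r \<in> C" "\<And>q. s \<le> q \<Longrightarrow> q < r \<Longrightarrow> g q \<notin> C"
        using first_time[OF g(1) C r0] by blast
      have rt: "r \<in> {s..t}" using r(1) r0(1) by auto
      have before: "g q \<in> V - Q0" if "s \<le> q" "q < r" for q
      proof -
        have "g q \<notin> Q j" if "j \<in> J" for j
        proof
          assume gq: "g q \<in> Q j"
          then have "j \<in> Jm" using that \<open>s \<le> q\<close> \<open>q < r\<close> rt by (auto simp: Jm_def)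
          then have "g q \<in> C" using gq closure_subset[of "Q j"] by (auto simp: C_def)
          then show False using r(3) \<open>s \<le> q\<close> \<open>q < r\<close> by blast
        qed
        then show ?thesis using r(3)[OF that] by (auto simp: C_def Q0_def)
      qed
      show ?thesis
      proof (cases "\<exists>j\<in>Jm. g r \<in> closure (Q j)")
        case True
        then obtain j where j: "j \<in> Jm" "g r \<in> closure (Q j)" by blast
        obtain r' where r': "r' \<in> {s..r}" "g r' \<in> frontier (Q j)"
          using first_time_closure_Q[OF g(1) S_not_Q[OF st(2)] rt j(2)] by blast
        have "r' = r"
        proof (rule ccontr)
          assume "r' \<noteq> r"
          then have "g r' \<notin> C" using r(3)[of r'] r'(1) by auto
          then show False using r'(2) j(1) closure_Q by (auto simp: C_def)
        qed
        then have gr: "g r \<in> frontier (Q j)" "g r \<in> S" using r'(2) frontier_Q_subset_S by auto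
        \<comment> \<open>Up to time \<open>r\<close> the disk \<open>j\<close> is not met, so its
          term is still available and pays for the move on its circle from \<open>g r\<close> to the
          good point \<open>z\<close>.\<close>
        obtain z where z: "z \<in> frontier (Q j)" "\<sigma> * u z \<le> M" using A3 j(1) by (auto simp: Jm_def)
        have jn: "j \<notin> meeting Q (g ` {s..r})"
        proof
          assume "j \<in> meeting Q (g ` {s..r})"
          then obtain q where q: "q \<in> {s..r}" "g q \<in> Q j" unfolding meeting_def by blast
          then have "q \<noteq> r" using gr(2) S_not_Q by auto
          then have "g q \<notin> Q0" using before q(1) by auto
          then show False using q(2) j(1) by (auto simp: Q0_def Jm_def)
        qed
        have \<rho>j: "\<rho> j = od u j" using meetJ j(1) by (auto simp: \<rho>_def Jm_def)
        have "w (g s) \<le> \<bar>u (g s) - u (g r)\<bar> + \<bar>u (g r) - u z\<bar>"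
          using wgs z(2) \<sigma>abs[of "u (g s)" "u (g r)"] \<sigma>abs[of "u (g r)" "u z"] by linarith
        then have "ennreal (w (g s)) \<le> ennreal \<bar>u (g s) - u (g r)\<bar> + ennreal \<bar>u (g r) - u z\<bar>"
          using ennreal_leI ennreal_plus[OF abs_ge_zero abs_ge_zero] by metis
        also have "\<dots> \<le> (\<Sum>\<^sub>\<infinity>i\<in>meeting Q (g ` {s..r}). \<rho> i) + infsum \<rho> {j}"
          using up[OF rt gr(2)] before od_ge[OF ubd gr(1) z(1)] \<rho>j by (intro add_mono) auto
        also have "\<dots> \<le> (\<Sum>\<^sub>\<infinity>i\<in>meeting Q (g ` {s..t}). \<rho> i)"
          using jn j(1) rt by (intro infsum_ennreal_UN_disjoint_finite_le) (auto simp: Jm_def meeting_def)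
        finally show ?thesis using wt order_trans by blast
      next
        case False
        then have grV: "g r \<notin> V" using r(2) by (auto simp: C_def)
        then have "r \<noteq> s" using gsV by auto
        then have sr: "s < r" using r(1) by auto
        have "continuous_on {s..r} g" using g(1) rt by (auto intro: continuous_on_subset)
        then have "(g \<longlongrightarrow> g r) (at_left r)" using sr by (simp add: continuous_on_Icc_at_leftD)
        moreover have "eventually (\<lambda>q. g q \<in> closure (V - Q0)) (at_left r)"
          unfolding eventually_at_left_field using sr before
          by (intro exI[of _ s]) (simp add: closure_subset[THEN subsetD] less_imp_le)
        ultimately have "g r \<in> closure (V - Q0)"
          by (intro Lim_in_closed_set[OF closed_closure]) auto
        moreover have "g r \<notin> Q0"
        proof
          assume "g r \<in> Q0"
          then obtain j where j: "j \<in> J" "g r \<in> Q j" by (auto simp: Q0_def)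
          then have "j \<in> Jm" using rt by (auto simp: Jm_def)
          then show False using False j(2) closure_subset[of "Q j"] by blast
        qed
        ultimately have grA: "g r \<in> A" using front grV by (auto simp: Q0_def)
        \<comment> \<open>The path leaves \<open>V\<close> in \<open>A\<close>. If this happens
          inside a disk, the first time on its circle is used instead, where \<open>A2\<close> gives
          the bound.\<close>
        obtain r' where r': "r' \<in> {s..r}" "g r' \<in> S" "\<sigma> * u (g r') \<le> M"
        proof (cases "g r \<in> S")
          case True
          then show ?thesis using that[of r] A1 grA sr by auto
        next
          case False
          moreover have "g r \<in> \<Omega>" using g(2) rt by auto
          ultimately obtain i where i: "g r \<in> Q i" using not_S_iff by blast
          have "i \<in> meeting Q A - J" using i grA \<open>g r \<notin> Q0\<close> by (auto simp: meeting_def Q0_def)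
          moreover have "g r \<in> closure (Q i)" using i closure_subset[of "Q i"] by blast
          then obtain r' where "r' \<in> {s..r}" "g r' \<in> frontier (Q i)"
            using first_time_closure_Q[OF g(1) S_not_Q[OF st(2)] rt] by blast
          ultimately show ?thesis using that[of r'] A2[of i "g r'"] frontier_Q_subset_S[of i] by blast
        qed
        have r't: "r' \<in> {s..t}" using r'(1) rt by auto
        have "w (g s) \<le> \<bar>u (g s) - u (g r')\<bar>"
          using wgs r'(3) \<sigma>abs[of "u (g s)" "u (g r')"] by linarith
        then have "ennreal (w (g s)) \<le> ennreal \<bar>u (g s) - u (g r')\<bar>" by (rule ennreal_leI)
        also have "\<dots> \<le> (\<Sum>\<^sub>\<infinity>i\<in>meeting Q (g ` {s..r'}). \<rho> i)"
          using before r'(1) by (intro up[OF r't r'(2)]) auto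
        also note sub[OF r't]
        finally show ?thesis using wt order_trans by blast
      qed
    qed
  qed
  have BG: "pgrad w \<rho> g a b" if g: "continuous_on {a..b} g" "g ` {a..b} \<subseteq> \<Omega>" and grad: "pgrad u (od u) g a b" for g a b
    unfolding pgrad_def
  proof (intro allI impI)
    fix s t assume st: "a \<le> s \<and> s \<le> t \<and> t \<le> b \<and> g s \<in> S \<and> g t \<in> S"
    have c: "continuous_on {s..t} g" "g ` {s..t} \<subseteq> \<Omega>" using g st by (auto intro: continuous_on_subset)
    have gr: "pgrad u (od u) g s t" using pgrad_subset[OF grad] st by auto
    let ?h = "\<lambda>r. g (s + t - r)"
    have h: "continuous_on {s..t} ?h" by (rule continuous_on_compose2[OF c(1)]) (auto intro!: continuous_intros)
    have im: "?h ` {s..t} = g ` {s..t}" using image_reverse[of g "s + t" s t] by simp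
    have "ennreal (w (?h s) - w (?h t)) \<le> (\<Sum>\<^sub>\<infinity>i\<in>meeting Q (?h ` {s..t}). \<rho> i)"
      by (rule BG1[OF h _ _ _ _ pgrad_reverse[OF gr]]) (use st c im in auto)
    then show "ennreal \<bar>w (g s) - w (g t)\<bar> \<le> (\<Sum>\<^sub>\<infinity>i\<in>meeting Q (g ` {s..t}). \<rho> i)"
      using BG1[OF c _ _ _ gr] st by (simp add: abs_if im)
  qed
  have ssV: "sobolev_sums Q (\<lambda>x. ereal (u x)) (meeting Q V)" by (rule sobolev_sums_compact[OF usob V(2)])
  have odu2: "(\<Sum>\<^sub>\<infinity>i\<in>meeting Q V. (od u i)\<^sup>2) < \<infinity>" using ssV by (simp add: sobolev_sums_def od_def)
  have \<rho>2: "(\<Sum>i. (\<rho> i)\<^sup>2) < \<infinity>"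
  proof -
    have "(\<Sum>i. (\<rho> i)\<^sup>2) = (\<Sum>\<^sub>\<infinity>i. (\<rho> i)\<^sup>2)" by (simp add: infsum_ennreal_suminf)
    also have "\<dots> = (\<Sum>\<^sub>\<infinity>i\<in>meeting Q V. (od u i)\<^sup>2)"
      by (rule infsum_cong_neutral) (auto simp: \<rho>_def meeting_def)
    finally show ?thesis using odu2 by simp
  qed
  have "upper_gradient v \<Omega> Q (\<lambda>x. ereal (u x)) (\<lambda>i. osc (\<lambda>x. ereal (u x)) (Q i))"
    using usob by (simp add: sobolev_loc_def)
  then obtain \<Gamma>u where \<Gamma>u: "carpet_mod v \<Omega> Q \<Gamma>u = 0"
    "\<And>\<gamma> a b. \<gamma> \<in> paths_in \<Omega> \<Longrightarrow> \<gamma> \<notin> \<Gamma>u \<Longrightarrow> {a..b} \<subseteq> fst \<gamma> \<Longrightarrow> pgrad u (od u) (snd \<gamma>) a b"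
    by (rule upper_gradient_pgrad) (auto simp: od_def[abs_def])
  define \<Gamma>w where "\<Gamma>w = \<Gamma>u \<union> {\<gamma>. (\<Sum>\<^sub>\<infinity>i\<in>meeting Q (trace \<gamma>). \<rho> i) = \<infinity>}"
  have \<Gamma>w0: "carpet_mod v \<Omega> Q \<Gamma>w = 0" unfolding \<Gamma>w_def
    by (intro carpet_mod_Un_eq_0 \<Gamma>u(1) carpet_mod_infinite_sum_eq_0[OF \<rho>2]) auto
  have wgrad: "ennreal \<bar>w (snd \<gamma> a) - w (snd \<gamma> b)\<bar> \<le> (\<Sum>\<^sub>\<infinity>i\<in>meeting Q (snd \<gamma> ` {a..b}). od w i)"
    if \<gamma>: "\<gamma> \<in> paths_in \<Omega>" "\<gamma> \<notin> \<Gamma>w" "a \<le> b" "{a..b} \<subseteq> fst \<gamma>" "snd \<gamma> a \<in> S" "snd \<gamma> b \<in> S" for \<gamma> a b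
  proof (rule truncation_gradient)
    show c: "continuous_on {a..b} (snd \<gamma>)" by (rule subpath_interval(3)[OF \<gamma>(1,3,4)])
    show "pgrad w \<rho> (snd \<gamma>) a b"
      using \<gamma> by (intro BG c subpath_interval(4) \<Gamma>u(2)) (auto simp: \<Gamma>w_def)
    have "(\<Sum>\<^sub>\<infinity>i\<in>meeting Q (snd \<gamma> ` {a..b}). \<rho> i) \<le> (\<Sum>\<^sub>\<infinity>i\<in>meeting Q (trace \<gamma>). \<rho> i)"
      using \<gamma>(4) by (intro infsum_ennreal_mono_set meeting_mono) (auto simp: trace_def)
    also have "\<dots> < \<infinity>" using \<gamma>(2) by (auto simp: \<Gamma>w_def less_top)
    finally show "(\<Sum>\<^sub>\<infinity>i\<in>meeting Q (snd \<gamma> ` {a..b}). \<rho> i) < \<infinity>" .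
  qed (use \<gamma> w0 cls in auto)
  have odw_le: "od w i \<le> \<rho> i" for i
  proof (cases "Q i \<inter> V = {}")
    case True
    then have "w x = 0" if "x \<in> frontier (Q i)" for x using F2 that by (auto simp: w_def)
    then have "od w i \<le> ennreal 0" by (intro od_le) auto
    then show ?thesis by simp
  next
    case False
    obtain c where c: "0 \<le> c" "od u i = ennreal c"
      "\<And>x y. x \<in> frontier (Q i) \<Longrightarrow> y \<in> frontier (Q i) \<Longrightarrow> u x - u y \<le> c" by (rule od_cases[OF ubd[of i]]) blast
    have "od w i \<le> ennreal c"
    proof (rule od_le)
      fix x y assume xy: "x \<in> frontier (Q i)" "y \<in> frontier (Q i)"
      have abs: "\<sigma> * u x - \<sigma> * u y \<le> c" if "x \<in> frontier (Q i)" "y \<in> frontier (Q i)" for x y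
        using c(3)[OF that] c(3)[OF that(2,1)] \<sigma> by auto
      show "w x - w y \<le> c"
      proof (cases "i \<in> J")
        case True
        then obtain z where z: "z \<in> frontier (Q i)" "\<sigma> * u z \<le> M" using A3 by blast
        have "w x \<le> c" using abs[OF xy(1) z(1)] z(2) c(1) wle[of x] by auto
        then show ?thesis using w0[of y] by simp
      next
        case iJ: False
        show ?thesis using abs[OF xy] F3[OF iJ False xy(1)] F3[OF iJ False xy(2)] c(1) by auto
      qed
    qed
    then show ?thesis using c(2) False by (simp add: \<rho>_def)
  qed
  \<comment> \<open>The test function: \<sigma> (u + \<zeta>) = \<sigma> u - w, and \<zeta> vanishes
    off \<open>V\<close>.\<close>
  define \<zeta> where "\<zeta> x = - \<sigma> * w x" for x
  have \<zeta>abs: "\<bar>\<zeta> x - \<zeta> y\<bar> = \<bar>w x - w y\<bar>" "\<bar>\<zeta> x\<bar> = \<bar>w x\<bar>" for x y using \<sigma> by (auto simp: \<zeta>_def)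
  have \<zeta>bd: "bounded (\<zeta> ` frontier (Q i))" for i using wbd[of i] unfolding bounded_iff by (auto simp: \<zeta>abs)
  have od\<zeta>: "od \<zeta> i = od w i" for i
  proof (rule antisym)
    obtain c where c: "od w i = ennreal c"
      "\<And>x y. x \<in> frontier (Q i) \<Longrightarrow> y \<in> frontier (Q i) \<Longrightarrow> w x - w y \<le> c" by (rule od_cases[OF wbd[of i]]) blast
    have "od \<zeta> i \<le> ennreal c"
    proof (rule od_le)
      fix x y assume "x \<in> frontier (Q i)" "y \<in> frontier (Q i)"
      then show "\<zeta> x - \<zeta> y \<le> c" using c(2)[of x y] c(2)[of y x] \<zeta>abs(1)[of x y] by linarith
    qed
    then show "od \<zeta> i \<le> od w i" using c(1) by simp
    obtain c where c: "od \<zeta> i = ennreal c"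
      "\<And>x y. x \<in> frontier (Q i) \<Longrightarrow> y \<in> frontier (Q i) \<Longrightarrow> \<zeta> x - \<zeta> y \<le> c" by (rule od_cases[OF \<zeta>bd[of i]]) blast
    have "od w i \<le> ennreal c"
    proof (rule od_le)
      fix x y assume "x \<in> frontier (Q i)" "y \<in> frontier (Q i)"
      then show "w x - w y \<le> c" using c(2)[of x y] c(2)[of y x] \<zeta>abs(1)[of x y] by linarith
    qed
    then show "od w i \<le> od \<zeta> i" using c(1) by simp
  qed
  have \<zeta>sums: "sobolev_sums Q (\<lambda>x. ereal (\<zeta> x)) UNIV" unfolding sobolev_sums_def
  proof
    have "(\<Sum>\<^sub>\<infinity>i\<in>UNIV. (od \<zeta> i)\<^sup>2) \<le> (\<Sum>\<^sub>\<infinity>i\<in>UNIV. (\<rho> i)\<^sup>2)"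
      unfolding od\<zeta> by (intro infsum_ennreal_mono power_mono odw_le) auto
    also have "\<dots> < \<infinity>" using \<rho>2 by (simp add: infsum_ennreal_suminf)
    finally show "(\<Sum>\<^sub>\<infinity>i\<in>UNIV. (osc (\<lambda>x. ereal (\<zeta> x)) (Q i))\<^sup>2) < \<infinity>" by (simp add: od_def)
    have Vb: "bounded V" using V(2) compact_imp_bounded[of "closure V"] bounded_subset[OF _ closure_subset[of V]]
      by (simp add: compactly_contained_def)
    obtain D0 where D0: "\<And>i. i \<in> meeting Q V \<Longrightarrow> diameter (Q i) \<le> D0" using sum_diameter_squares(2)[OF Vb] by blast
    let ?m = "\<lambda>i. real_of_ereal (Mx (\<lambda>x. ereal (u x)) (Q i))"
    \<comment> \<open>Expands the square of the bound |m| + c + |M| for \<zeta>, where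
      \<open>m\<close> and \<open>c\<close> are the supremum and the oscillation of \<open>u\<close>
      on the circle. The three terms are summable by the two Sobolev sums of \<open>u\<close> over
      \<open>V\<close> and by the sum of squared diameters, with \<open>D0\<close> a common bound
      for the diameters.\<close>
    let ?B = "\<lambda>i. ennreal 3 * ennreal ((?m i)\<^sup>2 * (diameter (Q i))\<^sup>2) + (ennreal (3 * D0\<^sup>2) * (od u i)\<^sup>2
        + ennreal (3 * M\<^sup>2) * ennreal ((diameter (Q i))\<^sup>2))"
    have each: "ennreal ((real_of_ereal (Mx (\<lambda>x. ereal (\<zeta> x)) (Q i)))\<^sup>2 * (diameter (Q i))\<^sup>2) \<le> ?B i"
      if iV: "i \<in> meeting Q V" for i
    proof -
      obtain m c where m: "Mx (\<lambda>x. ereal (u x)) (Q i) = ereal m" "0 \<le> c" "od u i = ennreal c"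
        "\<And>x. x \<in> frontier (Q i) \<Longrightarrow> u x \<le> m \<and> m \<le> u x + c"
        by (rule od_cases[OF ubd[of i]]) blast
      obtain z cz where z: "Mx (\<lambda>x. ereal (\<zeta> x)) (Q i) = ereal z" "0 \<le> cz"
        "\<And>x. x \<in> frontier (Q i) \<Longrightarrow> \<zeta> x \<le> z \<and> z \<le> \<zeta> x + cz"
        "\<And>c'. (\<And>x y. x \<in> frontier (Q i) \<Longrightarrow> y \<in> frontier (Q i) \<Longrightarrow> \<zeta> x - \<zeta> y \<le> c') \<Longrightarrow> cz \<le> c'"
        by (rule od_cases[OF \<zeta>bd[of i]]) blast
      let ?b = "\<bar>m\<bar> + c + \<bar>M\<bar>"
      have bnd: "\<bar>\<zeta> x\<bar> \<le> ?b" if "x \<in> frontier (Q i)" for x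
        using m(4)[OF that] m(2) wle[of x] w0[of x] \<zeta>abs(2)[of x] \<sigma> by auto
      obtain x0 where x0: "x0 \<in> frontier (Q i)" using frontier_Q_nonempty by blast
      have zb: "\<bar>z\<bar> \<le> ?b"
      proof (rule abs_leI)
        have "Mx (\<lambda>x. ereal (\<zeta> x)) (Q i) \<le> ereal ?b" unfolding Mx_def
          using bnd by (intro SUP_least) (metis abs_le_iff ereal_less_eq(3))
        then show "z \<le> ?b" using z(1) by simp
        show "- z \<le> ?b" using bnd[OF x0] z(3)[OF x0] by linarith
      qed
      have "z\<^sup>2 \<le> ?b\<^sup>2" using zb by (metis abs_ge_zero power2_abs power_mono)
      also have "\<dots> \<le> 3 * m\<^sup>2 + 3 * c\<^sup>2 + 3 * M\<^sup>2"
      proof -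
        have "(a + b + d)\<^sup>2 \<le> 3 * a\<^sup>2 + 3 * b\<^sup>2 + 3 * d\<^sup>2" for a b d :: real
          using sum_squares_bound[of a b] sum_squares_bound[of a d] sum_squares_bound[of b d]
          by (simp add: power2_eq_square algebra_simps)
        from this[of "\<bar>m\<bar>" c "\<bar>M\<bar>"] show ?thesis by simp
      qed
      finally have "z\<^sup>2 * (diameter (Q i))\<^sup>2 \<le> (3 * m\<^sup>2 + 3 * c\<^sup>2 + 3 * M\<^sup>2) * (diameter (Q i))\<^sup>2"
        by (rule mult_right_mono) simp
      also have "\<dots> = 3 * (m\<^sup>2 * (diameter (Q i))\<^sup>2) + (3 * (diameter (Q i))\<^sup>2 * c\<^sup>2 + 3 * M\<^sup>2 * (diameter (Q i))\<^sup>2)"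
        by (simp add: algebra_simps)
      also have "\<dots> \<le> 3 * (m\<^sup>2 * (diameter (Q i))\<^sup>2) + (3 * D0\<^sup>2 * c\<^sup>2 + 3 * M\<^sup>2 * (diameter (Q i))\<^sup>2)"
        using D0[OF iV] diameter_Q_pos[of i]
        by (intro add_mono mult_right_mono mult_left_mono power_mono order_refl) auto
      finally have "ennreal (z\<^sup>2 * (diameter (Q i))\<^sup>2)
          \<le> ennreal (3 * (m\<^sup>2 * (diameter (Q i))\<^sup>2) + (3 * D0\<^sup>2 * c\<^sup>2 + 3 * M\<^sup>2 * (diameter (Q i))\<^sup>2))"
        by (rule ennreal_leI)
      also have "\<dots> = ennreal 3 * ennreal (m\<^sup>2 * (diameter (Q i))\<^sup>2) + (ennreal (3 * D0\<^sup>2) * ennreal (c\<^sup>2)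
          + ennreal (3 * M\<^sup>2) * ennreal ((diameter (Q i))\<^sup>2))"
        by (simp only: ennreal_plus ennreal_mult zero_le_mult_iff zero_le_power2 zero_le_numeral add_nonneg_nonneg mult_nonneg_nonneg simp_thms)
      also have "ennreal (c\<^sup>2) = (od u i)\<^sup>2" using m(2,3) by (simp add: ennreal_power)
      finally show ?thesis using m(1) z(1) by simp
    qed
    have "(\<Sum>\<^sub>\<infinity>i\<in>UNIV. ennreal ((real_of_ereal (Mx (\<lambda>x. ereal (\<zeta> x)) (Q i)))\<^sup>2 * (diameter (Q i))\<^sup>2))
        = (\<Sum>\<^sub>\<infinity>i\<in>meeting Q V. ennreal ((real_of_ereal (Mx (\<lambda>x. ereal (\<zeta> x)) (Q i)))\<^sup>2 * (diameter (Q i))\<^sup>2))"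
    proof (rule infsum_cong_neutral)
      fix i assume "i \<in> UNIV - meeting Q V"
      then have "Q i \<inter> V = {}" by (auto simp: meeting_def)
      then have "\<zeta> x = 0" if "x \<in> frontier (Q i)" for x using F2 that by (auto simp: \<zeta>_def w_def)
      then have "Mx (\<lambda>x. ereal (\<zeta> x)) (Q i) = (SUP x\<in>frontier (Q i). 0)" unfolding Mx_def by (intro SUP_cong) (auto simp: zero_ereal_def)
      also have "\<dots> = 0" using frontier_Q_nonempty by simp
      finally show "ennreal ((real_of_ereal (Mx (\<lambda>x. ereal (\<zeta> x)) (Q i)))\<^sup>2 * (diameter (Q i))\<^sup>2) = 0" by simp
    qed auto
    also have "\<dots> \<le> infsum ?B (meeting Q V)" by (rule infsum_ennreal_mono[OF each])
    also have "\<dots> < \<infinity>"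
      unfolding infsum_ennreal_add infsum_ennreal_cmult
      using ssV odu2 sum_diameter_squares(1)[OF Vb]
      by (simp add: sobolev_sums_def ennreal_mult_less_top)
    finally show "(\<Sum>\<^sub>\<infinity>i\<in>UNIV. ennreal ((real_of_ereal (Mx (\<lambda>x. ereal (\<zeta> x)) (Q i)))\<^sup>2 * (diameter (Q i))\<^sup>2)) < \<infinity>" .
  qed
  have \<zeta>sob: "(\<lambda>x. ereal (\<zeta> x)) \<in> sobolev v \<Omega> Q"
  proof -
    have "upper_gradient v \<Omega> Q (\<lambda>x. ereal (\<zeta> x)) (od \<zeta>)"
      by (rule pgrad_upper_gradient[OF \<Gamma>w0]) (simp add: \<zeta>abs od\<zeta> wgrad)
    moreover have "sobolev_sums Q (\<lambda>x. ereal (\<zeta> x)) I" for I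
      using \<zeta>sums infsum_ennreal_mono_set[of I UNIV] unfolding sobolev_sums_def by (meson subset_UNIV le_less_trans)
    ultimately show ?thesis using Mx_Mn_finite[OF \<zeta>bd]
      by (simp add: sobolev_def sobolev_loc_def od_def[abs_def])
  qed
  define f where "f x = u x + \<zeta> x" for x
  have "dirichlet_energy Q V (\<lambda>x. ereal (u x)) \<le> dirichlet_energy Q V (\<lambda>x. ereal (u x) + ereal (\<zeta> x))"
  proof -
    have z: "\<forall>x\<in>S - V. ereal (\<zeta> x) = 0" by (simp add: \<zeta>_def w_def)
    show ?thesis
      using harm[unfolded carpet_harmonic_def, THEN conjunct2, rule_format, of V "\<lambda>x. ereal (\<zeta> x)"] V \<zeta>sob z by blast
  qed
  then have energy: "(\<Sum>\<^sub>\<infinity>i\<in>meeting Q V. (od u i)\<^sup>2) \<le> (\<Sum>\<^sub>\<infinity>i\<in>meeting Q V. (od f i)\<^sup>2)"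
    by (simp add: dirichlet_energy_def od_def f_def)
  have \<sigma>f: "\<sigma> * f x = \<sigma> * u x - w x" for x using \<sigma> by (auto simp: f_def \<zeta>_def)
  have \<sigma>f': "f x - f y \<le> c" if "\<bar>\<sigma> * f x - \<sigma> * f y\<bar> \<le> c" for x y c using that \<sigma>abs[of "f x" "f y"] by linarith
  have odf: "od f i \<le> od u i" if iV: "i \<in> meeting Q V" for i
  proof -
    obtain c where c: "0 \<le> c" "od u i = ennreal c"
      "\<And>x y. x \<in> frontier (Q i) \<Longrightarrow> y \<in> frontier (Q i) \<Longrightarrow> u x - u y \<le> c" by (rule od_cases[OF ubd[of i]]) blast
    have abs: "\<sigma> * u x - \<sigma> * u y \<le> c" if "x \<in> frontier (Q i)" "y \<in> frontier (Q i)" for x y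
      using c(3)[OF that] c(3)[OF that(2,1)] \<sigma> by auto
    have one: "\<sigma> * f x - \<sigma> * f y \<le> c" if xy: "x \<in> frontier (Q i)" "y \<in> frontier (Q i)" for x y
    proof (cases "w y = 0")
      case True
      then show ?thesis using abs[OF xy] w0[of x] by (simp add: \<sigma>f)
    next
      case False
      then have yM: "\<sigma> * u y - w y = M" "\<sigma> * u y > M" by (auto simp: w_def max_def split: if_splits)
      show ?thesis
      proof (cases "i \<in> J")
        case True
        then obtain z where z: "z \<in> frontier (Q i)" "\<sigma> * u z \<le> M" using A3 by blast
        show ?thesis using abs[OF xy(1) z(1)] z(2) yM w0[of x] by (simp add: \<sigma>f)
      next
        case iJ: False
        have "\<sigma> * u x - w x \<le> M" using F3[OF iJ _ xy(1)] iV by (auto simp: meeting_def)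
        then show ?thesis using yM c(1) by (simp add: \<sigma>f)
      qed
    qed
    have "od f i \<le> ennreal c" by (rule od_le) (use one \<sigma>f' in \<open>auto simp: abs_le_iff\<close>)
    then show ?thesis using c(2) by simp
  qed
  \<comment> \<open>Minimality of \<open>u\<close> together with \<open>odf\<close> forces
    \<open>f\<close> and \<open>u\<close> to have equal oscillation on each disk meeting
    \<open>V\<close>. If \<open>w\<close> varied on such a circle, cutting off at \<open>M\<close>
    would have reduced the oscillation by at least that variation.\<close>
  have odw0: "od w i = 0" if "i \<notin> J" for i
  proof (cases "Q i \<inter> V = {}")
    case True
    then show ?thesis using odw_le[of i] by (simp add: \<rho>_def)
  next
    case False
    then have iV: "i \<in> meeting Q V" by (simp add: meeting_def)
    have "(od u i)\<^sup>2 \<le> (od f i)\<^sup>2"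
      by (rule infsum_ennreal_eq_imp_eq[OF energy _ odu2 iV]) (auto intro: power_mono odf)
    then have uf: "od u i \<le> od f i" by (simp add: ennreal_power2_le_iff)
    obtain c where c: "0 \<le> c" "od u i = ennreal c"
      "\<And>x y. x \<in> frontier (Q i) \<Longrightarrow> y \<in> frontier (Q i) \<Longrightarrow> u x - u y \<le> c" by (rule od_cases[OF ubd[of i]]) blast
    have abs: "\<sigma> * u x - \<sigma> * u y \<le> c" if "x \<in> frontier (Q i)" "y \<in> frontier (Q i)" for x y
      using c(3)[OF that] c(3)[OF that(2,1)] \<sigma> by auto
    have wc: "w x \<le> w y" if xy: "x \<in> frontier (Q i)" "y \<in> frontier (Q i)" for x y
    proof (rule ccontr)
      assume con: "\<not> w x \<le> w y"
      define \<delta> where "\<delta> = w x - w y"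
      have \<delta>: "\<delta> > 0" using con by (simp add: \<delta>_def)
      have wx: "w x = \<sigma> * u x - M" using F3[OF \<open>i \<notin> J\<close> False xy(1)] con w0[of y] by (simp add: max_def split: if_splits)
      have cd: "\<delta> \<le> c" using abs[OF xy] F3[OF \<open>i \<notin> J\<close> False xy(1)] F3[OF \<open>i \<notin> J\<close> False xy(2)] c(1) by (auto simp: \<delta>_def)
      have one: "\<sigma> * f p - \<sigma> * f q \<le> c - \<delta>" if pq: "p \<in> frontier (Q i)" "q \<in> frontier (Q i)" for p q
      proof -
        have fp: "\<sigma> * f p = min (\<sigma> * u p) M" "\<sigma> * f q = min (\<sigma> * u q) M"
          using F3[OF \<open>i \<notin> J\<close> False pq(1)] F3[OF \<open>i \<notin> J\<close> False pq(2)] by (auto simp: \<sigma>f)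
        have "\<sigma> * u x - \<sigma> * u q \<le> c" by (rule abs[OF xy(1) pq(2)])
        then show ?thesis using cd w0[of y] wx unfolding fp \<delta>_def by auto
      qed
      have "od f i \<le> ennreal (c - \<delta>)" by (rule od_le) (use one \<sigma>f' in \<open>auto simp: abs_le_iff\<close>)
      then have "ennreal c \<le> ennreal (c - \<delta>)" using uf c(2) by simp
      then show False using \<delta> cd by (simp add: ennreal_le_iff2)
    qed
    have "od w i \<le> ennreal 0" by (rule od_le) (use wc in auto)
    then show ?thesis by simp
  qed
  have wconst: "w x = w y" if "i \<notin> J" "x \<in> frontier (Q i)" "y \<in> frontier (Q i)" for i x y
    using od_ge[OF wbd that(2,3)] odw0[OF that(1)] by simp
  \<comment> \<open>A generic segment in the ball joins the two disks and meets only disks not in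
    \<open>J\<close>, on which \<open>w\<close> does not oscillate.\<close>
  have line: "w x = w y" if ball: "ball q r \<subseteq> \<Omega> - D" and ik: "Q i \<inter> ball q r \<noteq> {}" "Q k \<inter> ball q r \<noteq> {}"
    and xy: "x \<in> frontier (Q i)" "y \<in> frontier (Q k)" for q r i k x y
  proof (cases "i = k")
    case True
    have "i \<notin> J" using ball ik(1) QJD[of i] by blast
    then show ?thesis using wconst[of i x y] xy True by simp
  next
    case False
    have iJ: "l \<notin> J" if "Q l \<inter> ball q r \<noteq> {}" for l
      using ball that QJD[of l] by blast
    obtain z z' where z: "z \<in> Q i" "z \<in> ball q r" "z' \<in> Q k" "z' \<in> ball q r" using ik by blast
    have zz: "z \<noteq> z'" using z Q_disjoint[OF False] by blast
    obtain e L s0 where e: "cmod e = 1" and L: "L > 0" and s0: "s0 > 0"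
      and seg: "\<And>s. s \<in> {-s0..s0} \<Longrightarrow> pline z e s 0 \<in> Q i \<and> pline z e s L \<in> Q k \<and> pline z e s ` {0..L} \<subseteq> ball q r"
      using parallel_segments[OF open_Q open_Q z(1,3,2,4) zz] by blast
    have "AE s in lborel. s \<in> {-s0..s0} \<longrightarrow> ({0..L}, pline z e s) \<notin> \<Gamma>w"
      by (rule carpet_mod_AE_pline[OF \<Gamma>w0 e L])
    from AE_E_interval[OF this, of "-s0" s0]
    obtain s where s: "s \<in> {-s0..s0}" "({0..L}, pline z e s) \<notin> \<Gamma>w"
      using s0 by auto
    let ?g = "pline z e s"
    have gc: "continuous_on {0..L} ?g" by (rule continuous_pline)
    have sb: "?g ` {0..L} \<subseteq> ball q r" using seg[OF s(1)] by blast
    have gp: "({0..L}, ?g) \<in> paths_in \<Omega>"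
      using sb ball L gc by (auto simp: paths_in_def is_path_def trace_def is_interval_cc)
    have "?g L \<notin> Q i" using seg[OF s(1)] Q_disjoint[OF False] by blast
    then obtain t1 where t1: "t1 \<in> {0..L}" "?g t1 \<in> frontier (Q i)"
      using first_exit_Q[OF gc, of i L] seg[OF s(1)] L by auto
    have n1: "?g t1 \<notin> Q k" using t1(2) frontier_Q_subset_S[of i] S_not_Q by auto
    have n2: "?g L \<in> closure (Q k)" using seg[OF s(1)] closure_subset[of "Q k"] by blast
    have L': "L \<in> {t1..L}" using t1(1) by auto
    obtain t2 where t2: "t2 \<in> {t1..L}" "?g t2 \<in> frontier (Q k)"
      using first_time_closure_Q[OF continuous_pline n1 L' n2] by blast
    have "ennreal \<bar>w (?g t1) - w (?g t2)\<bar> \<le> (\<Sum>\<^sub>\<infinity>l\<in>meeting Q (?g ` {t1..t2}). od w l)"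
      using wgrad[OF gp s(2), of t1 t2] t1 t2 frontier_Q_subset_S by auto
    also have "\<dots> = 0"
    proof -
      have "od w l = 0" if "l \<in> meeting Q (?g ` {t1..t2})" for l
      proof -
        have "?g ` {t1..t2} \<subseteq> ball q r" using sb t1(1) t2(1) by (force simp: image_subset_iff)
        then show ?thesis using that by (intro odw0 iJ) (auto simp: meeting_def)
      qed
      then show ?thesis by (simp cong: infsum_cong)
    qed
    finally have "w (?g t1) = w (?g t2)" by simp
    then show ?thesis using wconst[OF iJ[OF ik(1)] xy(1) t1(2)] wconst[OF iJ[OF ik(2)] xy(2) t2(2)] by simp
  qed
  \<comment> \<open>Near each point of \<Omega> - D, \<open>w\<close> takes one value on all circles
    of the disks met. Hence \<open>P\<close> and \<open>N\<close> are open, cover \<Omega> - D and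
    are disjoint there.\<close>
  define P where "P = {q. \<exists>r>0. ball q r \<subseteq> \<Omega> - D \<and> (\<forall>i. Q i \<inter> ball q r \<noteq> {} \<longrightarrow> (\<forall>x\<in>frontier (Q i). w x = 0))}"
  define N where "N = {q. \<exists>r>0. ball q r \<subseteq> \<Omega> - D \<and> (\<forall>i. Q i \<inter> ball q r \<noteq> {} \<longrightarrow> (\<forall>x\<in>frontier (Q i). w x \<noteq> 0))}"
  have oOD: "open (\<Omega> - D)" using open_\<Omega> closedD by auto
  have opn: "open {q. \<exists>r>0. ball q r \<subseteq> \<Omega> - D \<and> (\<forall>i. Q i \<inter> ball q r \<noteq> {} \<longrightarrow> R i)}" for R
    unfolding open_contains_ball
  proof clarify
    fix q r assume q: "r > 0" "ball q r \<subseteq> \<Omega> - D" "\<forall>i. Q i \<inter> ball q r \<noteq> {} \<longrightarrow> R i"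
    have "ball q' (r/2) \<subseteq> ball q r" if "q' \<in> ball q (r/2)" for q'
    proof
      fix y assume "y \<in> ball q' (r/2)"
      then show "y \<in> ball q r" using that dist_triangle_half_r[of q' q r y] by (auto simp: dist_commute)
    qed
    then show "\<exists>e>0. ball q e \<subseteq> {q. \<exists>r>0. ball q r \<subseteq> \<Omega> - D \<and> (\<forall>i. Q i \<inter> ball q r \<noteq> {} \<longrightarrow> R i)}"
      using q by (intro exI[of _ "r/2"]) (fastforce intro!: exI[of _ "r/2"])
  qed
  have PN: "\<Omega> - D \<subseteq> P \<union> N"
  proof
    fix q assume "q \<in> \<Omega> - D"
    then obtain r where r: "r > 0" "ball q r \<subseteq> \<Omega> - D" using oOD open_contains_ball by blast
    obtain k where k: "Q k \<inter> ball q r \<noteq> {}" using exists_Q_meeting[of "ball q r" q] r by auto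
    obtain y where y: "y \<in> frontier (Q k)" using frontier_Q_nonempty by blast
    show "q \<in> P \<union> N"
    proof (cases "w y = 0")
      case True
      then have "w x = 0" if "Q i \<inter> ball q r \<noteq> {}" "x \<in> frontier (Q i)" for i x
        using line[OF r(2) that(1) k that(2) y] by simp
      then have "q \<in> P" unfolding P_def mem_Collect_eq using r by (intro exI[of _ r] conjI allI impI ballI)
      then show ?thesis by simp
    next
      case False
      then have "w x \<noteq> 0" if "Q i \<inter> ball q r \<noteq> {}" "x \<in> frontier (Q i)" for i x
        using line[OF r(2) that(1) k that(2) y] by simp
      then have "q \<in> N" unfolding N_def mem_Collect_eq using r by (intro exI[of _ r] conjI allI impI ballI)
      then show ?thesis by simp
    qed
  qed
  have PN0: "P \<inter> N \<inter> (\<Omega> - D) = {}"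
  proof (rule ccontr)
    assume "P \<inter> N \<inter> (\<Omega> - D) \<noteq> {}"
    then obtain q where "q \<in> P" "q \<in> N" by blast
    then obtain r r' where r: "r > 0" "\<And>i. Q i \<inter> ball q r \<noteq> {} \<Longrightarrow> (\<forall>x\<in>frontier (Q i). w x = 0)" "ball q r \<subseteq> \<Omega> - D"
      "r' > 0" "\<And>i. Q i \<inter> ball q r' \<noteq> {} \<Longrightarrow> (\<forall>x\<in>frontier (Q i). w x \<noteq> 0)"
      unfolding P_def N_def by blast
    have "min r r' > 0" "ball q (min r r') \<subseteq> \<Omega>" using r by auto
    then obtain i where "Q i \<inter> ball q (min r r') \<noteq> {}" using exists_Q_meeting[of "ball q (min r r')" q] by auto
    then have "Q i \<inter> ball q r \<noteq> {}" "Q i \<inter> ball q r' \<noteq> {}" by auto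
    then show False using r(2,5) frontier_Q_nonempty[of i] by blast
  qed
  have "q1 \<in> P"
  proof -
    have "q1 \<in> (\<Omega> - D) - closure V" using q1 by (simp add: D_def)
    moreover have "open ((\<Omega> - D) - closure V)" using oOD by auto
    ultimately obtain r where r: "r > 0" "ball q1 r \<subseteq> (\<Omega> - D) - closure V" using open_contains_ball by blast
    have "w x = 0" if "Q i \<inter> ball q1 r \<noteq> {}" "x \<in> frontier (Q i)" for i x
    proof -
      have iJ: "i \<notin> J" using r(2) that(1) QJD[of i] by blast
      have nV: "\<not> Q i \<subseteq> V" using r(2) that(1) closure_subset[of V] by blast
      show ?thesis
      proof (cases "Q i \<inter> V = {}")
        case True then show ?thesis using F2 that(2) by (auto simp: w_def)
      next
        case False
        then have "i \<in> meeting Q A - J" using F0[OF iJ] nV iJ by (auto simp: meeting_def)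
        then show ?thesis using A2 that(2) by (auto simp: w_def)
      qed
    qed
    moreover have "ball q1 r \<subseteq> \<Omega> - D" using r(2) by blast
    ultimately show ?thesis unfolding P_def mem_Collect_eq using r(1) by (intro exI[of _ r] conjI allI impI ballI)
  qed
  moreover have "q1 \<in> \<Omega> - D" using q1 by (simp add: D_def)
  moreover have "connected (\<Omega> - D)" unfolding D_def by (rule connected_minus_closures[OF J])
  ultimately have NE: "N \<inter> (\<Omega> - D) = {}"
    using connectedD[of "\<Omega> - D" P N] opn[of "\<lambda>i. \<forall>x\<in>frontier (Q i). w x = 0"] opn[of "\<lambda>i. \<forall>x\<in>frontier (Q i). w x \<noteq> 0"] PN PN0
    unfolding P_def[symmetric] N_def[symmetric] by blast
  obtain q where q: "q \<in> Q i" using Q_nonempty by blast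
  have "q \<in> \<Omega> - D" using q QiD[OF i(1)] Q_subset[of i] closure_subset[of "Q i"] by blast
  then have "q \<in> P" using NE PN by blast
  then obtain r where r: "r > 0" "\<And>i. Q i \<inter> ball q r \<noteq> {} \<Longrightarrow> \<forall>x\<in>frontier (Q i). w x = 0" unfolding P_def by blast
  have "q \<in> ball q r" using r(1) by simp
  then have "Q i \<inter> ball q r \<noteq> {}" using q by blast
  then have "w x = 0" using r(2)[of i] x by blast
  then show ?thesis using F3[OF i x] by (auto simp: max_def split: if_splits)
qed

end


section \<open>Squares, crosscuts and separation\<close>

lemma supdist_le_eq_cbox: "{w. supdist x w \<le> R} = cbox (x - Complex R R) (x + Complex R R)"
  by (auto simp: supdist_def in_cbox_complex_iff abs_le_iff)

lemma convex_supdist_le: "convex {w. supdist x w \<le> R}"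
  unfolding supdist_le_eq_cbox by (rule convex_box)

lemma connected_supdist_gr: "connected {w. R < supdist x w}"
proof -
  have "connected (- {w. supdist x w \<le> R})"
    by (rule connected_complement_bounded_convex) (auto simp: bounded_supdist_le convex_supdist_le)
  moreover have "- {w. supdist x w \<le> R} = {w. R < supdist x w}" by auto
  ultimately show ?thesis by simp
qed

lemma connected_meets_supdist_sphere:
  assumes "connected T" "q \<in> T" "p \<in> T" "supdist x q \<le> \<rho>" "\<rho> \<le> supdist x p"
  shows "\<exists>w\<in>T. supdist x w = \<rho>"
proof -
  have "connected (supdist x ` T)"
    by (intro connected_continuous_image continuous_supdist assms(1))
  then have "\<rho> \<in> supdist x ` T"
    unfolding connected_iff_interval using assms(2-5) by blast
  then show ?thesis by auto
qed

lemma connected_componentI':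
  "connected T \<Longrightarrow> T \<subseteq> A \<Longrightarrow> q \<in> T \<Longrightarrow> p \<in> T \<Longrightarrow> connected_component A q p"
  unfolding connected_component_def by blast

text \<open>In the next lemma \<open>D\<close> is the closed disk, \<open>F\<close> is the closed curve formed by a crosscut and the arc of \<open>\<partial>D\<close>
  between its end points: it does not separate a point from infinity if both can be joined to the far part of \<open>D\<close>.\<close>

lemma connected_component_through_disk:
  assumes "connected Q0" "Q0 \<inter> F = {}" "F \<subseteq> {w. supdist x0 w \<le> R}" "ball z \<eta> \<inter> F = {}"
    and "z \<in> closure Q0" "z0 \<in> Q0" "R < supdist x0 z0" "R < supdist x0 p" "q \<in> ball z \<eta>"
  shows "connected_component (- F) q p"
proof (rule connected_componentI')
  have "ball z \<eta> \<inter> Q0 \<noteq> {}"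
  proof -
    have "\<eta> > 0" using assms(9) by (metis mem_ball zero_le_dist le_less_trans)
    then have "z \<in> ball z \<eta> \<inter> closure Q0" using assms(5) by simp
    then show ?thesis using open_Int_closure_eq_empty[OF open_ball] by blast
  qed
  then have "connected (ball z \<eta> \<union> Q0)" by (intro connected_Un assms) auto
  then show "connected ((ball z \<eta> \<union> Q0) \<union> {w. R < supdist x0 w})"
    by (rule connected_Un[OF _ connected_supdist_gr]) (use assms(6,7) in auto)
  show "(ball z \<eta> \<union> Q0) \<union> {w. R < supdist x0 w} \<subseteq> - F" using assms(2,3,4) by auto
qed (use assms in auto)

lemma nonseparating_Un:
  fixes q p :: complex
  assumes "compact A" "closed B" "A \<inter> B = C" "connected C"
    "connected_component (- A) q p" "connected_component (- B) q p"
  shows "connected_component (- (A \<union> B)) q p"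
  by (rule Janiszewski) (use assms in auto)

text \<open>The curve leaves \<open>D\<close> during disjoint open parameter intervals. If none of
  the corresponding arcs together with \<open>D\<close> separated \<open>q\<close> from
  \<open>p\<close>, a path from \<open>q\<close> to \<open>p\<close> off \<open>D\<close> would, by
  compactness, meet only finitely many of them. Janiszewski's theorem adds these one by one, and a
  last application adds the rest of the curve, which that path avoids.\<close>

lemma crosscut_separation:
  fixes \<beta> :: "real \<Rightarrow> complex"
  assumes D: "compact D" "connected D" "connected (- D)"
    and \<beta>: "simple_path \<beta>" "pathfinish \<beta> = pathstart \<beta>" "pathstart \<beta> \<in> D"
    and sep: "\<not> connected_component (- (D \<union> path_image \<beta>)) q p"
    and qp: "q \<notin> D" "p \<notin> D"
  obtains s t where "0 \<le> s" "s < t" "t \<le> 1" "\<beta> s \<in> D" "\<beta> t \<in> D" "\<And>r. s < r \<Longrightarrow> r < t \<Longrightarrow> \<beta> r \<notin> D"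
    "\<not> connected_component (- (D \<union> \<beta> ` {s<..<t})) q p"
proof -
  have cont: "continuous_on {0..1} \<beta>" using \<beta>(1) by (simp add: simple_path_def path_def)
  have b01: "\<beta> 0 \<in> D" "\<beta> 1 \<in> D" using \<beta>(2,3) by (auto simp: pathstart_def pathfinish_def)
  have inj: "r = r'" if "r \<in> {0<..<1}" "r' \<in> {0..1}" "\<beta> r = \<beta> r'" for r r'
    using \<beta>(1) that unfolding simple_path_def loop_free_def by fastforce
  have closedD: "closed D" using D(1) by (rule compact_imp_closed)
  define Op where "Op = {r \<in> {0<..<1}. \<beta> r \<notin> D}"
  have "continuous_on {0<..<1} \<beta>" using cont by (rule continuous_on_subset) auto
  then have "open ({0<..<1} \<inter> \<beta> -` (- D))"
    using closedD by (intro continuous_open_preimage) auto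
  moreover have "{0<..<1} \<inter> \<beta> -` (- D) = Op" by (auto simp: Op_def)
  ultimately have oO: "open Op" by simp
  \<comment> \<open>A component of the open set \<open>Op\<close> is an interval whose end points
    are not in \<open>Op\<close> by maximality, so they are mapped into \<open>D\<close>; at 0 and 1
    the value is the base point, which lies in \<open>D\<close>.\<close>
  have comp: "\<exists>s t. I = {s<..<t} \<and> 0 \<le> s \<and> s < t \<and> t \<le> 1 \<and> \<beta> s \<in> D \<and> \<beta> t \<in> D" if I: "I \<in> components Op" for I
  proof -
    have Io: "open I" and Ic: "connected I" and Ine: "I \<noteq> {}" and IO: "I \<subseteq> Op"
      by (rule open_components[OF oO I] in_components_connected[OF I] in_components_nonempty[OF I] in_components_subset[OF I])+
    have I01: "I \<subseteq> {0<..<1}" using IO by (auto simp: Op_def)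
    define s t where "s = Inf I" and "t = Sup I"
    have I01': "0 \<le> r" "r \<le> 1" if "r \<in> I" for r using subsetD[OF I01 that] by auto
    have bdd: "bdd_below I" "bdd_above I"
      by (rule bdd_belowI[of _ 0], erule I01', rule bdd_aboveI[of _ 1], erule I01')
    have st: "0 \<le> s" "t \<le> 1" unfolding s_def t_def
      by (rule cInf_greatest[OF Ine], erule I01', rule cSup_least[OF Ine], erule I01')
    have sl: "s < r" "r < t" if rI: "r \<in> I" for r
    proof -
      obtain e where e: "e > 0" "ball r e \<subseteq> I" using Io rI unfolding open_contains_ball by blast
      have "r - e/2 \<in> ball r e" "r + e/2 \<in> ball r e" using e(1) by (auto simp: dist_real_def)
      then have re: "r - e/2 \<in> I" "r + e/2 \<in> I" using e(2) by blast+
      have "s \<le> r - e/2" "r + e/2 \<le> t"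
        unfolding s_def t_def by (rule cInf_lower[OF re(1) bdd(1)], rule cSup_upper[OF re(2) bdd(2)])
      then show "s < r" "r < t" using e(1) by auto
    qed
    have eq: "I = {s<..<t}"
    proof
      show "I \<subseteq> {s<..<t}" using sl by auto
      show "{s<..<t} \<subseteq> I"
      proof
        fix r assume r: "r \<in> {s<..<t}"
        obtain a where a: "a \<in> I" "a < r" using cInf_lessD[of I r] Ine r by (auto simp: s_def)
        obtain b where b: "b \<in> I" "r < b" using less_cSupD[of I r] Ine r by (auto simp: t_def)
        show "r \<in> I" using Ic a b unfolding connected_iff_interval by (meson less_imp_le)
      qed
    qed
    have lt: "s < t" using Ine eq by auto
    have out: "x \<notin> Op" if "x = s \<or> x = t" for x
    proof
      assume xO: "x \<in> Op"
      have "connected (insert x I)"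
      proof (rule connected_intermediate_closure[OF Ic])
        show "insert x I \<subseteq> closure I" using that lt by (auto simp: eq closure_greaterThanLessThan)
      qed auto
      moreover have "insert x I \<subseteq> Op" using xO IO by auto
      ultimately have "insert x I \<subseteq> I"
        using components_maximal[OF I] Ine by auto
      then show False using that by (auto simp: eq)
    qed
    have "\<beta> s \<in> D"
    proof (cases "s = 0")
      case False
      then show ?thesis using out[of s] st lt by (auto simp: Op_def)
    qed (use b01 in simp)
    moreover have "\<beta> t \<in> D"
    proof (cases "t = 1")
      case False
      then show ?thesis using out[of t] st lt by (auto simp: Op_def)
    qed (use b01 in simp)
    ultimately show ?thesis using eq st lt by blast
  qed
  have closed_arc: "closed (D \<union> \<beta> ` I)" if I: "I \<in> components Op" for I
  proof -
    obtain s t where st: "I = {s<..<t}" "0 \<le> s" "s < t" "t \<le> 1" "\<beta> s \<in> D" "\<beta> t \<in> D" using comp[OF I] by blast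
    have "compact (\<beta> ` {s..t})" using st by (intro compact_continuous_image continuous_on_subset[OF cont]) auto
    then have "closed (D \<union> \<beta> ` {s..t})" using closedD compact_imp_closed by blast
    moreover have "D \<union> \<beta> ` {s..t} = D \<union> \<beta> ` I"
    proof -
      have "{s..t} = insert s (insert t I)" using st by auto
      then show ?thesis using st by auto
    qed
    ultimately show ?thesis by simp
  qed
  have disjD: "\<beta> ` X \<inter> D = {}" if "X \<subseteq> Op" for X using that by (auto simp: Op_def)
  have disj: "\<beta> ` X \<inter> \<beta> ` Y = {}" if XY: "X \<subseteq> Op" "Y \<subseteq> Op" "X \<inter> Y = {}" for X Y
  proof -
    have "\<beta> r \<noteq> \<beta> r'" if rr: "r \<in> X" "r' \<in> Y" for r r'
    proof
      assume eq: "\<beta> r = \<beta> r'"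
      have "r \<in> Op" "r' \<in> Op" using rr XY by blast+
      then have "r = r'" using inj[OF _ _ eq] by (auto simp: Op_def)
      then show False using rr XY(3) by blast
    qed
    then show ?thesis by blast
  qed
  have "\<exists>I\<in>components Op. \<not> connected_component (- (D \<union> \<beta> ` I)) q p"
  proof (rule ccontr)
    assume "\<not> ?thesis"
    then have each: "connected_component (- (D \<union> \<beta> ` I)) q p" if "I \<in> components Op" for I using that by blast
    have pc: "connected_component (- D) q p" using D(3) qp by (intro connected_componentI'[of "- D"]) auto
    then have "path_component (- D) q p"
      using closedD by (simp add: open_Compl open_path_connected_component)
    then obtain P where P: "path P" "path_image P \<subseteq> - D" "pathstart P = q" "pathfinish P = p"
      by (auto simp: path_component_def)
    \<comment> \<open>The times at which the curve meets the connecting path form a compact subset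
      of \<open>Op\<close>, so finitely many components cover them.\<close>
    define K where "K = {0..1} \<inter> \<beta> -` path_image P"
    have "closed K" unfolding K_def
      by (rule continuous_closed_preimage[OF cont]) (auto simp: closed_path_image P(1))
    moreover have "bounded K" by (rule bounded_subset[OF bounded_closed_interval[of 0 1]]) (auto simp: K_def)
    ultimately have cK: "compact K" by (simp add: compact_eq_bounded_closed)
    have KO: "K \<subseteq> \<Union>(components Op)"
    proof
      fix r assume r: "r \<in> K"
      then have "\<beta> r \<notin> D" using P(2) by (auto simp: K_def)
      moreover have "r \<noteq> 0" "r \<noteq> 1" using \<open>\<beta> r \<notin> D\<close> b01 by auto
      ultimately have "r \<in> Op" using r by (auto simp: K_def Op_def)
      then show "r \<in> \<Union>(components Op)" by (metis Union_components)
    qed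
    obtain \<C> where \<C>: "\<C> \<subseteq> components Op" "finite \<C>" "K \<subseteq> \<Union>\<C>"
      by (rule compactE[OF cK KO open_components[OF oO]])
    have CO: "\<Union>\<C> \<subseteq> Op" using \<C>(1) by (meson Sup_least in_components_subset subsetD)
    have fin: "connected_component (- (D \<union> \<beta> ` (\<Union>\<C>'))) q p \<and> compact (D \<union> \<beta> ` (\<Union>\<C>'))"
      if "finite \<C>'" "\<C>' \<subseteq> components Op" for \<C>'
      using that
    proof (induction \<C>')
      case empty then show ?case using pc D(1) by simp
    next
      case (insert I \<C>')
      have IO: "I \<in> components Op" using insert by auto
      have sub: "\<Union>\<C>' \<subseteq> Op" "I \<subseteq> Op" using insert.prems by (meson Sup_least in_components_subset subsetD insert_subset)+
      have "L \<inter> I = {}" if L: "L \<in> \<C>'" for L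
      proof -
        have "L \<in> components Op" "L \<noteq> I" using L insert.prems insert.hyps(2) by auto
        then show ?thesis using components_nonoverlap[OF _ IO] by blast
      qed
      then have "\<Union>\<C>' \<inter> I = {}" by blast
      \<comment> \<open>Arcs over different components are disjoint because the curve is simple, so
        the two sets intersect exactly in the connected set \<open>D\<close>.\<close>
      from disj[OF sub this] have eqD: "(D \<union> \<beta> ` (\<Union>\<C>')) \<inter> (D \<union> \<beta> ` I) = D" by blast
      have IH: "connected_component (- (D \<union> \<beta> ` (\<Union>\<C>'))) q p" "compact (D \<union> \<beta> ` (\<Union>\<C>'))"
        using insert by auto
      have "connected_component (- ((D \<union> \<beta> ` (\<Union>\<C>')) \<union> (D \<union> \<beta> ` I))) q p"
        by (rule nonseparating_Un[OF IH(2) closed_arc[OF IO] eqD D(2) IH(1) each[OF IO]])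
      moreover have "(D \<union> \<beta> ` (\<Union>\<C>')) \<union> (D \<union> \<beta> ` I) = D \<union> \<beta> ` (\<Union>(insert I \<C>'))" by auto
      moreover have "compact ((D \<union> \<beta> ` (\<Union>\<C>')) \<union> (D \<union> \<beta> ` I))"
      proof -
        obtain s t where st: "I = {s<..<t}" "0 \<le> s" "s < t" "t \<le> 1" using comp[OF IO] by blast
        have "bounded (\<beta> ` {0..1})" using compact_continuous_image[OF cont] compact_imp_bounded by blast
        moreover have "\<beta> ` I \<subseteq> \<beta> ` {0..1}" using st by (intro image_mono) auto
        ultimately have "bounded (D \<union> \<beta> ` I)" using D(1) compact_imp_bounded bounded_subset by (metis bounded_Un)
        then have "compact (D \<union> \<beta> ` I)" using closed_arc[OF IO] compact_eq_bounded_closed by blast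
        then show ?thesis by (rule compact_Un[OF IH(2)])
      qed
      ultimately show ?case by simp
    qed
    let ?K1 = "D \<union> \<beta> ` (\<Union>\<C>)" and ?K2 = "D \<union> \<beta> ` ({0..1} - \<Union>\<C>)"
    have 1: "connected_component (- ?K1) q p" "compact ?K1" using fin[OF \<C>(2,1)] by auto
    have oC: "open (\<Union>\<C>)" using \<C>(1) oO open_components by blast
    have "compact ({0..1} - \<Union>\<C>)" using oC by (intro compact_diff) auto
    then have "compact (\<beta> ` ({0..1} - \<Union>\<C>))" by (intro compact_continuous_image continuous_on_subset[OF cont]) auto
    then have 2: "closed ?K2" using closedD compact_imp_closed by blast
    have 3: "connected_component (- ?K2) q p"
    proof (rule connected_componentI')
      show "connected (path_image P)" by (rule connected_path_image[OF P(1)])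
      show "path_image P \<subseteq> - ?K2" using P(2) \<C>(3) by (auto simp: K_def)
      show "q \<in> path_image P" "p \<in> path_image P" using P(3,4) by auto
    qed
    have 4: "?K1 \<inter> ?K2 = D"
    proof -
      have "\<beta> r \<noteq> \<beta> r'" if "r \<in> \<Union>\<C>" "r' \<in> {0..1} - \<Union>\<C>" for r r'
        using inj[of r r'] CO that by (auto simp: Op_def)
      then show ?thesis using disjD[OF CO] by blast
    qed
    have "connected_component (- (?K1 \<union> ?K2)) q p" by (rule nonseparating_Un[OF 1(2) 2 4 D(2) 1(1) 3])
    moreover have "?K1 \<union> ?K2 = D \<union> path_image \<beta>" using CO by (auto simp: path_image_def Op_def)
    ultimately show False using sep by simp
  qed
  then obtain I where I: "I \<in> components Op" "\<not> connected_component (- (D \<union> \<beta> ` I)) q p" by blast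
  obtain s t where st: "I = {s<..<t}" "0 \<le> s" "s < t" "t \<le> 1" "\<beta> s \<in> D" "\<beta> t \<in> D" using comp[OF I(1)] by blast
  have "\<beta> r \<notin> D" if "s < r" "r < t" for r
    using in_components_subset[OF I(1)] st(1) that by (auto simp: Op_def)
  then show ?thesis using that[of s t] st I(2) by simp
qed


text \<open>The Jordan curve \<open>c\<close> passes through \<open>x0\<close> at parameter 1/2. A
  crosscut with end points on both sides of 1/2 along \<open>c\<close>, together with the arc of
  \<open>c\<close> not through \<open>x0\<close>, bounds a region around \<open>x0\<close>, which is
  taken for \<open>V\<close>. The number \<delta> depends only on the lower bound \<rho>0, neither
  on the half-side nor on the loop, which later makes it independent of the harmonic function.
  Points of \<open>V\<close> in \<open>Q0\<close> may lie far from \<open>x0\<close>; only the rest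
  is confined to the square.\<close>

lemma crosscut_region:
  fixes c :: "real \<Rightarrow> complex"
  assumes c: "simple_path c" "pathfinish c = pathstart c" "c (1/2) = x0"
    and Q0: "Q0 = inside (path_image c)"
    and far: "z0 \<in> closure Q0" "R < supdist x0 z0" and R: "0 < R"
  obtains r1 where "0 < r1" "r1 < R"
    "\<And>\<rho>0. 0 < \<rho>0 \<Longrightarrow> \<rho>0 \<le> r1 \<Longrightarrow> \<exists>\<delta>>0. \<forall>\<rho> \<beta>. \<rho>0 \<le> \<rho> \<longrightarrow> \<rho> \<le> r1 \<longrightarrow> simple_path \<beta> \<longrightarrow> pathfinish \<beta> = pathstart \<beta> \<longrightarrow>
        path_image \<beta> = {w. supdist x0 w = \<rho>} \<longrightarrow> pathstart \<beta> \<in> Q0 \<longrightarrow>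
        (\<exists>s t V. 0 \<le> s \<and> s < t \<and> t \<le> 1 \<and> \<beta> ` {s..t} \<inter> Q0 = {} \<and> \<beta> s \<in> frontier Q0 \<and> open V \<and> ball x0 \<delta> \<subseteq> V \<and>
           V \<subseteq> {w. supdist x0 w \<le> R} \<union> closure Q0 \<and> closure (V - Q0) - V \<subseteq> \<beta> ` {s..t})"
proof -
  define C where "C = path_image c"
  define D where "D = closure Q0"
  have JI: "Q0 \<noteq> {}" "open Q0" "connected Q0" "open (outside C)" "connected (outside C)" "bounded Q0"
    "\<not> bounded (outside C)" "Q0 \<inter> outside C = {}" "Q0 \<union> outside C = - C" "frontier Q0 = C" "frontier (outside C) = C"
    using Jordan_inside_outside[OF c(1,2)] unfolding Q0 C_def by auto
  have D_eq: "D = Q0 \<union> C" unfolding D_def using JI(10) closure_Un_frontier by metis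
  have E_eq: "- D = outside C"
  proof -
    have "outside C = (Q0 \<union> outside C) - Q0" using JI(8) by blast
    also have "\<dots> = - D" unfolding JI(9) D_eq by blast
    finally show ?thesis by simp
  qed
  have QC: "Q0 \<inter> C = {}" using JI(9) by blast
  have compD: "compact D" unfolding D_def using JI(6) by simp
  have connD: "connected D" unfolding D_def by (rule connected_imp_connected_closure[OF JI(3)])
  have compC: "compact C" unfolding C_def using c(1) by (simp add: compact_simple_path_image)
  have cont: "continuous_on {0..1} c" using c(1) by (simp add: simple_path_def path_def)
  have inj: "r = r'" if "r \<in> {0<..<1}" "r' \<in> {0..1}" "c r = c r'" for r r'
    using c(1) that unfolding simple_path_def loop_free_def by fastforce
  have c01: "c 0 = c 1" using c(2) by (simp add: pathstart_def pathfinish_def)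
  have nbhd: "\<exists>\<kappa>. 0 < \<kappa> \<and> \<kappa> < 1/2 \<and> (\<forall>t. \<bar>t - 1/2\<bar> \<le> \<kappa> \<longrightarrow> supdist x0 (c t) < r)" if "0 < r" for r
  proof -
    have "continuous_on {0<..<1} (\<lambda>t. supdist x0 (c t))"
      by (intro continuous_on_compose2[OF continuous_supdist[of UNIV]] continuous_on_subset[OF cont]) auto
    then have "open ({0<..<1} \<inter> (\<lambda>t. supdist x0 (c t)) -` {..<r})"
      by (intro continuous_open_preimage) auto
    moreover have "1/2 \<in> {0<..<1} \<inter> (\<lambda>t. supdist x0 (c t)) -` {..<r}" using c(3) that by simp
    ultimately obtain e where e: "e > 0" "cball (1/2) e \<subseteq> {0<..<1::real} \<inter> (\<lambda>t. supdist x0 (c t)) -` {..<r}"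
      using open_contains_cball by blast
    define \<kappa> where "\<kappa> = min e (1/4)"
    have "supdist x0 (c t) < r" if "\<bar>t - 1/2\<bar> \<le> \<kappa>" for t
    proof -
      have "t \<in> cball (1/2) e" using that by (auto simp: \<kappa>_def dist_real_def)
      then show ?thesis using e(2) by auto
    qed
    then show ?thesis using e(1) by (intro exI[of _ \<kappa>]) (auto simp: \<kappa>_def)
  qed
  have away: "\<exists>m>0. \<forall>t\<in>{0..1}. \<kappa> \<le> \<bar>t - 1/2\<bar> \<longrightarrow> m < supdist x0 (c t)" if \<kappa>: "0 < \<kappa>" for \<kappa>
  proof -
    let ?T = "{0..1} \<inter> {t. \<kappa> \<le> \<bar>t - 1/2\<bar>}"
    have "closed {t::real. \<kappa> \<le> \<bar>t - 1/2\<bar>}" by (intro closed_Collect_le continuous_intros)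
    then have cT: "compact ?T" by (intro compact_Int_closed) auto
    have pos: "0 < supdist x0 (c t)" if "t \<in> ?T" for t
    proof -
      have "c t \<noteq> x0" using inj[of "1/2" t] that \<kappa> c(3) by auto
      then show ?thesis using supdist_eq_0[of x0 "c t"] supdist_nonneg[of x0 "c t"] by linarith
    qed
    show ?thesis
    proof (cases "?T = {}")
      case True then show ?thesis by (intro exI[of _ 1]) auto
    next
      case False
      have "continuous_on ?T (\<lambda>t. supdist x0 (c t))"
        by (intro continuous_on_compose2[OF continuous_supdist[of UNIV]] continuous_on_subset[OF cont]) auto
      then obtain t0 where t0: "t0 \<in> ?T" "\<And>t. t \<in> ?T \<Longrightarrow> supdist x0 (c t0) \<le> supdist x0 (c t)"
        using continuous_attains_inf[OF cT False] by blast
      have "supdist x0 (c t0) / 2 < supdist x0 (c t)" if "t \<in> ?T" for t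
        using pos[OF t0(1)] t0(2)[OF that] by linarith
      then show ?thesis using pos[OF t0(1)] by (intro exI[of _ "supdist x0 (c t0) / 2"]) auto
    qed
  qed
  obtain \<kappa> where \<kappa>: "0 < \<kappa>" "\<kappa> < 1/2" "\<And>t. \<bar>t - 1/2\<bar> \<le> \<kappa> \<Longrightarrow> supdist x0 (c t) < R" using nbhd[OF R] by blast
  obtain m where m: "m > 0" "\<And>t. t \<in> {0..1} \<Longrightarrow> \<kappa> \<le> \<bar>t - 1/2\<bar> \<Longrightarrow> m < supdist x0 (c t)" using away[OF \<kappa>(1)] by blast
  \<comment> \<open>Points of \<open>c\<close> at sup-distance at most \<open>m\<close> have
    parameter within \<kappa> of 1/2, so the arc of \<open>c\<close> between two such points, over
    the parameters between theirs, stays in the square of half-side \<open>R\<close>.\<close>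
  define r1 where "r1 = min m (R / 2)"
  have r1: "0 < r1" "r1 < R" "r1 \<le> m" using m(1) R by (auto simp: r1_def)
  obtain z1 where z1: "z1 \<in> Q0" "R < supdist x0 z1"
  proof -
    have "open {w. R < supdist x0 w}" by (intro open_Collect_less continuous_intros)
    moreover have "z0 \<in> {w. R < supdist x0 w}" using far(2) by simp
    ultimately have "{w. R < supdist x0 w} \<inter> Q0 \<noteq> {}"
      using far(1) open_Int_closure_eq_empty by blast
    then show ?thesis using that by blast
  qed
  obtain p where p: "p \<in> - D" "R < supdist x0 p"
  proof -
    have "\<not> outside C \<subseteq> {w. supdist x0 w \<le> R}" using JI(7) bounded_supdist_le bounded_subset by blast
    then obtain p where "p \<in> outside C" "p \<notin> {w. supdist x0 w \<le> R}" by blast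
    then show ?thesis using that[of p] E_eq by simp
  qed
  have x0C: "x0 \<in> C" unfolding C_def path_image_def using c(3) by (auto intro!: image_eqI[of _ _ "1/2"])
  have main: "\<exists>\<delta>>0. \<forall>\<rho> \<beta>. \<rho>0 \<le> \<rho> \<longrightarrow> \<rho> \<le> r1 \<longrightarrow> simple_path \<beta> \<longrightarrow> pathfinish \<beta> = pathstart \<beta> \<longrightarrow>
        path_image \<beta> = {w. supdist x0 w = \<rho>} \<longrightarrow> pathstart \<beta> \<in> Q0 \<longrightarrow>
        (\<exists>s t V. 0 \<le> s \<and> s < t \<and> t \<le> 1 \<and> \<beta> ` {s..t} \<inter> Q0 = {} \<and> \<beta> s \<in> frontier Q0 \<and> open V \<and> ball x0 \<delta> \<subseteq> V \<and>
           V \<subseteq> {w. supdist x0 w \<le> R} \<union> closure Q0 \<and> closure (V - Q0) - V \<subseteq> \<beta> ` {s..t})"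
    if \<rho>0: "0 < \<rho>0" "\<rho>0 \<le> r1" for \<rho>0
  proof -
    obtain \<kappa>' where \<kappa>': "0 < \<kappa>'" "\<kappa>' < 1/2" "\<And>t. \<bar>t - 1/2\<bar> \<le> \<kappa>' \<Longrightarrow> supdist x0 (c t) < \<rho>0" using nbhd[OF \<rho>0(1)] by blast
    obtain m' where m': "m' > 0" "\<And>t. t \<in> {0..1} \<Longrightarrow> \<kappa>' \<le> \<bar>t - 1/2\<bar> \<Longrightarrow> m' < supdist x0 (c t)" using away[OF \<kappa>'(1)] by blast
    \<comment> \<open>Points of \<open>c\<close> at sup-distance at least \<rho>0, such as the ends
      of a crosscut, have parameter farther than \<kappa>' from 1/2. The ball of radius \<delta>
      misses all points of \<open>c\<close> with such parameters.\<close>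
    define \<delta> where "\<delta> = min m' \<rho>0"
    have \<delta>: "\<delta> > 0" using m'(1) \<rho>0 by (simp add: \<delta>_def)
    have bsup: "supdist x0 w < \<delta>" if "w \<in> ball x0 \<delta>" for w
      using supdist_le_dist[of x0 w] that by simp
    have bc: "c t \<notin> ball x0 \<delta>" if "t \<in> {0..1}" "\<kappa>' \<le> \<bar>t - 1/2\<bar>" for t
      using bsup[of "c t"] m'(2)[OF that] by (auto simp: \<delta>_def)
    have X: "\<exists>s t V. 0 \<le> s \<and> s < t \<and> t \<le> 1 \<and> \<beta> ` {s..t} \<inter> Q0 = {} \<and> \<beta> s \<in> frontier Q0 \<and> open V \<and> ball x0 \<delta> \<subseteq> V \<and>
           V \<subseteq> {w. supdist x0 w \<le> R} \<union> closure Q0 \<and> closure (V - Q0) - V \<subseteq> \<beta> ` {s..t}"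
      if \<rho>: "\<rho>0 \<le> \<rho>" "\<rho> \<le> r1" and \<beta>: "simple_path \<beta>" "pathfinish \<beta> = pathstart \<beta>"
        "path_image \<beta> = {w. supdist x0 w = \<rho>}" "pathstart \<beta> \<in> Q0" for \<rho> \<beta>
    proof -
      have \<beta>\<rho>: "supdist x0 (\<beta> t) = \<rho>" if "t \<in> {0..1}" for t
        using \<beta>(3) that unfolding path_image_def by blast
      have contb: "continuous_on {0..1} \<beta>" using \<beta>(1) by (simp add: simple_path_def path_def)
      have "ball x0 \<delta> \<inter> outside C \<noteq> {}"
      proof -
        have "x0 \<in> closure (outside C)" using x0C JI(11) by (auto simp: frontier_def)
        moreover have "x0 \<in> ball x0 \<delta>" using \<delta> by simp
        ultimately show ?thesis using open_Int_closure_eq_empty[OF open_ball] by blast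
      qed
      then obtain q where q: "q \<in> ball x0 \<delta>" "q \<in> - D" using E_eq by blast
      \<comment> \<open>\<open>q\<close> lies inside the square and \<open>p\<close> outside, so the
        square alone separates them.\<close>
      have sep: "\<not> connected_component (- (D \<union> path_image \<beta>)) q p"
      proof
        assume "connected_component (- (D \<union> path_image \<beta>)) q p"
        then obtain T where T: "connected T" "T \<subseteq> - (D \<union> path_image \<beta>)" "q \<in> T" "p \<in> T"
          unfolding connected_component_def by blast
        have "supdist x0 q \<le> \<rho>" using bsup[OF q(1)] \<rho> by (simp add: \<delta>_def)
        moreover have "\<rho> \<le> supdist x0 p" using p(2) \<rho> r1 by linarith
        ultimately obtain w where "w \<in> T" "supdist x0 w = \<rho>" using connected_meets_supdist_sphere[OF T(1,3,4)] by blast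
        then show False using T(2) \<beta>(3) by blast
      qed
      have conn_mD: "connected (- D)" using JI(5) E_eq by simp
      have bD: "pathstart \<beta> \<in> D" using \<beta>(4) D_eq by blast
      obtain s t where st: "0 \<le> s" "s < t" "t \<le> 1" "\<beta> s \<in> D" "\<beta> t \<in> D" "\<And>r. s < r \<Longrightarrow> r < t \<Longrightarrow> \<beta> r \<notin> D"
        "\<not> connected_component (- (D \<union> \<beta> ` {s<..<t})) q p"
        using crosscut_separation[OF compD connD conn_mD \<beta>(1,2) bD sep] p(1) q(2) by auto
      define \<alpha> where "\<alpha> = \<beta> ` {s..t}"
      have contst: "continuous_on {s..t} \<beta>" using st by (intro continuous_on_subset[OF contb]) auto
      have compa: "compact \<alpha>" unfolding \<alpha>_def by (rule compact_continuous_image[OF contst]) auto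
      have tend: "\<beta> x \<notin> Q0" if xst: "x = s \<or> x = t" for x
      proof
        assume "\<beta> x \<in> Q0"
        then have "x \<in> {s..t} \<inter> \<beta> -` Q0" using xst st by auto
        moreover have "openin (top_of_set {s..t}) ({s..t} \<inter> \<beta> -` Q0)"
          using contst JI(2) continuous_openin_preimage_gen by blast
        ultimately obtain e where e: "e > 0" "ball x e \<inter> {s..t} \<subseteq> {s..t} \<inter> \<beta> -` Q0"
          by (meson openin_contains_ball)
        define d where "d = min (e/2) ((t - s)/2)"
        have d: "d > 0" "d < e" "d < t - s" using e(1) st(2) by (auto simp: d_def min_def)
        define r where "r = (if x = s then s + d else t - d)"
        have r: "s < r" "r < t" "r \<in> ball x e \<inter> {s..t}"
          using xst d by (auto simp: r_def dist_real_def)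
        then have "\<beta> r \<in> Q0" using e(2) by blast
        then show False using st(6)[OF r(1,2)] D_eq by blast
      qed
      have aQ: "\<alpha> \<inter> Q0 = {}"
      proof -
        have "\<beta> r \<notin> Q0" if "r \<in> {s..t}" for r
          using tend[of r] st(6)[of r] that D_eq by (cases "r = s \<or> r = t") auto
        then show ?thesis by (auto simp: \<alpha>_def)
      qed
      have aD: "\<alpha> \<inter> D = {\<beta> s, \<beta> t}"
      proof -
        have "r = s \<or> r = t" if "r \<in> {s..t}" "\<beta> r \<in> D" for r using st(6)[of r] that by force
        then have "\<alpha> \<inter> D \<subseteq> {\<beta> s, \<beta> t}" unfolding \<alpha>_def by blast
        moreover have "{\<beta> s, \<beta> t} \<subseteq> \<alpha> \<inter> D" using st(2,4,5) by (auto simp: \<alpha>_def)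
        ultimately show ?thesis by blast
      qed
      have D\<alpha>: "D \<union> \<beta> ` {s<..<t} = D \<union> \<alpha>"
      proof -
        have "{s..t} = insert s (insert t {s<..<t})" using st by auto
        then show ?thesis using st by (auto simp: \<alpha>_def)
      qed
      have sepa: "\<not> connected_component (- (D \<union> \<alpha>)) q p" using st(7) D\<alpha> by simp
      have aR: "\<alpha> \<subseteq> {w. supdist x0 w \<le> R}" using \<beta>\<rho> st \<rho> r1 by (auto simp: \<alpha>_def)
      have ab: "\<alpha> \<inter> ball x0 \<delta> = {}"
      proof -
        have "\<beta> r \<notin> ball x0 \<delta>" if "r \<in> {s..t}" for r
          using bsup[of "\<beta> r"] \<beta>\<rho>[of r] that st \<rho> by (auto simp: \<delta>_def)
        then show ?thesis by (auto simp: \<alpha>_def)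
      qed
      have bC: "\<beta> s \<in> C" "\<beta> t \<in> C" using tend st(4,5) D_eq by auto
      have par: "\<kappa>' < \<bar>\<tau> - 1/2\<bar> \<and> \<bar>\<tau> - 1/2\<bar> < \<kappa>" if "\<tau> \<in> {0..1}" "supdist x0 (c \<tau>) = \<rho>" for \<tau>
        using m(2)[OF that(1)] \<kappa>'(3)[of \<tau>] that(2) \<rho> r1 \<rho>0 by force
      obtain \<tau> \<tau>' where \<tau>: "\<tau> \<in> {0..1}" "\<beta> s = c \<tau>" "\<tau>' \<in> {0..1}" "\<beta> t = c \<tau>'"
        using bC unfolding C_def path_image_def by blast
      have \<tau>par: "\<kappa>' < \<bar>\<tau> - 1/2\<bar>" "\<bar>\<tau> - 1/2\<bar> < \<kappa>" "\<kappa>' < \<bar>\<tau>' - 1/2\<bar>" "\<bar>\<tau>' - 1/2\<bar> < \<kappa>"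
        using par[OF \<tau>(1)] par[OF \<tau>(3)] \<tau>(2,4) \<beta>\<rho>[of s] \<beta>\<rho>[of t] st by auto
      define \<tau>1 \<tau>2 where "\<tau>1 = min \<tau> \<tau>'" and "\<tau>2 = max \<tau> \<tau>'"
      have \<tau>12: "{c \<tau>1, c \<tau>2} = {\<beta> s, \<beta> t}" "\<tau>1 \<le> \<tau>2" "\<tau>1 \<in> {0..1}" "\<tau>2 \<in> {0..1}"
        using \<tau> by (auto simp: \<tau>1_def \<tau>2_def min_def max_def)
      have \<tau>12par: "\<kappa>' < \<bar>\<tau>1 - 1/2\<bar>" "\<bar>\<tau>1 - 1/2\<bar> < \<kappa>" "\<kappa>' < \<bar>\<tau>2 - 1/2\<bar>" "\<bar>\<tau>2 - 1/2\<bar> < \<kappa>"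
        using \<tau>par by (auto simp: \<tau>1_def \<tau>2_def min_def max_def)
      \<comment> \<open>The arc of \<open>c\<close> joining the ends of the crosscut through
        parameters within \<kappa> of 1/2, hence inside the square of half-side \<open>R\<close>;
        \<open>opp\<close> shows that it passes through \<open>x0\<close>.\<close>
      define J where "J = c ` {\<tau>1..\<tau>2}"
      have JC: "J \<subseteq> C" unfolding J_def C_def path_image_def using \<tau>12 by (intro image_mono) auto
      have compJ: "compact J" "connected J" unfolding J_def using \<tau>12
        by (auto intro!: compact_continuous_image connected_continuous_image continuous_on_subset[OF cont])
      have JR: "J \<subseteq> {w. supdist x0 w \<le> R}"
      proof -
        have "supdist x0 (c r) < R" if "r \<in> {\<tau>1..\<tau>2}" for r
          using that \<tau>12par by (intro \<kappa>(3)) (auto simp: abs_le_iff abs_if split: if_splits)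
        then show ?thesis by (force simp: J_def)
      qed
      have aC: "\<alpha> \<inter> C \<subseteq> {c \<tau>1, c \<tau>2}" using aD D_eq \<tau>12(1) by blast
      have DF: "D \<inter> (\<alpha> \<union> J) = J"
      proof -
        have "c \<tau>1 \<in> J" "c \<tau>2 \<in> J" using \<tau>12 by (auto simp: J_def)
        moreover have "\<alpha> \<inter> D \<subseteq> {c \<tau>1, c \<tau>2}" using aD \<tau>12(1) by simp
        moreover have "J \<subseteq> D" using JC D_eq by blast
        ultimately show ?thesis by blast
      qed
      have CF: "C \<inter> (\<alpha> \<union> J) = J"
      proof -
        have "c \<tau>1 \<in> J" "c \<tau>2 \<in> J" using \<tau>12 by (auto simp: J_def)
        then show ?thesis using aC JC by blast
      qed
      have Fc: "compact (\<alpha> \<union> J)" using compa compJ by (intro compact_Un)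
      have FR: "\<alpha> \<union> J \<subseteq> {w. supdist x0 w \<le> R}" using aR JR by blast
      have QF: "Q0 \<inter> (\<alpha> \<union> J) = {}" using aQ JC QC by blast
      \<comment> \<open>Otherwise the curve formed by the crosscut and \<open>J\<close> stays off
        the ball about \<open>x0\<close>, and \<open>q\<close> is joined to \<open>p\<close> through
        this ball, \<open>Q0\<close> and the exterior of the square of half-side \<open>R\<close>.
        By Janiszewski's theorem the crosscut together with \<open>D\<close> would then not separate
        them.\<close>
      have opp: "\<tau>1 < 1/2 \<and> 1/2 < \<tau>2"
      proof (rule ccontr)
        assume con: "\<not> ?thesis"
        have out: "\<kappa>' \<le> \<bar>r - 1/2\<bar>" if "r \<in> {\<tau>1..\<tau>2}" for r
          using con that \<tau>12par(1,3) \<tau>12(2) by (auto simp: abs_if split: if_splits)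
        have "ball x0 \<delta> \<inter> J = {}"
        proof -
          have "c r \<notin> ball x0 \<delta>" if "r \<in> {\<tau>1..\<tau>2}" for r
            using bc[OF _ out[OF that]] that \<tau>12(3,4) by auto
          then show ?thesis by (auto simp: J_def)
        qed
        then have "ball x0 \<delta> \<inter> (\<alpha> \<union> J) = {}" using ab by blast
        moreover have "x0 \<in> closure Q0" using x0C D_eq D_def by blast
        ultimately have "connected_component (- (\<alpha> \<union> J)) q p"
          using connected_component_through_disk[OF JI(3) QF FR _ _ z1 p(2) q(1)] by blast
        moreover have "connected_component (- D) q p"
          using conn_mD p(1) q(2) by (intro connected_componentI'[of "- D"]) auto
        ultimately have "connected_component (- (D \<union> (\<alpha> \<union> J))) q p"
          by (intro nonseparating_Un[OF compD compact_imp_closed[OF Fc] DF compJ(2)])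
        moreover have "D \<union> (\<alpha> \<union> J) = D \<union> \<alpha>" using JC D_eq by blast
        ultimately show False using sepa by simp
      qed
      define J' where "J' = c ` ({0..\<tau>1} \<union> {\<tau>2..1})"
      have J'C: "J' \<subseteq> C" unfolding J'_def C_def path_image_def using \<tau>12 by (intro image_mono) auto
      have compJ': "compact J'" unfolding J'_def using \<tau>12
        by (intro compact_continuous_image continuous_on_subset[OF cont] compact_Un) auto
      have connJ': "connected J'"
      proof -
        have "connected (c ` {0..\<tau>1})" "connected (c ` {\<tau>2..1})"
          using \<tau>12 by (auto intro!: connected_continuous_image continuous_on_subset[OF cont])
        moreover have "c 0 \<in> c ` {0..\<tau>1}" "c 1 \<in> c ` {\<tau>2..1}" using \<tau>12(3,4) by (auto intro!: imageI)
        then have "c ` {0..\<tau>1} \<inter> c ` {\<tau>2..1} \<noteq> {}" using c01 by auto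
        ultimately show ?thesis unfolding J'_def image_Un by (intro connected_Un) auto
      qed
      have CJ: "C = J \<union> J'"
      proof -
        have "{0..1} = {\<tau>1..\<tau>2} \<union> ({0..\<tau>1} \<union> {\<tau>2..1})" using \<tau>12 by auto
        then show ?thesis unfolding C_def path_image_def J_def J'_def by (metis image_Un)
      qed
      have endsJ': "c \<tau>1 \<in> J'" "c \<tau>2 \<in> J'" using \<tau>12 by (auto simp: J'_def)
      have endsa: "c \<tau>1 \<in> \<alpha>" "c \<tau>2 \<in> \<alpha>" using \<tau>12(1) aD by blast+
      have JJ': "J \<inter> J' \<subseteq> \<alpha>"
      proof
        fix w assume "w \<in> J \<inter> J'"
        then obtain r r' where r: "r \<in> {\<tau>1..\<tau>2}" "w = c r" "r' \<in> {0..\<tau>1} \<union> {\<tau>2..1}" "w = c r'"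
          by (auto simp: J_def J'_def)
        have "r = r'" using inj[of r r'] r \<tau>12par \<kappa> \<tau>12 by (auto simp: abs_if split: if_splits)
        then have "r = \<tau>1 \<or> r = \<tau>2" using r by auto
        then show "w \<in> \<alpha>" using r(2) endsa by blast
      qed
      have CaJ': "C \<inter> (\<alpha> \<union> J') = J'" using aC endsJ' J'C by blast
      have caJ': "compact (\<alpha> \<union> J')" using compa compJ' by (intro compact_Un)
      have bJ': "ball x0 \<delta> \<inter> (\<alpha> \<union> J') = {}"
      proof -
        have "c r \<notin> ball x0 \<delta>" if "r \<in> {0..\<tau>1} \<union> {\<tau>2..1}" for r
        proof (rule bc)
          show "r \<in> {0..1}" using that \<tau>12 by auto
          show "\<kappa>' \<le> \<bar>r - 1/2\<bar>" using that opp \<tau>12par by (auto simp: abs_if split: if_splits)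
        qed
        then show ?thesis using ab by (auto simp: J'_def)
      qed
      have oG: "open (- (\<alpha> \<union> J'))" using caJ' compact_imp_closed by (intro open_Compl) auto
      define V where "V = connected_component_set (- (\<alpha> \<union> J')) x0"
      have oV: "open V" unfolding V_def by (rule open_connected_component[OF oG])
      have VG: "V \<subseteq> - (\<alpha> \<union> J')" unfolding V_def by (rule connected_component_subset)
      have bV: "ball x0 \<delta> \<subseteq> V" unfolding V_def
        using bJ' \<delta> by (intro connected_component_maximal) auto
      have E_conn: "connected_component (- C) z p" if "z \<in> - D" for z
        using that p(1) conn_mD D_eq by (intro connected_componentI'[of "- D"]) auto
      \<comment> \<open>If \<open>p\<close> were in \<open>V\<close>, adding the whole curve would
        not separate \<open>q\<close> from \<open>p\<close>, since \<open>C\<close> meets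
        \<open>\<alpha> \<union> J'\<close> in the connected arc \<open>J'\<close>. A connected set
        joining them off \<open>C\<close> stays outside \<open>Q0\<close>, which contradicts
        \<open>sepa\<close>.\<close>
      have pV: "p \<notin> V"
      proof
        assume "p \<in> V"
        moreover have "q \<in> V" using q(1) bV by blast
        ultimately have "connected_component (- (\<alpha> \<union> J')) q p"
          unfolding V_def by (metis connected_component_sym connected_component_trans mem_Collect_eq)
        then have "connected_component (- (C \<union> (\<alpha> \<union> J'))) q p"
          by (rule nonseparating_Un[OF compC compact_imp_closed[OF caJ'] CaJ' connJ' E_conn[OF q(2)]])
        then obtain T where T: "connected T" "T \<subseteq> - (C \<union> (\<alpha> \<union> J'))" "q \<in> T" "p \<in> T"
          unfolding connected_component_def by blast
        have "T \<inter> Q0 = {}"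
        proof (rule ccontr)
          assume ne: "T \<inter> Q0 \<noteq> {}"
          have "T \<subseteq> Q0 \<union> outside C" using T(2) JI(9) by blast
          moreover have "outside C \<inter> T \<noteq> {}" using T(3) q(2) E_eq by blast
          ultimately show False using connectedD[OF T(1) JI(2,4)] JI(8) ne by blast
        qed
        then have "T \<subseteq> - (D \<union> \<alpha>)" using T(2) D_eq by blast
        then show False using sepa T unfolding connected_component_def by blast
      qed
      \<comment> \<open>The same argument with \<open>J\<close> in place of \<open>J'\<close>: a
        point of \<open>V\<close> outside \<open>D\<close> that can be joined to \<open>p\<close>
        off the crosscut and \<open>J\<close> would put \<open>p\<close> into
        \<open>V\<close>.\<close>
      have noV: False if "z \<in> V" "z \<in> - D" "connected_component (- (\<alpha> \<union> J)) z p" for z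
      proof -
        have "connected_component (- (C \<union> (\<alpha> \<union> J))) z p"
          by (rule nonseparating_Un[OF compC compact_imp_closed[OF Fc] CF compJ(2) E_conn[OF that(2)] that(3)])
        moreover have "- (C \<union> (\<alpha> \<union> J)) \<subseteq> - (\<alpha> \<union> J')" using CJ by blast
        ultimately have "connected_component (- (\<alpha> \<union> J')) z p" using connected_component_of_subset by blast
        then have "p \<in> V" using that(1) unfolding V_def by (metis connected_component_trans mem_Collect_eq)
        then show False using pV by simp
      qed
      have VR: "V \<subseteq> {w. supdist x0 w \<le> R} \<union> closure Q0"
      proof
        fix z assume z: "z \<in> V"
        show "z \<in> {w. supdist x0 w \<le> R} \<union> closure Q0"
        proof (rule ccontr)
          assume "z \<notin> {w. supdist x0 w \<le> R} \<union> closure Q0"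
          then have z': "R < supdist x0 z" "z \<in> - D" by (auto simp: D_def)
          have "connected_component (- (\<alpha> \<union> J)) z p"
            by (rule connected_componentI'[OF connected_supdist_gr[of R x0]]) (use FR z' p in \<open>auto simp: not_le\<close>)
          then show False using noV z z'(2) by blast
        qed
      qed
      \<comment> \<open>A limit point of \<open>V - Q0\<close> that is neither in \<open>V\<close>
        nor on the crosscut lies on \<open>J'\<close> and off \<open>J\<close>. Nearby points of
        \<open>V\<close> outside \<open>Q0\<close> could then be joined to \<open>p\<close> through
        \<open>Q0\<close> and its far part, contrary to \<open>noV\<close>.\<close>
      have front: "closure (V - Q0) - V \<subseteq> \<alpha>"
      proof
        fix z assume z: "z \<in> closure (V - Q0) - V"
        show "z \<in> \<alpha>"
        proof (rule ccontr)
          assume za: "z \<notin> \<alpha>"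
          have zcl: "z \<in> closure V" using z closure_mono[of "V - Q0" V] by blast
          have "z \<notin> - (\<alpha> \<union> J')"
          proof
            assume "z \<in> - (\<alpha> \<union> J')"
            then have zc: "z \<in> connected_component_set (- (\<alpha> \<union> J')) z" by simp
            have "open (connected_component_set (- (\<alpha> \<union> J')) z)" by (rule open_connected_component[OF oG])
            then have "connected_component_set (- (\<alpha> \<union> J')) z \<inter> V \<noteq> {}"
              using zc zcl open_Int_closure_eq_empty by blast
            then have "z \<in> V" unfolding V_def
              by (metis connected_component_nonoverlap connected_component_eq zc)
            then show False using z by blast
          qed
          then have zJ': "z \<in> J'" using za by blast
          then have zF: "z \<notin> \<alpha> \<union> J" using za JJ' by blast
          have "open (- (\<alpha> \<union> J))" using Fc compact_imp_closed by (intro open_Compl) auto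
          then obtain \<eta> where \<eta>: "\<eta> > 0" "ball z \<eta> \<subseteq> - (\<alpha> \<union> J)" using zF open_contains_ball by blast
          have "z \<in> ball z \<eta> \<inter> closure (V - Q0)" using z \<eta>(1) by simp
          then have "ball z \<eta> \<inter> (V - Q0) \<noteq> {}" using open_Int_closure_eq_empty[OF open_ball] by blast
          then obtain z' where z': "z' \<in> ball z \<eta>" "z' \<in> V" "z' \<notin> Q0" by blast
          have "z' \<notin> C" using z'(1,2) VG \<eta>(2) CJ by blast
          then have zD: "z' \<in> - D" using z'(3) D_eq by blast
          have "z \<in> closure Q0" using zJ' J'C D_eq D_def by blast
          moreover have "ball z \<eta> \<inter> (\<alpha> \<union> J) = {}" using \<eta>(2) by blast
          ultimately have "connected_component (- (\<alpha> \<union> J)) z' p"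
            using connected_component_through_disk[OF JI(3) QF FR _ _ z1 p(2) z'(1)] by blast
          then show False using noV z'(2) zD by blast
        qed
      qed
      show ?thesis
        using st(1-3) aQ bC(1) JI(10) oV bV VR front unfolding \<alpha>_def
        by (intro exI[of _ s] exI[of _ t] exI[of _ V]) auto
    qed
    show ?thesis by (rule exI[of _ \<delta>], intro conjI \<delta> allI impI) (rule X; assumption)
  qed
  show ?thesis by (rule that[OF r1(1,2) main])
qed


context rel_carpet
begin

section \<open>Squares of small oscillation\<close>

abbreviation annulus :: "complex \<Rightarrow> real \<Rightarrow> complex set" where
  "annulus x R \<equiv> {w. R \<le> supdist x w \<and> supdist x w \<le> 2 * R}"

text \<open>If the outer annulus carries more than 1/(N+1) of the energy, the disks met further in
  carry less than N/(N+1) of it, and the induction hypothesis finds an annulus with at most 1/N of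
  that. The next scale is chosen from the positions of the disks alone, so \<delta> is fixed before
  \<rho>.\<close>

lemma small_annulus:
  fixes N :: nat
  assumes J: "\<And>i. i \<notin> J \<Longrightarrow> x0 \<notin> closure (Q i)"
  shows "0 < R0 \<Longrightarrow> \<exists>\<delta>>0. \<forall>\<rho> :: nat \<Rightarrow> ennreal. \<exists>R. \<delta> \<le> R \<and> R \<le> R0 / 2 \<and>
     of_nat N * (\<Sum>\<^sub>\<infinity>i\<in>meeting Q (annulus x0 R) - J. (\<rho> i)\<^sup>2) \<le> (\<Sum>\<^sub>\<infinity>i\<in>meeting Q {w. supdist x0 w \<le> R0} - J. (\<rho> i)\<^sup>2)"
proof (induction N arbitrary: R0)
  case 0
  then show ?case by (intro exI[of _ "R0 / 2"]) (auto intro!: exI[of _ "R0 / 2"])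
next
  case (Suc N)
  note R0 = Suc.prems
  define A where "A = annulus x0 (R0 / 2)"
  define K where "K = {i \<in> meeting Q {w. supdist x0 w \<le> R0}. R0 / 4 \<le> diameter (Q i)} - J"
  have "finite {i \<in> meeting Q {w. supdist x0 w \<le> R0}. R0 / 4 \<le> diameter (Q i)}"
    by (rule finite_big_Q[OF bounded_supdist_le]) (use R0 in simp)
  then have finK: "finite K" by (simp add: K_def)
  have "\<exists>e>0. \<forall>p\<in>Q i. e < supdist x0 p" if "i \<in> K" for i
  proof -
    have "x0 \<notin> closure (Q i)" using J that by (simp add: K_def)
    then have "x0 \<in> - closure (Q i)" "open (- closure (Q i))" by auto
    then obtain e where e: "e > 0" "ball x0 e \<subseteq> - closure (Q i)" unfolding open_contains_ball by blast
    have "e / 4 < supdist x0 p" if p: "p \<in> Q i" for p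
    proof -
      have "p \<notin> ball x0 e" using e(2) p closure_subset[of "Q i"] by blast
      then have "e \<le> 2 * supdist x0 p" using dist_le_supdist[of x0 p] by simp
      then show ?thesis using e(1) by simp
    qed
    then show ?thesis using e(1) by (intro exI[of _ "e / 4"]) auto
  qed
  then obtain e where e: "\<And>i. i \<in> K \<Longrightarrow> 0 < e i" "\<And>i p. i \<in> K \<Longrightarrow> p \<in> Q i \<Longrightarrow> e i < supdist x0 p" by metis
  \<comment> \<open>No disk off \<open>J\<close> may be counted at both scales: those of diameter at
    least \<open>R0 / 4\<close> are finitely many and keep a distance from \<open>x0\<close>, and
    smaller ones cannot reach from the square of half-side \<open>R1\<close> to the annulus.\<close>
  define R1 where "R1 = Min (insert (R0 / 4) (e ` K))"
  have R1: "0 < R1" "R1 \<le> R0 / 4" "\<And>i. i \<in> K \<Longrightarrow> R1 \<le> e i"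
  proof -
    show "0 < R1" unfolding R1_def using finK R0 e(1) by (subst Min_gr_iff) auto
    show "R1 \<le> R0 / 4" unfolding R1_def using finK by (intro Min_le) auto
    show "R1 \<le> e i" if "i \<in> K" for i unfolding R1_def using finK that by (intro Min_le) auto
  qed
  have disj: "(meeting Q A - J) \<inter> (meeting Q {w. supdist x0 w \<le> R1} - J) = {}"
  proof (rule ccontr)
    assume "\<not> ?thesis"
    then obtain i where i: "i \<in> meeting Q A" "i \<in> meeting Q {w. supdist x0 w \<le> R1}" "i \<notin> J" by blast
    obtain p where p: "p \<in> Q i" "R0 / 2 \<le> supdist x0 p" "supdist x0 p \<le> R0" using i(1) by (auto simp: meeting_def A_def)
    obtain p' where p': "p' \<in> Q i" "supdist x0 p' \<le> R1" using i(2) by (auto simp: meeting_def)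
    have "dist p p' \<le> diameter (Q i)" using p p' by (intro diameter_bounded_bound bounded_Q)
    moreover have "supdist x0 p - supdist x0 p' \<le> dist p p'" using supdist_Lip[of x0 p p'] by linarith
    ultimately have "R0 / 4 \<le> diameter (Q i)" using p p' R1 by linarith
    then have "i \<in> K" using i(3) p by (auto simp: K_def meeting_def)
    then show False using e(2)[OF _ p'(1)] R1(3) p'(2) by force
  qed
  obtain \<delta> where \<delta>: "\<delta> > 0" "\<And>\<rho> :: nat \<Rightarrow> ennreal. \<exists>R. \<delta> \<le> R \<and> R \<le> R1 / 2 \<and>
     of_nat N * (\<Sum>\<^sub>\<infinity>i\<in>meeting Q (annulus x0 R) - J. (\<rho> i)\<^sup>2) \<le> (\<Sum>\<^sub>\<infinity>i\<in>meeting Q {w. supdist x0 w \<le> R1} - J. (\<rho> i)\<^sup>2)"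
    using Suc.IH[OF R1(1)] by blast
  have "\<exists>R. min \<delta> (R0 / 2) \<le> R \<and> R \<le> R0 / 2 \<and>
     of_nat (Suc N) * (\<Sum>\<^sub>\<infinity>i\<in>meeting Q (annulus x0 R) - J. (\<rho> i)\<^sup>2) \<le> (\<Sum>\<^sub>\<infinity>i\<in>meeting Q {w. supdist x0 w \<le> R0} - J. (\<rho> i)\<^sup>2)"
    for \<rho> :: "nat \<Rightarrow> ennreal"
  proof -
    let ?s = "\<lambda>X. \<Sum>\<^sub>\<infinity>i\<in>meeting Q X - J. (\<rho> i)\<^sup>2"
    let ?T = "?s {w. supdist x0 w \<le> R0}"
    show ?thesis
    proof (cases "of_nat (Suc N) * ?s A \<le> ?T")
      case True
      then show ?thesis by (intro exI[of _ "R0 / 2"]) (auto simp: A_def)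
    next
      case False
      then have lt: "?T < of_nat (Suc N) * ?s A" by simp
      obtain R where R: "\<delta> \<le> R" "R \<le> R1 / 2" "of_nat N * ?s (annulus x0 R) \<le> ?s {w. supdist x0 w \<le> R1}"
        using \<delta>(2) by blast
      have sub: "?s A + ?s {w. supdist x0 w \<le> R1} \<le> ?T"
      proof (rule infsum_ennreal_UN_disjoint_finite_le[OF disj])
        show "meeting Q A - J \<subseteq> meeting Q {w. supdist x0 w \<le> R0} - J" by (auto simp: meeting_def A_def)
        have "{w. supdist x0 w \<le> R1} \<subseteq> {w. supdist x0 w \<le> R0}" using R1 R0 by auto
        then show "meeting Q {w. supdist x0 w \<le> R1} - J \<subseteq> meeting Q {w. supdist x0 w \<le> R0} - J" by (auto simp: meeting_def)
      qed
      have sR: "?s (annulus x0 R) \<le> ?T"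
      proof (rule infsum_ennreal_mono_set)
        have "annulus x0 R \<subseteq> {w. supdist x0 w \<le> R0}" using R R1 R0 by auto
        then show "meeting Q (annulus x0 R) - J \<subseteq> meeting Q {w. supdist x0 w \<le> R0} - J" by (auto simp: meeting_def)
      qed
      have "of_nat (Suc N) * ?s (annulus x0 R) \<le> ?T"
      proof -
        have fin: "?T < top" by (rule less_le_trans[OF lt top_greatest])
        obtain T where T: "?T = ennreal T" "T \<ge> 0" using fin by (cases ?T) auto
        obtain a where a: "?s A = ennreal a" "a \<ge> 0" using sub fin by (cases "?s A") (auto simp: top_unique)
        obtain b where b: "?s {w. supdist x0 w \<le> R1} = ennreal b" "b \<ge> 0" using sub fin by (cases "?s {w. supdist x0 w \<le> R1}") (auto simp: top_unique)
        obtain s where s: "?s (annulus x0 R) = ennreal s" "s \<ge> 0" using sR fin by (cases "?s (annulus x0 R)") (auto simp: top_unique)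
        have nn: "of_nat n * ennreal x = ennreal (real n * x)" for n x
          unfolding ennreal_of_nat_eq_real_of_nat by (rule ennreal_mult'[symmetric]) simp
        have 1: "a + b \<le> T" using sub T a b by (simp flip: ennreal_plus)
        have 2: "T < real (Suc N) * a" using lt unfolding T(1) a(1) nn using T(2) by (simp only: ennreal_less_iff)
        have 3: "real N * s \<le> b" using R(3) unfolding b(1) s(1) nn using b(2) by (simp only: ennreal_le_iff)
        have 4: "s \<le> T" using sR s T by simp
        have "real (Suc N) * s \<le> T"
        proof (cases "N = 0")
          case False
          have "real N * (real (Suc N) * s) = real (Suc N) * (real N * s)" by simp
          also have "\<dots> \<le> real (Suc N) * b" using 3 by (intro mult_left_mono) auto
          also have "\<dots> \<le> real (Suc N) * (T - a)" using 1 by (intro mult_left_mono) auto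
          also have "\<dots> \<le> real N * T" using 2 by (simp add: algebra_simps)
          finally show ?thesis using False by simp
        qed (use 4 in simp)
        then show ?thesis unfolding T(1) s(1) nn by (rule ennreal_leI)
      qed
      then show ?thesis using R R1 R0 by (intro exI[of _ R]) auto
    qed
  qed
  then show ?case using \<delta>(1) R0 by (intro exI[of _ "min \<delta> (R0 / 2)"]) auto
qed

text \<open>If every radius with the generic property \<open>P\<close> gave a larger sum,
  integration over the radii would contradict the length-area bound; the factor 2 in
  \<open>2 * sqrt C\<close> makes the contradiction strict. \<open>P\<close> leaves room for further
  generic conditions on the radius.\<close>

lemma good_radius:
  "\<exists>C>0. \<forall>x0 R J \<eta> (\<rho> :: nat \<Rightarrow> ennreal) P. 0 < R \<longrightarrow> 0 < \<eta> \<longrightarrow>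
     (\<Sum>\<^sub>\<infinity>i\<in>meeting Q (annulus x0 R) - J. (\<rho> i)\<^sup>2) \<le> ennreal (\<eta>\<^sup>2) \<longrightarrow> (AE r in lborel. r \<in> {R..2 * R} \<longrightarrow> P r) \<longrightarrow>
     (\<exists>r\<in>{R..2 * R}. P r \<and> (\<Sum>\<^sub>\<infinity>i\<in>meeting Q {w. supdist x0 w = r} - J. \<rho> i) \<le> ennreal (C * \<eta>))"
proof -
  obtain C where C: "C > 0"
    "\<And>f x r I c d (\<rho> :: nat \<Rightarrow> ennreal). (\<And>x y. \<bar>f x - f y\<bar> \<le> dist x y) \<Longrightarrow> r > 0 \<Longrightarrow> I \<subseteq> meeting Q {w. supdist x w \<le> 2 * r} \<Longrightarrow>
      c \<le> d \<Longrightarrow> d - c \<le> r \<Longrightarrow>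
      (\<integral>\<^sup>+s\<in>{c..d}. (\<Sum>\<^sub>\<infinity>i\<in>I. \<rho> i * width_ind f (Q i) s) \<partial>lborel)\<^sup>2 \<le> ennreal (C * r\<^sup>2) * (\<Sum>\<^sub>\<infinity>i\<in>I. (\<rho> i)\<^sup>2)"
    using width_sum_bound by blast
  have "\<exists>r\<in>{R..2 * R}. P r \<and> (\<Sum>\<^sub>\<infinity>i\<in>meeting Q {w. supdist x0 w = r} - J. \<rho> i) \<le> ennreal (2 * sqrt C * \<eta>)"
    if R: "0 < R" and \<eta>: "0 < \<eta>" and sm: "(\<Sum>\<^sub>\<infinity>i\<in>meeting Q (annulus x0 R) - J. (\<rho> i)\<^sup>2) \<le> ennreal (\<eta>\<^sup>2)"
      and P: "AE r in lborel. r \<in> {R..2 * R} \<longrightarrow> P r" for x0 R J \<eta> and \<rho> :: "nat \<Rightarrow> ennreal" and P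
  proof (rule ccontr)
    assume con: "\<not> ?thesis"
    define I where "I = meeting Q (annulus x0 R) - J"
    define F where "F s = (\<Sum>\<^sub>\<infinity>i\<in>I. \<rho> i * width_ind (supdist x0) (Q i) s)" for s
    have [measurable]: "F \<in> borel_measurable borel"
      unfolding F_def by (rule nn_integral_width_sum(2)[OF supdist_Lip, of 0 0]) simp
    have "(\<integral>\<^sup>+s\<in>{R..2*R}. F s \<partial>lborel)\<^sup>2 \<le> ennreal (C * R\<^sup>2) * (\<Sum>\<^sub>\<infinity>i\<in>I. (\<rho> i)\<^sup>2)"
      unfolding F_def using R by (intro C(2)[where x = x0] supdist_Lip) (auto simp: I_def meeting_def)
    also have "\<dots> \<le> ennreal (C * R\<^sup>2) * ennreal (\<eta>\<^sup>2)" using sm by (intro mult_left_mono) (auto simp: I_def)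
    also have "\<dots> = ennreal ((sqrt C * R * \<eta>)\<^sup>2)" using C(1) by (simp add: power_mult_distrib flip: ennreal_mult)
    also have "\<dots> = (ennreal (sqrt C * R * \<eta>))\<^sup>2" using C(1) R \<eta> by (simp add: ennreal_power)
    finally have up: "(\<integral>\<^sup>+s\<in>{R..2*R}. F s \<partial>lborel) \<le> ennreal (sqrt C * R * \<eta>)" by (simp add: ennreal_power2_le_iff)
    have each: "(\<Sum>\<^sub>\<infinity>i\<in>meeting Q {w. supdist x0 w = r} - J. \<rho> i) \<le> F r" if r: "r \<in> {R..2 * R}" for r
    proof -
      have "(\<Sum>\<^sub>\<infinity>i\<in>meeting Q {w. supdist x0 w = r} - J. \<rho> i)
          = (\<Sum>\<^sub>\<infinity>i\<in>meeting Q {w. supdist x0 w = r} - J. \<rho> i * width_ind (supdist x0) (Q i) r)"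
      proof (rule infsum_cong)
        fix i assume "i \<in> meeting Q {w. supdist x0 w = r} - J"
        then obtain w where "w \<in> Q i" "supdist x0 w = r" unfolding meeting_def by blast
        then show "\<rho> i = \<rho> i * width_ind (supdist x0) (Q i) r"
          using width_ind_meeting[where f = "supdist x0", OF supdist_Lip] by fastforce
      qed
      also have "\<dots> \<le> F r" unfolding F_def
        by (rule infsum_ennreal_mono_set) (use r in \<open>auto simp: I_def meeting_def\<close>)
      finally show ?thesis .
    qed
    have "(\<integral>\<^sup>+s. ennreal (2 * sqrt C * \<eta>) * indicator {R..2*R} s \<partial>lborel) \<le> (\<integral>\<^sup>+s\<in>{R..2*R}. F s \<partial>lborel)"
    proof (rule nn_integral_mono_AE, use P in eventually_elim)
      case (elim s)
      show ?case
      proof (cases "s \<in> {R..2 * R}")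
        case True
        then have "\<not> (\<Sum>\<^sub>\<infinity>i\<in>meeting Q {w. supdist x0 w = s} - J. \<rho> i) \<le> ennreal (2 * sqrt C * \<eta>)"
          using con elim by blast
        then have "ennreal (2 * sqrt C * \<eta>) \<le> F s" using each[OF True] by (meson le_less_trans linorder_not_le less_imp_le)
        then show ?thesis using True by simp
      qed simp
    qed
    also have "(\<integral>\<^sup>+s. ennreal (2 * sqrt C * \<eta>) * indicator {R..2*R} s \<partial>lborel) = ennreal (2 * sqrt C * \<eta>) * ennreal R"
      using R by (simp add: nn_integral_cmult_indicator)
    also have "\<dots> = ennreal (2 * sqrt C * \<eta> * R)" using C(1) \<eta> R by (intro ennreal_mult[symmetric]) auto
    finally have "ennreal (2 * sqrt C * \<eta> * R) \<le> ennreal (sqrt C * R * \<eta>)" using up by (rule order_trans)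
    then have "2 * sqrt C * \<eta> * R \<le> sqrt C * R * \<eta>" using C(1) \<eta> R by (simp add: ennreal_le_iff)
    then show False using C(1) \<eta> R by simp
  qed
  then show ?thesis using C(1) by (intro exI[of _ "2 * sqrt C"]) auto
qed

text \<open>A set is seen by \<open>f\<close> through its points in the carpet and through the full
  circles of the disks it meets, since the values of \<open>f\<close> inside the disks are
  irrelevant. These are the values on which the maximum principle asks for bounds along a
  curve.\<close>

definition vals :: "(complex \<Rightarrow> real) \<Rightarrow> complex set \<Rightarrow> real set" where
  "vals f X = f ` (X \<inter> S) \<union> (\<Union>i\<in>meeting Q X. f ` frontier (Q i))"

definition vdiam :: "(complex \<Rightarrow> real) \<Rightarrow> complex set \<Rightarrow> real \<Rightarrow> bool" where
  "vdiam f X c \<longleftrightarrow> (\<forall>a\<in>vals f X. \<forall>b\<in>vals f X. \<bar>a - b\<bar> \<le> c)"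

lemma vals_Un: "vals f (X \<union> Y) = vals f X \<union> vals f Y"
  by (auto simp: vals_def meeting_def)

lemma vals_point: "z \<in> X \<Longrightarrow> z \<in> \<Omega> \<Longrightarrow> \<exists>a\<in>vals f {z}. a \<in> vals f X"
proof -
  assume z: "z \<in> X" "z \<in> \<Omega>"
  show ?thesis
  proof (cases "z \<in> S")
    case False
    then obtain i where i: "z \<in> Q i" using not_S_iff z(2) by blast
    obtain y where "y \<in> frontier (Q i)" using frontier_Q_nonempty by blast
    then show ?thesis using i z(1) by (auto simp: vals_def meeting_def)
  qed (use z in \<open>auto simp: vals_def\<close>)
qed

lemma vdiam_Un:
  assumes "vdiam f X c" "vdiam f Y d" "z \<in> X" "z \<in> Y" "z \<in> \<Omega>" "0 \<le> c" "0 \<le> d"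
  shows "vdiam f (X \<union> Y) (c + d)"
proof -
  obtain a where a: "a \<in> vals f {z}" using vals_point[of z "{z}"] assms(5) by blast
  have sub: "vals f {z} \<subseteq> vals f X" "vals f {z} \<subseteq> vals f Y" using assms(3,4) by (auto simp: vals_def meeting_def)
  have aX: "a \<in> vals f X" "a \<in> vals f Y" using a sub by auto
  show ?thesis unfolding vdiam_def vals_Un
  proof (intro ballI)
    fix b b' assume b: "b \<in> vals f X \<union> vals f Y" "b' \<in> vals f X \<union> vals f Y"
    have X: "\<bar>p - q\<bar> \<le> c" if "p \<in> vals f X" "q \<in> vals f X" for p q using assms(1) that by (auto simp: vdiam_def)
    have Y: "\<bar>p - q\<bar> \<le> d" if "p \<in> vals f Y" "q \<in> vals f Y" for p q using assms(2) that by (auto simp: vdiam_def)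
    consider "b \<in> vals f X" "b' \<in> vals f X" | "b \<in> vals f X" "b' \<in> vals f Y"
      | "b \<in> vals f Y" "b' \<in> vals f X" | "b \<in> vals f Y" "b' \<in> vals f Y" using b by blast
    then show "\<bar>b - b'\<bar> \<le> c + d"
    proof cases
      case 1 then show ?thesis using X[of b b'] assms(7) by linarith
    next
      case 2 then show ?thesis using X[OF 2(1) aX(1)] Y[OF aX(2) 2(2)] by linarith
    next
      case 3 then show ?thesis using Y[OF 3(1) aX(2)] X[OF aX(1) 3(2)] by linarith
    next
      case 4 then show ?thesis using Y[of b b'] assms(6) by linarith
    qed
  qed
qed

lemma vdiam_mono: "vdiam f X c \<Longrightarrow> c \<le> d \<Longrightarrow> vdiam f X d"
  unfolding vdiam_def by (meson order_trans)

text \<open>One \<open>c\<close> for the change along the curve and one for each of the two circles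
  on which the compared values may lie. A curve contained in a single disk has no point in the
  carpet and is treated apart.\<close>

lemma vdiam_pgrad:
  assumes f: "\<And>i. bounded (f ` frontier (Q i))" and g: "continuous_on {s..t} g" "g ` {s..t} \<subseteq> \<Omega>"
    and grad: "pgrad f (od f) g s t" and sm: "(\<Sum>\<^sub>\<infinity>i\<in>meeting Q (g ` {s..t}). od f i) \<le> ennreal c" and c: "0 \<le> c"
  shows "vdiam f (g ` {s..t}) (3 * c)"
proof (cases "\<exists>i. g ` {s..t} \<subseteq> Q i")
  case True
  then obtain i where i: "g ` {s..t} \<subseteq> Q i" by blast
  have "\<bar>a - b\<bar> \<le> 3 * c" if ab: "a \<in> vals f (g ` {s..t})" "b \<in> vals f (g ` {s..t})" for a b
  proof -
    have SI: "g ` {s..t} \<inter> S = {}" using i S_not_Q by blast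
    have m: "j = i" if "j \<in> meeting Q (g ` {s..t})" for j
      using that i Q_disjoint[of j i] by (auto simp: meeting_def)
    have iM: "i \<in> meeting Q (g ` {s..t})" using ab(1) SI m by (auto simp: vals_def)
    obtain x y where xy: "x \<in> frontier (Q i)" "a = f x" "y \<in> frontier (Q i)" "b = f y"
      using ab SI m unfolding vals_def by blast
    have "ennreal \<bar>a - b\<bar> \<le> od f i" using od_ge[OF f xy(1,3)] xy by simp
    also have "\<dots> \<le> ennreal c" using infsum_ennreal_ge[OF iM] sm by (rule order_trans)
    finally show ?thesis using c by (simp add: ennreal_le_iff)
  qed
  then show ?thesis by (simp add: vdiam_def)
next
  case nQ: False
  have near: "\<exists>\<tau>\<in>{s..t}. g \<tau> \<in> S \<and> \<bar>a - f (g \<tau>)\<bar> \<le> c" if a: "a \<in> vals f (g ` {s..t})" for a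
  proof (cases "a \<in> f ` (g ` {s..t} \<inter> S)")
    case True
    then show ?thesis using c by auto
  next
    case False
    then obtain i y where i: "i \<in> meeting Q (g ` {s..t})" "y \<in> frontier (Q i)" "a = f y" using a unfolding vals_def by blast
    have "connected (g ` {s..t})" by (intro connected_continuous_image g(1)) auto
    moreover have "g ` {s..t} \<inter> Q i \<noteq> {}" using i(1) unfolding meeting_def by blast
    moreover have "g ` {s..t} - Q i \<noteq> {}" using nQ by blast
    ultimately have "g ` {s..t} \<inter> frontier (Q i) \<noteq> {}" by (rule connected_Int_frontier)
    then obtain \<tau> where \<tau>: "\<tau> \<in> {s..t}" "g \<tau> \<in> frontier (Q i)" by blast
    have "ennreal \<bar>a - f (g \<tau>)\<bar> \<le> od f i" using od_ge[OF f i(2) \<tau>(2)] i(3) by simp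
    also have "\<dots> \<le> ennreal c" using infsum_ennreal_ge[OF i(1)] sm by (rule order_trans)
    finally have "\<bar>a - f (g \<tau>)\<bar> \<le> c" using c by (simp add: ennreal_le_iff)
    then show ?thesis using \<tau> frontier_Q_subset_S[of i] by blast
  qed
  have two: "\<bar>f (g \<tau>) - f (g \<tau>')\<bar> \<le> c" if \<tau>: "\<tau> \<in> {s..t}" "\<tau>' \<in> {s..t}" "g \<tau> \<in> S" "g \<tau>' \<in> S" "\<tau> \<le> \<tau>'" for \<tau> \<tau>'
  proof -
    have "ennreal \<bar>f (g \<tau>) - f (g \<tau>')\<bar> \<le> (\<Sum>\<^sub>\<infinity>i\<in>meeting Q (g ` {\<tau>..\<tau>'}). od f i)"
      by (rule pgradD[OF grad]) (use \<tau> in auto)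
    also have "\<dots> \<le> (\<Sum>\<^sub>\<infinity>i\<in>meeting Q (g ` {s..t}). od f i)"
      using \<tau> by (intro infsum_ennreal_mono_set meeting_mono image_mono) auto
    finally have "ennreal \<bar>f (g \<tau>) - f (g \<tau>')\<bar> \<le> ennreal c" using sm by (rule order_trans)
    then show ?thesis using c by (simp add: ennreal_le_iff)
  qed
  show ?thesis unfolding vdiam_def
  proof (intro ballI)
    fix a b assume ab: "a \<in> vals f (g ` {s..t})" "b \<in> vals f (g ` {s..t})"
    obtain \<tau> where \<tau>: "\<tau> \<in> {s..t}" "g \<tau> \<in> S" "\<bar>a - f (g \<tau>)\<bar> \<le> c" using near[OF ab(1)] by blast
    obtain \<tau>' where \<tau>': "\<tau>' \<in> {s..t}" "g \<tau>' \<in> S" "\<bar>b - f (g \<tau>')\<bar> \<le> c" using near[OF ab(2)] by blast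
    have "\<bar>f (g \<tau>) - f (g \<tau>')\<bar> \<le> c"
    proof (cases "\<tau> \<le> \<tau>'")
      case True then show ?thesis using two \<tau> \<tau>' by blast
    next
      case False then show ?thesis using two[of \<tau>' \<tau>] \<tau> \<tau>' by (simp add: abs_minus_commute)
    qed
    then show "\<bar>a - b\<bar> \<le> 3 * c" using \<tau>(3) \<tau>'(3) by linarith
  qed
qed

definition path_vdiam :: "(complex \<Rightarrow> real) \<Rightarrow> complex set \<Rightarrow> (real \<Rightarrow> complex) \<Rightarrow> real \<Rightarrow> bool" where
  "path_vdiam f B g c \<longleftrightarrow> 0 \<le> c \<and> path_image g \<subseteq> \<Omega> \<and>
     (\<forall>s t. 0 \<le> s \<longrightarrow> s \<le> t \<longrightarrow> t \<le> 1 \<longrightarrow> g ` {s..t} \<inter> B = {} \<longrightarrow> vdiam f (g ` {s..t}) c)"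

lemma path_vdiam_join:
  assumes "path_vdiam f B g c" "path_vdiam f B h d" "pathfinish g = pathstart h"
  shows "path_vdiam f B (g +++ h) (c + d)"
proof -
  have nn: "0 \<le> c" "0 \<le> d" using assms by (auto simp: path_vdiam_def)
  have G: "vdiam f (g ` {s..t}) c" if "0 \<le> s" "s \<le> t" "t \<le> 1" "g ` {s..t} \<inter> B = {}" for s t
    using assms(1) that by (auto simp: path_vdiam_def)
  have H: "vdiam f (h ` {s..t}) d" if "0 \<le> s" "s \<le> t" "t \<le> 1" "h ` {s..t} \<inter> B = {}" for s t
    using assms(2) that by (auto simp: path_vdiam_def)
  have sc: "(*) 2 ` {s..t} = {2 * s..2 * t}" for s t :: real
    by (simp add: image_mult_atLeastAtMost)
  have sc2: "(\<lambda>x. 2 * x - 1) ` {s..t} = {2 * s - 1..2 * t - 1}" if "s \<le> t" for s t :: real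
    using image_affinity_atLeastAtMost_diff[of 2 1 s t] that by simp
  have e1: "(g +++ h) ` {s..t} = g ` {2 * s..2 * t}" if "t \<le> 1/2" for s t
  proof -
    have "(g +++ h) ` {s..t} = (\<lambda>x. g (2 * x)) ` {s..t}" using that by (intro image_cong) (auto simp: joinpaths_def)
    also have "\<dots> = g ` ((*) 2 ` {s..t})" by (simp only: image_image)
    finally show ?thesis by (simp only: sc)
  qed
  have e2: "(g +++ h) ` {s..t} = h ` {2 * s - 1..2 * t - 1}" if "1/2 \<le> s" "s \<le> t" for s t
  proof -
    have "(g +++ h) x = h (2 * x - 1)" if x: "x \<in> {s..t}" for x
    proof (cases "x \<le> 1/2")
      case True
      then have x2: "x = 1/2" using x \<open>1/2 \<le> s\<close> by auto
      show ?thesis unfolding x2 using assms(3) by (simp add: joinpaths_def pathfinish_def pathstart_def)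
    qed (simp add: joinpaths_def)
    then have "(g +++ h) ` {s..t} = (\<lambda>x. h (2 * x - 1)) ` {s..t}" by (intro image_cong) auto
    also have "\<dots> = h ` ((\<lambda>x. 2 * x - 1) ` {s..t})" by (simp only: image_image)
    finally show ?thesis using that by (simp only: sc2)
  qed
  show ?thesis unfolding path_vdiam_def
  proof (intro conjI allI impI)
    show "path_image (g +++ h) \<subseteq> \<Omega>"
      using assms path_image_join_subset[of g h] unfolding path_vdiam_def by blast
    fix s t :: real assume st: "0 \<le> s" "s \<le> t" "t \<le> 1" and B: "(g +++ h) ` {s..t} \<inter> B = {}"
    consider "t \<le> 1/2" | "1/2 \<le> s" | "s < 1/2" "1/2 < t" by linarith
    then show "vdiam f ((g +++ h) ` {s..t}) (c + d)"
    proof cases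
      case 1
      then show ?thesis using G[of "2 * s" "2 * t"] st B nn by (simp add: e1 vdiam_mono)
    next
      case 2
      then show ?thesis using H[of "2 * s - 1" "2 * t - 1"] st B nn by (simp add: e2 vdiam_mono)
    next
      case 3
      have "{s..t} = {s..1/2} \<union> {1/2..t}" using 3 by auto
      then have eq: "(g +++ h) ` {s..t} = g ` {2 * s..1} \<union> h ` {0..2 * t - 1}"
        using e1[of "1/2" s] e2[of "1/2" t] 3 by (simp add: image_Un)
      have "g 1 = h 0" using assms(3) by (simp add: pathfinish_def pathstart_def)
      moreover have "g 1 \<in> g ` {2 * s..1}" "h 0 \<in> h ` {0..2 * t - 1}" using 3 by auto
      moreover have "g 1 \<in> \<Omega>" using assms(1) by (auto simp: path_vdiam_def path_image_def)
      ultimately show ?thesis unfolding eq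
        using G[of "2 * s" 1] H[of 0 "2 * t - 1"] 3 st B nn eq by (intro vdiam_Un) (auto simp: Int_Un_distrib2)
    qed
  qed (use nn in simp)
qed

text \<open>A subpath of the shifted loop consists of at most two subpaths of the original one,
  hence the doubled constant.\<close>

lemma path_vdiam_shift:
  assumes g: "path_vdiam f B g c" "pathfinish g = pathstart g" and a: "a \<in> {0..1}"
  shows "path_vdiam f B (shiftpath a g) (c + c)"
proof -
  have nn: "0 \<le> c" using g by (auto simp: path_vdiam_def)
  have G: "vdiam f (g ` {s..t}) c" if "0 \<le> s" "s \<le> t" "t \<le> 1" "g ` {s..t} \<inter> B = {}" for s t
    using g(1) that by (auto simp: path_vdiam_def)
  have e1: "shiftpath a g ` {s..t} = g ` {a + s..a + t}" if "a + t \<le> 1" for s t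
  proof -
    have "shiftpath a g ` {s..t} = (\<lambda>x. g (a + x)) ` {s..t}" using that by (intro image_cong) (auto simp: shiftpath_def)
    also have "\<dots> = g ` ((+) a ` {s..t})" by (simp only: image_image)
    finally show ?thesis by (simp add: add.commute)
  qed
  have g01: "g 1 = g 0" using g(2) by (simp add: pathfinish_def pathstart_def)
  have e2: "shiftpath a g ` {s..t} = g ` {a + s - 1..a + t - 1}" if "1 \<le> a + s" for s t
  proof -
    have "shiftpath a g x = g (a + x - 1)" if x: "x \<in> {s..t}" for x
    proof (cases "a + x \<le> 1")
      case True
      then have "a + x = 1" using x \<open>1 \<le> a + s\<close> by auto
      then show ?thesis using g01 by (simp add: shiftpath_def)
    next
      case False then show ?thesis by (simp add: shiftpath_def)
    qed
    then have "shiftpath a g ` {s..t} = (\<lambda>x. g ((a - 1) + x)) ` {s..t}" by (intro image_cong) (auto simp: algebra_simps)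
    also have "\<dots> = g ` ((+) (a - 1) ` {s..t})" by (simp only: image_image)
    also have "(+) (a - 1) ` {s..t} = {s + (a - 1)..t + (a - 1)}" by (rule image_add_atLeastAtMost)
    also have "\<dots> = {a + s - 1..a + t - 1}" by (simp add: algebra_simps)
    finally show ?thesis .
  qed
  show ?thesis unfolding path_vdiam_def
  proof (intro conjI allI impI)
    show "path_image (shiftpath a g) \<subseteq> \<Omega>"
      using g a by (simp add: path_image_shiftpath path_vdiam_def)
    fix s t :: real assume st: "0 \<le> s" "s \<le> t" "t \<le> 1" and B: "shiftpath a g ` {s..t} \<inter> B = {}"
    consider "a + t \<le> 1" | "1 \<le> a + s" | "a + s < 1" "1 < a + t" by linarith
    then show "vdiam f (shiftpath a g ` {s..t}) (c + c)"
    proof cases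
      case 1
      then show ?thesis using G[of "a + s" "a + t"] st a B nn by (simp add: e1 vdiam_mono)
    next
      case 2
      then show ?thesis using G[of "a + s - 1" "a + t - 1"] st a B nn by (simp add: e2 vdiam_mono)
    next
      case 3
      have "{s..t} = {s..1 - a} \<union> {1 - a..t}" using 3 by auto
      then have eq: "shiftpath a g ` {s..t} = g ` {a + s..1} \<union> g ` {0..a + t - 1}"
        using e1[of "1 - a" s] e2[of "1 - a" t] by (simp add: image_Un)
      have "g 1 \<in> g ` {a + s..1}" "g 0 \<in> g ` {0..a + t - 1}" using 3 by (auto intro!: imageI)
      then have "g 1 \<in> g ` {a + s..1}" "g 1 \<in> g ` {0..a + t - 1}" by (simp_all only: g01)
      moreover have "g 1 \<in> \<Omega>" using g(1) by (auto simp: path_vdiam_def path_image_def)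
      ultimately show ?thesis unfolding eq
        using G[of "a + s" 1] G[of 0 "a + t - 1"] 3 st a B nn eq by (intro vdiam_Un) (auto simp: Int_Un_distrib2)
    qed
  qed (use nn in simp)
qed

lemma path_vdiam_side:
  assumes e: "cmod e = 1" and f: "\<And>i. bounded (f ` frontier (Q i))"
    and grad: "pgrad f (od f) (pline x0 e r) (-r) r" and sub: "{w. supdist x0 w = r} \<subseteq> \<Omega>"
    and side: "\<And>t. t \<in> {-r..r} \<Longrightarrow> supdist x0 (pline x0 e r t) = r"
    and sm: "(\<Sum>\<^sub>\<infinity>i\<in>meeting Q {w. supdist x0 w = r} - J. od f i) \<le> ennreal c" and c: "0 \<le> c"
    and t: "t1 \<in> {-r..r}" "t2 \<in> {-r..r}"
  shows "path_vdiam f (\<Union>j\<in>J. Q j) (linepath (pline x0 e r t1) (pline x0 e r t2)) (3 * c)"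
proof -
  let ?l = "linepath (pline x0 e r t1) (pline x0 e r t2)" and ?h = "\<lambda>\<tau>. (1 - \<tau>) * t1 + \<tau> * t2"
  have l: "?l \<tau> = pline x0 e r (?h \<tau>)" for \<tau>
    by (simp add: linepath_def pline_def Complex_eq scaleR_conv_of_real algebra_simps)
  have h: "?h \<tau> \<in> {-r..r}" if "\<tau> \<in> {0..1}" for \<tau>
    using convexD[OF convex_real_interval(5) t, of "1 - \<tau>" \<tau>] that by simp
  show ?thesis unfolding path_vdiam_def
  proof (intro conjI allI impI)
    show "path_image ?l \<subseteq> \<Omega>" using sub side h by (auto simp: path_image_def l)
    fix s t :: real assume st: "0 \<le> s" "s \<le> t" "t \<le> 1" and B: "?l ` {s..t} \<inter> (\<Union>j\<in>J. Q j) = {}"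
    have "continuous_on {s..t} ?h" by (intro continuous_intros)
    then obtain p q where pq: "?h ` {s..t} = {p..q}" "p \<le> q"
      using continuous_image_closed_interval[OF st(2)] by blast
    have "{p..q} \<subseteq> {-r..r}" using h st unfolding pq(1)[symmetric] by force
    then have pqr: "-r \<le> p" "q \<le> r" using pq(2) by auto
    have im: "?l ` {s..t} = pline x0 e r ` {p..q}" unfolding pq(1)[symmetric] by (simp add: image_image l)
    have sd: "pline x0 e r ` {p..q} \<subseteq> {w. supdist x0 w = r}" using side pqr by auto
    show "vdiam f (?l ` {s..t}) (3 * c)" unfolding im
    proof (rule vdiam_pgrad[OF f continuous_pline _ pgrad_subset[OF grad pqr] _ c])
      show "pline x0 e r ` {p..q} \<subseteq> \<Omega>" using sd sub by blast
      have "(\<Sum>\<^sub>\<infinity>i\<in>meeting Q (pline x0 e r ` {p..q}). od f i) \<le> (\<Sum>\<^sub>\<infinity>i\<in>meeting Q {w. supdist x0 w = r} - J. od f i)"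
        using B sd unfolding im by (intro infsum_ennreal_mono_set) (auto simp: meeting_def; blast)
      then show "(\<Sum>\<^sub>\<infinity>i\<in>meeting Q (pline x0 e r ` {p..q}). od f i) \<le> ennreal c" using sm by (rule order_trans)
    qed
  qed (use c in simp)
qed

text \<open>Each side contributes \<open>3 * c\<close>, the four sides \<open>12 * c\<close>, and
  moving the base point to \<open>z1\<close> doubles this. The base point is prescribed because a
  crosscut is extracted from a loop based inside the disk.\<close>

lemma square_loop:
  assumes r: "0 < r" and f: "\<And>i. bounded (f ` frontier (Q i))"
    and grad: "\<And>e. e \<in> {1, \<i>, -1, -\<i>} \<Longrightarrow> pgrad f (od f) (pline x0 e r) (-r) r" and sub: "{w. supdist x0 w = r} \<subseteq> \<Omega>"
    and sm: "(\<Sum>\<^sub>\<infinity>i\<in>meeting Q {w. supdist x0 w = r} - J. od f i) \<le> ennreal c" and c: "0 \<le> c"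
    and z1: "supdist x0 z1 = r"
  obtains \<beta> where "simple_path \<beta>" "pathfinish \<beta> = pathstart \<beta>" "pathstart \<beta> = z1"
    "path_image \<beta> = {w. supdist x0 w = r}" "path_vdiam f (\<Union>j\<in>J. Q j) \<beta> (24 * c)"
proof -
  define a1 a3 where "a1 = x0 - Complex r r" and "a3 = x0 + Complex r r"
  let ?g = "rectpath a1 a3"
  have sp: "simple_path ?g" using r by (intro simple_path_rectpath) (auto simp: a1_def a3_def)
  have pi: "path_image ?g = {w. supdist x0 w = r}"
  proof (rule set_eqI)
    fix w
    have "w \<in> path_image ?g \<longleftrightarrow> (Re w = Re x0 - r \<or> Re w = Re x0 + r) \<and> Im x0 - r \<le> Im w \<and> Im w \<le> Im x0 + r \<or>
        (Im w = Im x0 - r \<or> Im w = Im x0 + r) \<and> Re x0 - r \<le> Re w \<and> Re w \<le> Re x0 + r"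
      using r by (subst path_image_rectpath) (simp_all add: a1_def a3_def)
    also have "\<dots> \<longleftrightarrow> max \<bar>Re w - Re x0\<bar> \<bar>Im w - Im x0\<bar> = r"
      using r by (smt (verit))
    finally show "w \<in> path_image ?g \<longleftrightarrow> w \<in> {w. supdist x0 w = r}" by (simp add: supdist_def)
  qed
  have sd: "supdist x0 (pline x0 e r t) = r" if "e \<in> {1, \<i>, -1, -\<i>}" "t \<in> {-r..r}" for e t
  proof -
    have "\<bar>t\<bar> \<le> r" using that(2) by auto
    moreover from that(1) have "supdist x0 (pline x0 e r t) = max \<bar>t\<bar> \<bar>r\<bar> \<or> supdist x0 (pline x0 e r t) = max \<bar>r\<bar> \<bar>t\<bar>"
      by (elim insertE emptyE) (simp_all add: pline_def supdist_def)
    ultimately show ?thesis using r by auto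
  qed
  have V: "path_vdiam f (\<Union>j\<in>J. Q j) (linepath (pline x0 e r r) (pline x0 e r (-r))) (3 * c)" if "e \<in> {1, \<i>, -1, -\<i>}" for e
    using that r by (intro path_vdiam_side[OF _ f grad[OF that] sub sd[OF that] sm c]) auto
  have g_eq: "?g = linepath (pline x0 (-1) r r) (pline x0 (-1) r (-r)) +++ linepath (pline x0 (-\<i>) r r) (pline x0 (-\<i>) r (-r))
      +++ linepath (pline x0 1 r r) (pline x0 1 r (-r)) +++ linepath (pline x0 \<i> r r) (pline x0 \<i> r (-r))"
  proof -
    have "a1 = pline x0 (-1) r r" "a1 = pline x0 \<i> r (-r)" "Complex (Re a3) (Im a1) = pline x0 (-1) r (-r)"
      "Complex (Re a3) (Im a1) = pline x0 (-\<i>) r r" "a3 = pline x0 (-\<i>) r (-r)" "a3 = pline x0 1 r r"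
      "Complex (Re a1) (Im a3) = pline x0 1 r (-r)" "Complex (Re a1) (Im a3) = pline x0 \<i> r r"
      by (auto simp: a1_def a3_def pline_def complex_eq_iff)
    then show ?thesis unfolding rectpath_def Let_def by metis
  qed
  have corners: "pline x0 (-1) r (-r) = pline x0 (-\<i>) r r" "pline x0 (-\<i>) r (-r) = pline x0 1 r r" "pline x0 1 r (-r) = pline x0 \<i> r r"
    by (auto simp: pline_def complex_eq_iff)
  have "path_vdiam f (\<Union>j\<in>J. Q j) ?g (3 * c + (3 * c + (3 * c + 3 * c)))" unfolding g_eq
    by (intro path_vdiam_join V) (auto simp: corners)
  then have gv: "path_vdiam f (\<Union>j\<in>J. Q j) ?g (12 * c)" by simp
  have "z1 \<in> path_image ?g" using z1 pi by simp
  then obtain a where a: "a \<in> {0..1}" "?g a = z1" unfolding path_image_def by blast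
  show ?thesis
  proof (rule that[of "shiftpath a ?g"])
    show "simple_path (shiftpath a ?g)" using sp a by (intro simple_path_shiftpath) auto
    show "pathfinish (shiftpath a ?g) = pathstart (shiftpath a ?g)" using a by (simp add: endpoints_shiftpath)
    show "pathstart (shiftpath a ?g) = z1" using a by (simp add: endpoints_shiftpath)
    show "path_image (shiftpath a ?g) = {w. supdist x0 w = r}" using a by (subst path_image_shiftpath) (auto simp: pi)
    show "path_vdiam f (\<Union>j\<in>J. Q j) (shiftpath a ?g) (24 * c)"
      using path_vdiam_shift[OF gv _ a(1)] by simp
  qed
qed

end


section \<open>Choice of the radius, uniformly in the function\<close>

lemma supdist_pline:
  "e \<in> {1, \<i>, -1, -\<i>} \<Longrightarrow> supdist x0 (pline x0 e r t) = max \<bar>t\<bar> \<bar>r\<bar>"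
  by (elim insertE emptyE) (simp_all add: pline_def supdist_def max.commute)

context rel_carpet
begin

text \<open>Part of the Jordan curve theorem: the curve is also the frontier of its outside.\<close>

lemma frontier_Q_closure_exterior: "x \<in> frontier (Q i) \<Longrightarrow> x \<in> closure (- closure (Q i))"
proof -
  assume x: "x \<in> frontier (Q i)"
  obtain c where c: "simple_path c" "pathfinish c = pathstart c" "Q i = inside (path_image c)"
    "frontier (Q i) = path_image c" "closure (Q i) = Q i \<union> path_image c" "- closure (Q i) = outside (path_image c)"
    by (rule jordan_region_imp[OF jordan_Q])
  have "frontier (outside (path_image c)) = path_image c" using Jordan_inside_outside[OF c(1,2)] by blast
  then show ?thesis using x c(4,6) unfolding frontier_def by auto
qed

text \<open>What the estimates on squares use of a Sobolev function, stated for real-valued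
  functions; it applies both to the harmonic function and to the function whose normalized version
  it is.\<close>

definition regular :: "version \<Rightarrow> (complex \<Rightarrow> real) \<Rightarrow> bool" where
  "regular v f \<longleftrightarrow> (\<forall>i. bounded (f ` frontier (Q i))) \<and> (\<exists>\<Gamma>. carpet_mod v \<Omega> Q \<Gamma> = 0 \<and>
     (\<forall>\<gamma>\<in>paths_in \<Omega> - \<Gamma>. \<forall>a b. {a..b} \<subseteq> fst \<gamma> \<longrightarrow> pgrad f (od f) (snd \<gamma>) a b))"

definition osc_loop :: "complex \<Rightarrow> nat set \<Rightarrow> (complex \<Rightarrow> real) \<Rightarrow> real \<Rightarrow> real \<Rightarrow> bool" where
  "osc_loop x0 J f \<eta> r \<longleftrightarrow> (\<forall>z1. supdist x0 z1 = r \<longrightarrow> (\<exists>\<beta>. simple_path \<beta> \<and> pathfinish \<beta> = pathstart \<beta> \<and>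
     pathstart \<beta> = z1 \<and> path_image \<beta> = {w. supdist x0 w = r} \<and> path_vdiam f (\<Union>j\<in>J. Q j) \<beta> \<eta>))"

text \<open>Among sufficiently many annuli, met by disjoint sets of disks off \<open>J\<close>, one
  has small energy, and in it a generic half-side gives small sums along the four sides. \<delta>
  depends on the disks, \<open>T\<close> and \<eta> but not on \<open>f\<close>, while
  \<open>P\<close> may depend on \<open>f\<close>.\<close>

lemma oscillation_radius:
  assumes J: "\<And>i. i \<notin> J \<Longrightarrow> x0 \<notin> closure (Q i)" and R0: "0 < R0" "{w. supdist x0 w \<le> R0} \<subseteq> \<Omega>"
    and \<eta>: "0 < \<eta>" and T: "0 < T"
  shows "\<exists>\<delta>>0. \<forall>f P. regular v f \<longrightarrow> (\<Sum>\<^sub>\<infinity>i\<in>meeting Q {w. supdist x0 w \<le> R0} - J. (od f i)\<^sup>2) \<le> ennreal T \<longrightarrow>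
      (AE r in lborel. P r) \<longrightarrow> (\<exists>r\<in>{\<delta>..R0}. P r \<and> osc_loop x0 J f \<eta> r)"
proof -
  obtain C where C0: "C > 0" "\<forall>x0 R J \<eta> (\<rho> :: nat \<Rightarrow> ennreal) P. 0 < R \<longrightarrow> 0 < \<eta> \<longrightarrow>
     (\<Sum>\<^sub>\<infinity>i\<in>meeting Q (annulus x0 R) - J. (\<rho> i)\<^sup>2) \<le> ennreal (\<eta>\<^sup>2) \<longrightarrow> (AE r in lborel. r \<in> {R..2 * R} \<longrightarrow> P r) \<longrightarrow>
     (\<exists>r\<in>{R..2 * R}. P r \<and> (\<Sum>\<^sub>\<infinity>i\<in>meeting Q {w. supdist x0 w = r} - J. \<rho> i) \<le> ennreal (C * \<eta>))"
    using good_radius by (elim exE conjE) (rule that)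
  note C = C0(1) C0(2)[THEN spec, THEN spec, THEN spec, THEN spec, THEN spec, THEN spec, THEN mp, THEN mp, THEN mp, THEN mp]
  \<comment> \<open>24 is the factor of \<open>square_loop\<close> and \<open>C\<close> that of
    \<open>good_radius\<close>; the \<open>N\<close> chosen next makes the energy share
    \<open>T / N\<close> smaller than \<open>h\<^sup>2\<close>.\<close>
  define h where "h = \<eta> / (24 * C)"
  have h: "h > 0" "24 * (C * h) = \<eta>" using \<eta> C(1) by (auto simp: h_def)
  obtain N :: nat where N: "T / h\<^sup>2 < real N" using reals_Archimedean2 by blast
  have N0: "real N > 0" using N T h(1) by (smt (verit) divide_pos_pos zero_less_power)
  obtain \<delta> where \<delta>: "\<delta> > 0" "\<forall>\<rho> :: nat \<Rightarrow> ennreal. \<exists>R. \<delta> \<le> R \<and> R \<le> R0 / 2 \<and>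
     of_nat N * (\<Sum>\<^sub>\<infinity>i\<in>meeting Q (annulus x0 R) - J. (\<rho> i)\<^sup>2) \<le> (\<Sum>\<^sub>\<infinity>i\<in>meeting Q {w. supdist x0 w \<le> R0} - J. (\<rho> i)\<^sup>2)"
    by (rule exE[OF small_annulus[where J = J and N = N]], erule J, rule R0(1), erule conjE, rule that)
  show ?thesis
  proof (intro exI[of _ \<delta>] conjI allI impI)
    fix f and P :: "real \<Rightarrow> bool"
    assume reg: "regular v f"
      and fT: "(\<Sum>\<^sub>\<infinity>i\<in>meeting Q {w. supdist x0 w \<le> R0} - J. (od f i)\<^sup>2) \<le> ennreal T" and P: "AE r in lborel. P r"
    have f: "\<And>i. bounded (f ` frontier (Q i))" using reg by (simp add: regular_def)
    obtain \<Gamma> where \<Gamma>0: "carpet_mod v \<Omega> Q \<Gamma> = 0"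
      "\<forall>\<gamma>\<in>paths_in \<Omega> - \<Gamma>. \<forall>a b. {a..b} \<subseteq> fst \<gamma> \<longrightarrow> pgrad f (od f) (snd \<gamma>) a b"
      using reg unfolding regular_def by (elim exE conjE) (rule that)
    have \<Gamma>: "carpet_mod v \<Omega> Q \<Gamma> = 0"
      "\<And>\<gamma> a b. \<gamma> \<in> paths_in \<Omega> \<Longrightarrow> \<gamma> \<notin> \<Gamma> \<Longrightarrow> {a..b} \<subseteq> fst \<gamma> \<Longrightarrow> pgrad f (od f) (snd \<gamma>) a b"
      using \<Gamma>0 by auto
    obtain R where R: "\<delta> \<le> R" "R \<le> R0 / 2"
      "of_nat N * (\<Sum>\<^sub>\<infinity>i\<in>meeting Q (annulus x0 R) - J. (od f i)\<^sup>2) \<le> (\<Sum>\<^sub>\<infinity>i\<in>meeting Q {w. supdist x0 w \<le> R0} - J. (od f i)\<^sup>2)"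
      using \<delta>(2)[THEN spec, of "od f"] by blast
    have Rp: "0 < R" using R \<delta> by simp
    have sm: "(\<Sum>\<^sub>\<infinity>i\<in>meeting Q (annulus x0 R) - J. (od f i)\<^sup>2) \<le> ennreal (h\<^sup>2)"
    proof -
      let ?s = "\<Sum>\<^sub>\<infinity>i\<in>meeting Q (annulus x0 R) - J. (od f i)\<^sup>2"
      have le: "ennreal (real N) * ?s \<le> ennreal T" using R(3) fT by (simp add: ennreal_of_nat_eq_real_of_nat)
      have "?s \<noteq> top" using le N0 by (auto simp: ennreal_mult_top top_unique)
      then obtain s where s: "?s = ennreal s" "0 \<le> s" by (cases ?s) auto
      have "real N * s \<le> T" using le T s N0 by (simp add: ennreal_mult'[symmetric] ennreal_le_iff)
      also have "T \<le> real N * h\<^sup>2" using N h(1) by (simp add: field_simps)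
      finally show ?thesis using N0 s by (simp add: ennreal_leI)
    qed
    have AE1: "AE r in lborel. r \<in> {R..2 * R} \<longrightarrow> ({- (2 * R)..2 * R}, pline x0 e r) \<notin> \<Gamma>" if "e \<in> {1, \<i>, -1, -\<i>}" for e
      using that Rp by (intro carpet_mod_AE_pline[OF \<Gamma>(1)]) auto
    have "AE r in lborel. r \<in> {R..2 * R} \<longrightarrow> (P r \<and> (\<forall>e\<in>{1, \<i>, -1, -\<i>}. ({- (2 * R)..2 * R}, pline x0 e r) \<notin> \<Gamma>))"
      using AE1[of 1, simplified] AE1[of \<i>, simplified] AE1[of "-1", simplified] AE1[of "-\<i>", simplified] P
      by eventually_elim auto
    from C(2)[OF Rp h(1) sm this] obtain r where r: "r \<in> {R..2 * R}" "P r"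
      "\<And>e. e \<in> {1, \<i>, -1, -\<i>} \<Longrightarrow> ({- (2 * R)..2 * R}, pline x0 e r) \<notin> \<Gamma>"
      "(\<Sum>\<^sub>\<infinity>i\<in>meeting Q {w. supdist x0 w = r} - J. od f i) \<le> ennreal (C * h)" by blast
    have rp: "0 < r" "r \<le> R0" "\<delta> \<le> r" using r(1) Rp R by auto
    have grad: "pgrad f (od f) (pline x0 e r) (-r) r" if e: "e \<in> {1, \<i>, -1, -\<i>}" for e
    proof -
      have "supdist x0 (pline x0 e r t) \<le> R0" if "t \<in> {- (2 * R)..2 * R}" for t
        unfolding supdist_pline[OF e] using that R r rp by auto
      then have "pline x0 e r ` {- (2 * R)..2 * R} \<subseteq> \<Omega>" using R0(2) by blast
      then have "({- (2 * R)..2 * R}, pline x0 e r) \<in> paths_in \<Omega>"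
        using Rp continuous_pline by (auto simp: paths_in_def is_path_def trace_def intro!: exI[of _ "pline x0 e r"])
      from \<Gamma>(2)[OF this r(3)[OF e], of "-(2*R)" "2*R"] have "pgrad f (od f) (pline x0 e r) (-(2*R)) (2*R)" by simp
      then show ?thesis by (rule pgrad_subset) (use r in auto)
    qed
    have sub: "{w. supdist x0 w = r} \<subseteq> \<Omega>" using R0(2) rp by auto
    have Ch: "0 \<le> C * h" using C(1) h(1) by simp
    have loop: "\<exists>\<beta>. simple_path \<beta> \<and> pathfinish \<beta> = pathstart \<beta> \<and>
        pathstart \<beta> = z1 \<and> path_image \<beta> = {w. supdist x0 w = r} \<and> path_vdiam f (\<Union>j\<in>J. Q j) \<beta> \<eta>" if z1: "supdist x0 z1 = r" for z1
    proof -
      obtain \<beta> where "simple_path \<beta>" "pathfinish \<beta> = pathstart \<beta>" "pathstart \<beta> = z1"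
        "path_image \<beta> = {w. supdist x0 w = r}" "path_vdiam f (\<Union>j\<in>J. Q j) \<beta> (24 * (C * h))"
        by (rule square_loop[OF rp(1) f _ sub r(4) Ch z1], erule grad, (rule that; assumption))
      then show ?thesis unfolding h(2) by blast
    qed
    then show "\<exists>r\<in>{\<delta>..R0}. P r \<and> osc_loop x0 J f \<eta> r"
      using rp r(2) unfolding osc_loop_def by (intro bexI[of _ r]) auto
  qed (rule \<delta>(1))
qed

lemma sobolev_loc_regular:
  assumes "g \<in> sobolev_loc v \<Omega> Q"
  shows "regular v (\<lambda>x. real_of_ereal (g x))"
proof -
  have fin: "\<And>i. \<bar>Mx g (Q i)\<bar> \<noteq> \<infinity>" "\<And>i. \<bar>Mn g (Q i)\<bar> \<noteq> \<infinity>" using assms by (auto simp: sobolev_loc_def)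
  have ug: "upper_gradient v \<Omega> Q g (\<lambda>i. osc g (Q i))" using assms by (simp add: sobolev_loc_def)
  have o: "(\<lambda>i. osc g (Q i)) = od (\<lambda>x. real_of_ereal (g x))" using finite_Mx_Mn(4)[OF fin] by (simp add: fun_eq_iff)
  obtain \<Gamma> where \<Gamma>: "carpet_mod v \<Omega> Q \<Gamma> = 0"
    "\<And>\<gamma> a b. \<gamma> \<in> paths_in \<Omega> \<Longrightarrow> \<gamma> \<notin> \<Gamma> \<Longrightarrow> {a..b} \<subseteq> fst \<gamma> \<Longrightarrow>
      pgrad (\<lambda>x. real_of_ereal (g x)) (\<lambda>i. osc g (Q i)) (snd \<gamma>) a b"
    by (rule upper_gradient_pgrad[OF ug]) blast
  then have "\<forall>\<gamma>\<in>paths_in \<Omega> - \<Gamma>. \<forall>a b. {a..b} \<subseteq> fst \<gamma> \<longrightarrow>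
      pgrad (\<lambda>x. real_of_ereal (g x)) (od (\<lambda>x. real_of_ereal (g x))) (snd \<gamma>) a b" unfolding o by simp
  then show ?thesis using finite_Mx_Mn(2)[OF fin] \<Gamma>(1) unfolding regular_def by blast
qed

section \<open>Local bounds for carpet-harmonic functions\<close>

text \<open>Both signs of the maximum principle at the level \<sigma> a + c, where \<open>a\<close>
  is any value seen on \<open>A\<close>. By \<open>A3\<close> the set \<open>A\<close> touches the
  circle of the excluded disk, and this contact supplies the one good boundary point required
  there.\<close>

lemma harmonic_bounds:
  fixes u :: "complex \<Rightarrow> real"
  assumes harm: "carpet_harmonic v \<Omega> Q (\<lambda>x. ereal (u x))"
    and V: "open V" "V \<subset>\<subset> \<Omega>"
    and J: "J = {} \<or> (\<exists>j. J = {j})"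
    and front: "closure (V - (\<Union>j\<in>J. Q j)) - V \<subseteq> A \<union> (\<Union>j\<in>J. Q j)"
    and meetJ: "\<And>j. j \<in> J \<Longrightarrow> Q j \<inter> V \<noteq> {}"
    and A: "vdiam u A c" "A \<subseteq> \<Omega>" "A \<noteq> {}"
    and A3: "\<And>j. j \<in> J \<Longrightarrow> A \<inter> frontier (Q j) \<noteq> {}"
    and q1: "q1 \<in> \<Omega> - (\<Union>j\<in>J. closure (Q j))" "q1 \<notin> closure V"
  shows "\<exists>a. \<forall>i. i \<notin> J \<longrightarrow> Q i \<subseteq> V \<longrightarrow> (\<forall>x\<in>frontier (Q i). a - c \<le> u x \<and> u x \<le> a + c)"
proof -
  obtain z where "z \<in> A" using A(3) by blast
  then obtain a where a: "a \<in> vals u A" using vals_point[of z A] A(2) by blast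
  have near: "\<bar>b - a\<bar> \<le> c" if "b \<in> vals u A" for b using A(1) a that by (auto simp: vdiam_def)
  have v1: "u x \<in> vals u A" if "x \<in> A \<inter> S" for x using that by (auto simp: vals_def)
  have v2: "u x \<in> vals u A" if "i \<in> meeting Q A" "x \<in> frontier (Q i)" for x i using that by (auto simp: vals_def)
  have main: "\<sigma> * u x \<le> \<sigma> * a + c" if \<sigma>: "\<sigma> = 1 \<or> \<sigma> = -1" and i: "i \<notin> J" "Q i \<subseteq> V" "x \<in> frontier (Q i)" for \<sigma> i x
  proof (rule maximum_principle[OF harm \<sigma> V J front meetJ _ _ _ q1 i(1) _ i(3)])
    have nb: "\<sigma> * b \<le> \<sigma> * a + c" if "b \<in> vals u A" for b using near[OF that] \<sigma> by auto
    show "\<sigma> * u y \<le> \<sigma> * a + c" if "y \<in> A \<inter> S" for y using nb v1[OF that] by blast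
    show "\<sigma> * u y \<le> \<sigma> * a + c" if "k \<in> meeting Q A - J" "y \<in> frontier (Q k)" for k y using nb v2 that by blast
    show "\<exists>y\<in>frontier (Q j). \<sigma> * u y \<le> \<sigma> * a + c" if jJ: "j \<in> J" for j
    proof -
      obtain y where y: "y \<in> A" "y \<in> frontier (Q j)" using A3[OF jJ] by blast
      then have "y \<in> A \<inter> S" using frontier_Q_subset_S[of j] by blast
      then show ?thesis using nb v1 y(2) by blast
    qed
    show "Q i \<inter> V \<noteq> {}" using i(2) Q_nonempty[of i] by blast
  qed
  have "a - c \<le> u x \<and> u x \<le> a + c" if "i \<notin> J" "Q i \<subseteq> V" "x \<in> frontier (Q i)" for i x
    using main[of 1 i x] main[of "-1" i x] that by auto
  then show ?thesis by blast
qed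

text \<open>At most one closed disk contains \<open>x0\<close>. If none does, an open square serves
  as \<open>V\<close>; otherwise the crosscut region does, and that disk is left out of the
  conclusion. All sizes are chosen before \<open>u\<close> is introduced.\<close>

lemma harmonic_local:
  assumes x0: "x0 \<in> S" and U: "open U" "U \<subset>\<subset> \<Omega>" "x0 \<in> U" and \<epsilon>: "0 < \<epsilon>" and M: "0 < M"
  shows "\<exists>\<delta>>0. \<forall>u. carpet_harmonic v \<Omega> Q (\<lambda>x. ereal (u x)) \<longrightarrow> dirichlet_energy Q U (\<lambda>x. ereal (u x)) \<le> ennreal M \<longrightarrow>
    (\<exists>V a. open V \<and> ball x0 \<delta> \<subseteq> V \<and>
      (\<forall>i. x0 \<notin> closure (Q i) \<longrightarrow> Q i \<subseteq> V \<longrightarrow> (\<forall>x\<in>frontier (Q i). a - \<epsilon> \<le> u x \<and> u x \<le> a + \<epsilon>)))"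
proof -
  define J where "J = {i. x0 \<in> closure (Q i)}"
  have J: "J = {} \<or> (\<exists>j. J = {j})"
  proof (cases "J = {}")
    case False
    then obtain j where "j \<in> J" by blast
    then have "J = {j}" using Q_unique[of x0] by (auto simp: J_def)
    then show ?thesis by blast
  qed simp
  have Jn: "x0 \<notin> closure (Q i)" if "i \<notin> J" for i using that by (simp add: J_def)
  have Jf: "x0 \<in> frontier (Q j)" if "j \<in> J" for j using that x0 S_Int_closure_Q by (simp add: J_def)
  have U\<Omega>: "U \<subseteq> \<Omega>" using U(2) closure_subset[of U] by (auto simp: compactly_contained_def)
  \<comment> \<open>The anchor point of the maximum principle: a point of \<Omega> other than
    \<open>x0\<close> and off the closed disk of \<open>J\<close>; \<open>R\<close> will be small
    enough to leave it outside the square.\<close>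
  obtain q1 where q1: "q1 \<in> \<Omega> - (\<Union>j\<in>J. closure (Q j))" "q1 \<noteq> x0"
  proof (cases "J = {}")
    case True
    obtain r where r: "r > 0" "ball x0 r \<subseteq> \<Omega>" using open_\<Omega> U(3) U\<Omega> open_contains_ball by (meson subsetD)
    have "x0 + of_real (r/2) \<in> ball x0 r" using r(1) by (simp add: dist_norm)
    then show ?thesis using that[of "x0 + of_real (r/2)"] True r by auto
  next
    case False
    then obtain j where j: "J = {j}" using J by blast
    have "x0 \<in> closure (- closure (Q j))" using frontier_Q_closure_exterior Jf j by blast
    moreover have "x0 \<in> \<Omega>" using U(3) U\<Omega> by blast
    ultimately have "\<Omega> \<inter> - closure (Q j) \<noteq> {}" using open_Int_closure_eq_empty[OF open_\<Omega>] by blast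
    then obtain q where q: "q \<in> \<Omega>" "q \<notin> closure (Q j)" by blast
    have "q \<noteq> x0" using q(2) j by (auto simp: J_def)
    then show ?thesis using that[of q] q j by simp
  qed
  obtain r0 where r0: "r0 > 0" "ball x0 r0 \<subseteq> U" using U(1,3) open_contains_ball by blast
  have "\<exists>m>0. \<forall>j\<in>J. \<exists>z\<in>Q j. m \<le> supdist x0 z"
  proof (cases "J = {}")
    case True then show ?thesis by (intro exI[of _ 1]) auto
  next
    case False
    then obtain j where j: "J = {j}" using J by blast
    obtain z where z: "z \<in> Q j" using Q_nonempty by blast
    have "z \<noteq> x0" using z x0 S_not_Q by blast
    then have "0 < supdist x0 z" using supdist_eq_0[of x0 z] supdist_nonneg[of x0 z] by linarith
    then show ?thesis using j z by (intro exI[of _ "supdist x0 z"]) auto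
  qed
  then obtain m where m: "m > 0" "\<And>j. j \<in> J \<Longrightarrow> \<exists>z\<in>Q j. m \<le> supdist x0 z" by blast
  have q1p: "0 < supdist x0 q1" using q1(2) supdist_eq_0[of x0 q1] supdist_nonneg[of x0 q1] by linarith
  \<comment> \<open>\<open>r0 / 4\<close> keeps the square inside \<open>U\<close>, as the Euclidean
    distance is at most twice the sup distance; \<open>m / 2\<close> makes the disk of
    \<open>J\<close> reach out of the square; the last term leaves \<open>q1\<close>
    outside.\<close>
  define R where "R = min (r0 / 4) (min (m / 2) (supdist x0 q1 / 2))"
  have R: "0 < R" "R \<le> r0 / 4" "R < m" "R < supdist x0 q1" using r0 m q1p by (auto simp: R_def min_def)
  have RU: "{w. supdist x0 w \<le> R} \<subseteq> U"
  proof
    fix w assume "w \<in> {w. supdist x0 w \<le> R}"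
    then have "dist x0 w < r0" using dist_le_supdist[of x0 w] R r0(1) by simp
    then show "w \<in> U" using r0(2) by auto
  qed
  have usual: "regular v u \<and> (\<forall>R0\<le>R. (\<Sum>\<^sub>\<infinity>i\<in>meeting Q {w. supdist x0 w \<le> R0} - J. (od u i)\<^sup>2) \<le> ennreal M)"
    if u: "carpet_harmonic v \<Omega> Q (\<lambda>x. ereal (u x))" "dirichlet_energy Q U (\<lambda>x. ereal (u x)) \<le> ennreal M" for u
  proof -
    have "(\<lambda>x. ereal (u x)) \<in> sobolev_loc v \<Omega> Q" using u(1) by (simp add: carpet_harmonic_def)
    from sobolev_loc_regular[OF this] have reg: "regular v u" by (simp add: comp_def)
    have "(\<Sum>\<^sub>\<infinity>i\<in>meeting Q {w. supdist x0 w \<le> R0} - J. (od u i)\<^sup>2) \<le> ennreal M" if "R0 \<le> R" for R0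
    proof -
      have "{w. supdist x0 w \<le> R0} \<subseteq> U" using RU that by auto
      then have "(\<Sum>\<^sub>\<infinity>i\<in>meeting Q {w. supdist x0 w \<le> R0} - J. (od u i)\<^sup>2) \<le> (\<Sum>\<^sub>\<infinity>i\<in>meeting Q U. (od u i)\<^sup>2)"
        by (intro infsum_ennreal_mono_set) (auto simp: meeting_def)
      also have "\<dots> \<le> ennreal M" using u(2) by (simp add: dirichlet_energy_def od_def)
      finally show ?thesis .
    qed
    then show ?thesis using reg by blast
  qed
  show ?thesis
  proof (cases "J = {}")
    case True
    have R\<Omega>: "{w. supdist x0 w \<le> R} \<subseteq> \<Omega>" using RU U\<Omega> by blast
    obtain \<delta> where \<delta>: "0 < \<delta>" "\<forall>f P. regular v f \<longrightarrow>
      (\<Sum>\<^sub>\<infinity>i\<in>meeting Q {w. supdist x0 w \<le> R} - J. (od f i)\<^sup>2) \<le> ennreal M \<longrightarrow>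
      (AE r in lborel. P r) \<longrightarrow> (\<exists>r\<in>{\<delta>..R}. P r \<and> osc_loop x0 J f \<epsilon> r)"
      by (rule exE[OF oscillation_radius[OF _ R(1) R\<Omega> \<epsilon> M, where v = v and J = J]], erule Jn, erule conjE, rule that)
    show ?thesis
    proof (intro exI[of _ \<delta>] conjI allI impI)
      fix u assume u: "carpet_harmonic v \<Omega> Q (\<lambda>x. ereal (u x))" "dirichlet_energy Q U (\<lambda>x. ereal (u x)) \<le> ennreal M"
      obtain r where r: "r \<in> {\<delta>..R}" "osc_loop x0 J u \<epsilon> r"
        using \<delta>(2)[THEN spec, THEN spec, of u "\<lambda>_. True"] usual[OF u] by auto
      note r = r(1)[unfolded atLeastAtMost_iff, THEN conjunct1] r(1)[unfolded atLeastAtMost_iff, THEN conjunct2]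
        r(2)[unfolded osc_loop_def, THEN spec, THEN mp]
      have "supdist x0 (x0 + Complex r r) = r" using r(1) \<delta>(1) by (simp add: supdist_def)
      then obtain \<beta> where \<beta>: "path_image \<beta> = {w. supdist x0 w = r}" "path_vdiam u (\<Union>j\<in>J. Q j) \<beta> \<epsilon>"
        "x0 + Complex r r = pathstart \<beta>" using r(3) by metis
      have vd: "vdiam u {w. supdist x0 w = r} \<epsilon>"
        using \<beta>(2)[unfolded path_vdiam_def, THEN conjunct2, THEN conjunct2, rule_format, of 0 1] True \<beta>(1)
        by (simp add: path_image_def)
      define V where "V = {w. supdist x0 w < r}"
      have clV: "closure V \<subseteq> {w. supdist x0 w \<le> r}"
        unfolding V_def by (rule closure_minimal[OF _ closed_supdist_le]) auto
      have V\<Omega>: "V \<subset>\<subset> \<Omega>" unfolding compactly_contained_def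
      proof
        show "closure V \<subseteq> \<Omega>" using clV R\<Omega> r(2) by fastforce
        show "compact (closure V)" using clV bounded_supdist_le bounded_subset closed_closure compact_eq_bounded_closed by blast
      qed
      have "\<exists>a. \<forall>i. i \<notin> J \<longrightarrow> Q i \<subseteq> V \<longrightarrow> (\<forall>x\<in>frontier (Q i). a - \<epsilon> \<le> u x \<and> u x \<le> a + \<epsilon>)"
      proof (rule harmonic_bounds[OF u(1) _ V\<Omega> J _ _ vd])
        show "open V" unfolding V_def by (rule open_supdist_less)
        show "closure (V - (\<Union>j\<in>J. Q j)) - V \<subseteq> {w. supdist x0 w = r} \<union> (\<Union>j\<in>J. Q j)"
          using clV True by (auto simp: V_def)
        show "{w. supdist x0 w = r} \<subseteq> \<Omega>" using R\<Omega> r(2) by auto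
        show "{w. supdist x0 w = r} \<noteq> {}" using \<open>supdist x0 (x0 + Complex r r) = r\<close> by blast
        show "q1 \<in> \<Omega> - (\<Union>j\<in>J. closure (Q j))" by (rule q1(1))
        show "q1 \<notin> closure V" using clV R(4) r(2) by auto
      qed (use True in auto)
      moreover have "open V" unfolding V_def by (rule open_supdist_less)
      moreover have "ball x0 \<delta> \<subseteq> V"
      proof
        fix w assume "w \<in> ball x0 \<delta>"
        then show "w \<in> V" using supdist_le_dist[of x0 w] r(1) by (simp add: V_def)
      qed
      ultimately show "\<exists>V a. open V \<and> ball x0 \<delta> \<subseteq> V \<and>
        (\<forall>i. x0 \<notin> closure (Q i) \<longrightarrow> Q i \<subseteq> V \<longrightarrow> (\<forall>x\<in>frontier (Q i). a - \<epsilon> \<le> u x \<and> u x \<le> a + \<epsilon>))"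
        unfolding J_def by blast
    qed (rule \<delta>(1))
  next
    case False
    then obtain j where j: "J = {j}" using J by blast
    have xf: "x0 \<in> frontier (Q j)" and xcl: "x0 \<in> closure (Q j)" using Jf j by (auto simp: J_def)
    obtain z0 where z0: "z0 \<in> Q j" "R < supdist x0 z0" using m(2)[of j] j R(3) by force
    obtain c0 where c0: "simple_path c0" "pathfinish c0 = pathstart c0" "Q j = inside (path_image c0)"
      "frontier (Q j) = path_image c0" "closure (Q j) = Q j \<union> path_image c0" "- closure (Q j) = outside (path_image c0)"
      by (rule jordan_region_imp[OF jordan_Q[of j]])
    have "x0 \<in> c0 ` {0..1}" using xf c0(4) by (simp add: path_image_def)
    then obtain a0 where a0: "a0 \<in> {0..1}" "c0 a0 = x0" by (metis imageE)
    \<comment> \<open>Shifts the parametrization of the Jordan curve so that \<open>x0\<close> is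
      reached at time 1/2, away from the ends of the parameter interval.\<close>
    define b0 where "b0 = (if a0 \<ge> 1/2 then a0 - 1/2 else a0 + 1/2)"
    define c where "c = shiftpath b0 c0"
    have b0: "b0 \<in> {0..1}" using a0(1) by (auto simp: b0_def)
    have c: "simple_path c" "pathfinish c = pathstart c" "path_image c = path_image c0"
      unfolding c_def using b0 c0 by (auto simp: simple_path_shiftpath endpoints_shiftpath path_image_shiftpath)
    have c12: "c (1/2) = x0"
    proof (cases "a0 \<ge> 1/2")
      case True
      then show ?thesis using a0 by (simp add: c_def shiftpath_def b0_def)
    next
      case False
      have c01: "c0 1 = c0 0" using c0(2) by (simp add: pathfinish_def pathstart_def)
      show ?thesis using False a0 c01 by (cases "a0 = 0") (auto simp: c_def shiftpath_def b0_def)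
    qed
    have Qc: "Q j = inside (path_image c)" using c0(3) c(3) by simp
    have z0cl: "z0 \<in> closure (Q j)" using z0(1) closure_subset[of "Q j"] by blast
    obtain r1 where r1: "0 < r1" "r1 < R"
      and cut: "\<forall>\<rho>0. 0 < \<rho>0 \<longrightarrow> \<rho>0 \<le> r1 \<longrightarrow> (\<exists>\<delta>>0. \<forall>\<rho> \<beta>. \<rho>0 \<le> \<rho> \<longrightarrow> \<rho> \<le> r1 \<longrightarrow> simple_path \<beta> \<longrightarrow> pathfinish \<beta> = pathstart \<beta> \<longrightarrow>
        path_image \<beta> = {w. supdist x0 w = \<rho>} \<longrightarrow> pathstart \<beta> \<in> Q j \<longrightarrow>
        (\<exists>s t V. 0 \<le> s \<and> s < t \<and> t \<le> 1 \<and> \<beta> ` {s..t} \<inter> Q j = {} \<and> \<beta> s \<in> frontier (Q j) \<and> open V \<and> ball x0 \<delta> \<subseteq> V \<and>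
           V \<subseteq> {w. supdist x0 w \<le> R} \<union> closure (Q j) \<and> closure (V - Q j) - V \<subseteq> \<beta> ` {s..t}))"
      by (rule crosscut_region[OF c(1,2) c12 Qc z0cl z0(2) R(1)], rule that, assumption, assumption)
        (intro allI impI, drule meta_spec, drule meta_mp, assumption, drule meta_mp, assumption, assumption)
    have r1\<Omega>: "{w. supdist x0 w \<le> r1} \<subseteq> \<Omega>" using RU U\<Omega> r1(2) by fastforce
    obtain \<delta>0 where \<delta>0: "0 < \<delta>0" "\<forall>f P. regular v f \<longrightarrow>
      (\<Sum>\<^sub>\<infinity>i\<in>meeting Q {w. supdist x0 w \<le> r1} - J. (od f i)\<^sup>2) \<le> ennreal M \<longrightarrow>
      (AE r in lborel. P r) \<longrightarrow> (\<exists>r\<in>{\<delta>0..r1}. P r \<and> osc_loop x0 J f \<epsilon> r)"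
      by (rule exE[OF oscillation_radius[OF _ r1(1) r1\<Omega> \<epsilon> M, where v = v and J = J]], erule Jn, erule conjE, rule that)
    \<comment> \<open>The half-side found for a given \<open>u\<close> will lie between \<delta>0
      and \<open>r1\<close>; the crosscut region is prepared for this whole range
      beforehand.\<close>
    have "0 < min \<delta>0 r1" "min \<delta>0 r1 \<le> r1" using \<delta>0(1) r1(1) by auto
    note cut[THEN spec, THEN mp, THEN mp, OF this]
    then obtain \<delta> where \<delta>: "0 < \<delta>"
      "\<forall>\<rho> \<beta>. min \<delta>0 r1 \<le> \<rho> \<longrightarrow> \<rho> \<le> r1 \<longrightarrow> simple_path \<beta> \<longrightarrow> pathfinish \<beta> = pathstart \<beta> \<longrightarrow>
        path_image \<beta> = {w. supdist x0 w = \<rho>} \<longrightarrow> pathstart \<beta> \<in> Q j \<longrightarrow>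
        (\<exists>s t V. 0 \<le> s \<and> s < t \<and> t \<le> 1 \<and> \<beta> ` {s..t} \<inter> Q j = {} \<and> \<beta> s \<in> frontier (Q j) \<and> open V \<and> ball x0 \<delta> \<subseteq> V \<and>
           V \<subseteq> {w. supdist x0 w \<le> R} \<union> closure (Q j) \<and> closure (V - Q j) - V \<subseteq> \<beta> ` {s..t})"
      by (elim exE conjE) (rule that)
    show ?thesis
    proof (intro exI[of _ \<delta>] conjI allI impI)
      fix u assume u: "carpet_harmonic v \<Omega> Q (\<lambda>x. ereal (u x))" "dirichlet_energy Q U (\<lambda>x. ereal (u x)) \<le> ennreal M"
      obtain r where r: "r \<in> {\<delta>0..r1}" "osc_loop x0 J u \<epsilon> r"
        using \<delta>0(2)[THEN spec, THEN spec, of u "\<lambda>_. True"] usual[OF u] r1(2) by auto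
      note r = r(1)[unfolded atLeastAtMost_iff, THEN conjunct1] r(1)[unfolded atLeastAtMost_iff, THEN conjunct2]
        r(2)[unfolded osc_loop_def, THEN spec, THEN mp]
      \<comment> \<open>The disk has points on both sides of the square boundary, so by
        connectedness the loop can be based inside it.\<close>
      obtain z2 where z2: "z2 \<in> Q j" "supdist x0 z2 \<le> r"
      proof -
        have "x0 \<in> ball x0 r" using r(1) \<delta>0(1) by simp
        then have "ball x0 r \<inter> Q j \<noteq> {}" using xcl open_Int_closure_eq_empty[OF open_ball] by blast
        then obtain z where "z \<in> Q j" "dist x0 z < r" by auto
        then show ?thesis using that[of z] supdist_le_dist[of x0 z] by simp
      qed
      have "r \<le> supdist x0 z0" using r(2) r1(2) z0(2) by linarith
      then obtain z1 where z1: "z1 \<in> Q j" "supdist x0 z1 = r"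
        using connected_meets_supdist_sphere[OF connected_Q z2(1) z0(1) z2(2)] by blast
      obtain \<beta> where \<beta>: "simple_path \<beta>" "pathfinish \<beta> = pathstart \<beta>" "pathstart \<beta> = z1"
        "path_image \<beta> = {w. supdist x0 w = r}" "path_vdiam u (\<Union>j\<in>J. Q j) \<beta> \<epsilon>" using r(3)[OF z1(2)] by blast
      have "pathstart \<beta> \<in> Q j" "min \<delta>0 r1 \<le> r" using \<beta>(3) z1(1) r(1) by auto
      from \<delta>(2)[THEN spec, THEN spec, THEN mp, THEN mp, THEN mp, THEN mp, THEN mp, THEN mp, OF this(2) r(2) \<beta>(1,2,4) this(1)]
      obtain s t V where stV: "0 \<le> s" "s < t" "t \<le> 1" "\<beta> ` {s..t} \<inter> Q j = {}" "\<beta> s \<in> frontier (Q j)" "open V" "ball x0 \<delta> \<subseteq> V"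
        "V \<subseteq> {w. supdist x0 w \<le> R} \<union> closure (Q j)" "closure (V - Q j) - V \<subseteq> \<beta> ` {s..t}" by blast
      have vd: "vdiam u (\<beta> ` {s..t}) \<epsilon>"
        using \<beta>(5)[unfolded path_vdiam_def, THEN conjunct2, THEN conjunct2, rule_format, of s t] j stV by simp
      have clV: "closure V \<subseteq> {w. supdist x0 w \<le> R} \<union> closure (Q j)"
        using closed_supdist_le by (intro closure_minimal[OF stV(8)]) auto
      have V\<Omega>: "V \<subset>\<subset> \<Omega>" unfolding compactly_contained_def
      proof
        show "closure V \<subseteq> \<Omega>" using clV RU U\<Omega> closure_Q_subset[of j] by blast
        have "compact ({w. supdist x0 w \<le> R} \<union> closure (Q j))"
          by (intro compact_Un compact_supdist_le compact_closure_Q)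
        then show "compact (closure V)" using clV closed_closure by (metis compact_Int_closed inf.absorb_iff2)
      qed
      have b\<Omega>: "\<beta> ` {s..t} \<subseteq> \<Omega>"
      proof -
        have "\<beta> ` {s..t} \<subseteq> path_image \<beta>" unfolding path_image_def using stV by (intro image_mono) auto
        then show ?thesis unfolding \<beta>(4) using r1\<Omega> r(2) by auto
      qed
      have "\<exists>a. \<forall>i. i \<notin> J \<longrightarrow> Q i \<subseteq> V \<longrightarrow> (\<forall>x\<in>frontier (Q i). a - \<epsilon> \<le> u x \<and> u x \<le> a + \<epsilon>)"
      proof (rule harmonic_bounds[OF u(1) stV(6) V\<Omega> J _ _ vd b\<Omega>])
        show "closure (V - (\<Union>j\<in>J. Q j)) - V \<subseteq> \<beta> ` {s..t} \<union> (\<Union>j\<in>J. Q j)" using stV(9) j by auto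
        have "x0 \<in> V" using stV(7) \<delta>(1) by auto
        then have "V \<inter> Q j \<noteq> {}" using xcl open_Int_closure_eq_empty[OF stV(6)] by blast
        then show "Q k \<inter> V \<noteq> {}" if "k \<in> J" for k using that j by auto
        show "\<beta> ` {s..t} \<noteq> {}" using stV by auto
        have "\<beta> s \<in> \<beta> ` {s..t}" using stV by auto
        then show "\<beta> ` {s..t} \<inter> frontier (Q k) \<noteq> {}" if "k \<in> J" for k using stV(5) that j by auto
        show "q1 \<in> \<Omega> - (\<Union>j\<in>J. closure (Q j))" by (rule q1(1))
        then show "q1 \<notin> closure V" using clV R(4) j by auto
      qed
      then show "\<exists>V a. open V \<and> ball x0 \<delta> \<subseteq> V \<and>
        (\<forall>i. x0 \<notin> closure (Q i) \<longrightarrow> Q i \<subseteq> V \<longrightarrow> (\<forall>x\<in>frontier (Q i). a - \<epsilon> \<le> u x \<and> u x \<le> a + \<epsilon>))"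
        using stV(6,7) unfolding J_def by blast
    qed (rule \<delta>(1))
  qed
qed


section \<open>Normalized versions\<close>

lemma infsum_tail_near:
  fixes \<rho> :: "nat \<Rightarrow> ennreal"
  assumes fin: "infsum \<rho> I < \<infinity>" and y: "\<And>i. i \<in> I \<Longrightarrow> y \<notin> closure (Q i)" and \<eta>: "0 < \<eta>"
  obtains e where "0 < e" "infsum \<rho> {i \<in> I. Q i \<inter> ball y e \<noteq> {}} < \<eta>"
proof -
  obtain F where F: "finite F" "F \<subseteq> I" "infsum \<rho> (I - F) < \<eta>" by (rule infsum_ennreal_tail[OF fin \<eta>])
  have "open (- (\<Union>i\<in>F. closure (Q i)))" using F(1) by (intro open_Compl closed_UN) auto
  moreover have "y \<in> - (\<Union>i\<in>F. closure (Q i))" using y F(2) by blast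
  ultimately obtain e where e: "e > 0" "ball y e \<subseteq> - (\<Union>i\<in>F. closure (Q i))"
    using open_contains_ball by blast
  have "{i \<in> I. Q i \<inter> ball y e \<noteq> {}} \<subseteq> I - F"
  proof
    fix i assume i: "i \<in> {i \<in> I. Q i \<inter> ball y e \<noteq> {}}"
    then have "i \<notin> F" using e(2) closure_subset[of "Q i"] by blast
    then show "i \<in> I - F" using i by blast
  qed
  then have "infsum \<rho> {i \<in> I. Q i \<inter> ball y e \<noteq> {}} \<le> infsum \<rho> (I - F)" by (rule infsum_ennreal_mono_set)
  then show ?thesis using that[OF e(1)] F(3) by (meson le_less_trans)
qed

lemma last_time_closure_Q:
  fixes g :: "real \<Rightarrow> complex"
  assumes g: "continuous_on {a..b} g" and p: "p \<in> {a..b}" "g p \<in> closure (Q i)" and b: "g b \<notin> closure (Q i)"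
  obtains s where "p \<le> s" "s < b" "g s \<in> frontier (Q i)" "\<And>r. s < r \<Longrightarrow> r \<le> b \<Longrightarrow> g r \<notin> closure (Q i)"
proof -
  have "closed ({a..b} \<inter> g -` closure (Q i))" by (rule continuous_closed_preimage[OF g]) auto
  then have "compact ({a..b} \<inter> ({a..b} \<inter> g -` closure (Q i)))" by (intro compact_Int_closed) auto
  then have "compact ({a..b} \<inter> g -` closure (Q i))" by (simp add: Int_absorb Int_assoc[symmetric])
  moreover have "{a..b} \<inter> g -` closure (Q i) \<noteq> {}" using p by blast
  ultimately obtain s where s: "s \<in> {a..b}" "g s \<in> closure (Q i)"
    and max: "\<And>r. r \<in> {a..b} \<Longrightarrow> g r \<in> closure (Q i) \<Longrightarrow> r \<le> s"
    using compact_attains_sup[of "{a..b} \<inter> g -` closure (Q i)"] by (metis Int_iff vimageI vimageE)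
  have sb: "s < b" using s b by (cases "s = b") auto
  have "g s \<in> frontier (Q i)"
  proof (cases "g s \<in> Q i")
    case True
    have c: "continuous_on {s..b} g" using g by (rule continuous_on_subset) (use s in auto)
    have "g b \<notin> Q i" using b closure_subset[of "Q i"] by blast
    then obtain s' where s': "s' \<in> {s..b}" "g s' \<in> frontier (Q i)"
      using first_exit_Q[OF c True, of b] sb by auto
    have "g s' \<in> closure (Q i)" using s'(2) by (simp add: frontier_def)
    then have "s' = s" using max[of s'] s' s by auto
    then show ?thesis using s'(2) by simp
  next
    case False
    then show ?thesis using s(2) open_Q[of i] by (simp add: frontier_def interior_open)
  qed
  moreover have "g r \<notin> closure (Q i)" if "s < r" "r \<le> b" for r using max[of r] that s by auto
  ultimately show ?thesis using that[of s] max[OF p] sb by blast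
qed

lemma first_entry_Q:
  fixes g :: "real \<Rightarrow> complex"
  assumes g: "continuous_on {a..b} g" "a \<le> b" "g a \<notin> Q i" "g b \<in> closure (Q i)"
  obtains s where "s \<in> {a..b}" "g s \<in> frontier (Q i)" "\<And>r. a \<le> r \<Longrightarrow> r < s \<Longrightarrow> g r \<notin> closure (Q i)"
  using first_time_closure_Q[OF g(1,3), of b] g(2,4) by auto

section \<open>Maxima over circles along paths\<close>

definition topv :: "(complex \<Rightarrow> real) \<Rightarrow> nat \<Rightarrow> real" where
  "topv f i = real_of_ereal (Mx (\<lambda>x. ereal (f x)) (Q i))"

lemma Mx_topv: "bounded (f ` frontier (Q i)) \<Longrightarrow> Mx (\<lambda>x. ereal (f x)) (Q i) = ereal (topv f i)"
  using Mx_Mn_finite[of f i] by (simp add: topv_def ereal_real')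

lemma topv_bounds:
  assumes "bounded (f ` frontier (Q i))" "x \<in> frontier (Q i)"
  shows "f x \<le> topv f i" "ennreal (topv f i - f x) \<le> od f i"
proof -
  have M: "Mx (\<lambda>x. ereal (f x)) (Q i) = ereal (topv f i)" by (rule Mx_topv[OF assms(1)])
  obtain m where m: "Mn (\<lambda>x. ereal (f x)) (Q i) = ereal m"
    using Mx_Mn_finite[OF assms(1)] by (cases "Mn (\<lambda>x. ereal (f x)) (Q i)") auto
  have "ereal (f x) \<le> ereal (topv f i)" unfolding M[symmetric] Mx_def by (rule SUP_upper[OF assms(2)])
  then show "f x \<le> topv f i" by simp
  have "ereal m \<le> ereal (f x)" unfolding m[symmetric] Mn_def by (rule INF_lower[OF assms(2)])
  then have "topv f i - f x \<le> topv f i - m" by simp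
  then show "ennreal (topv f i - f x) \<le> od f i" by (simp add: od_def osc_def M m ennreal_leI)
qed

lemma topv_abs:
  assumes "bounded (f ` frontier (Q i))" "x \<in> frontier (Q i)"
  shows "ennreal \<bar>topv f i - f x\<bar> \<le> od f i"
  using topv_bounds[OF assms] by simp

text \<open>Between the last visit to the closure of \<open>Q i\<close> and the first subsequent
  visit to that of \<open>Q j\<close> neither disk is met. So the terms \<open>od f i\<close> and
  \<open>od f j\<close> remain free to pay for passing from the maxima to the values at the exit and
  entry points.\<close>

lemma topv_pgrad_le:
  assumes f: "\<And>i. bounded (f ` frontier (Q i))" and g: "continuous_on {p..q} g" and grad: "pgrad f (od f) g p q"
    and pq: "p \<le> q" "g p \<in> Q i" "g q \<in> Q j"
  shows "ennreal \<bar>topv f i - topv f j\<bar> \<le> (\<Sum>\<^sub>\<infinity>k\<in>meeting Q (g ` {p..q}). od f k)"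
proof (cases "i = j")
  case False
  have dis: "x \<in> closure (Q j) \<Longrightarrow> x \<notin> closure (Q i)" for x using Q_unique[of x i j] False by blast
  have cl: "g q \<in> closure (Q j)" "g p \<in> closure (Q i)" using pq closure_subset[of "Q j"] closure_subset[of "Q i"] by auto
  obtain s where s: "p \<le> s" "s < q" "g s \<in> frontier (Q i)" "\<And>r. s < r \<Longrightarrow> r \<le> q \<Longrightarrow> g r \<notin> closure (Q i)"
    by (rule last_time_closure_Q[OF g _ cl(2) dis[OF cl(1)]]) (use pq(1) in auto)
  have gs: "g s \<in> closure (Q i)" "g s \<notin> Q i" using s(3) open_Q[of i] by (auto simp: frontier_def interior_open)
  then have "g s \<notin> Q j" using dis[of "g s"] closure_subset[of "Q j"] by blast
  moreover have "continuous_on {s..q} g" using g by (rule continuous_on_subset) (use s in auto)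
  ultimately obtain t where t: "t \<in> {s..q}" "g t \<in> frontier (Q j)" "\<And>r. s \<le> r \<Longrightarrow> r < t \<Longrightarrow> g r \<notin> closure (Q j)"
    using first_entry_Q[of s q g j] cl(1) s(2) by auto
  let ?K = "meeting Q (g ` {s..t})"
  have gt: "g t \<notin> Q j" using t(2) open_Q[of j] by (auto simp: frontier_def interior_open)
  have iK: "i \<notin> ?K"
  proof
    assume "i \<in> ?K"
    then obtain r where r: "r \<in> {s..t}" "g r \<in> Q i" unfolding meeting_def by blast
    then have "r = s" using s(4)[of r] t(1) closure_subset[of "Q i"] by fastforce
    then show False using r gs by simp
  qed
  have jK: "j \<notin> ?K"
  proof
    assume "j \<in> ?K"
    then obtain r where r: "r \<in> {s..t}" "g r \<in> Q j" unfolding meeting_def by blast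
    then have "r = t" using t(3)[of r] closure_subset[of "Q j"] by fastforce
    then show False using r gt by simp
  qed
  have S: "g s \<in> S" "g t \<in> S" using s(3) t(2) frontier_Q_subset_S by blast+
  have mid: "ennreal \<bar>f (g s) - f (g t)\<bar> \<le> infsum (od f) ?K"
    using pgradD[OF grad, of s t] s t S by auto
  have "\<bar>topv f i - topv f j\<bar> \<le> \<bar>topv f i - f (g s)\<bar> + (\<bar>f (g s) - f (g t)\<bar> + \<bar>topv f j - f (g t)\<bar>)" by linarith
  then have "ennreal \<bar>topv f i - topv f j\<bar> \<le> ennreal \<bar>topv f i - f (g s)\<bar> + (ennreal \<bar>f (g s) - f (g t)\<bar> + ennreal \<bar>topv f j - f (g t)\<bar>)"
    by (subst ennreal_plus[symmetric], simp, simp)+ (rule ennreal_leI)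
  also have "\<dots> \<le> od f i + (infsum (od f) ?K + od f j)"
    by (intro add_mono mid topv_abs f s(3) t(2))
  also have "\<dots> = infsum (od f) (insert i (insert j ?K))"
  proof -
    have "infsum (od f) (insert j ?K) = od f j + infsum (od f) ?K"
      using jK by (intro infsum_insert) (auto intro: nonneg_summable_on_complete)
    moreover have "infsum (od f) (insert i (insert j ?K)) = od f i + infsum (od f) (insert j ?K)"
      using iK False by (intro infsum_insert) (auto intro: nonneg_summable_on_complete)
    ultimately show ?thesis by (simp add: add.commute)
  qed
  also have "\<dots> \<le> infsum (od f) (meeting Q (g ` {p..q}))"
  proof (rule infsum_ennreal_mono_set)
    have "g p \<in> g ` {p..q}" "g q \<in> g ` {p..q}" using pq(1) by auto
    moreover have "g ` {s..t} \<subseteq> g ` {p..q}" using s t by (intro image_mono) auto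
    ultimately show "insert i (insert j ?K) \<subseteq> meeting Q (g ` {p..q})"
      using pq unfolding meeting_def by blast
  qed
  finally show ?thesis .
qed simp

definition nice :: "version \<Rightarrow> (complex \<Rightarrow> real) \<Rightarrow> bool" where
  "nice v f \<longleftrightarrow> regular v f \<and> (\<forall>V. V \<subset>\<subset> \<Omega> \<longrightarrow> (\<Sum>\<^sub>\<infinity>i\<in>meeting Q V. (od f i)\<^sup>2) < \<infinity>)"

lemma nice_bounded: "nice v f \<Longrightarrow> bounded (f ` frontier (Q i))"
  by (simp add: nice_def regular_def)

text \<open>The normalized version depends on \<open>g\<close> only through its maxima and
  oscillations over the circles, and these are unchanged by the passage to real values.\<close>

lemma sobolev_loc_nice:
  assumes "g \<in> sobolev_loc v \<Omega> Q"
  shows "nice v (\<lambda>x. real_of_ereal (g x))"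
    and "normalized_version \<Omega> Q (\<lambda>x. ereal (real_of_ereal (g x))) = normalized_version \<Omega> Q g"
proof -
  have fin: "\<And>i. \<bar>Mx g (Q i)\<bar> \<noteq> \<infinity>" "\<And>i. \<bar>Mn g (Q i)\<bar> \<noteq> \<infinity>" using assms by (auto simp: sobolev_loc_def)
  show "nice v (\<lambda>x. real_of_ereal (g x))"
    using sobolev_loc_regular[OF assms] sobolev_sums_compact[OF assms] finite_Mx_Mn(4)[OF fin]
    by (simp add: nice_def sobolev_sums_def)
  have o: "osc (\<lambda>x. ereal (real_of_ereal (g x))) (Q i) = osc g (Q i)" for i
    using finite_Mx_Mn(4)[OF fin] by (simp add: od_def)
  show "normalized_version \<Omega> Q (\<lambda>x. ereal (real_of_ereal (g x))) = normalized_version \<Omega> Q g"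
    unfolding normalized_version_def[abs_def] accessible_value_def[abs_def] accessible_def good_paths_def
      o finite_Mx_Mn(3)[OF fin] by simp
qed

text \<open>The condition on maxima for good paths is \<open>topv_pgrad_le\<close> on the interval
  between two parameters lying in the two disks; choosing these first covers subpaths over open and
  half-open intervals.\<close>

lemma line_good_path:
  assumes f: "nice v f" and L: "0 < L" and g: "continuous_on {0..L} g" "g ` {0..L} \<subseteq> \<Omega>" "g 0 \<noteq> g L"
    and grad: "pgrad f (od f) g 0 L" and H: "hausdorff 1 (g ` {0..L} \<inter> S) = 0"
    and fin: "(\<Sum>\<^sub>\<infinity>i\<in>meeting Q (g ` {0..L}). od f i) < \<infinity>"
  shows "({0..L}, g) \<in> good_paths \<Omega> Q (\<lambda>x. ereal (f x))"
proof -
  let ?F = "\<lambda>x. ereal (f x)"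
  note bd = nice_bounded[OF f]
  have path: "({0..L}, g) \<in> paths_in \<Omega>" using g L
    by (auto simp: paths_in_def is_path_def trace_def intro!: exI[of _ g])
  have nc: "\<nexists>z. trace ({0..L}, g) = {z}"
  proof
    assume "\<exists>z. trace ({0..L}, g) = {z}"
    then obtain z where "g ` {0..L} = {z}" by (auto simp: trace_def)
    moreover have "g 0 \<in> g ` {0..L}" "g L \<in> g ` {0..L}" using L by auto
    ultimately show False using g(3) by simp
  qed
  have key: "ennreal \<bar>topv f i - topv f j\<bar> \<le> (\<Sum>\<^sub>\<infinity>k\<in>meeting Q (trace \<gamma>'). od f k)"
    if \<gamma>': "is_subpath \<gamma>' ({0..L}, g)" and ij: "i \<in> meeting Q (trace \<gamma>')" "j \<in> meeting Q (trace \<gamma>')" for \<gamma>' i j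
  proof -
    have sub: "fst \<gamma>' \<subseteq> {0..L}" "snd \<gamma>' = g" "is_interval (fst \<gamma>')" using \<gamma>' by (auto simp: is_subpath_def)
    have one: "ennreal \<bar>topv f i - topv f j\<bar> \<le> (\<Sum>\<^sub>\<infinity>k\<in>meeting Q (trace \<gamma>'). od f k)"
      if pq: "p \<le> q" "p \<in> fst \<gamma>'" "q \<in> fst \<gamma>'" "g p \<in> Q i" "g q \<in> Q j" for p q i j
    proof -
      have pqs: "{p..q} \<subseteq> fst \<gamma>'" using mem_is_interval_1_I[OF sub(3) pq(2,3)] by (auto simp del: is_interval_cc)
      then have pqL: "{p..q} \<subseteq> {0..L}" using sub(1) by blast
      have 0: "0 \<le> p" "q \<le> L" using subsetD[OF sub(1) pq(2)] subsetD[OF sub(1) pq(3)] by auto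
      have "ennreal \<bar>topv f i - topv f j\<bar> \<le> (\<Sum>\<^sub>\<infinity>k\<in>meeting Q (g ` {p..q}). od f k)"
        by (rule topv_pgrad_le[OF bd continuous_on_subset[OF g(1) pqL] pgrad_subset[OF grad 0] pq(1,4,5)])
      also have "\<dots> \<le> (\<Sum>\<^sub>\<infinity>k\<in>meeting Q (trace \<gamma>'). od f k)"
        unfolding trace_def sub(2) by (intro infsum_ennreal_mono_set meeting_mono image_mono pqs)
      finally show ?thesis .
    qed
    obtain p q where pq: "p \<in> fst \<gamma>'" "g p \<in> Q i" "q \<in> fst \<gamma>'" "g q \<in> Q j"
      using ij unfolding meeting_def trace_def sub(2) by blast
    show ?thesis
    proof (cases "p \<le> q")
      case True then show ?thesis using one pq by blast
    next
      case False
      then have "ennreal \<bar>topv f j - topv f i\<bar> \<le> (\<Sum>\<^sub>\<infinity>k\<in>meeting Q (trace \<gamma>'). od f k)" using one[of q p j i] pq by simp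
      then show ?thesis by (simp add: abs_minus_commute)
    qed
  qed
  have key': "\<bar>Mx ?F (Q i) - Mx ?F (Q j)\<bar> \<le> enn2ereal (\<Sum>\<^sub>\<infinity>k\<in>meeting Q (trace \<gamma>'). osc ?F (Q k))"
    if "is_subpath \<gamma>' ({0..L}, g)" "i \<in> meeting Q (trace \<gamma>')" "j \<in> meeting Q (trace \<gamma>')" for \<gamma>' i j
  proof -
    have "enn2ereal (ennreal \<bar>topv f i - topv f j\<bar>) \<le> enn2ereal (\<Sum>\<^sub>\<infinity>k\<in>meeting Q (trace \<gamma>'). od f k)"
      using key[OF that] by (simp add: less_eq_ennreal.rep_eq)
    then show ?thesis by (simp add: Mx_topv[OF bd] enn2ereal_ennreal od_def[abs_def])
  qed
  have fin': "(\<Sum>\<^sub>\<infinity>k\<in>meeting Q (trace \<gamma>'). osc ?F (Q k)) < \<infinity>" if "is_subpath \<gamma>' ({0..L}, g)" for \<gamma>'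
  proof -
    have "trace \<gamma>' \<subseteq> g ` {0..L}" using that by (auto simp: is_subpath_def trace_def)
    then have "(\<Sum>\<^sub>\<infinity>k\<in>meeting Q (trace \<gamma>'). od f k) \<le> (\<Sum>\<^sub>\<infinity>k\<in>meeting Q (g ` {0..L}). od f k)"
      by (intro infsum_ennreal_mono_set meeting_mono)
    then show ?thesis using fin by (simp add: od_def[abs_def] order_le_less_trans)
  qed
  have self: "is_subpath ({0..L}, g) ({0..L}, g)" using L by (simp add: is_subpath_def)
  show ?thesis unfolding good_paths_def mem_Collect_eq
    using path nc H key' fin' fin'[OF self] by (auto simp: trace_def)
qed

text \<open>A substitute for continuity at \<open>y\<close>, to be combined with squares of small
  oscillation: all values seen on such a square are then close to \<open>f y\<close>.\<close>

definition radial :: "(complex \<Rightarrow> real) \<Rightarrow> complex \<Rightarrow> bool" where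
  "radial f y \<longleftrightarrow> (\<forall>\<eta>>0. \<exists>r0>0. \<forall>r. 0 < r \<longrightarrow> r \<le> r0 \<longrightarrow> (\<exists>a\<in>vals f {w. supdist y w = r}. \<bar>f y - a\<bar> \<le> \<eta>))"

lemma path_osc_small:
  fixes g :: "real \<Rightarrow> complex"
  assumes f: "\<And>i. bounded (f ` frontier (Q i))" and g: "continuous_on {a..t} g" and at: "a < t"
    and fin: "(\<Sum>\<^sub>\<infinity>i\<in>meeting Q (g ` {a..t}). od f i) < \<infinity>"
    and y: "\<And>i. i \<in> meeting Q (g ` {a..t}) \<Longrightarrow> g t \<notin> closure (Q i)" and \<eta>: "0 < \<eta>"
  obtains c where "a \<le> c" "c < t" "(\<Sum>\<^sub>\<infinity>i\<in>meeting Q (g ` {c..t}). od f i) \<le> ennreal \<eta>"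
proof -
  obtain e where e: "0 < e" "infsum (od f) {i \<in> meeting Q (g ` {a..t}). Q i \<inter> ball (g t) e \<noteq> {}} < ennreal \<eta>"
    by (rule infsum_tail_near[OF fin y, where \<eta> = "ennreal \<eta>"]) (use \<eta> in auto)
  obtain d where d: "d > 0" "\<And>r. r \<in> {a..t} \<Longrightarrow> dist r t < d \<Longrightarrow> dist (g r) (g t) < e"
    using g e(1) at unfolding continuous_on_iff by (metis atLeastAtMost_iff less_imp_le order_refl)
  define c where "c = max a (t - d / 2)"
  have c: "a \<le> c" "c < t" using d(1) at by (auto simp: c_def)
  have "meeting Q (g ` {c..t}) \<subseteq> {i \<in> meeting Q (g ` {a..t}). Q i \<inter> ball (g t) e \<noteq> {}}"
  proof
    fix i assume "i \<in> meeting Q (g ` {c..t})"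
    then obtain r where r: "r \<in> {c..t}" "g r \<in> Q i" unfolding meeting_def by blast
    then have "dist (g r) (g t) < e" using d(1) by (intro d(2)) (auto simp: c_def dist_real_def)
    then have "g r \<in> ball (g t) e" by (simp add: dist_commute)
    moreover have "r \<in> {a..t}" using r c by auto
    ultimately show "i \<in> {i \<in> meeting Q (g ` {a..t}). Q i \<inter> ball (g t) e \<noteq> {}}" using r(2) by (auto simp: meeting_def)
  qed
  then have "infsum (od f) (meeting Q (g ` {c..t})) \<le> ennreal \<eta>"
    using e(2) by (meson infsum_ennreal_mono_set less_imp_le order_trans)
  then show ?thesis using that c by blast
qed

text \<open>No closed disk contains the end point \<open>g t\<close>, so a short final piece of the
  path has a small sum and \<open>f\<close> changes little along it; this piece crosses every
  sufficiently small square about the end point.\<close>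

lemma radial_path:
  fixes g :: "real \<Rightarrow> complex"
  assumes f: "\<And>i. bounded (f ` frontier (Q i))" and g: "continuous_on {a..t} g" "g ` {a..t} \<subseteq> \<Omega>" "inj_on g {a..t}" and at: "a < t"
    and grad: "pgrad f (od f) g a t" and fin: "(\<Sum>\<^sub>\<infinity>i\<in>meeting Q (g ` {a..t}). od f i) < \<infinity>"
    and y: "g t \<in> carpet_interior \<Omega> Q"
  shows "radial f (g t)"
  unfolding radial_def
proof (intro allI impI)
  fix \<eta> :: real assume \<eta>: "0 < \<eta>"
  have yS: "g t \<in> S" and ycl: "g t \<notin> closure (Q i)" for i
    using y S_Int_closure_Q by (auto simp: carpet_interior_def)
  obtain c where c: "a \<le> c" "c < t" "(\<Sum>\<^sub>\<infinity>i\<in>meeting Q (g ` {c..t}). od f i) \<le> ennreal (\<eta> / 3)"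
    by (rule path_osc_small[OF f g(1) at fin ycl, of "\<eta> / 3"]) (use \<eta> in auto)
  have sub: "{c..t} \<subseteq> {a..t}" using c by auto
  have gc: "continuous_on {c..t} g" "g ` {c..t} \<subseteq> \<Omega>" using g sub continuous_on_subset by blast+
  have vd: "vdiam f (g ` {c..t}) (3 * (\<eta> / 3))"
    by (rule vdiam_pgrad[OF f gc pgrad_subset[OF grad c(1) order_refl] c(3)]) (use \<eta> in simp)
  have "g c \<noteq> g t" using inj_onD[OF g(3), of c t] c by auto
  then have p: "0 < supdist (g t) (g c)" using supdist_eq_0[of "g t" "g c"] supdist_nonneg[of "g t" "g c"] by linarith
  have "\<exists>b\<in>vals f {w. supdist (g t) w = r}. \<bar>f (g t) - b\<bar> \<le> \<eta>" if r: "0 < r" "r \<le> supdist (g t) (g c)" for r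
  proof -
    have "connected (g ` {c..t})" using gc(1) by (intro connected_continuous_image) auto
    moreover have "g t \<in> g ` {c..t}" "g c \<in> g ` {c..t}" using c by auto
    moreover have "supdist (g t) (g t) \<le> r" using supdist_eq_0[of "g t" "g t"] r by simp
    ultimately obtain w where w: "w \<in> g ` {c..t}" "supdist (g t) w = r"
      using connected_meets_supdist_sphere r(2) by metis
    obtain b where b: "b \<in> vals f {w}" "b \<in> vals f (g ` {c..t})" using vals_point[OF w(1)] w(1) gc(2) by blast
    have "f (g t) \<in> vals f (g ` {c..t})" using yS c by (auto simp: vals_def)
    then have "\<bar>f (g t) - b\<bar> \<le> \<eta>" using vd b(2) by (auto simp: vdiam_def)
    moreover have "b \<in> vals f {w. supdist (g t) w = r}" using b(1) w(2) by (auto simp: vals_def meeting_def)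
    ultimately show ?thesis by blast
  qed
  then show "\<exists>r0>0. \<forall>r. 0 < r \<longrightarrow> r \<le> r0 \<longrightarrow> (\<exists>b\<in>vals f {w. supdist (g t) w = r}. \<bar>f (g t) - b\<bar> \<le> \<eta>)"
    using p by blast
qed

text \<open>By Sierpinski's theorem an interval is a disjoint union of countably many nonempty
  closed sets only if it is one of them. Were the path after time \<open>s\<close> covered by closed
  disks, their preimages would be such a decomposition, and the one containing \<open>s\<close>
  would be the whole interval, against \<open>out\<close>.\<close>

lemma carpet_interior_on_path:
  fixes g :: "real \<Rightarrow> complex"
  assumes g: "continuous_on {s..b} g" "g ` {s..b} \<subseteq> \<Omega>" and sb: "s < b" and s: "g s \<in> closure (Q i)"
    and out: "\<And>r. s < r \<Longrightarrow> r \<le> b \<Longrightarrow> g r \<notin> closure (Q i)"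
  shows "\<exists>r. s < r \<and> r \<le> b \<and> g r \<in> carpet_interior \<Omega> Q"
proof (rule ccontr)
  assume neg: "\<not> ?thesis"
  define A where "A k = {s..b} \<inter> g -` closure (Q k)" for k
  define \<U> where "\<U> = {A k |k. A k \<noteq> {}}"
  have cov: "\<exists>k. r \<in> A k" if r: "r \<in> {s..b}" for r
  proof (cases "r = s")
    case True
    then show ?thesis using s sb by (auto simp: A_def)
  next
    case False
    then have ni: "g r \<notin> carpet_interior \<Omega> Q" using neg r by auto
    have "g r \<in> \<Omega>" using g(2) r by blast
    then have "\<exists>k. g r \<in> closure (Q k)"
    proof (cases "g r \<in> S")
      case True
      then obtain k where "g r \<in> frontier (Q k)" using ni by (auto simp: carpet_interior_def)
      then show ?thesis by (auto simp: frontier_def)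
    next
      case False
      then obtain k where "g r \<in> Q k" using \<open>g r \<in> \<Omega>\<close> by (auto simp: carpet_def)
      then have "g r \<in> closure (Q k)" using closure_subset[of "Q k"] by blast
      then show ?thesis by blast
    qed
    then show ?thesis using r by (auto simp: A_def)
  qed
  have "\<U> = {{s..b}}"
  proof (rule real_Sierpinski_lemma)
    have "\<U> \<subseteq> range A" by (auto simp: \<U>_def)
    then show "countable \<U>" by (rule countable_subset) simp
    show "pairwise disjnt \<U>"
    proof (rule pairwiseI)
      fix X Y assume XY: "X \<in> \<U>" "Y \<in> \<U>" "X \<noteq> Y"
      then obtain k l where kl: "X = A k" "Y = A l" by (auto simp: \<U>_def)
      then have "k \<noteq> l" using XY(3) by blast
      then show "disjnt X Y" using Q_unique[of _ k l] unfolding kl A_def disjnt_iff by blast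
    qed
    fix C assume "C \<in> \<U>"
    then obtain k where k: "C = A k" "A k \<noteq> {}" by (auto simp: \<U>_def)
    have "closed (A k)" unfolding A_def by (rule continuous_closed_preimage[OF g(1)]) auto
    then show "closed C \<and> C \<noteq> {}" using k by simp
  next
    show "\<Union>\<U> = {s..b}"
    proof
      show "\<Union>\<U> \<subseteq> {s..b}" by (auto simp: \<U>_def A_def)
      show "{s..b} \<subseteq> \<Union>\<U>"
      proof
        fix r assume "r \<in> {s..b}"
        then obtain k where "r \<in> A k" using cov by blast
        then show "r \<in> \<Union>\<U>" unfolding \<U>_def by blast
      qed
    qed
  qed (use sb in simp)
  moreover have "s \<in> A i" using s sb by (simp add: A_def)
  then have "A i \<in> \<U>" unfolding \<U>_def by blast
  ultimately have "A i = {s..b}" by blast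
  then have "b \<in> A i" using sb by simp
  then show False using out[of b] sb by (simp add: A_def)
qed


lemma osc_loop_vdiam:
  assumes "osc_loop x0 {} f \<eta> r" "0 < r"
  shows "vdiam f {w. supdist x0 w = r} \<eta>"
proof -
  have "supdist x0 (x0 + Complex r r) = r" using assms(2) by (simp add: supdist_def)
  then obtain \<beta> where \<beta>: "path_image \<beta> = {w. supdist x0 w = r}" "path_vdiam f (\<Union>j\<in>{}. Q j) \<beta> \<eta>"
    using assms(1) unfolding osc_loop_def by blast
  then show ?thesis
    using \<beta>(2)[unfolded path_vdiam_def, THEN conjunct2, THEN conjunct2, rule_format, of 0 1]
    by (simp add: path_image_def)
qed

text \<open>The path is an arbitrary good path, so it is known only through the disks it meets. It
  crosses squares of small oscillation about \<open>y\<close>, for almost every half-side at a point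
  off the carpet, hence inside a disk. That disk links the maxima along the path to the values on
  the square, and \<open>radial\<close> links these to \<open>f y\<close>.\<close>

lemma normalized_limit:
  assumes f: "nice v f" and y: "y \<in> carpet_interior \<Omega> Q" and rad: "radial f y"
    and \<gamma>0: "\<gamma>0 \<in> good_paths \<Omega> Q (\<lambda>x. ereal (f x))" and acc: "access \<Omega> Q y \<gamma>0 \<gamma>" and \<eta>: "0 < \<eta>"
  shows "\<exists>\<epsilon>>0. \<forall>i\<in>meeting Q (trace \<gamma>). Q i \<subseteq> ball y \<epsilon> \<longrightarrow> \<bar>topv f i - f y\<bar> \<le> \<eta>"
proof (rule ccontr)
  assume neg: "\<not> ?thesis"
  define g where "g = snd \<gamma>0"
  note bd = nice_bounded[OF f]
  have yS: "y \<in> S" and ycl: "y \<notin> closure (Q i)" for i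
    using y S_Int_closure_Q by (auto simp: carpet_interior_def)
  have path: "\<gamma>0 \<in> paths_in \<Omega>" and H0: "hausdorff 1 (trace \<gamma>0 \<inter> S) = 0"
    using \<gamma>0 by (auto simp: good_paths_def)
  have sub: "fst \<gamma> \<noteq> {}" "fst \<gamma> \<subseteq> fst \<gamma>0" "snd \<gamma> = g" "is_interval (fst \<gamma>)"
    using acc path unfolding access_def is_subpath_def paths_in_def is_path_def g_def by (auto split: if_splits)
  obtain h where h: "continuous_on (closure (fst \<gamma>0)) h" "\<And>t. t \<in> fst \<gamma>0 \<Longrightarrow> h t = g t" and bdI: "bounded (fst \<gamma>0)"
    using path unfolding paths_in_def is_path_def g_def by auto
  have g\<Omega>: "g t \<in> \<Omega>" if "t \<in> fst \<gamma>0" for t using path that by (auto simp: paths_in_def trace_def g_def)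
  have "\<forall>n::nat. \<exists>i\<in>meeting Q (trace \<gamma>). Q i \<subseteq> ball y (1 / real (Suc n)) \<and> \<not> \<bar>topv f i - f y\<bar> \<le> \<eta>"
  proof
    fix n :: nat
    have "0 < 1 / real (Suc n)" by simp
    then show "\<exists>i\<in>meeting Q (trace \<gamma>). Q i \<subseteq> ball y (1 / real (Suc n)) \<and> \<not> \<bar>topv f i - f y\<bar> \<le> \<eta>"
      using neg by blast
  qed
  then obtain ix where ix: "\<And>n. ix n \<in> meeting Q (trace \<gamma>)" "\<And>n. Q (ix n) \<subseteq> ball y (1 / real (Suc n))"
    "\<And>n. \<not> \<bar>topv f (ix n) - f y\<bar> \<le> \<eta>" by metis
  have "\<exists>t\<in>fst \<gamma>. g t \<in> Q (ix n)" for n using ix(1)[of n] sub(3) by (auto simp: meeting_def trace_def)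
  then obtain t where t: "\<And>n. t n \<in> fst \<gamma>" "\<And>n. g (t n) \<in> Q (ix n)" by metis
  have "compact (closure (fst \<gamma>))" using bdI sub(2) bounded_subset compact_closure by blast
  moreover have "\<forall>n. t n \<in> closure (fst \<gamma>)" using t(1) closure_subset[of "fst \<gamma>"] by blast
  \<comment> \<open>The parameters of the offending disks accumulate at \<tau>, possibly an end
    point outside the parameter interval; the continuous extension \<open>h\<close> takes the value
    \<open>y\<close> there.\<close>
  ultimately obtain \<tau> k where \<tau>: "\<tau> \<in> closure (fst \<gamma>)" "strict_mono (k :: nat \<Rightarrow> nat)" "(t \<circ> k) \<longlonglongrightarrow> \<tau>"
    unfolding compact_def by blast
  have dk: "dist y (g (t (k n))) < 1 / real (Suc n)" for n
  proof -
    have "dist y (g (t (k n))) < 1 / real (Suc (k n))" using ix(2)[of "k n"] t(2)[of "k n"] by auto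
    also have "\<dots> \<le> 1 / real (Suc n)" using seq_suble[OF \<tau>(2), of n] by (simp add: frac_le)
    finally show ?thesis .
  qed
  have \<tau>0: "\<tau> \<in> closure (fst \<gamma>0)" using \<tau>(1) closure_mono[OF sub(2)] by blast
  have h\<tau>: "h \<tau> = y"
  proof -
    have m: "\<forall>n. (t \<circ> k) n \<in> closure (fst \<gamma>0)" using t(1) sub(2) closure_subset[of "fst \<gamma>0"] by auto
    then have "(h \<circ> (t \<circ> k)) \<longlonglongrightarrow> h \<tau>" using h(1) \<tau>(3) \<tau>0 unfolding continuous_on_sequentially by blast
    moreover have "(h \<circ> (t \<circ> k)) \<longlonglongrightarrow> y"
    proof (rule metric_LIMSEQ_I)
      fix e :: real assume e: "0 < e"
      obtain N where N: "1 / real (Suc N) < e" using nat_approx_posE[OF e] .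
      have "dist ((h \<circ> (t \<circ> k)) n) y < e" if n: "n \<ge> N" for n
      proof -
        have "h (t (k n)) = g (t (k n))" using h(2) t(1) sub(2) by blast
        moreover have "1 / real (Suc n) \<le> 1 / real (Suc N)" using n by (simp add: frac_le)
        ultimately show ?thesis using dk[of n] N by (simp add: dist_commute)
      qed
      then show "\<exists>N. \<forall>n\<ge>N. dist ((h \<circ> (t \<circ> k)) n) y < e" by blast
    qed
    ultimately show ?thesis by (rule LIMSEQ_unique)
  qed
  have y\<Omega>: "y \<in> \<Omega>" using yS by (simp add: carpet_def)
  obtain e0 where e0: "e0 > 0" "cball y e0 \<subseteq> \<Omega>" using open_\<Omega> y\<Omega> open_contains_cball by blast
  have near: "\<exists>d>0. \<forall>s\<in>fst \<gamma>. \<bar>s - \<tau>\<bar> < d \<longrightarrow> g s \<in> ball y e" if e: "e > 0" for e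
  proof -
    obtain d where d: "d > 0" "\<And>s. s \<in> closure (fst \<gamma>0) \<Longrightarrow> dist s \<tau> < d \<Longrightarrow> dist (h s) (h \<tau>) < e"
      using h(1) \<tau>0 e unfolding continuous_on_iff by metis
    have "g s \<in> ball y e" if s: "s \<in> fst \<gamma>" "\<bar>s - \<tau>\<bar> < d" for s
    proof -
      have "s \<in> fst \<gamma>0" "s \<in> closure (fst \<gamma>0)" using s(1) sub(2) closure_subset[of "fst \<gamma>0"] by auto
      then show ?thesis using d(2)[of s] s(2) h(2)[of s] h\<tau> by (simp add: dist_real_def dist_commute)
    qed
    then show ?thesis using d(1) by blast
  qed
  \<comment> \<open>Restricting to a small neighbourhood of \<tau> gives a subpath compactly
    contained in \<Omega>, whose sum is finite although that of the whole path may be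
    infinite.\<close>
  define N where "N d = fst \<gamma> \<inter> {\<tau> - d<..<\<tau> + d}" for d
  have subN: "is_subpath (N d, g) \<gamma>0" if "d > 0" for d
  proof -
    have "\<tau> \<in> {\<tau> - d<..<\<tau> + d}" using that by simp
    then have "{\<tau> - d<..<\<tau> + d} \<inter> fst \<gamma> \<noteq> {}"
      using \<tau>(1) open_Int_closure_eq_empty[OF open_greaterThanLessThan] by blast
    then have "N d \<noteq> {}" by (auto simp: N_def)
    moreover have "is_interval (N d)" unfolding N_def by (intro is_interval_Int sub(4) is_interval_oo)
    ultimately show ?thesis using sub(2) by (auto simp: is_subpath_def N_def g_def)
  qed
  obtain d0 where d0: "d0 > 0" "\<And>s. s \<in> fst \<gamma> \<Longrightarrow> \<bar>s - \<tau>\<bar> < d0 \<Longrightarrow> g s \<in> ball y e0" using near[OF e0(1)] by blast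
  have inb: "g ` N d0 \<subseteq> ball y e0" using d0(2) by (auto simp: N_def abs_less_iff)
  have cc: "trace (N d0, g) \<subset>\<subset> \<Omega>" unfolding compactly_contained_def
  proof
    have c: "closure (trace (N d0, g)) \<subseteq> cball y e0"
      by (rule closure_minimal) (use inb in \<open>auto simp: trace_def\<close>)
    then show "closure (trace (N d0, g)) \<subseteq> \<Omega>" using e0(2) by blast
    show "compact (closure (trace (N d0, g)))" using c bounded_subset[OF bounded_cball] by (simp add: compact_eq_bounded_closed)
  qed
  have "(\<Sum>\<^sub>\<infinity>k\<in>meeting Q (trace (N d0, g)). osc (\<lambda>x. ereal (f x)) (Q k)) < \<infinity>"
    using \<gamma>0 subN[OF d0(1)] cc unfolding good_paths_def by blast
  then have "infsum (od f) (meeting Q (trace (N d0, g))) < \<infinity>" by (simp add: od_def[abs_def])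
  then obtain e where e: "0 < e" "infsum (od f) {i \<in> meeting Q (trace (N d0, g)). Q i \<inter> ball y e \<noteq> {}} < ennreal (\<eta> / 4)"
    by (rule infsum_tail_near[OF _ ycl, where \<eta> = "ennreal (\<eta> / 4)"]) (use \<eta> in auto)
  obtain d' where d': "d' > 0" "\<And>s. s \<in> fst \<gamma> \<Longrightarrow> \<bar>s - \<tau>\<bar> < d' \<Longrightarrow> g s \<in> ball y e" using near[OF e(1)] by blast
  define d where "d = min d0 d'"
  have d: "d > 0" "d \<le> d0" "d \<le> d'" using d0 d' by (auto simp: d_def)
  let ?K = "meeting Q (trace (N d, g))"
  have "?K \<subseteq> {i \<in> meeting Q (trace (N d0, g)). Q i \<inter> ball y e \<noteq> {}}"
  proof
    fix i assume "i \<in> ?K"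
    then obtain s where s: "s \<in> N d" "g s \<in> Q i" unfolding meeting_def trace_def by auto
    have "s \<in> N d0" using s(1) d(2) by (auto simp: N_def)
    moreover have "g s \<in> ball y e" using s(1) d(3) by (intro d'(2)) (auto simp: N_def abs_less_iff)
    ultimately show "i \<in> {i \<in> meeting Q (trace (N d0, g)). Q i \<inter> ball y e \<noteq> {}}"
      using s(2) unfolding meeting_def trace_def by auto
  qed
  then have Ks: "infsum (od f) ?K \<le> ennreal (\<eta> / 4)" using e(2) by (meson infsum_ennreal_mono_set less_imp_le order_trans)
  have Kdiff: "\<bar>topv f i - topv f j\<bar> \<le> \<eta> / 4" if "i \<in> ?K" "j \<in> ?K" for i j
  proof -
    have "\<bar>Mx (\<lambda>x. ereal (f x)) (Q i) - Mx (\<lambda>x. ereal (f x)) (Q j)\<bar> \<le> enn2ereal (infsum (od f) ?K)"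
      using \<gamma>0 subN[OF d(1)] that unfolding good_paths_def od_def[abs_def] by blast
    also have "\<dots> \<le> enn2ereal (ennreal (\<eta> / 4))" using Ks by (simp add: less_eq_ennreal.rep_eq)
    finally show ?thesis using \<eta> by (simp add: Mx_topv[OF bd] enn2ereal_ennreal)
  qed
  have ev: "\<forall>\<^sub>F n in sequentially. t (k n) \<in> N d"
  proof -
    have "\<forall>\<^sub>F n in sequentially. (t \<circ> k) n \<in> {\<tau> - d<..<\<tau> + d}"
      by (rule topological_tendstoD[OF \<tau>(3)]) (use d(1) in auto)
    then show ?thesis using t(1) by (simp add: N_def)
  qed
  then obtain n where n: "t (k n) \<in> N d" using eventually_happens'[OF sequentially_bot] by blast
  define w where "w = g (t (k n))"
  define i where "i = ix (k n)"
  have wi: "w \<in> Q i" using t(2) by (simp add: w_def i_def)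
  have iK: "i \<in> ?K" using wi n unfolding w_def meeting_def trace_def by auto
  have "w \<noteq> y" using wi S_not_Q[OF yS] by blast
  then have wp: "0 < supdist y w" using supdist_eq_0[of y w] supdist_nonneg[of y w] by linarith
  obtain r0 where r0: "r0 > 0" "\<And>r. 0 < r \<Longrightarrow> r \<le> r0 \<Longrightarrow> \<exists>a\<in>vals f {w. supdist y w = r}. \<bar>f y - a\<bar> \<le> \<eta> / 4"
    using rad \<eta> unfolding radial_def by (metis divide_pos_pos zero_less_numeral)
  \<comment> \<open>As \<open>R0\<close> is at most the sup distance of \<open>w\<close> from
    \<open>y\<close>, a square boundary of half-side at most \<open>R0\<close> is crossed between
    \<open>w\<close> and points of the path closer to \<open>y\<close>, because the image of
    \<open>N d\<close> is connected.\<close>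
  define R0 where "R0 = min (e0 / 4) (min r0 (supdist y w))"
  have R0: "R0 > 0" "R0 \<le> e0 / 4" "R0 \<le> r0" "R0 \<le> supdist y w" using e0(1) r0(1) wp by (auto simp: R0_def)
  have R0\<Omega>: "{w. supdist y w \<le> R0} \<subseteq> \<Omega>"
  proof
    fix x assume "x \<in> {w. supdist y w \<le> R0}"
    then have "x \<in> cball y e0" using dist_le_supdist[of y x] R0 e0(1) by simp
    then show "x \<in> \<Omega>" using e0(2) by blast
  qed
  have "{w. supdist y w \<le> R0} \<subset>\<subset> \<Omega>" unfolding compactly_contained_def
    using R0\<Omega> closed_supdist_le[of y R0] compact_supdist_le[of y R0] by (simp add: closure_closed)
  then have fin: "(\<Sum>\<^sub>\<infinity>i\<in>meeting Q {w. supdist y w \<le> R0} - {}. (od f i)\<^sup>2) < \<infinity>" using f by (simp add: nice_def)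
  obtain T where T: "0 < T" "(\<Sum>\<^sub>\<infinity>i\<in>meeting Q {w. supdist y w \<le> R0} - {}. (od f i)\<^sup>2) \<le> ennreal T"
  proof (cases "\<Sum>\<^sub>\<infinity>i\<in>meeting Q {w. supdist y w \<le> R0} - {}. (od f i)\<^sup>2")
    case (real x)
    then show ?thesis using that[of "x + 1"] by (simp add: ennreal_leI)
  next
    case top then show ?thesis using fin by simp
  qed
  obtain \<delta> where \<delta>: "0 < \<delta>" "\<forall>f P. regular v f \<longrightarrow>
      (\<Sum>\<^sub>\<infinity>i\<in>meeting Q {w. supdist y w \<le> R0} - {}. (od f i)\<^sup>2) \<le> ennreal T \<longrightarrow>
      (AE r in lborel. P r) \<longrightarrow> (\<exists>r\<in>{\<delta>..R0}. P r \<and> osc_loop y {} f (\<eta> / 4) r)"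
  proof (rule exE[OF oscillation_radius[of "{}" y R0 "\<eta> / 4" T v]])
    show "y \<notin> closure (Q i)" for i by (rule ycl)
    show "0 < R0" "{w. supdist y w \<le> R0} \<subseteq> \<Omega>" "0 < \<eta> / 4" "0 < T" using R0 R0\<Omega> \<eta> T by auto
  qed (erule conjE, rule that)
  \<comment> \<open>A good path meets the carpet in zero length, so for almost every half-side the
    crossing point is not in the carpet.\<close>
  have "AE r in lborel. r \<notin> supdist y ` (trace \<gamma>0 \<inter> S)" by (rule AE_notin_image_hausdorff_null[OF H0 supdist_Lip])
  then obtain r where r: "r \<in> {\<delta>..R0}" "r \<notin> supdist y ` (trace \<gamma>0 \<inter> S)" "osc_loop y {} f (\<eta> / 4) r"
    using \<delta>(2)[THEN spec, THEN spec, of f "\<lambda>r. r \<notin> supdist y ` (trace \<gamma>0 \<inter> S)"] f T(2) by (auto simp: nice_def)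
  have rp: "0 < r" using r(1) \<delta>(1) by auto
  have vd: "vdiam f {w. supdist y w = r} (\<eta> / 4)" by (rule osc_loop_vdiam[OF r(3) rp])
  obtain a where a: "a \<in> vals f {w. supdist y w = r}" "\<bar>f y - a\<bar> \<le> \<eta> / 4" using r0(2)[OF rp] r(1) R0(3) by auto
  have "\<exists>m. t (k m) \<in> N d \<and> dist y (g (t (k m))) < r"
  proof -
    obtain m0 where m0: "1 / real (Suc m0) < r" using nat_approx_posE[OF rp] .
    have "\<forall>\<^sub>F n in sequentially. t (k n) \<in> N d \<and> n \<ge> m0" using ev eventually_ge_at_top[of m0] by eventually_elim simp
    then obtain m where m: "t (k m) \<in> N d" "m \<ge> m0" using eventually_happens'[OF sequentially_bot] by blast
    have "1 / real (Suc m) \<le> 1 / real (Suc m0)" using m(2) by (simp add: frac_le)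
    then show ?thesis using m(1) dk[of m] m0 by (intro exI[of _ m]) auto
  qed
  then obtain m where m: "t (k m) \<in> N d" "supdist y (g (t (k m))) \<le> r"
    using supdist_le_dist by (meson less_imp_le order_trans)
  have "connected (g ` N d)"
  proof (rule connected_continuous_image)
    have "continuous_on (N d) h"
      using h(1) by (rule continuous_on_subset) (use sub(2) closure_subset[of "fst \<gamma>0"] in \<open>auto simp: N_def\<close>)
    then show "continuous_on (N d) g"
      by (rule continuous_on_cong[THEN iffD1, rotated -1]) (use h(2) sub(2) in \<open>auto simp: N_def\<close>)
    show "connected (N d)" using subN[OF d(1)] by (simp add: is_subpath_def is_interval_connected)
  qed
  then obtain p where p: "p \<in> g ` N d" "supdist y p = r"
    using connected_meets_supdist_sphere[of "g ` N d" "g (t (k m))" w y r] m n r(1) R0(4) by (auto simp: w_def)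
  then obtain s where s: "s \<in> N d" "p = g s" by blast
  have s0: "s \<in> fst \<gamma>0" using s(1) sub(2) by (auto simp: N_def)
  have "p \<notin> S" using r(2) p(2) s(2) s0 by (auto simp: trace_def g_def)
  then obtain l where l: "p \<in> Q l" using g\<Omega>[OF s0] s(2) by (auto simp: carpet_def)
  have lK: "l \<in> ?K" using l s unfolding meeting_def trace_def by auto
  obtain x where x: "x \<in> frontier (Q l)" using frontier_Q_nonempty[of l] by blast
  have "l \<in> meeting Q {w. supdist y w = r}" using l p(2) by (auto simp: meeting_def)
  then have "f x \<in> vals f {w. supdist y w = r}" using x by (auto simp: vals_def)
  then have xa: "\<bar>f x - a\<bar> \<le> \<eta> / 4" using vd a(1) by (auto simp: vdiam_def)
  have "ennreal \<bar>topv f l - f x\<bar> \<le> ennreal (\<eta> / 4)"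
    using topv_abs[OF bd x] infsum_ennreal_ge[OF lK, of "od f"] Ks by (meson order_trans)
  then have "\<bar>topv f l - f x\<bar> \<le> \<eta> / 4" using \<eta> by simp
  \<comment> \<open>Four quarters: along the path from \<open>i\<close> to \<open>l\<close>, from
    the maximum on the circle of \<open>l\<close> to a value on it, between two values seen on the
    square, and from the square to \<open>f y\<close>.\<close>
  then have "\<bar>topv f i - f y\<bar> \<le> \<eta>" using Kdiff[OF iK lK] xa a(2) by linarith
  then show False using ix(3) by (simp add: i_def)
qed

section \<open>Passing to lower limits\<close>

lemma eventually_disks_to:
  assumes "0 < \<epsilon>" "\<And>i. i \<in> meeting Q (trace \<gamma>) \<Longrightarrow> Q i \<subseteq> ball y \<epsilon> \<Longrightarrow> P i"
  shows "eventually P (disks_to Q y \<gamma>)"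
  unfolding disks_to_def
  by (rule eventually_INF1[of \<epsilon>]) (use assms in \<open>auto simp: eventually_principal\<close>)

text \<open>Over the trivial filter the lower limit is \<infinity>; the assumption
  \<open>fin\<close> excludes this case.\<close>

lemma Liminf_disks_to:
  assumes f: "\<And>i. bounded (f ` frontier (Q i))" and lim: "\<And>\<eta>. 0 < \<eta> \<Longrightarrow>
      \<exists>\<epsilon>>0. \<forall>i\<in>meeting Q (trace \<gamma>). Q i \<subseteq> ball y \<epsilon> \<longrightarrow> \<bar>topv f i - c\<bar> \<le> \<eta>"
    and fin: "Liminf (disks_to Q y \<gamma>) (\<lambda>i. Mx (\<lambda>x. ereal (f x)) (Q i)) \<noteq> \<infinity>"
  shows "Liminf (disks_to Q y \<gamma>) (\<lambda>i. Mx (\<lambda>x. ereal (f x)) (Q i)) = ereal c"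
proof (rule lim_imp_Liminf)
  show "disks_to Q y \<gamma> \<noteq> bot" using fin by (auto simp: top_ereal_def)
  have "(topv f \<longlongrightarrow> c) (disks_to Q y \<gamma>)"
  proof (rule tendstoI)
    fix e :: real assume "0 < e"
    then have "0 < e / 2" by simp
    from lim[OF this] obtain \<epsilon> where \<epsilon>: "0 < \<epsilon>"
      "\<And>i. i \<in> meeting Q (trace \<gamma>) \<Longrightarrow> Q i \<subseteq> ball y \<epsilon> \<Longrightarrow> \<bar>topv f i - c\<bar> \<le> e / 2" by blast
    show "\<forall>\<^sub>F i in disks_to Q y \<gamma>. dist (topv f i) c < e"
      by (rule eventually_disks_to[OF \<epsilon>(1)]) (use \<epsilon>(2) \<open>0 < e\<close> in \<open>force simp: dist_real_def\<close>)
  qed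
  then show "((\<lambda>i. Mx (\<lambda>x. ereal (f x)) (Q i)) \<longlongrightarrow> ereal c) (disks_to Q y \<gamma>)"
    unfolding Mx_topv[OF f] by (rule tendsto_ereal)
qed

text \<open>The path behind the value is picked by choice; all that is available is that it gives
  access to \<open>y\<close>, so the limit has to be computed for every such path.\<close>

lemma accessible_value_access:
  assumes "y \<in> accessible \<Omega> Q g"
  obtains \<gamma>0 \<gamma> where "\<gamma>0 \<in> good_paths \<Omega> Q g" "access \<Omega> Q y \<gamma>0 \<gamma>"
    "accessible_value \<Omega> Q g y = Liminf (disks_to Q y \<gamma>) (\<lambda>i. Mx g (Q i))"
proof -
  let ?P = "\<lambda>\<gamma>. \<exists>\<gamma>0\<in>good_paths \<Omega> Q g. access \<Omega> Q y \<gamma>0 \<gamma>"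
  have "\<exists>\<gamma>. ?P \<gamma>" using assms by (auto simp: accessible_def)
  then have "?P (SOME \<gamma>. ?P \<gamma>)" by (rule someI_ex)
  then show ?thesis using that unfolding accessible_value_def by blast
qed

lemma normalized_eq_on_interior:
  assumes f: "nice v f" and u: "\<And>x. x \<in> S \<Longrightarrow> ereal (u x) = normalized_version \<Omega> Q (\<lambda>x. ereal (f x)) x"
    and y: "y \<in> carpet_interior \<Omega> Q" "radial f y" and \<gamma>: "\<gamma> \<in> good_paths \<Omega> Q (\<lambda>x. ereal (f x))" "y \<in> trace \<gamma>"
  shows "u y = f y"
proof -
  let ?F = "\<lambda>x. ereal (f x)"
  have yS: "y \<in> S" using y(1) by (simp add: carpet_interior_def)
  have "access \<Omega> Q y \<gamma> \<gamma>" using y(1) \<gamma>(2) by (simp add: access_def)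
  then have ac: "y \<in> accessible \<Omega> Q ?F" using \<gamma>(1) yS unfolding accessible_def by blast
  obtain \<gamma>0 \<gamma>1 where g: "\<gamma>0 \<in> good_paths \<Omega> Q ?F" "access \<Omega> Q y \<gamma>0 \<gamma>1"
    "accessible_value \<Omega> Q ?F y = Liminf (disks_to Q y \<gamma>1) (\<lambda>i. Mx ?F (Q i))" by (rule accessible_value_access[OF ac])
  have uy: "ereal (u y) = Liminf (disks_to Q y \<gamma>1) (\<lambda>i. Mx ?F (Q i))"
    using u[OF yS] ac g(3) by (simp add: normalized_version_def)
  then have "Liminf (disks_to Q y \<gamma>1) (\<lambda>i. Mx ?F (Q i)) = ereal (f y)"
    by (intro Liminf_disks_to[OF nice_bounded[OF f] normalized_limit[OF f y g(1,2)]]) auto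
  then show ?thesis using uy by simp
qed

text \<open>By \<open>link\<close> each circle carries a point where \<open>f\<close> agrees with
  \<open>u\<close>, so for the disks not in \<open>J\<close> inside \<open>W\<close> the maximum of
  \<open>f\<close> is within \<open>od f i\<close> of a value between \<open>lo\<close> and
  \<open>hi\<close>. Near \<open>x\<close> only finitely many disks have oscillation at least
  \<eta>, and small enough balls about \<open>x\<close> contain neither these nor the disks of
  \<open>J\<close>.\<close>

lemma normalized_bounds_accessible:
  assumes f: "nice v f" and W: "open W" and J: "finite J"
    and link: "\<And>i. \<exists>y\<in>frontier (Q i). u y = f y"
    and u: "\<And>x. x \<in> S \<Longrightarrow> ereal (u x) = normalized_version \<Omega> Q (\<lambda>x. ereal (f x)) x"
    and bds: "\<And>i z. i \<notin> J \<Longrightarrow> Q i \<subseteq> W \<Longrightarrow> z \<in> frontier (Q i) \<Longrightarrow> lo \<le> u z \<and> u z \<le> hi"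
    and x: "x \<in> accessible \<Omega> Q (\<lambda>x. ereal (f x))" "x \<in> W"
  shows "lo \<le> u x \<and> u x \<le> hi"
proof -
  let ?F = "\<lambda>x. ereal (f x)"
  note bd = nice_bounded[OF f]
  have xS: "x \<in> S" using x(1) by (simp add: accessible_def)
  obtain \<gamma>0 \<gamma> where g: "\<gamma>0 \<in> good_paths \<Omega> Q ?F" "access \<Omega> Q x \<gamma>0 \<gamma>"
    "accessible_value \<Omega> Q ?F x = Liminf (disks_to Q x \<gamma>) (\<lambda>i. Mx ?F (Q i))" by (rule accessible_value_access[OF x(1)])
  have ux: "ereal (u x) = Liminf (disks_to Q x \<gamma>) (\<lambda>i. Mx ?F (Q i))"
    using u[OF xS] x(1) g(3) by (simp add: normalized_version_def)
  then have nb: "disks_to Q x \<gamma> \<noteq> bot" by (auto simp: top_ereal_def)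
  have ev: "\<forall>\<^sub>F i in disks_to Q x \<gamma>. ereal lo \<le> Mx ?F (Q i) \<and> Mx ?F (Q i) \<le> ereal (hi + \<eta>)" if \<eta>: "0 < \<eta>" for \<eta>
  proof -
    have "x \<in> \<Omega>" using xS by (simp add: carpet_def)
    then obtain e where e: "e > 0" "cball x e \<subseteq> \<Omega> \<inter> W"
      using open_contains_cball[of "\<Omega> \<inter> W"] open_\<Omega> W x(2) by blast
    have "ball x e \<subset>\<subset> \<Omega>" using e by (auto simp: compactly_contained_def)
    then have fin: "(\<Sum>\<^sub>\<infinity>i\<in>meeting Q (ball x e). (od f i)\<^sup>2) < \<infinity>" using f by (simp add: nice_def)
    define B where "B = {i \<in> meeting Q (ball x e). ennreal (\<eta>\<^sup>2) \<le> (od f i)\<^sup>2}"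
    have "finite B" unfolding B_def by (rule infsum_ennreal_finite_small[OF fin]) (use \<eta> in auto)
    \<comment> \<open>One witness point in each excluded disk is enough: a ball missing it cannot
      contain the disk. This also covers an excluded disk with \<open>x\<close> on its
      circle.\<close>
    have "\<forall>j. \<exists>z. z \<in> Q j" using Q_nonempty by blast
    then obtain zz where zz: "zz j \<in> Q j" for j by metis
    have "finite (zz ` (J \<union> B))" using J \<open>finite B\<close> by simp
    moreover have "x \<notin> zz ` (J \<union> B)" using zz S_not_Q[OF xS] by blast
    ultimately obtain e' where e': "e' > 0" "ball x e' \<subseteq> - (zz ` (J \<union> B))"
      using open_contains_ball[of "- (zz ` (J \<union> B))"] finite_imp_closed by (metis ComplI open_Compl)
    show ?thesis
    proof (rule eventually_disks_to[of "min e e'"])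
      show "0 < min e e'" using e e' by simp
      fix i assume i: "Q i \<subseteq> ball x (min e e')"
      have "zz i \<in> ball x e'" using zz[of i] i by auto
      then have iJ: "i \<notin> J" "i \<notin> B" using e'(2) by blast+
      have ie: "Q i \<subseteq> ball x e" using i by auto
      have iW: "Q i \<subseteq> W" using ie e(2) ball_subset_cball[of x e] by blast
      have "i \<in> meeting Q (ball x e)" using ie zz[of i] by (auto simp: meeting_def)
      then have "(od f i)\<^sup>2 \<le> ennreal (\<eta>\<^sup>2)" using iJ(2) by (simp add: B_def)
      then have od: "od f i \<le> ennreal \<eta>" using \<eta> by (simp add: ennreal_power[symmetric] ennreal_power2_le_iff)
      obtain y where y: "y \<in> frontier (Q i)" "u y = f y" using link by blast
      have b: "lo \<le> f y" "f y \<le> hi" using bds[OF iJ(1) iW y(1)] y(2) by auto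
      have "ennreal (topv f i - f y) \<le> ennreal \<eta>" using topv_bounds(2)[OF bd y(1)] od by (rule order_trans)
      then have "topv f i - f y \<le> \<eta>" using \<eta> by (simp add: ennreal_le_iff)
      then show "ereal lo \<le> Mx ?F (Q i) \<and> Mx ?F (Q i) \<le> ereal (hi + \<eta>)"
        using b topv_bounds(1)[OF bd y(1)] by (simp add: Mx_topv[OF bd])
    qed
  qed
  have "ereal lo \<le> ereal (u x)" unfolding ux
    by (rule Liminf_bounded, rule eventually_mono[OF ev[of 1]]) auto
  moreover have "u x \<le> hi + \<eta>" if "0 < \<eta>" for \<eta>
  proof -
    have "ereal (u x) \<le> Limsup (disks_to Q x \<gamma>) (\<lambda>i. Mx ?F (Q i))" unfolding ux by (rule Liminf_le_Limsup[OF nb])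
    also have "\<dots> \<le> ereal (hi + \<eta>)" by (rule Limsup_bounded, rule eventually_mono[OF ev[OF that]]) auto
    finally show ?thesis by simp
  qed
  ultimately show ?thesis by (auto intro: field_le_epsilon)
qed

text \<open>At a point that is not accessible the value is a lower limit of values at accessible
  points, on the same circle or nearby. Since \<open>u\<close> is real, the filter is nontrivial and
  both bounds pass to the limit.\<close>

lemma normalized_bounds:
  assumes f: "nice v f" and W: "open W" and J: "finite J"
    and link: "\<And>i. \<exists>y\<in>frontier (Q i). u y = f y"
    and u: "\<And>x. x \<in> S \<Longrightarrow> ereal (u x) = normalized_version \<Omega> Q (\<lambda>x. ereal (f x)) x"
    and bds: "\<And>i z. i \<notin> J \<Longrightarrow> Q i \<subseteq> W \<Longrightarrow> z \<in> frontier (Q i) \<Longrightarrow> lo \<le> u z \<and> u z \<le> hi"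
    and x: "x \<in> S" "x \<in> W"
  shows "lo \<le> u x \<and> u x \<le> hi"
proof (cases "x \<in> accessible \<Omega> Q (\<lambda>x. ereal (f x))")
  case True
  show ?thesis
    by (rule normalized_bounds_accessible[OF f W J link], erule u, erule (2) bds, rule True, rule x(2))
next
  case False
  let ?F = "\<lambda>x. ereal (f x)"
  have acc: "\<exists>z. accessible_value \<Omega> Q ?F y = ereal z \<and> lo \<le> z \<and> z \<le> hi" if y: "y \<in> accessible \<Omega> Q ?F" "y \<in> W" for y
  proof -
    have "y \<in> S" using y(1) by (simp add: accessible_def)
    then have "accessible_value \<Omega> Q ?F y = ereal (u y)" using u y(1) by (simp add: normalized_version_def)
    moreover have "lo \<le> u y \<and> u y \<le> hi"
      by (rule normalized_bounds_accessible[OF f W J link], erule u, erule (2) bds, rule y(1), rule y(2))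
    ultimately show ?thesis by blast
  qed
  have main: "lo \<le> u x \<and> u x \<le> hi" if A: "A \<subseteq> accessible \<Omega> Q ?F" and e: "ereal (u x) = Liminf (at x within A) (accessible_value \<Omega> Q ?F)" for A
  proof -
    have nb: "at x within A \<noteq> bot" using e by (auto simp: top_ereal_def)
    have ev: "\<forall>\<^sub>F y in at x within A. ereal lo \<le> accessible_value \<Omega> Q ?F y \<and> accessible_value \<Omega> Q ?F y \<le> ereal hi"
      unfolding eventually_at_topological using W x(2) acc A by (intro exI[of _ W]) force
    have "ereal lo \<le> ereal (u x)" unfolding e by (rule Liminf_bounded, rule eventually_mono[OF ev]) auto
    moreover have "ereal (u x) \<le> ereal hi"
    proof -
      have "ereal (u x) \<le> Limsup (at x within A) (accessible_value \<Omega> Q ?F)" unfolding e by (rule Liminf_le_Limsup[OF nb])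
      also have "\<dots> \<le> ereal hi" by (rule Limsup_bounded, rule eventually_mono[OF ev]) auto
      finally show ?thesis .
    qed
    ultimately show ?thesis by simp
  qed
  show ?thesis
  proof (cases "\<exists>i. x \<in> frontier (Q i)")
    case True
    then show ?thesis using False u[OF x(1)]
      by (intro main[of "{y \<in> accessible \<Omega> Q ?F. y \<in> frontier (Q (THE i. x \<in> frontier (Q i)))}"]) (auto simp: normalized_version_def)
  next
    case ne: False
    then show ?thesis using False u[OF x(1)] by (intro main[of "accessible \<Omega> Q ?F"]) (auto simp: normalized_version_def)
  qed
qed


lemma path_osc_small_right:
  fixes g :: "real \<Rightarrow> complex"
  assumes f: "\<And>i. bounded (f ` frontier (Q i))" and g: "continuous_on {t..b} g" and tb: "t < b"
    and fin: "(\<Sum>\<^sub>\<infinity>i\<in>meeting Q (g ` {t..b}). od f i) < \<infinity>"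
    and y: "\<And>i. i \<in> meeting Q (g ` {t..b}) \<Longrightarrow> g t \<notin> closure (Q i)" and \<eta>: "0 < \<eta>"
  obtains c where "t < c" "c \<le> b" "(\<Sum>\<^sub>\<infinity>i\<in>meeting Q (g ` {t..c}). od f i) \<le> ennreal \<eta>"
proof -
  let ?h = "\<lambda>s. g (t + b - s)"
  have im: "?h ` {c..b} = g ` {t..t + b - c}" for c by (simp add: image_reverse)
  have "continuous_on {t..b} ?h"
    by (rule continuous_on_compose2[OF g]) (auto intro!: continuous_intros)
  then obtain c where c: "t \<le> c" "c < b" "(\<Sum>\<^sub>\<infinity>i\<in>meeting Q (?h ` {c..b}). od f i) \<le> ennreal \<eta>"
    by (rule path_osc_small[OF f _ tb _ _ \<eta>, where g = ?h]) (use fin y in \<open>simp_all add: im\<close>)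
  show ?thesis using that[of "t + b - c"] c im by simp
qed

text \<open>On a segment that leaves \<open>Q i\<close> and is generic for both functions, points of
  the carpet lying on no circle accumulate at the last exit point. There \<open>u\<close> and
  \<open>f\<close> agree, and along the segment both approach their values at the exit point,
  because the sums over short pieces are small.\<close>

lemma normalized_link:
  assumes f: "nice v f" and u: "nice v u"
    and norm: "\<And>x. x \<in> S \<Longrightarrow> ereal (u x) = normalized_version \<Omega> Q (\<lambda>x. ereal (f x)) x"
  shows "\<exists>y\<in>frontier (Q i). u y = f y"
proof -
  note bd = nice_bounded[OF f] nice_bounded[OF u]
  obtain q where q: "q \<in> frontier (Q i)" using frontier_Q_nonempty[of i] by blast
  have qcl: "q \<in> closure (Q i)" using q by (simp add: frontier_def)
  have "q \<in> \<Omega>" using qcl closure_Q_subset[of i] by blast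
  then obtain r where r: "r > 0" "cball q r \<subseteq> \<Omega>" using open_\<Omega> open_contains_cball by blast
  have cc: "ball q r \<subset>\<subset> \<Omega>" using r by (auto simp: compactly_contained_def)
  have qb: "q \<in> ball q r" using r(1) by simp
  obtain z where z: "z \<in> Q i" "z \<in> ball q r"
    using open_Int_closure_eq_empty[OF open_ball, of q r "Q i"] qb qcl by blast
  obtain z' where z': "z' \<in> - closure (Q i)" "z' \<in> ball q r"
    using open_Int_closure_eq_empty[OF open_ball, of q r "- closure (Q i)"] qb frontier_Q_closure_exterior[OF q] by blast
  have ne: "z \<noteq> z'" using z(1) z'(1) closure_subset[of "Q i"] by blast
  have op: "open (- closure (Q i))" by (intro open_Compl closed_closure)
  obtain e L s0 where e: "cmod e = 1" "L > 0" "s0 > 0"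
    "\<And>s. s \<in> {-s0..s0} \<Longrightarrow> pline z e s 0 \<in> Q i \<and> pline z e s L \<in> - closure (Q i) \<and> pline z e s ` {0..L} \<subseteq> ball q r"
    by (rule parallel_segments[OF open_Q op z(1) z'(1) z(2) z'(2) ne]) blast
  obtain \<Gamma>f where \<Gamma>f: "carpet_mod v \<Omega> Q \<Gamma>f = 0"
    "\<forall>\<gamma>\<in>paths_in \<Omega> - \<Gamma>f. \<forall>a b. {a..b} \<subseteq> fst \<gamma> \<longrightarrow> pgrad f (od f) (snd \<gamma>) a b"
    using f unfolding nice_def regular_def by (elim exE conjE) (rule that)
  obtain \<Gamma>u where \<Gamma>u: "carpet_mod v \<Omega> Q \<Gamma>u = 0"
    "\<forall>\<gamma>\<in>paths_in \<Omega> - \<Gamma>u. \<forall>a b. {a..b} \<subseteq> fst \<gamma> \<longrightarrow> pgrad u (od u) (snd \<gamma>) a b"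
    using u unfolding nice_def regular_def by (elim exE conjE) (rule that)
  let ?J = "meeting Q (ball q r)"
  have ss: "infsum (\<lambda>i. (od f i)\<^sup>2) ?J < \<infinity>" "infsum (\<lambda>i. (od u i)\<^sup>2) ?J < \<infinity>" using f u cc by (auto simp: nice_def)
  have "AE s in lborel. s \<in> {-s0..s0} \<longrightarrow> ({0..L}, pline z e s) \<notin> \<Gamma>f \<and> ({0..L}, pline z e s) \<notin> \<Gamma>u \<and>
      hausdorff 1 (pline z e s ` {0..L} \<inter> S) = 0 \<and>
      (\<Sum>\<^sub>\<infinity>i\<in>meeting Q (pline z e s ` {0..L}) \<inter> ?J. od f i) < \<infinity> \<and> (\<Sum>\<^sub>\<infinity>i\<in>meeting Q (pline z e s ` {0..L}) \<inter> ?J. od u i) < \<infinity>"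
    using carpet_mod_AE_pline[OF \<Gamma>f(1) e(1,2), of "-s0" s0 z] carpet_mod_AE_pline[OF \<Gamma>u(1) e(1,2), of "-s0" s0 z]
      AE_pline_hausdorff1[OF e(1), of z "{0..L}"] AE_pline_sum_finite[OF ss(1) e(1), of "-s0" s0 z 0 L]
      AE_pline_sum_finite[OF ss(2) e(1), of "-s0" s0 z 0 L]
    by eventually_elim blast
  from AE_E_interval[OF this, of "-s0" s0] e(3) obtain s where s: "s \<in> {-s0..s0}"
    "({0..L}, pline z e s) \<notin> \<Gamma>f" "({0..L}, pline z e s) \<notin> \<Gamma>u" "hausdorff 1 (pline z e s ` {0..L} \<inter> S) = 0"
    "(\<Sum>\<^sub>\<infinity>i\<in>meeting Q (pline z e s ` {0..L}) \<inter> ?J. od f i) < \<infinity>"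
    "(\<Sum>\<^sub>\<infinity>i\<in>meeting Q (pline z e s ` {0..L}) \<inter> ?J. od u i) < \<infinity>" by auto
  define g where "g = pline z e s"
  have g0: "g 0 \<in> Q i" "g L \<notin> closure (Q i)" and gb: "g ` {0..L} \<subseteq> ball q r" using e(4)[OF s(1)] by (auto simp: g_def)
  have g\<Omega>: "g ` {0..L} \<subseteq> \<Omega>" using gb r(2) ball_subset_cball[of q r] by blast
  have gc: "continuous_on A g" for A unfolding g_def by (rule continuous_pline)
  have ginj: "inj_on g A" for A
  proof (rule inj_onI)
    fix a b assume "g a = g b"
    then have "dist (pline z e s a) (pline z e s b) = 0" by (simp add: g_def)
    then show "a = b" by (simp add: pline_dist[OF e(1)] complex_eq_iff)
  qed
  have path: "({0..L}, g) \<in> paths_in \<Omega>" using g\<Omega> gc e(2)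
    by (auto simp: paths_in_def is_path_def trace_def intro!: exI[of _ g])
  have "({0..L}, g) \<in> paths_in \<Omega> - \<Gamma>f" "({0..L}, g) \<in> paths_in \<Omega> - \<Gamma>u" using path s(2,3) by (auto simp: g_def)
  from bspec[OF \<Gamma>f(2) this(1)] bspec[OF \<Gamma>u(2) this(2)]
  have gr: "pgrad f (od f) g 0 L" "pgrad u (od u) g 0 L" by auto
  have "meeting Q (g ` {0..L}) \<inter> ?J = meeting Q (g ` {0..L})" using gb by (auto simp: meeting_def)
  then have fin: "infsum (od f) (meeting Q (g ` {0..L})) < \<infinity>" "infsum (od u) (meeting Q (g ` {0..L})) < \<infinity>"
    using s(5,6) by (simp_all add: g_def)
  have "g 0 \<noteq> g L" using inj_onD[OF ginj, of 0 L UNIV] e(2) by auto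
  then have good: "({0..L}, g) \<in> good_paths \<Omega> Q (\<lambda>x. ereal (f x))"
    using line_good_path[OF f e(2) gc g\<Omega> _ gr(1) _ fin(1)] s(4) by (simp add: g_def)
  have g0cl: "g 0 \<in> closure (Q i)" using g0(1) closure_subset[of "Q i"] by blast
  have mem: "0 \<in> {0..L}" using e(2) by simp
  obtain t where t: "0 \<le> t" "t < L" "g t \<in> frontier (Q i)" "\<And>r. t < r \<Longrightarrow> r \<le> L \<Longrightarrow> g r \<notin> closure (Q i)"
    by (rule last_time_closure_Q[OF gc mem g0cl g0(2)]) blast
  have tS: "g t \<in> S" using t(3) frontier_Q_subset_S[of i] by blast
  have tcl: "g t \<in> closure (Q i)" "g t \<notin> Q i" using t(3) open_Q[of i] by (auto simp: frontier_def interior_open)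
  have sub: "g ` {t..L} \<subseteq> g ` {0..L}" using t(1) by (intro image_mono) auto
  have fin': "infsum (od f) (meeting Q (g ` {t..L})) < \<infinity>" "infsum (od u) (meeting Q (g ` {t..L})) < \<infinity>"
    using fin infsum_ennreal_mono_set[OF meeting_mono[OF sub]] by (meson le_less_trans)+
  \<comment> \<open>The piece after the last exit does not meet \<open>Q i\<close>, the only disk
    with the exit point in its closure, so the sums over shorter and shorter pieces tend to
    0.\<close>
  have out: "g t \<notin> closure (Q k)" if k: "k \<in> meeting Q (g ` {t..L})" for k
  proof
    assume "g t \<in> closure (Q k)"
    then have ki: "k = i" using Q_unique[of "g t" k i] tcl(1) by simp
    obtain p where p: "p \<in> {t..L}" "g p \<in> Q i" using k unfolding ki meeting_def by blast
    then have "p = t" using t(4)[of p] closure_subset[of "Q i"] by fastforce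
    then show False using p tcl by simp
  qed
  have eq: "u (g p) = f (g p)" if p: "t < p" "p \<le> L" "g p \<in> carpet_interior \<Omega> Q" for p
  proof (rule normalized_eq_on_interior[OF f norm p(3) _ good])
    have sp: "g ` {0..p} \<subseteq> g ` {0..L}" using p by (intro image_mono) auto
    show "radial f (g p)"
    proof (rule radial_path[OF bd(1) gc _ ginj _ _ _ p(3), of 0])
      show "g ` {0..p} \<subseteq> \<Omega>" using sp g\<Omega> by blast
      show "0 < p" using p t by simp
      show "pgrad f (od f) g 0 p" by (rule pgrad_subset[OF gr(1)]) (use p in auto)
      show "infsum (od f) (meeting Q (g ` {0..p})) < \<infinity>"
        using fin(1) infsum_ennreal_mono_set[OF meeting_mono[OF sp]] by (meson le_less_trans)
    qed
    show "g p \<in> trace ({0..L}, g)" using p t by (simp add: trace_def)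
  qed
  have small: "\<bar>u (g t) - f (g t)\<bar> \<le> 2 * \<eta>" if \<eta>: "0 < \<eta>" for \<eta>
  proof -
    obtain cf where cf: "t < cf" "cf \<le> L" "infsum (od f) (meeting Q (g ` {t..cf})) \<le> ennreal \<eta>"
      by (rule path_osc_small_right[OF bd(1) gc t(2) fin'(1) out \<eta>])
    obtain cu where cu: "t < cu" "cu \<le> L" "infsum (od u) (meeting Q (g ` {t..cu})) \<le> ennreal \<eta>"
      by (rule path_osc_small_right[OF bd(2) gc t(2) fin'(2) out \<eta>])
    define c where "c = min cf cu"
    have c: "t < c" "c \<le> L" "c \<le> cf" "c \<le> cu" using cf cu by (auto simp: c_def)
    have "g ` {t..c} \<subseteq> \<Omega>" using g\<Omega> t(1) c by auto
    then obtain p where p: "t < p" "p \<le> c" "g p \<in> carpet_interior \<Omega> Q"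
      using carpet_interior_on_path[OF gc _ c(1) tcl(1)] t(4) c(2) by (metis order_trans)
    have pS: "g p \<in> S" using p(3) by (simp add: carpet_interior_def)
    have "ennreal \<bar>f (g t) - f (g p)\<bar> \<le> infsum (od f) (meeting Q (g ` {t..p}))"
      using t(1) p c by (intro pgradD[OF gr(1)] tS pS) auto
    also have "\<dots> \<le> infsum (od f) (meeting Q (g ` {t..cf}))"
      using p c by (intro infsum_ennreal_mono_set meeting_mono image_mono) auto
    also note cf(3)
    finally have 1: "\<bar>f (g t) - f (g p)\<bar> \<le> \<eta>" using \<eta> by simp
    have "ennreal \<bar>u (g t) - u (g p)\<bar> \<le> infsum (od u) (meeting Q (g ` {t..p}))"
      using t(1) p c by (intro pgradD[OF gr(2)] tS pS) auto
    also have "\<dots> \<le> infsum (od u) (meeting Q (g ` {t..cu}))"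
      using p c by (intro infsum_ennreal_mono_set meeting_mono image_mono) auto
    also note cu(3)
    finally have 2: "\<bar>u (g t) - u (g p)\<bar> \<le> \<eta>" using \<eta> by simp
    have "u (g p) = f (g p)" using eq p c by auto
    then show ?thesis using 1 2 by linarith
  qed
  have "u (g t) = f (g t)"
  proof (rule ccontr)
    assume "u (g t) \<noteq> f (g t)"
    then have "0 < \<bar>u (g t) - f (g t)\<bar> / 4" by simp
    from small[OF this] show False using \<open>u (g t) \<noteq> f (g t)\<close> by simp
  qed
  then show ?thesis using t(3) by blast
qed

section \<open>Uniform control near a point and compactness\<close>

lemma harmonic_oscillation:
  assumes x0: "x0 \<in> \<Omega>" and U: "open U" "U \<subset>\<subset> \<Omega>" "x0 \<in> U" and \<epsilon>: "0 < \<epsilon>" and M: "0 < M"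
  shows "\<exists>\<delta>>0. \<forall>u. carpet_harmonic v \<Omega> Q (\<lambda>x. ereal (u x)) \<longrightarrow> normalized v \<Omega> Q (\<lambda>x. ereal (u x)) \<longrightarrow>
     dirichlet_energy Q U (\<lambda>x. ereal (u x)) \<le> ennreal M \<longrightarrow>
     (\<forall>x\<in>S \<inter> ball x0 \<delta>. \<forall>y\<in>S \<inter> ball x0 \<delta>. \<bar>u x - u y\<bar> < \<epsilon>)"
proof (cases "x0 \<in> S")
  case True
  \<comment> \<open>Values within \<epsilon> / 4 of a common number differ by at most \<epsilon> /
    2, which gives the strict inequality.\<close>
  have "0 < \<epsilon> / 4" using \<epsilon> by simp
  from harmonic_local[OF True U this M, of v] obtain \<delta> where \<delta>: "0 < \<delta>"
    "\<forall>u. carpet_harmonic v \<Omega> Q (\<lambda>x. ereal (u x)) \<longrightarrow> dirichlet_energy Q U (\<lambda>x. ereal (u x)) \<le> ennreal M \<longrightarrow>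
    (\<exists>V a. open V \<and> ball x0 \<delta> \<subseteq> V \<and>
      (\<forall>i. x0 \<notin> closure (Q i) \<longrightarrow> Q i \<subseteq> V \<longrightarrow> (\<forall>x\<in>frontier (Q i). a - \<epsilon> / 4 \<le> u x \<and> u x \<le> a + \<epsilon> / 4)))"
    by (elim exE conjE) (rule that)
  define J where "J = {i. x0 \<in> closure (Q i)}"
  have J: "finite J"
  proof (cases "J = {}")
    case False
    then obtain j where "j \<in> J" by blast
    then have "J \<subseteq> {j}" using Q_unique[of x0] by (auto simp: J_def)
    then show ?thesis using finite_subset by blast
  qed simp
  show ?thesis
  proof (intro exI[of _ \<delta>] conjI allI impI)
    fix u assume u: "carpet_harmonic v \<Omega> Q (\<lambda>x. ereal (u x))" "normalized v \<Omega> Q (\<lambda>x. ereal (u x))"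
      "dirichlet_energy Q U (\<lambda>x. ereal (u x)) \<le> ennreal M"
    obtain W a where W: "open W" "ball x0 \<delta> \<subseteq> W"
      "\<And>i x. x0 \<notin> closure (Q i) \<Longrightarrow> Q i \<subseteq> W \<Longrightarrow> x \<in> frontier (Q i) \<Longrightarrow> a - \<epsilon> / 4 \<le> u x \<and> u x \<le> a + \<epsilon> / 4"
      using \<delta>(2)[THEN spec, THEN mp, THEN mp, OF u(1,3)] by blast
    obtain g where g: "g \<in> sobolev_loc v \<Omega> Q" "\<And>x. x \<in> S \<Longrightarrow> ereal (u x) = normalized_version \<Omega> Q g x"
      using u(2) by (auto simp: normalized_def)
    define f where "f = (\<lambda>x. real_of_ereal (g x))"
    have f: "nice v f" and fg: "normalized_version \<Omega> Q (\<lambda>x. ereal (f x)) = normalized_version \<Omega> Q g"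
      using sobolev_loc_nice[OF g(1)] by (simp_all add: f_def)
    have norm: "ereal (u x) = normalized_version \<Omega> Q (\<lambda>x. ereal (f x)) x" if "x \<in> S" for x using g(2)[OF that] fg by simp
    have us: "(\<lambda>x. ereal (u x)) \<in> sobolev_loc v \<Omega> Q" using u(1) by (simp add: carpet_harmonic_def)
    have "nice v u" using sobolev_loc_nice(1)[OF us] by simp
    then have link: "\<exists>y\<in>frontier (Q i). u y = f y" for i by (rule normalized_link[OF f _ norm])
    have b: "a - \<epsilon> / 4 \<le> u x \<and> u x \<le> a + \<epsilon> / 4" if x: "x \<in> S \<inter> ball x0 \<delta>" for x
      by (rule normalized_bounds[OF f W(1) J link norm]) (use W x in \<open>auto simp: J_def\<close>)
    show "\<forall>x\<in>S \<inter> ball x0 \<delta>. \<forall>y\<in>S \<inter> ball x0 \<delta>. \<bar>u x - u y\<bar> < \<epsilon>"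
    proof (intro ballI)
      fix x y assume "x \<in> S \<inter> ball x0 \<delta>" "y \<in> S \<inter> ball x0 \<delta>"
      from b[OF this(1)] b[OF this(2)] show "\<bar>u x - u y\<bar> < \<epsilon>" using \<epsilon> by linarith
    qed
  qed (rule \<delta>(1))
next
  case False
  then obtain i where "x0 \<in> Q i" using x0 by (auto simp: carpet_def)
  then obtain \<delta> where \<delta>: "\<delta> > 0" "ball x0 \<delta> \<subseteq> Q i" using open_Q[of i] open_contains_ball by blast
  then have "S \<inter> ball x0 \<delta> = {}" using S_not_Q by blast
  then show ?thesis using \<delta>(1) by (intro exI[of _ \<delta>]) auto
qed

end

theorem theorem2p84:
  fixes \<Omega> U V :: "complex set" and Q :: "nat \<Rightarrow> complex set" and v :: version and M :: real
  assumes "relative_sierpinski_carpet \<Omega> Q"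
    and "open V" and "open U" and "V \<subset>\<subset> U" and "U \<subset>\<subset> \<Omega>"
    and "0 < M"
  shows "\<forall>\<epsilon>>0. \<exists>\<delta>>0. \<forall>u :: complex \<Rightarrow> real.
           carpet_harmonic v \<Omega> Q (\<lambda>x. ereal (u x)) \<and> normalized v \<Omega> Q (\<lambda>x. ereal (u x)) \<and>
           dirichlet_energy Q U (\<lambda>x. ereal (u x)) \<le> ennreal M \<longrightarrow>
           (\<forall>x\<in>carpet \<Omega> Q \<inter> V. \<forall>y\<in>carpet \<Omega> Q \<inter> V. cmod (x - y) < \<delta> \<longrightarrow> \<bar>u x - u y\<bar> < \<epsilon>)"
proof (intro allI impI)
  interpret rel_carpet \<Omega> Q by unfold_locales (rule assms(1))
  fix \<epsilon> :: real assume \<epsilon>: "0 < \<epsilon>"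
  define P where "P x0 \<delta> \<longleftrightarrow> (\<forall>u. carpet_harmonic v \<Omega> Q (\<lambda>x. ereal (u x)) \<longrightarrow> normalized v \<Omega> Q (\<lambda>x. ereal (u x)) \<longrightarrow>
     dirichlet_energy Q U (\<lambda>x. ereal (u x)) \<le> ennreal M \<longrightarrow>
     (\<forall>x\<in>S \<inter> ball x0 \<delta>. \<forall>y\<in>S \<inter> ball x0 \<delta>. \<bar>u x - u y\<bar> < \<epsilon>))" for x0 \<delta>
  define G where "G = {ball x0 \<delta> |x0 \<delta>. 0 < \<delta> \<and> P x0 \<delta>}"
  have V: "compact (closure V)" "closure V \<subseteq> U" and U\<Omega>: "U \<subseteq> \<Omega>"
    using assms(4,5) closure_subset[of U] by (auto simp: compactly_contained_def)
  have cov: "closure V \<subseteq> \<Union>G"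
  proof
    fix x0 assume "x0 \<in> closure V"
    then have x0: "x0 \<in> \<Omega>" "x0 \<in> U" using V(2) U\<Omega> by auto
    have "\<exists>\<delta>>0. P x0 \<delta>"
      unfolding P_def by (rule harmonic_oscillation[OF x0(1) assms(3,5) x0(2) \<epsilon> assms(6)])
    then obtain \<delta> where \<delta>: "0 < \<delta>" "P x0 \<delta>" by blast
    then have "ball x0 \<delta> \<in> G" "x0 \<in> ball x0 \<delta>" by (auto simp: G_def)
    then show "x0 \<in> \<Union>G" by blast
  qed
  \<comment> \<open>A Lebesgue number of the cover: two points of \<open>V\<close> closer than
    \<delta> lie in a common ball of \<open>G\<close>.\<close>
  obtain \<delta> where \<delta>: "0 < \<delta>" "\<forall>x\<in>closure V. \<exists>B\<in>G. ball x \<delta> \<subseteq> B"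
    by (rule Heine_Borel_lemma[OF V(1) cov]) (auto simp: G_def)
  show "\<exists>\<delta>>0. \<forall>u. carpet_harmonic v \<Omega> Q (\<lambda>x. ereal (u x)) \<and> normalized v \<Omega> Q (\<lambda>x. ereal (u x)) \<and>
           dirichlet_energy Q U (\<lambda>x. ereal (u x)) \<le> ennreal M \<longrightarrow>
           (\<forall>x\<in>carpet \<Omega> Q \<inter> V. \<forall>y\<in>carpet \<Omega> Q \<inter> V. cmod (x - y) < \<delta> \<longrightarrow> \<bar>u x - u y\<bar> < \<epsilon>)"
  proof (intro exI[of _ \<delta>] conjI allI impI ballI)
    fix u x y
    assume u: "carpet_harmonic v \<Omega> Q (\<lambda>x. ereal (u x)) \<and> normalized v \<Omega> Q (\<lambda>x. ereal (u x)) \<and>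
           dirichlet_energy Q U (\<lambda>x. ereal (u x)) \<le> ennreal M"
      and x: "x \<in> S \<inter> V" and y: "y \<in> S \<inter> V" and xy: "cmod (x - y) < \<delta>"
    have "x \<in> closure V" using x closure_subset[of V] by blast
    then obtain x0 d where B: "ball x \<delta> \<subseteq> ball x0 d" "P x0 d" using \<delta>(2) unfolding G_def by blast
    have "x \<in> ball x \<delta>" "y \<in> ball x \<delta>" using \<delta>(1) xy by (auto simp: dist_norm)
    then have "x \<in> S \<inter> ball x0 d" "y \<in> S \<inter> ball x0 d" using B(1) x y by blast+
    then show "\<bar>u x - u y\<bar> < \<epsilon>" using B(2) u unfolding P_def by blast
  qed (rule \<delta>(1))
qed

end
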